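(* Let $G$ be a nontrivial finite group whose character graph associated with codegrees $\Gamma(G)$ has no triangles. Then $G$ is isomorphic to one of the following groups: the cyclic group of order $2$ or $3$; the alternating group $A_4$; the symmetric group $S_3$; the dihedral group $D_{10}$ of order $10$; the nonabelian group $F_{7,3}$ of order $21$. Conversely, for each of these groups $G$, the graph $\Gamma(G)$ has no triangles.
   Context: $\operatorname{Irr}(G)$ is the set of complex irreducible characters of the finite group $G$, and $1_G$ is the principal character. For a character $\chi$ of $G$, the codegree is $a(\chi):=\frac{|G:\ker\chi|}{\chi(1)}$. The character graph $\Gamma(G)$ of $G$ associated with codegrees is the simple graph with vertex set $\operatorname{Irr}(G)\setminus\{1_G\}$ in which two distinct vertices $\chi,\psi$ are joined by an edge if and only if $\gcd(a(\chi),a(\psi))\neq 1$. A triangle is a set of three distinct pairwise adjacent vertices. *)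

theory Defs
  imports "HOL-Algebra.Algebra" "HOL-Number_Theory.Cong" "Jordan_Normal_Form.VS_Connect"
begin

section \<open>Complex irreducible characters\<close>

definition GL :: "nat \<Rightarrow> complex mat monoid" where
  "GL n = units_of (ring_mat TYPE(complex) n ())"

definition representation :: "('a, 'b) monoid_scheme \<Rightarrow> nat \<Rightarrow> ('a \<Rightarrow> complex mat) \<Rightarrow> bool" where
  "representation G n \<rho> \<longleftrightarrow> \<rho> \<in> hom G (GL n)"

definition irreducible_representation ::
  "('a, 'b) monoid_scheme \<Rightarrow> nat \<Rightarrow> ('a \<Rightarrow> complex mat) \<Rightarrow> bool" where
  "irreducible_representation G n \<rho> \<longleftrightarrow>
     representation G n \<rho> \<and> 0 < n \<and>
     (\<forall>W. subspace class_ring W (module_vec TYPE(complex) n) \<longrightarrow>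
          (\<forall>g\<in>carrier G. \<forall>w\<in>W. \<rho> g *\<^sub>v w \<in> W) \<longrightarrow>
          W = {0\<^sub>v n} \<or> W = carrier_vec n)"

definition mat_trace :: "complex mat \<Rightarrow> complex" where
  "mat_trace A = (\<Sum>i<dim_row A. A $$ (i, i))"

text \<open>Characters are restricted to the carrier (with value \<open>undefined\<close> outside it), so that
  two of them are equal as HOL functions iff they agree on \<open>G\<close>.\<close>

definition character_of :: "('a, 'b) monoid_scheme \<Rightarrow> ('a \<Rightarrow> complex mat) \<Rightarrow> 'a \<Rightarrow> complex" where
  "character_of G \<rho> = (\<lambda>g\<in>carrier G. mat_trace (\<rho> g))"

definition Irr :: "('a, 'b) monoid_scheme \<Rightarrow> ('a \<Rightarrow> complex) set" where
  "Irr G = {character_of G \<rho> | n \<rho>. irreducible_representation G n \<rho>}"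

definition principal_character :: "('a, 'b) monoid_scheme \<Rightarrow> 'a \<Rightarrow> complex" where
  "principal_character G = (\<lambda>g\<in>carrier G. 1)"

definition character_kernel :: "('a, 'b) monoid_scheme \<Rightarrow> ('a \<Rightarrow> complex) \<Rightarrow> 'a set" where
  "character_kernel G \<chi> = {g \<in> carrier G. \<chi> g = \<chi> \<one>\<^bsub>G\<^esub>}"


section \<open>Codegrees and their character graph\<close>

text \<open>For irreducible \<open>\<chi>\<close> the degree divides the index of the kernel, so the
  complex number \<open>|G : ker \<chi>| / \<chi>(1)\<close> is a natural number; \<open>THE\<close> only
  retypes that number in order to take greatest common divisors.\<close>

definition codegree :: "('a, 'b) monoid_scheme \<Rightarrow> ('a \<Rightarrow> complex) \<Rightarrow> nat" where
  "codegree G \<chi> =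
     (THE a. of_nat a = of_nat (card (rcosets\<^bsub>G\<^esub> (character_kernel G \<chi>))) / \<chi> \<one>\<^bsub>G\<^esub>)"

text \<open>A simple graph is a pair of a vertex set and a set of two-element sets of vertices.\<close>

definition codegree_graph ::
  "('a, 'b) monoid_scheme \<Rightarrow> ('a \<Rightarrow> complex) set \<times> ('a \<Rightarrow> complex) set set" where
  "codegree_graph G =
     (let V = Irr G - {principal_character G}
      in (V, {{\<chi>, \<psi>} | \<chi> \<psi>. \<chi> \<in> V \<and> \<psi> \<in> V \<and> \<chi> \<noteq> \<psi> \<and>
                gcd (codegree G \<chi>) (codegree G \<psi>) \<noteq> 1}))"

definition is_triangle :: "'v set \<times> 'v set set \<Rightarrow> 'v set \<Rightarrow> bool" where
  "is_triangle \<Gamma> T \<longleftrightarrow>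
     T \<subseteq> fst \<Gamma> \<and> card T = 3 \<and> (\<forall>x\<in>T. \<forall>y\<in>T. x \<noteq> y \<longrightarrow> {x, y} \<in> snd \<Gamma>)"

definition triangle_free :: "'v set \<times> 'v set set \<Rightarrow> bool" where
  "triangle_free \<Gamma> \<longleftrightarrow> \<not> (\<exists>T. is_triangle \<Gamma> T)"


section \<open>The groups \<open>D\<^bsub>10\<^esub>\<close> and \<open>F\<^bsub>7,3\<^esub>\<close>\<close>

text \<open>The semidirect product of \<open>\<int>/n\<close> by \<open>\<int>/m\<close> in which the generator of \<open>\<int>/m\<close> acts on
  \<open>\<int>/n\<close> as multiplication by \<open>r\<close>; it is a group when \<open>r^m \<equiv> 1 (mod n)\<close>.\<close>

definition cyclic_semidirect :: "nat \<Rightarrow> nat \<Rightarrow> int \<Rightarrow> (int \<times> int) monoid" where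
  "cyclic_semidirect n m r =
     \<lparr>carrier = carrier (integer_mod_group n) \<times> carrier (integer_mod_group m),
      monoid.mult = (\<lambda>(a, b) (c, d). ((a + r ^ nat b * c) mod int n, (b + d) mod int m)),
      one = (0, 0)\<rparr>"

text \<open>\<open>dihedral_group n\<close> has order \<open>2 * n\<close>; hence \<open>D\<^bsub>10\<^esub>\<close> is \<open>dihedral_group 5\<close>.\<close>

definition dihedral_group :: "nat \<Rightarrow> (int \<times> int) monoid" where
  "dihedral_group n = cyclic_semidirect n 2 (- 1)"

definition F73 :: "(int \<times> int) monoid" where
  "F73 = cyclic_semidirect 7 3 2"

lemma group_cyclic_semidirect:
  assumes "n > 0" "m > 0" and r: "[r ^ m = 1] (mod int n)"
  shows "group (cyclic_semidirect n m r)"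
proof -
  have pow_mod: "[r ^ nat (b mod int m) = r ^ nat b] (mod int n)" if "0 \<le> b" for b
  proof -
    have "nat b = m * (nat b div m) + nat (b mod int m)"
      using that \<open>m > 0\<close> by (simp add: nat_mod_distrib)
    then have "r ^ nat b = (r ^ m) ^ (nat b div m) * r ^ nat (b mod int m)"
      by (metis power_add power_mult)
    moreover have "[(r ^ m) ^ (nat b div m) * r ^ nat (b mod int m)
                    = 1 ^ (nat b div m) * r ^ nat (b mod int m)] (mod int n)"
      by (intro cong_mult cong_pow r cong_refl)
    ultimately show ?thesis by (simp add: cong_sym)
  qed
  have assoc: "((a + r ^ nat b * c) mod int n + r ^ nat ((b + d) mod int m) * e) mod int n
      = (a + r ^ nat b * ((c + r ^ nat d * e) mod int n)) mod int n"
    if "0 \<le> b" "0 \<le> d" for a b c d e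
  proof -
    have "[(a + r ^ nat b * c) mod int n + r ^ nat ((b + d) mod int m) * e
           = (a + r ^ nat b * c) + r ^ nat (b + d) * e] (mod int n)"
      by (intro cong_add cong_mult pow_mod) (use that in auto)
    also have "(a + r ^ nat b * c) + r ^ nat (b + d) * e = a + r ^ nat b * (c + r ^ nat d * e)"
      using that by (simp add: nat_add_distrib power_add algebra_simps)
    also have "[\<dots> = a + r ^ nat b * ((c + r ^ nat d * e) mod int n)] (mod int n)"
      by (intro cong_add cong_mult cong_refl) (simp add: cong_sym)
    finally show ?thesis by (simp add: cong_def)
  qed
  show ?thesis
  proof (rule groupI)
    fix x y z
    assume "x \<in> carrier (cyclic_semidirect n m r)" "y \<in> carrier (cyclic_semidirect n m r)"
      "z \<in> carrier (cyclic_semidirect n m r)"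
    then show "x \<otimes>\<^bsub>cyclic_semidirect n m r\<^esub> y \<otimes>\<^bsub>cyclic_semidirect n m r\<^esub> z
        = x \<otimes>\<^bsub>cyclic_semidirect n m r\<^esub> (y \<otimes>\<^bsub>cyclic_semidirect n m r\<^esub> z)"
      using assms(1,2) assoc
      by (auto simp: cyclic_semidirect_def carrier_integer_mod_group mod_simps add.assoc)
  next
    fix x assume "x \<in> carrier (cyclic_semidirect n m r)"
    then obtain a b where x: "x = (a, b)" "0 \<le> b" "b < int m" "0 \<le> a" "a < int n"
      using assms by (auto simp: cyclic_semidirect_def carrier_integer_mod_group)
    define b' where "b' = (- b) mod int m"
    have b': "0 \<le> b'" "b' < int m" "(b' + b) mod int m = 0"
      using \<open>m > 0\<close> by (auto simp: b'_def mod_simps)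
    have "((- (r ^ nat b' * a)) mod int n, b') \<otimes>\<^bsub>cyclic_semidirect n m r\<^esub> x
        = \<one>\<^bsub>cyclic_semidirect n m r\<^esub>"
      using b' x by (auto simp: cyclic_semidirect_def mod_simps)
    moreover have "((- (r ^ nat b' * a)) mod int n, b') \<in> carrier (cyclic_semidirect n m r)"
      using b' assms by (auto simp: cyclic_semidirect_def carrier_integer_mod_group)
    ultimately show "\<exists>y\<in>carrier (cyclic_semidirect n m r).
        y \<otimes>\<^bsub>cyclic_semidirect n m r\<^esub> x = \<one>\<^bsub>cyclic_semidirect n m r\<^esub>"
      by blast
  qed (use assms in \<open>auto simp: cyclic_semidirect_def carrier_integer_mod_group\<close>)
qed

lemma group_dihedral_group: "n > 0 \<Longrightarrow> group (dihedral_group n)"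
  unfolding dihedral_group_def by (rule group_cyclic_semidirect) auto

lemma order_dihedral_group: "n > 0 \<Longrightarrow> Coset.order (dihedral_group n) = 2 * n"
  by (simp add: dihedral_group_def Coset.order_def cyclic_semidirect_def carrier_integer_mod_group)

lemma group_F73: "group F73"
  unfolding F73_def by (rule group_cyclic_semidirect) (auto simp: cong_def)

lemma order_F73: "Coset.order F73 = 21"
  by (simp add: F73_def Coset.order_def cyclic_semidirect_def carrier_integer_mod_group)

lemma F73_nonabelian: "\<not> comm_group F73"
proof
  assume "comm_group F73"
  then interpret comm_group F73 .
  have "(1, 0) \<otimes>\<^bsub>F73\<^esub> (0, 1) = (0, 1) \<otimes>\<^bsub>F73\<^esub> (1, 0)"
    by (rule m_comm) (auto simp: F73_def cyclic_semidirect_def carrier_integer_mod_group)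
  then show False
    by (simp add: F73_def cyclic_semidirect_def)
qed

end

theory Submission
  imports Defs "Jordan_Normal_Form.Schur_Decomposition"
begin

text \<open>
  The main consequence of triangle-freeness is that for each prime \<open>p\<close> at most two nonprincipal
  irreducible characters have a codegree divisible by \<open>p\<close>, since three of them would be pairwise
  adjacent (\<open>card_chars_with\<close>). A character whose codegree is prime to \<open>p\<close> has defect zero modulo its
  kernel, so it vanishes on the elements of order \<open>p\<close> outside its kernel
  (\<open>vanish_outside_kernel\<close>). The column relation \<open>\<Sum>\<chi>(1)\<chi>(x) = 0\<close> at an element \<open>x\<close> of order \<open>p\<close>
  therefore involves, besides characters with \<open>x\<close> in the kernel, at most two nonprincipal ones, and this
  determines the group.

  The first consequence is that a nontrivial triangle-free group \<open>G\<close> has a nontrivial linear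
  character (\<open>exists_linear_character\<close>). The property passes to quotients, so all nonprincipal
  characters may be taken to be faithful. If \<open>|G|\<close> is even and every linear character is trivial,
  determinants are trivial, values at an involution are congruent to degrees modulo 4, and the column
  relation makes \<open>-1\<close> a sum of at most two squares modulo 4. If \<open>|G|\<close> is odd, the characters
  belonging to a prime form a complex conjugate pair, and the column relation makes their
  degree 1. A linear character of prime order \<open>q > 3\<close> has three distinct nontrivial powers, which form
  a triangle; hence there is one of order 2 or 3 (\<open>linear_exponent_2_or_3\<close>). Let \<open>K\<close> be its
  kernel, of index \<open>q\<close>.

  Let \<open>q = 3\<close>. The character and its square are the only ones whose codegree is divisible by 3, so
  elements of order 3 lie outside \<open>K\<close> and have centralizer of order 3; counting conjugates, every
  element outside \<open>K\<close> has order 3 and acts on \<open>K\<close> without fixed points. It follows that conjugate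
  elements of \<open>K\<close> commute. There being at most \<open>3 + 2s\<close> characters, where \<open>s\<close> is the
  number of primes other than 3 dividing \<open>|G|\<close>, and as many classes, exhibiting classes inside
  \<open>K\<close> gives \<open>s \<le> 1\<close>; then \<open>K\<close> is abelian, and counting classes gives \<open>|K| \<in> {1, 4, 7}\<close>
  (\<open>exponent3_structure\<close>). Let \<open>q = 2\<close> and suppose that there is no linear character of order 3.
  Every nontrivial quotient by a kernel then has even order, so the degrees of the other characters are even and
  \<open>|G| = \<Sum>\<chi>(1)\<^sup>2\<close> is 2 modulo 4. All other codegrees are odd, involutions act on
  \<open>K\<close> by inversion, \<open>K\<close> is abelian of odd order, and the class count, at most \<open>2 + 2s\<close> with
  \<open>s\<close> the number of odd primes, leaves \<open>|K| \<in> {1, 3, 5}\<close> (\<open>exponent2_structure\<close>).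

  In every case \<open>G\<close> is the product of an abelian normal subgroup \<open>K\<close> and a group of order \<open>q\<close>
  acting on it without fixed points (\<open>split_by\<close>). For the six pairs \<open>(q, |K|)\<close> such a group is unique
  up to isomorphism (\<open>split_unique\<close>) and triangle-free (\<open>split_triangle_free\<close>): it has \<open>q - 1\<close>
  nonprincipal linear characters with codegree \<open>q\<close> and at most two further ones, of degree \<open>q\<close>,
  whose codegrees divide \<open>|K|\<close>. The six named groups are of this form.

  The character theory is developed from matrix representations: Schur orthogonality in the
  convolution form (\<open>Irr_convolution\<close>), integrality of codegrees (\<open>codegree_integral\<close>),
  and, via completeness of the irreducible characters (\<open>Irr_complete\<close>), the column relations.
\<close>

section \<open>Sums of matrices and traces\<close>

lemma mult_mat_entry:
  "A \<in> carrier_mat n m \<Longrightarrow> B \<in> carrier_mat m p \<Longrightarrow> i < n \<Longrightarrow> j < p \<Longrightarrow>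
    (A * B) $$ (i, j) = (\<Sum>k<m. A $$ (i, k) * B $$ (k, j))"
  by (auto simp: scalar_prod_def atLeast0LessThan)

definition msum :: "nat \<Rightarrow> nat \<Rightarrow> ('s \<Rightarrow> complex mat) \<Rightarrow> 's set \<Rightarrow> complex mat" where
  "msum n m f S = mat n m (\<lambda>ij. \<Sum>s\<in>S. f s $$ ij)"

lemma msum_carrier [simp]: "msum n m f S \<in> carrier_mat n m"
  by (simp add: msum_def)

lemma msum_index: "i < n \<Longrightarrow> j < m \<Longrightarrow> msum n m f S $$ (i, j) = (\<Sum>s\<in>S. f s $$ (i, j))"
  by (simp add: msum_def)

lemma msum_cong: "(\<And>s. s \<in> S \<Longrightarrow> f s = g s) \<Longrightarrow> msum n m f S = msum n m g S"
  by (simp add: msum_def)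

lemma msum_reindex_bij:
  "bij_betw h S T \<Longrightarrow> msum n m (\<lambda>s. f (h s)) S = msum n m f T"
  by (auto simp: msum_def intro!: eq_matI sum.reindex_bij_betw)

lemma mult_msum_left:
  assumes "A \<in> carrier_mat k n" "\<And>s. s \<in> S \<Longrightarrow> f s \<in> carrier_mat n m"
  shows "A * msum n m f S = msum k m (\<lambda>s. A * f s) S"
proof (rule eq_matI)
  fix i j assume "i < dim_row (msum k m (\<lambda>s. A * f s) S)" "j < dim_col (msum k m (\<lambda>s. A * f s) S)"
  then have ij: "i < k" "j < m" by (auto simp: msum_def)
  have "(A * msum n m f S) $$ (i, j) = (\<Sum>l<n. \<Sum>s\<in>S. A $$ (i, l) * f s $$ (l, j))"
    using ij by (simp add: mult_mat_entry[OF assms(1) msum_carrier] msum_index sum_distrib_left)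
  also have "\<dots> = (\<Sum>s\<in>S. \<Sum>l<n. A $$ (i, l) * f s $$ (l, j))" by (rule sum.swap)
  also have "\<dots> = (\<Sum>s\<in>S. (A * f s) $$ (i, j))"
    using ij assms by (intro sum.cong refl mult_mat_entry[symmetric]) auto
  finally show "(A * msum n m f S) $$ (i, j) = msum k m (\<lambda>s. A * f s) S $$ (i, j)"
    using ij by (simp add: msum_index)
qed (use assms in \<open>auto simp: msum_def\<close>)

lemma mult_msum_right:
  assumes "A \<in> carrier_mat m k" "\<And>s. s \<in> S \<Longrightarrow> f s \<in> carrier_mat n m"
  shows "msum n m f S * A = msum n k (\<lambda>s. f s * A) S"
proof (rule eq_matI)
  fix i j assume "i < dim_row (msum n k (\<lambda>s. f s * A) S)" "j < dim_col (msum n k (\<lambda>s. f s * A) S)"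
  then have ij: "i < n" "j < k" by (auto simp: msum_def)
  have "(msum n m f S * A) $$ (i, j) = (\<Sum>l<m. \<Sum>s\<in>S. f s $$ (i, l) * A $$ (l, j))"
    using ij by (simp add: mult_mat_entry[OF msum_carrier assms(1)] msum_index sum_distrib_right)
  also have "\<dots> = (\<Sum>s\<in>S. \<Sum>l<m. f s $$ (i, l) * A $$ (l, j))" by (rule sum.swap)
  also have "\<dots> = (\<Sum>s\<in>S. (f s * A) $$ (i, j))"
    using ij assms by (intro sum.cong refl mult_mat_entry[symmetric]) auto
  finally show "(msum n m f S * A) $$ (i, j) = msum n k (\<lambda>s. f s * A) S $$ (i, j)"
    using ij by (simp add: msum_index)
qed (use assms in \<open>auto simp: msum_def\<close>)

lemma mat_trace_carrier: "A \<in> carrier_mat n n \<Longrightarrow> mat_trace A = (\<Sum>i<n. A $$ (i, i))"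
  by (auto simp: mat_trace_def)

lemma mat_trace_msum: "(\<And>s. s \<in> S \<Longrightarrow> f s \<in> carrier_mat n n) \<Longrightarrow> mat_trace (msum n n f S) = (\<Sum>s\<in>S. mat_trace (f s))"
  by (simp add: mat_trace_carrier[of _ n] msum_index sum.swap[of _ S])

lemma mat_trace_mult:
  assumes "A \<in> carrier_mat n m" "B \<in> carrier_mat m n"
  shows "mat_trace (A * B) = (\<Sum>i<n. \<Sum>k<m. A $$ (i, k) * B $$ (k, i))"
  using assms by (subst mat_trace_carrier[of _ n]) (auto simp: mult_mat_entry simp del: index_mult_mat)

lemma mat_trace_comm:
  assumes "A \<in> carrier_mat n m" "B \<in> carrier_mat m n"
  shows "mat_trace (A * B) = mat_trace (B * A)"
  unfolding mat_trace_mult[OF assms] mat_trace_mult[OF assms(2,1)]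
  by (subst sum.swap) (simp add: mult.commute)

lemma mat_trace_smult_one: "mat_trace (c \<cdot>\<^sub>m 1\<^sub>m n) = of_nat n * c"
  by (simp add: mat_trace_def)

lemma mat_trace_smult: "mat_trace (c \<cdot>\<^sub>m A) = c * mat_trace A" if "A \<in> carrier_mat n n"
  using that by (simp add: mat_trace_def sum_distrib_left)


section \<open>Representations\<close>

locale fin_group = group G for G (structure) +
  assumes fin [simp, intro]: "finite (carrier G)"
begin

abbreviation N :: complex where "N \<equiv> of_nat (card (carrier G))"

lemma card_pos: "card (carrier G) > 0"
  using fin by (auto simp: card_gt_0_iff)

end

lemma representation_iff:
  assumes "group G"
  shows "representation G n \<rho> \<longleftrightarrow> (\<forall>g\<in>carrier G. \<rho> g \<in> carrier_mat n n) \<and>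
    (\<forall>g\<in>carrier G. \<forall>h\<in>carrier G. \<rho> (g \<otimes>\<^bsub>G\<^esub> h) = \<rho> g * \<rho> h) \<and> \<rho> \<one>\<^bsub>G\<^esub> = 1\<^sub>m n"
    (is "_ \<longleftrightarrow> ?R")
proof -
  interpret G: group G by fact
  interpret R: ring "ring_mat TYPE(complex) n ()" by (rule ring_mat)
  note s = GL_def representation_def units_of_def hom_def ring_mat_def
  show ?thesis
  proof
    assume r: "representation G n \<rho>"
    interpret U: group "GL n" unfolding GL_def by (rule R.units_group)
    have "\<rho> \<one>\<^bsub>G\<^esub> = \<one>\<^bsub>GL n\<^esub>"
      using r unfolding representation_def by (rule hom_one[OF _ G.group_axioms U.group_axioms])
    with r show ?R by (auto simp: s Units_def)
  next
    assume r: ?R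
    have "\<rho> g \<in> Units (ring_mat TYPE(complex) n ())" if "g \<in> carrier G" for g
    proof -
      have "\<rho> (inv\<^bsub>G\<^esub> g) * \<rho> g = 1\<^sub>m n" "\<rho> g * \<rho> (inv\<^bsub>G\<^esub> g) = 1\<^sub>m n"
        using r that by (metis G.inv_closed G.l_inv, metis G.inv_closed G.r_inv)
      then show ?thesis using that r by (auto simp: Units_def ring_mat_def intro!: bexI[of _ "\<rho> (inv\<^bsub>G\<^esub> g)"])
    qed
    then show "representation G n \<rho>"
      using r by (auto simp: representation_def GL_def units_of_def hom_def) (simp add: ring_mat_def)
  qed
qed

lemma subspace_vec_iff:
  "subspace class_ring W (module_vec TYPE(complex) n) \<longleftrightarrow>
     W \<subseteq> carrier_vec n \<and> 0\<^sub>v n \<in> W \<and> (\<forall>v\<in>W. \<forall>w\<in>W. v + w \<in> W) \<and> (\<forall>c. \<forall>v\<in>W. c \<cdot>\<^sub>v v \<in> W)"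
proof -
  interpret vec_space "TYPE(complex)" n .
  show ?thesis
    using vec_vs vec_module
    by (auto simp: VectorSpace.subspace_def submodule_def module_vec_def)
qed

lemma irreducible_representationD:
  assumes "irreducible_representation G n \<rho>" "W \<subseteq> carrier_vec n" "0\<^sub>v n \<in> W"
    "\<And>v w. v \<in> W \<Longrightarrow> w \<in> W \<Longrightarrow> v + w \<in> W" "\<And>c v. v \<in> W \<Longrightarrow> c \<cdot>\<^sub>v v \<in> W"
    "\<And>g w. g \<in> carrier G \<Longrightarrow> w \<in> W \<Longrightarrow> \<rho> g *\<^sub>v w \<in> W"
  shows "W = {0\<^sub>v n} \<or> W = carrier_vec n"
  using assms unfolding irreducible_representation_def by (auto simp: subspace_vec_iff)

text \<open>Schur's lemma: an eigenspace of a matrix commuting with an irreducible representation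
  is invariant, hence everything.\<close>

lemma schur_scalar:
  assumes irr: "irreducible_representation G n \<rho>" and "group G"
    and A: "A \<in> carrier_mat n n" and comm: "\<And>g. g \<in> carrier G \<Longrightarrow> A * \<rho> g = \<rho> g * A"
  shows "\<exists>c. A = c \<cdot>\<^sub>m 1\<^sub>m n"
proof -
  have n: "n > 0" and rho: "\<And>g. g \<in> carrier G \<Longrightarrow> \<rho> g \<in> carrier_mat n n"
    using irr by (auto simp: irreducible_representation_def representation_iff[OF \<open>group G\<close>])
  obtain as where as: "char_poly A = (\<Prod>a\<leftarrow>as. [:- a, 1:])" "length as = n"
    using char_poly_factorized[OF A] by blast
  then obtain c as' where "as = c # as'" using n by (cases as) auto
  then have "poly (char_poly A) c = 0" by (simp add: as)
  then have "eigenvalue A c" by (simp add: eigenvalue_root_char_poly[OF A])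
  then obtain v where v: "v \<in> carrier_vec n" "v \<noteq> 0\<^sub>v n" "A *\<^sub>v v = c \<cdot>\<^sub>v v"
    using A by (auto simp: eigenvalue_def eigenvector_def)
  define W where "W = {v \<in> carrier_vec n. A *\<^sub>v v = c \<cdot>\<^sub>v v}"
  have "W = {0\<^sub>v n} \<or> W = carrier_vec n"
  proof (rule irreducible_representationD[OF irr])
    fix g w assume g: "g \<in> carrier G" and "w \<in> W"
    then have w: "w \<in> carrier_vec n" "A *\<^sub>v w = c \<cdot>\<^sub>v w" by (auto simp: W_def)
    have "A *\<^sub>v (\<rho> g *\<^sub>v w) = (A * \<rho> g) *\<^sub>v w"
      using A rho[OF g] w by (simp add: assoc_mult_mat_vec)
    also have "\<dots> = \<rho> g *\<^sub>v (A *\<^sub>v w)"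
      using A rho[OF g] w by (simp add: comm[OF g] assoc_mult_mat_vec)
    also have "\<dots> = c \<cdot>\<^sub>v (\<rho> g *\<^sub>v w)"
      using w rho[OF g] by (simp add: mult_mat_vec)
    finally show "\<rho> g *\<^sub>v w \<in> W" using rho[OF g] w by (simp add: W_def)
  qed (use A in \<open>auto simp: W_def mult_add_distrib_mat_vec smult_add_distrib_vec mult_mat_vec smult_smult_assoc mult.commute\<close>)
  moreover have "v \<in> W" using v by (simp add: W_def)
  ultimately have W: "W = carrier_vec n" using v by auto
  have "A = c \<cdot>\<^sub>m 1\<^sub>m n"
  proof (rule eq_matI)
    fix i j assume "i < dim_row (c \<cdot>\<^sub>m 1\<^sub>m n)" "j < dim_col (c \<cdot>\<^sub>m 1\<^sub>m n)"
    then have ij: "i < n" "j < n" by auto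
    have "unit_vec n j \<in> W" by (simp add: W)
    then have "A *\<^sub>v unit_vec n j = c \<cdot>\<^sub>v unit_vec n j" by (simp add: W_def)
    then have "(A *\<^sub>v unit_vec n j) $ i = (c \<cdot>\<^sub>v unit_vec n j) $ i" by simp
    moreover have "(A *\<^sub>v unit_vec n j) $ i = A $$ (i, j)"
      using A ij by (simp add: scalar_prod_right_unit)
    ultimately show "A $$ (i, j) = (c \<cdot>\<^sub>m 1\<^sub>m n) $$ (i, j)"
      using ij by (auto simp: unit_vec_def)
  qed (use A in auto)
  then show ?thesis ..
qed

context fin_group
begin

lemma rep_closed: "representation G n \<rho> \<Longrightarrow> g \<in> carrier G \<Longrightarrow> \<rho> g \<in> carrier_mat n n"
  and rep_mult: "representation G n \<rho> \<Longrightarrow> g \<in> carrier G \<Longrightarrow> h \<in> carrier G \<Longrightarrow> \<rho> (g \<otimes> h) = \<rho> g * \<rho> h"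
  and rep_one: "representation G n \<rho> \<Longrightarrow> \<rho> \<one> = 1\<^sub>m n"
  by (auto simp: representation_iff[OF group_axioms])

lemma irr_rep: "irreducible_representation G n \<rho> \<Longrightarrow> representation G n \<rho>"
  and irr_pos: "irreducible_representation G n \<rho> \<Longrightarrow> n > 0"
  by (auto simp: irreducible_representation_def)

lemma mult_inv_cancel [simp]:
  assumes "h \<in> carrier G" "y \<in> carrier G"
  shows "h \<otimes> (inv h \<otimes> y) = y" "inv h \<otimes> (h \<otimes> y) = y"
  using assms by (simp_all add: m_assoc[symmetric])

lemma bij_mult_right: "h \<in> carrier G \<Longrightarrow> bij_betw (\<lambda>g. g \<otimes> h) (carrier G) (carrier G)"
  by (rule bij_betwI[where g = "\<lambda>g. g \<otimes> inv h"]) (auto simp: m_assoc)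

lemma bij_mult_left: "h \<in> carrier G \<Longrightarrow> bij_betw (\<lambda>g. h \<otimes> g) (carrier G) (carrier G)"
  by (rule bij_betwI[where g = "\<lambda>g. inv h \<otimes> g"]) auto

lemma bij_inv: "bij_betw (\<lambda>g. inv g) (carrier G) (carrier G)"
  by (rule bij_betwI[where g = "\<lambda>g. inv g"]) auto

lemma bij_conj: "h \<in> carrier G \<Longrightarrow> bij_betw (\<lambda>g. h \<otimes> g \<otimes> inv h) (carrier G) (carrier G)"
  by (rule bij_betwI[where g = "\<lambda>g. inv h \<otimes> g \<otimes> h"])
     (auto simp: m_assoc)

definition average :: "nat \<Rightarrow> nat \<Rightarrow> ('a \<Rightarrow> complex mat) \<Rightarrow> ('a \<Rightarrow> complex mat) \<Rightarrow> complex mat \<Rightarrow> complex mat" where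
  "average n m \<rho> \<sigma> Y = msum n m (\<lambda>g. \<rho> (inv g) * Y * \<sigma> g) (carrier G)"

lemma average_carrier [simp]: "average n m \<rho> \<sigma> Y \<in> carrier_mat n m"
  by (simp add: average_def)

lemma average_intertwines:
  assumes r: "representation G n \<rho>" and s: "representation G m \<sigma>" and Y: "Y \<in> carrier_mat n m"
    and h: "h \<in> carrier G"
  shows "\<rho> h * average n m \<rho> \<sigma> Y = average n m \<rho> \<sigma> Y * \<sigma> h"
proof -
  have c: "\<rho> g \<in> carrier_mat n n" "\<sigma> g \<in> carrier_mat m m" if "g \<in> carrier G" for g
    using that r s by (auto simp: rep_closed)
  have mc: "\<rho> (inv g) * Y * \<sigma> g \<in> carrier_mat n m" if "g \<in> carrier G" for g
    using c[OF that] c[of "inv g"] that Y by simp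
  have "\<rho> h * average n m \<rho> \<sigma> Y = msum n m (\<lambda>g. \<rho> h * (\<rho> (inv g) * Y * \<sigma> g)) (carrier G)"
    unfolding average_def using c Y h by (intro mult_msum_left) (auto intro: mc)
  also have "\<dots> = msum n m (\<lambda>g. \<rho> h * (\<rho> (inv (g \<otimes> h)) * Y * \<sigma> (g \<otimes> h))) (carrier G)"
    by (rule msum_reindex_bij[OF bij_mult_right[OF h], symmetric])
  also have "\<dots> = msum n m (\<lambda>g. (\<rho> (inv g) * Y * \<sigma> g) * \<sigma> h) (carrier G)"
  proof (rule msum_cong)
    fix g assume g: "g \<in> carrier G"
    have "\<rho> h * (\<rho> (inv (g \<otimes> h)) * Y * \<sigma> (g \<otimes> h)) = \<rho> h * \<rho> (inv (g \<otimes> h)) * Y * (\<sigma> g * \<sigma> h)"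
      using g h c[of h] c[of "inv (g \<otimes> h)"] c[of "g \<otimes> h"] Y c[of g] 
      by (simp add: rep_mult[OF s] assoc_mult_mat[of _ n n _ n _ m] assoc_mult_mat[of _ n n _ m _ m])
    also have "\<rho> h * \<rho> (inv (g \<otimes> h)) = \<rho> (inv g)"
      using g h by (simp add: rep_mult[OF r, symmetric] inv_mult_group m_assoc[symmetric])
    finally show "\<rho> h * (\<rho> (inv (g \<otimes> h)) * Y * \<sigma> (g \<otimes> h)) = (\<rho> (inv g) * Y * \<sigma> g) * \<sigma> h"
      by (simp only: assoc_mult_mat[OF mult_carrier_mat[OF c(1)[OF inv_closed[OF g]] Y] c(2)[OF g] c(2)[OF h]])
  qed
  also have "\<dots> = average n m \<rho> \<sigma> Y * \<sigma> h"
    unfolding average_def using c Y h by (intro mult_msum_right[symmetric]) (auto intro: mc)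
  finally show ?thesis .
qed

text \<open>By Schur's lemma the average is a scalar, and its trace identifies the scalar.\<close>

lemma average_scalar:
  assumes irr: "irreducible_representation G n \<rho>" and Y: "Y \<in> carrier_mat n n"
  shows "average n n \<rho> \<rho> Y = (N * mat_trace Y / of_nat n) \<cdot>\<^sub>m 1\<^sub>m n"
proof -
  note r = irr_rep[OF irr]
  obtain c where c: "average n n \<rho> \<rho> Y = c \<cdot>\<^sub>m 1\<^sub>m n"
    using schur_scalar[OF irr group_axioms average_carrier] average_intertwines[OF r r Y] by metis
  have "of_nat n * c = mat_trace (average n n \<rho> \<rho> Y)" by (simp add: c mat_trace_smult_one)
  also have "\<dots> = (\<Sum>g\<in>carrier G. mat_trace (\<rho> (inv g) * Y * \<rho> g))"
    unfolding average_def using Y by (intro mat_trace_msum) (auto intro!: mult_carrier_mat[of _ n n _ n] rep_closed[OF r])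
  also have "\<dots> = (\<Sum>g\<in>carrier G. mat_trace Y)"
  proof (rule sum.cong[OF refl])
    fix g assume g: "g \<in> carrier G"
    have cg: "\<rho> g \<in> carrier_mat n n" "\<rho> (inv g) \<in> carrier_mat n n" using g rep_closed[OF r] by auto
    have "mat_trace (\<rho> (inv g) * Y * \<rho> g) = mat_trace (\<rho> g * (\<rho> (inv g) * Y))"
      using cg Y by (intro mat_trace_comm) auto
    also have "\<rho> g * (\<rho> (inv g) * Y) = \<rho> (g \<otimes> inv g) * Y"
      using cg Y g by (simp only: rep_mult[OF r] inv_closed assoc_mult_mat[OF cg Y])
    also have "\<dots> = Y" using g Y by (simp add: rep_one[OF r])
    finally show "mat_trace (\<rho> (inv g) * Y * \<rho> g) = mat_trace Y" .
  qed
  finally have "c = N * mat_trace Y / of_nat n"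
    using irr_pos[OF irr] by (simp add: field_simps)
  then show ?thesis by (simp add: c)
qed

text \<open>A nonzero intertwiner \<open>A\<close> is invertible up to a scalar: averaging an elementary matrix
  gives an intertwiner in the other direction, and by the trace formula it can be chosen with
  nonzero product. Hence the two characters agree.\<close>

lemma average_zero:
  assumes irr: "irreducible_representation G n \<rho>" "irreducible_representation G m \<sigma>"
    and ne: "character_of G \<rho> \<noteq> character_of G \<sigma>" and Y: "Y \<in> carrier_mat n m"
  shows "average n m \<rho> \<sigma> Y = 0\<^sub>m n m"
proof (rule ccontr)
  define A where "A = average n m \<rho> \<sigma> Y"
  assume "average n m \<rho> \<sigma> Y \<noteq> 0\<^sub>m n m"
  then have "A \<noteq> 0\<^sub>m n m" by (simp add: A_def)
  have A: "A \<in> carrier_mat n m" by (simp add: A_def)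
  note r = irr_rep[OF irr(1)] and s = irr_rep[OF irr(2)]
  have "\<exists>i<n. \<exists>j<m. A $$ (i, j) \<noteq> 0"
    using A \<open>A \<noteq> 0\<^sub>m n m\<close> by (metis carrier_matD eq_matI index_zero_mat)
  then obtain i j where ij: "i < n" "j < m" "A $$ (i, j) \<noteq> 0" by blast
  \<comment> \<open>The trace of \<open>X0 * A\<close> is the entry \<open>A $$ (i, j)\<close>, which is not zero.\<close>
  define X0 :: "complex mat" where "X0 = mat m n (\<lambda>kl. if kl = (j, i) then 1 else 0)"
  have X0: "X0 \<in> carrier_mat m n" by (simp add: X0_def)
  define B where "B = average m n \<sigma> \<rho> X0"
  have B: "B \<in> carrier_mat m n" by (simp add: B_def)
  have iA: "\<rho> h * A = A * \<sigma> h" if "h \<in> carrier G" for h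
    unfolding A_def by (rule average_intertwines[OF r s Y that])
  have iB: "\<sigma> h * B = B * \<rho> h" if "h \<in> carrier G" for h
    unfolding B_def by (rule average_intertwines[OF s r X0 that])
  have cr: "\<rho> g \<in> carrier_mat n n" "\<sigma> g \<in> carrier_mat m m" if "g \<in> carrier G" for g
    using that rep_closed[OF r] rep_closed[OF s] by auto
  have mcX: "\<sigma> (inv g) * X0 * \<rho> g \<in> carrier_mat m n" if "g \<in> carrier G" for g
    using cr[OF that] cr[of "inv g"] that X0 by simp
  have "B * A = msum m m (\<lambda>g. \<sigma> (inv g) * X0 * \<rho> g * A) (carrier G)"
    unfolding B_def average_def using A X0 cr by (intro mult_msum_right) (auto intro: mcX)
  also have "\<dots> = average m m \<sigma> \<sigma> (X0 * A)"
    unfolding average_def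
  proof (rule msum_cong)
    fix g assume g: "g \<in> carrier G"
    show "\<sigma> (inv g) * X0 * \<rho> g * A = \<sigma> (inv g) * (X0 * A) * \<sigma> g"
      using cr[OF g] cr[of "inv g"] X0 A g
      by (simp add: assoc_mult_mat[of _ m n _ n _ m] iA assoc_mult_mat[of _ m m _ n _ m]
          assoc_mult_mat[of _ m n _ m _ m] assoc_mult_mat[of _ m m _ m _ m])
  qed
  also have "\<dots> = (N * mat_trace (X0 * A) / of_nat m) \<cdot>\<^sub>m 1\<^sub>m m"
    using X0 A by (intro average_scalar irr) auto
  also have "mat_trace (X0 * A) = A $$ (i, j)"
  proof -
    have "mat_trace (X0 * A) = (\<Sum>k<m. \<Sum>l<n. if k = j then if l = i then A $$ (l, k) else 0 else 0)"
      unfolding mat_trace_mult[OF X0 A] by (intro sum.cong) (auto simp: X0_def)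
    also have "\<dots> = (\<Sum>k<m. if k = j then \<Sum>l<n. if l = i then A $$ (l, k) else 0 else 0)"
      by (intro sum.cong) auto
    also have "\<dots> = A $$ (i, j)" using ij by simp
    finally show ?thesis .
  qed
  finally have BA': "B * A = (N * A $$ (i, j) / of_nat m) \<cdot>\<^sub>m 1\<^sub>m m" .
  define c' where "c' = N * A $$ (i, j) / of_nat m"
  have BA: "B * A = c' \<cdot>\<^sub>m 1\<^sub>m m" and c': "c' \<noteq> 0"
    using BA' ij irr_pos[OF irr(2)] card_pos by (auto simp: c'_def)
  have "A * B * \<rho> g = \<rho> g * (A * B)" if g: "g \<in> carrier G" for g
  proof -
    have "A * B * \<rho> g = A * (\<sigma> g * B)" using A B cr[OF g] by (simp add: iB[OF g])
    also have "\<dots> = \<rho> g * A * B" using A B cr[OF g] by (simp add: iA[OF g])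
    also have "\<dots> = \<rho> g * (A * B)" using A B cr[OF g] by simp
    finally show ?thesis .
  qed
  then obtain c where AB: "A * B = c \<cdot>\<^sub>m 1\<^sub>m n"
    using schur_scalar[OF irr(1) group_axioms mult_carrier_mat[OF A B]] by blast
  have "c \<cdot>\<^sub>m A = A * B * A" using A by (simp add: AB mult_smult_assoc_mat[of _ n n])
  also have "\<dots> = A * (B * A)" using A B by simp
  also have "\<dots> = c' \<cdot>\<^sub>m A" using A by (simp add: BA mult_smult_distrib[of A n m _ m])
  finally have "(c \<cdot>\<^sub>m A) $$ (i, j) = (c' \<cdot>\<^sub>m A) $$ (i, j)" by simp
  then have cc: "c = c'" using ij A by auto
  have "mat_trace (\<rho> g) = mat_trace (\<sigma> g)" if g: "g \<in> carrier G" for g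
  proof -
    have "c' * mat_trace (\<sigma> g) = mat_trace (\<sigma> g * (B * A))"
      using cr[OF g] by (simp add: BA mult_smult_distrib[of _ m m _ m] mat_trace_smult)
    also have "\<sigma> g * (B * A) = (B * \<rho> g) * A"
      using cr[OF g] A B by (simp add: iB[OF g, symmetric])
    also have "mat_trace \<dots> = mat_trace (A * (B * \<rho> g))"
      using cr[OF g] A B by (intro mat_trace_comm) auto
    also have "A * (B * \<rho> g) = c \<cdot>\<^sub>m \<rho> g"
      using cr[OF g] A B by (simp add: assoc_mult_mat[of A n m B n "\<rho> g" n, symmetric] AB mult_smult_assoc_mat[of _ n n])
    also have "mat_trace \<dots> = c' * mat_trace (\<rho> g)"
      using cr[OF g] by (simp add: cc mat_trace_smult)
    finally show ?thesis using c' by simp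
  qed
  then have "character_of G \<rho> = character_of G \<sigma>"
    by (auto simp: character_of_def)
  with ne show False ..
qed

lemma average_elementary_entry:
  assumes r: "representation G n \<rho>" and s: "representation G m \<sigma>"
    and ijkl: "i < n" "j < n" "k < m" "l < m"
  shows "average n m \<rho> \<sigma> (mat n m (\<lambda>x. if x = (j, k) then 1 else 0)) $$ (i, l) =
    (\<Sum>g\<in>carrier G. \<rho> (inv g) $$ (i, j) * \<sigma> g $$ (k, l))"
proof -
  let ?E = "mat n m (\<lambda>x. if x = (j, k) then 1 else 0) :: complex mat"
  have "(\<rho> (inv g) * ?E * \<sigma> g) $$ (i, l) = \<rho> (inv g) $$ (i, j) * \<sigma> g $$ (k, l)" if g: "g \<in> carrier G" for g
  proof -
    have c: "\<rho> (inv g) \<in> carrier_mat n n" "\<sigma> g \<in> carrier_mat m m" "?E \<in> carrier_mat n m"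
      using g rep_closed[OF r] rep_closed[OF s] by auto
    have e: "(\<rho> (inv g) * ?E) $$ (i, k') = (if k' = k then \<rho> (inv g) $$ (i, j) else 0)" if "k' < m" for k'
    proof -
      have "(\<rho> (inv g) * ?E) $$ (i, k') = (\<Sum>j'<n. if j' = j then (if k' = k then \<rho> (inv g) $$ (i, j') else 0) else 0)"
        unfolding mult_mat_entry[OF c(1,3) ijkl(1) that] using that by (intro sum.cong) auto
      then show ?thesis using ijkl by simp
    qed
    have "(\<rho> (inv g) * ?E * \<sigma> g) $$ (i, l) = (\<Sum>k'<m. if k' = k then \<rho> (inv g) $$ (i, j) * \<sigma> g $$ (k', l) else 0)"
      unfolding mult_mat_entry[OF mult_carrier_mat[OF c(1,3)] c(2) ijkl(1,4)]
      by (intro sum.cong) (auto simp: e)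
    then show ?thesis using ijkl by simp
  qed
  then show ?thesis using ijkl by (simp add: average_def msum_index)
qed

lemma schur_orthogonality_same:
  assumes irr: "irreducible_representation G n \<rho>" and ijkl: "i < n" "j < n" "k < n" "l < n"
  shows "(\<Sum>g\<in>carrier G. \<rho> (inv g) $$ (i, j) * \<rho> g $$ (k, l)) =
    (if i = l \<and> j = k then N / of_nat n else 0)"
proof -
  let ?E = "mat n n (\<lambda>x. if x = (j, k) then 1 else 0) :: complex mat"
  have "mat_trace ?E = (\<Sum>i<n. if i = j then if j = k then 1 else 0 else 0)"
    unfolding mat_trace_def by (intro sum.cong) auto
  then have "mat_trace ?E = (if j = k then 1 else 0)" using ijkl by simp
  then show ?thesis
    unfolding average_elementary_entry[OF irr_rep[OF irr] irr_rep[OF irr] ijkl, symmetric]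
    by (subst average_scalar[OF irr]) (use ijkl in auto)
qed

lemma schur_orthogonality_diff:
  assumes irr: "irreducible_representation G n \<rho>" "irreducible_representation G m \<sigma>"
    and ne: "character_of G \<rho> \<noteq> character_of G \<sigma>" and ijkl: "i < n" "j < n" "k < m" "l < m"
  shows "(\<Sum>g\<in>carrier G. \<rho> (inv g) $$ (i, j) * \<sigma> g $$ (k, l)) = 0"
  unfolding average_elementary_entry[OF irr_rep[OF irr(1)] irr_rep[OF irr(2)] ijkl, symmetric]
  by (subst average_zero[OF irr ne]) (use ijkl in auto)

end

section \<open>Character values\<close>

lemma upper_triangular_mult:
  assumes A: "(A :: complex mat) \<in> carrier_mat n n" "upper_triangular A"
    and B: "B \<in> carrier_mat n n" "upper_triangular B"
  shows "upper_triangular (A * B)" "i < n \<Longrightarrow> (A * B) $$ (i, i) = A $$ (i, i) * B $$ (i, i)"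
proof -
  have z: "A $$ (i, k) * B $$ (k, j) = 0" if "i < n" "j < n" "k < n" "j \<le> i" "k \<noteq> i \<or> j < i" for i j k
  proof (cases "k < i")
    case True
    then show ?thesis using A that by (auto simp: upper_triangular_def)
  next
    case False
    then have "j < k" using that by auto
    then show ?thesis using B that by (auto simp: upper_triangular_def)
  qed
  show "upper_triangular (A * B)"
  proof
    fix i j assume "j < i" "i < dim_row (A * B)"
    then show "(A * B) $$ (i, j) = 0"
      using A(1) B(1) z[of i j]
      by (subst mult_mat_entry[OF A(1) B(1)]) (auto intro!: sum.neutral)
  qed
  show "(A * B) $$ (i, i) = A $$ (i, i) * B $$ (i, i)" if "i < n"
  proof -
    have "(A * B) $$ (i, i) = (\<Sum>k<n. if k = i then A $$ (i, k) * B $$ (k, i) else 0)"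
      unfolding mult_mat_entry[OF A(1) B(1) that that] using that z[of i i]
      by (intro sum.cong) auto
    then show ?thesis using that by simp
  qed
qed

lemma upper_triangular_pow:
  assumes A: "(A :: complex mat) \<in> carrier_mat n n" "upper_triangular A"
  shows "upper_triangular (A ^\<^sub>m k) \<and> (\<forall>i<n. (A ^\<^sub>m k) $$ (i, i) = (A $$ (i, i)) ^ k)"
proof (induction k)
  case 0
  then show ?case using A by auto
next
  case (Suc k)
  have c: "A ^\<^sub>m k \<in> carrier_mat n n" using A by simp
  show ?case
    using upper_triangular_mult[OF c _ A] Suc A by (auto simp del: index_mult_mat)
qed

context fin_group
begin

lemma rep_pow:
  assumes r: "representation G n \<rho>" and g: "g \<in> carrier G"
  shows "\<rho> (g [^] (k::nat)) = \<rho> g ^\<^sub>m k"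
proof (induction k)
  case 0
  then show ?case using rep_one[OF r] rep_closed[OF r g] by auto
next
  case (Suc k)
  then show ?case using rep_mult[OF r _ g, of "g [^] k"] g by auto
qed

lemma pow_card_eq_one: "g \<in> carrier G \<Longrightarrow> g [^] card (carrier G) = \<one>"
  using pow_order_eq_1[of g] by (simp add: Coset.order_def)

text \<open>Triangularising \<open>\<rho>(g)\<close> shows all powers of \<open>g\<close> at once to have as trace the
  corresponding power sum of the eigenvalues, which are roots of unity.\<close>

lemma rep_eigenvalues:
  assumes r: "representation G n \<rho>" and g: "g \<in> carrier G"
  obtains es where "length es = n" "\<And>e m. e \<in> set es \<Longrightarrow> g [^] (m::nat) = \<one> \<Longrightarrow> e ^ m = 1"
    "\<And>k::nat. mat_trace (\<rho> (g [^] k)) = (\<Sum>e\<leftarrow>es. e ^ k)" "det (\<rho> g) = prod_list es"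
proof -
  have A: "\<rho> g \<in> carrier_mat n n" by (rule rep_closed[OF r g])
  obtain as where as: "char_poly (\<rho> g) = (\<Prod>a\<leftarrow>as. [:- a, 1:])" "length as = n"
    using char_poly_factorized[OF A] by blast
  obtain B P Q where "schur_decomposition (\<rho> g) as = (B, P, Q)" by (cases "schur_decomposition (\<rho> g) as")
  from schur_decomposition[OF A as(1) this]
  have sim: "similar_mat_wit (\<rho> g) B P Q" and ut: "upper_triangular B" and diag: "diag_mat B = as" by auto
  from similar_mat_witD2[OF A sim] have PQ: "P * Q = 1\<^sub>m n" "Q * P = 1\<^sub>m n"
    and B: "B \<in> carrier_mat n n" and P: "P \<in> carrier_mat n n" and Q: "Q \<in> carrier_mat n n" by auto
  have pw: "\<rho> (g [^] k) = P * B ^\<^sub>m k * Q" for k :: nat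
    using similar_mat_wit_pow_id[OF sim] rep_pow[OF r g] by simp
  have Bk: "B ^\<^sub>m k \<in> carrier_mat n n" for k using B by simp
  have "map (\<lambda>i. B $$ (i, i)) [0..<n] = as" using diag B by (simp add: diag_mat_def)
  then have as': "as = map (\<lambda>i. B $$ (i, i)) [0..<n]" by simp
  show thesis
  proof
    show "length as = n" by fact
    show "mat_trace (\<rho> (g [^] k)) = (\<Sum>e\<leftarrow>as. e ^ k)" for k :: nat
    proof -
      have "mat_trace (\<rho> (g [^] k)) = mat_trace (Q * (P * B ^\<^sub>m k))"
        unfolding pw using P Q Bk by (intro mat_trace_comm) auto
      also have "Q * (P * B ^\<^sub>m k) = B ^\<^sub>m k"
        using assoc_mult_mat[OF Q P Bk, of k] PQ left_mult_one_mat[OF Bk[of k]] by simp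
      also have "mat_trace (B ^\<^sub>m k) = (\<Sum>i<n. (B $$ (i, i)) ^ k)"
        using upper_triangular_pow[OF B ut, of k] by (simp add: mat_trace_carrier[OF Bk])
      also have "\<dots> = (\<Sum>e\<leftarrow>as. e ^ k)"
        by (simp add: as' comp_def interv_sum_list_conv_sum_set_nat atLeast0LessThan)
      finally show ?thesis .
    qed
    show "e ^ m = 1" if e: "e \<in> set as" and m: "g [^] m = \<one>" for e m
    proof -
      have "P * B ^\<^sub>m m * Q = 1\<^sub>m n" using pw[of m] rep_one[OF r] m by simp
      then have "Q * (P * B ^\<^sub>m m * Q) * P = 1\<^sub>m n" using Q P PQ by simp
      moreover have "Q * (P * B ^\<^sub>m m * Q) * P = (Q * P) * B ^\<^sub>m m * (Q * P)"
        using P Q Bk[of m] by (simp add: assoc_mult_mat[of _ n n _ n _ n])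
      ultimately have "B ^\<^sub>m m = 1\<^sub>m n"
        using PQ left_mult_one_mat[OF Bk[of m]] right_mult_one_mat[OF Bk[of m]] by simp
      moreover obtain i where i: "i < n" "e = B $$ (i, i)" using e as' by auto
      ultimately show ?thesis
        using upper_triangular_pow[OF B ut, of m] by auto
    qed
    have "det (\<rho> g) = det B"
      using det_similar[of "\<rho> g" B] sim by (auto simp: similar_mat_def)
    then show "det (\<rho> g) = prod_list as"
      using det_upper_triangular[OF ut B] diag by simp
  qed
qed

lemma IrrE:
  assumes "\<chi> \<in> Irr G"
  obtains n \<rho> where "irreducible_representation G n \<rho>" "\<chi> = character_of G \<rho>" "n > 0"
    "\<And>g. g \<in> carrier G \<Longrightarrow> \<chi> g = mat_trace (\<rho> g)" "\<chi> \<one> = of_nat n" "representation G n \<rho>"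
proof -
  obtain n \<rho> where r: "irreducible_representation G n \<rho>" "\<chi> = character_of G \<rho>"
    using assms unfolding Irr_def by auto
  show thesis
    by (rule that[OF r]) (use irr_pos[OF r(1)] irr_rep[OF r(1)] in \<open>auto simp: r(2) character_of_def rep_one mat_trace_def\<close>)
qed

definition deg :: "('a \<Rightarrow> complex) \<Rightarrow> nat" where
  "deg \<chi> = nat \<lfloor>Re (\<chi> \<one>)\<rfloor>"

lemma deg: "\<chi> \<in> Irr G \<Longrightarrow> \<chi> \<one> = of_nat (deg \<chi>)"
  and deg_pos: "\<chi> \<in> Irr G \<Longrightarrow> deg \<chi> > 0"
  by (erule IrrE; simp add: deg_def)+

lemma Irr_ext: "\<chi> \<in> Irr G \<Longrightarrow> \<psi> \<in> Irr G \<Longrightarrow> (\<And>g. g \<in> carrier G \<Longrightarrow> \<chi> g = \<psi> g) \<Longrightarrow> \<chi> = \<psi>"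
  by (auto simp: Irr_def character_of_def restrict_def fun_eq_iff)

lemma Irr_comm:
  assumes "\<chi> \<in> Irr G" "g \<in> carrier G" "h \<in> carrier G"
  shows "\<chi> (g \<otimes> h) = \<chi> (h \<otimes> g)"
proof -
  obtain n \<rho> where "\<And>g. g \<in> carrier G \<Longrightarrow> \<chi> g = mat_trace (\<rho> g)" and r: "representation G n \<rho>"
    by (rule IrrE[OF assms(1)]) blast
  then show ?thesis
    using assms(2,3) mat_trace_comm[OF rep_closed[OF r] rep_closed[OF r], of g h] by (simp add: rep_mult[OF r])
qed

lemma Irr_conj:
  assumes "\<chi> \<in> Irr G" "g \<in> carrier G" "h \<in> carrier G"
  shows "\<chi> (h \<otimes> g \<otimes> inv h) = \<chi> g"
  using Irr_comm[OF assms(1), of h "g \<otimes> inv h"] assms by (simp add: m_assoc)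

text \<open>On roots of unity, inversion is complex conjugation.\<close>

lemma Irr_inverse:
  assumes "\<chi> \<in> Irr G" and g: "g \<in> carrier G"
  shows "\<chi> (inv g) = cnj (\<chi> g)"
proof -
  obtain n \<rho> where *: "\<And>g. g \<in> carrier G \<Longrightarrow> \<chi> g = mat_trace (\<rho> g)" and r: "representation G n \<rho>"
    by (rule IrrE[OF assms(1)]) blast
  obtain es where es: "\<And>e m. e \<in> set es \<Longrightarrow> g [^] (m::nat) = \<one> \<Longrightarrow> e ^ m = 1"
    "\<And>k::nat. mat_trace (\<rho> (g [^] k)) = (\<Sum>e\<leftarrow>es. e ^ k)"
    using rep_eigenvalues[OF r g] by metis
  define M where "M = card (carrier G)"
  have M: "M > 0" "g [^] M = \<one>" using card_pos pow_card_eq_one[OF g] by (auto simp: M_def)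
  have "g [^] (M - 1) \<otimes> g = \<one>" using M g by (simp flip: nat_pow_Suc)
  then have ig: "inv g = g [^] (M - 1)" using g by (simp add: inv_equality)
  have "e ^ (M - 1) = cnj e" if "e \<in> set es" for e
  proof -
    have e: "e ^ M = 1" using es(1)[OF that M(2)] .
    then have "norm e ^ M = 1" by (metis norm_one norm_power)
    then have "norm e = 1" using M(1) using power_eq_iff_eq_base[of M "norm e" 1] by simp
    then have "e * cnj e = 1" by (simp add: complex_norm_square[symmetric])
    moreover have "e * e ^ (M - 1) = 1" using e M(1) by (simp flip: power_Suc)
    ultimately show ?thesis by (metis mult.assoc mult.commute mult_1)
  qed
  then have "(\<Sum>e\<leftarrow>es. e ^ (M - 1)) = (\<Sum>e\<leftarrow>es. cnj e)" by (simp cong: map_cong)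
  also have "\<dots> = cnj (\<Sum>e\<leftarrow>es. e)" by (induction es) auto
  finally show ?thesis
    using es(2)[of "M - 1"] es(2)[of 1] g by (simp add: * ig)
qed

text \<open>The convolution form of the orthogonality relations; at \<open>g = \<one>\<close> it is the first
  orthogonality relation.\<close>

lemma Irr_convolution:
  assumes "\<chi> \<in> Irr G" "\<psi> \<in> Irr G" and g: "g \<in> carrier G"
  shows "(\<Sum>h\<in>carrier G. \<chi> (g \<otimes> inv h) * \<psi> h) = (if \<chi> = \<psi> then N / \<chi> \<one> * \<chi> g else 0)"
proof -
  obtain n \<rho> where c: "\<And>g. g \<in> carrier G \<Longrightarrow> \<chi> g = mat_trace (\<rho> g)" and r: "representation G n \<rho>"
    and ir: "irreducible_representation G n \<rho>" "\<chi> = character_of G \<rho>" and n: "\<chi> \<one> = of_nat n"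
    by (rule IrrE[OF assms(1)]) blast
  obtain m \<sigma>' where c'': "\<And>g. g \<in> carrier G \<Longrightarrow> \<psi> g = mat_trace (\<sigma>' g)"
    and irs': "irreducible_representation G m \<sigma>'" "\<psi> = character_of G \<sigma>'"
    by (rule IrrE[OF assms(2)]) blast
  \<comment> \<open>Equal characters may come from different representations; in that case both are represented by \<open>\<rho>\<close>.\<close>
  define \<sigma> where "\<sigma> = (if \<chi> = \<psi> then \<rho> else \<sigma>')"
  define k where "k = (if \<chi> = \<psi> then n else m)"
  have c': "\<And>g. g \<in> carrier G \<Longrightarrow> \<psi> g = mat_trace (\<sigma> g)" and irs: "irreducible_representation G k \<sigma>"
    using c c'' ir irs' by (auto simp: \<sigma>_def k_def)
  note s = irr_rep[OF irs]
  have "\<chi> (g \<otimes> inv h) * \<psi> h = (\<Sum>i<n. \<Sum>j<n. \<Sum>l<k. \<rho> g $$ (i, j) * (\<rho> (inv h) $$ (j, i) * \<sigma> h $$ (l, l)))"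
    if h: "h \<in> carrier G" for h
  proof -
    have "\<chi> (g \<otimes> inv h) = (\<Sum>i<n. \<Sum>j<n. \<rho> g $$ (i, j) * \<rho> (inv h) $$ (j, i))"
      using g h by (simp add: c rep_mult[OF r] mat_trace_mult[OF rep_closed[OF r] rep_closed[OF r]])
    moreover have "\<psi> h = (\<Sum>l<k. \<sigma> h $$ (l, l))"
      using h by (simp add: c' mat_trace_carrier[OF rep_closed[OF s]])
    ultimately show ?thesis
      by (simp only: sum_distrib_right) (simp only: sum_distrib_left mult.assoc)
  qed
  then have "(\<Sum>h\<in>carrier G. \<chi> (g \<otimes> inv h) * \<psi> h) =
      (\<Sum>h\<in>carrier G. \<Sum>i<n. \<Sum>j<n. \<Sum>l<k. \<rho> g $$ (i, j) * (\<rho> (inv h) $$ (j, i) * \<sigma> h $$ (l, l)))"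
    by (rule sum.cong[OF refl])
  also have "\<dots> = (\<Sum>i<n. \<Sum>j<n. \<Sum>l<k. \<Sum>h\<in>carrier G. \<rho> g $$ (i, j) * (\<rho> (inv h) $$ (j, i) * \<sigma> h $$ (l, l)))"
    by (simp only: sum.swap[of _ _ "carrier G"])
  also have "\<dots> = (\<Sum>i<n. \<Sum>j<n. \<Sum>l<k. \<rho> g $$ (i, j) * (\<Sum>h\<in>carrier G. \<rho> (inv h) $$ (j, i) * \<sigma> h $$ (l, l)))"
    by (simp only: sum_distrib_left)
  also have "\<dots> = (if \<chi> = \<psi> then N / \<chi> \<one> * \<chi> g else 0)"
  proof (cases "\<chi> = \<psi>")
    case True
    then have sk: "\<sigma> = \<rho>" "k = n" by (auto simp: \<sigma>_def k_def)
    have "(\<Sum>i<n. \<Sum>j<n. \<Sum>l<k. \<rho> g $$ (i, j) * (\<Sum>h\<in>carrier G. \<rho> (inv h) $$ (j, i) * \<sigma> h $$ (l, l)))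
      = (\<Sum>i<n. \<Sum>j<n. \<Sum>l<n. if j = l then if i = l then \<rho> g $$ (i, j) * (N / of_nat n) else 0 else 0)"
      unfolding sk by (intro sum.cong refl) (auto simp: schur_orthogonality_same[OF ir(1)])
    also have "\<dots> = (\<Sum>i<n. \<Sum>j<n. if i = j then \<rho> g $$ (i, j) * (N / of_nat n) else 0)"
      by (intro sum.cong refl) auto
    also have "\<dots> = (\<Sum>i<n. \<rho> g $$ (i, i) * (N / of_nat n))"
      by (intro sum.cong refl) auto
    also have "\<dots> = N / of_nat n * \<chi> g"
      using g by (simp add: c mat_trace_carrier[OF rep_closed[OF r]] sum_distrib_left mult.commute)
    finally show ?thesis using True n by simp
  next
    case False
    have "character_of G \<rho> \<noteq> character_of G \<sigma>" using False ir irs' by (auto simp: \<sigma>_def)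
    then show ?thesis
      using False by (simp add: schur_orthogonality_diff[OF ir(1) irs])
  qed
  finally show ?thesis .
qed

lemma Irr_orthogonality:
  assumes "\<chi> \<in> Irr G" "\<psi> \<in> Irr G"
  shows "(\<Sum>h\<in>carrier G. cnj (\<chi> h) * \<psi> h) = (if \<chi> = \<psi> then N else 0)"
proof -
  have "(\<Sum>h\<in>carrier G. cnj (\<chi> h) * \<psi> h) = (\<Sum>h\<in>carrier G. \<chi> (\<one> \<otimes> inv h) * \<psi> h)"
    using assms(1) by (intro sum.cong) (auto simp: Irr_inverse)
  then show ?thesis
    using Irr_convolution[OF assms one_closed] deg[OF assms(1)] deg_pos[OF assms(1)] by (cases "\<chi> = \<psi>") simp_all
qed

lemma Irr_norm:
  assumes "\<chi> \<in> Irr G"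
  shows "(\<Sum>h\<in>carrier G. (cmod (\<chi> h))\<^sup>2) = card (carrier G)"
proof -
  have "complex_of_real (\<Sum>h\<in>carrier G. (cmod (\<chi> h))\<^sup>2) = (\<Sum>h\<in>carrier G. cnj (\<chi> h) * \<chi> h)"
    by (simp add: complex_norm_square mult.commute del: of_real_power)
  also have "\<dots> = of_real (card (carrier G))" using Irr_orthogonality[OF assms assms] by simp
  finally show ?thesis by (simp only: of_real_eq_iff)
qed

end

section \<open>Algebraic integers\<close>

text \<open>The vector of generators \<open>v\<close> is an eigenvector of an integer matrix, with eigenvalue \<open>z\<close>.\<close>

lemma algebraic_int_family:
  fixes z :: complex
  assumes "finite I" "k \<in> I" "v k \<noteq> 0"
    and eq: "\<And>i. i \<in> I \<Longrightarrow> z * v i = (\<Sum>j\<in>I. of_int (M i j) * v j)"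
  shows "algebraic_int z"
proof -
  define n where "n = card I"
  obtain f where f: "bij_betw f {0..<n} I" using ex_bij_betw_nat_finite[OF assms(1)] unfolding n_def by blast
  define A :: "int mat" where "A = mat n n (\<lambda>(i, j). M (f i) (f j))"
  have A: "A \<in> carrier_mat n n" by (simp add: A_def)
  define A' :: "complex mat" where "A' = map_mat of_int A"
  have A': "A' \<in> carrier_mat n n" using A by (simp add: A'_def)
  define w where "w = vec n (\<lambda>i. v (f i))"
  have "eigenvector A' w z"
    unfolding eigenvector_def
  proof (intro conjI)
    show "w \<in> carrier_vec (dim_row A')" using A' by (auto simp: w_def)
    obtain k' where k: "k' < n" "f k' = k" using f assms(2) by (auto simp: bij_betw_def)
    then have "w $ k' \<noteq> 0\<^sub>v n $ k'" using assms(3) by (auto simp: w_def)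
    then show "w \<noteq> 0\<^sub>v (dim_row A')" using A' by auto
    show "A' *\<^sub>v w = z \<cdot>\<^sub>v w"
    proof (rule eq_vecI)
      fix i assume "i < dim_vec (z \<cdot>\<^sub>v w)"
      then have i: "i < n" by (simp add: w_def)
      then have fi: "f i \<in> I" using f by (auto simp: bij_betw_def)
      have "(A' *\<^sub>v w) $ i = (\<Sum>j = 0..<n. of_int (M (f i) (f j)) * v (f j))"
        using i A by (auto simp: A'_def A_def w_def scalar_prod_def)
      also have "\<dots> = (\<Sum>j\<in>I. of_int (M (f i) j) * v j)"
        using f by (rule sum.reindex_bij_betw)
      finally show "(A' *\<^sub>v w) $ i = (z \<cdot>\<^sub>v w) $ i" using i by (simp add: w_def eq[OF fi])
    qed (use A' in \<open>auto simp: w_def\<close>)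
  qed
  then have "poly (char_poly A') z = 0"
    using eigenvalue_root_char_poly[OF A'] by (auto simp: eigenvalue_def)
  moreover have "char_poly A' = map_poly of_int (char_poly A)"
    unfolding A'_def by (rule of_int_hom.char_poly_hom[OF A])
  ultimately show ?thesis
    using degree_monic_char_poly[OF A] unfolding algebraic_int_altdef_ipoly by auto
qed

text \<open>The ring generated by the \<open>m\<close>-th roots of unity. Roots of unity being closed under
  multiplication, additive generation suffices.\<close>

inductive_set cyc :: "nat \<Rightarrow> complex set" for m where
  zero: "0 \<in> cyc m"
| plus: "w \<in> cyc m \<Longrightarrow> z ^ m = 1 \<Longrightarrow> w + z \<in> cyc m"
| minus: "w \<in> cyc m \<Longrightarrow> z ^ m = 1 \<Longrightarrow> w - z \<in> cyc m"

lemma cyc_root: "z ^ m = 1 \<Longrightarrow> z \<in> cyc m"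
  using cyc.plus[OF cyc.zero] by simp

lemma cyc_add: "b \<in> cyc m \<Longrightarrow> a \<in> cyc m \<Longrightarrow> a + b \<in> cyc m"
  by (induction b rule: cyc.induct) (auto simp: add.assoc[symmetric] add_diff_eq intro: cyc.intros)

lemma cyc_uminus: "a \<in> cyc m \<Longrightarrow> - a \<in> cyc m"
  by (induction rule: cyc.induct) (use cyc.minus cyc.plus in \<open>fastforce intro: cyc.zero\<close>)+

lemma cyc_diff: "a \<in> cyc m \<Longrightarrow> b \<in> cyc m \<Longrightarrow> a - b \<in> cyc m"
  using cyc_add[OF cyc_uminus, of b m a] by simp

lemma cyc_mult_root: "a \<in> cyc m \<Longrightarrow> z ^ m = 1 \<Longrightarrow> a * z \<in> cyc m"
  by (induction rule: cyc.induct) (auto simp: distrib_right left_diff_distrib power_mult_distrib intro: cyc.intros)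

lemma cyc_mult: "b \<in> cyc m \<Longrightarrow> a \<in> cyc m \<Longrightarrow> a * b \<in> cyc m"
  by (induction b rule: cyc.induct) (auto simp: distrib_left right_diff_distrib intro: cyc.zero cyc_add cyc_diff cyc_mult_root)

lemma cyc_one [simp]: "1 \<in> cyc m"
  by (rule cyc_root) simp

lemma cyc_of_nat: "of_nat k \<in> cyc m"
  by (induction k) (auto simp: cyc.zero cyc_add)

lemma cyc_of_int: "of_int k \<in> cyc m"
  by (cases k rule: int_cases2) (auto intro: cyc_of_nat cyc_uminus)

lemma cyc_sum: "(\<And>i. i \<in> S \<Longrightarrow> f i \<in> cyc m) \<Longrightarrow> sum f S \<in> cyc m"
  by (induction S rule: infinite_finite_induct) (auto intro: cyc.zero cyc_add)

lemma cyc_prod_list: "(\<And>i. i \<in> set xs \<Longrightarrow> f i \<in> cyc m) \<Longrightarrow> prod_list (map f xs) \<in> cyc m"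
  by (induction xs) (auto intro: cyc_root cyc_mult)

lemma cyc_sum_list: "(\<And>i. i \<in> set xs \<Longrightarrow> f i \<in> cyc m) \<Longrightarrow> sum_list (map f xs) \<in> cyc m"
  by (induction xs) (auto intro: cyc.zero cyc_add)

lemma cyc_poly: "x \<in> cyc m \<Longrightarrow> poly (map_poly of_int p) x \<in> cyc m"
proof (induction p)
  case (pCons a p)
  then show ?case by (auto simp: map_poly_pCons intro: cyc_add cyc_of_int cyc_mult)
qed (auto intro: cyc.zero)

lemma cyc_combination:
  assumes "a \<in> cyc m" "m > 0"
  obtains c :: "complex \<Rightarrow> int" where "a = (\<Sum>z | z ^ m = 1. of_int (c z) * z)"
proof -
  have fin: "finite {z::complex. z ^ m = 1}" using assms(2) by (intro finite_roots_unity) auto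
  have "\<exists>c::complex \<Rightarrow> int. a = (\<Sum>z | z ^ m = 1. of_int (c z) * z)"
    using assms(1)
  proof (induction rule: cyc.induct)
    case zero
    show ?case by (rule exI[of _ "\<lambda>_. 0"]) simp
  next
    case (plus w z)
    then obtain c :: "complex \<Rightarrow> int" where c: "w = (\<Sum>z | z ^ m = 1. of_int (c z) * z)" by blast
    have "(\<Sum>u | u ^ m = 1. (if u = z then u else 0)) = z" using plus fin by (simp add: sum.delta)
    then have "w + z = (\<Sum>u | u ^ m = 1. of_int (c u + (if u = z then 1 else 0)) * u)"
      unfolding c by (simp add: sum.distrib distrib_right if_distrib[of of_int] if_distribR if_distrib[of "\<lambda>x. x * _"] cong: if_cong)
    then show ?case by (rule exI[of _ "\<lambda>u. c u + (if u = z then 1 else 0)"])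
  next
    case (minus w z)
    then obtain c :: "complex \<Rightarrow> int" where c: "w = (\<Sum>z | z ^ m = 1. of_int (c z) * z)" by blast
    have "(\<Sum>u | u ^ m = 1. (if u = z then u else 0)) = z" using minus fin by (simp add: sum.delta)
    then have "w - z = (\<Sum>u | u ^ m = 1. of_int (c u - (if u = z then 1 else 0)) * u)"
      unfolding c by (simp add: sum_subtractf left_diff_distrib if_distrib[of of_int] if_distribR if_distrib[of "\<lambda>x. x * _"] cong: if_cong)
    then show ?case by (rule exI[of _ "\<lambda>u. c u - (if u = z then 1 else 0)"])
  qed
  then show thesis using that by blast
qed

text \<open>Multiplication by a root of unity permutes the roots of unity, so a ring element times a
  root of unity is again an integer combination, with translated coefficients.\<close>

lemma root_mult_combination:
  fixes c :: "complex \<Rightarrow> int"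
  assumes "y ^ m = 1" "m > 0"
  shows "(\<Sum>z | z ^ m = 1. of_int (c z) * z) * y = (\<Sum>z | z ^ m = 1. of_int (c (z / y)) * z)"
proof -
  have y: "y \<noteq> 0" using assms by (auto simp: power_0_left)
  have "(\<Sum>z | z ^ m = 1. of_int (c z) * z) * y = (\<Sum>z | z ^ m = 1. of_int (c z) * (z * y))"
    by (simp add: sum_distrib_right mult.assoc)
  also have "\<dots> = (\<Sum>z | z ^ m = 1. of_int (c (z / y)) * z)"
    using assms y
    by (intro sum.reindex_bij_witness[of _ "\<lambda>z. z / y" "\<lambda>z. z * y"])
       (auto simp: power_mult_distrib power_divide)
  finally show ?thesis .
qed

lemma cyc_algebraic_int:
  assumes "a \<in> cyc m" "m > 0"
  shows "algebraic_int a"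
proof -
  obtain c :: "complex \<Rightarrow> int" where c: "a = (\<Sum>z | z ^ m = 1. of_int (c z) * z)"
    using cyc_combination[OF assms] by blast
  show ?thesis
  proof (rule algebraic_int_family[where I = "{z. z ^ m = 1}" and v = "\<lambda>z. z" and k = 1 and M = "\<lambda>y z. c (z / y)"])
    show "finite {z::complex. z ^ m = 1}" using assms(2) by (intro finite_roots_unity) auto
  qed (use root_mult_combination[OF _ assms(2), of _ c] in \<open>auto simp: c\<close>)
qed

lemma cyc_rat_int: "a \<in> cyc m \<Longrightarrow> m > 0 \<Longrightarrow> a \<in> \<rat> \<Longrightarrow> a \<in> \<int>"
  using cyc_algebraic_int rational_algebraic_int_is_int by blast

text \<open>Since \<open>x\<close> is not zero, factors \<open>X\<close> of the polynomial can be divided out.\<close>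

lemma monic_root_nonzero_const:
  fixes x :: complex
  assumes "lead_coeff p = 1" "poly (map_poly of_int p) x = 0" "x \<noteq> 0"
  shows "\<exists>q::int poly. poly (map_poly of_int q) x = 0 \<and> coeff q 0 \<noteq> 0"
  using assms
proof (induction p)
  case (pCons a p)
  show ?case
  proof (cases "a = 0")
    case True
    then have "poly (map_poly of_int p) x = 0" "lead_coeff p = 1"
      using pCons.prems pCons.hyps by (auto simp: map_poly_pCons split: if_splits)
    then show ?thesis using pCons by blast
  next
    case False
    then show ?thesis using pCons by (intro exI[of _ "pCons a p"]) auto
  qed
qed auto

text \<open>A nonzero element of the ring divides a nonzero integer, namely the constant term of an integer
  polynomial of which it is a root, and only finitely many powers of \<open>p\<close> divide that integer.\<close>

lemma cyc_infinitely_divisible: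
  assumes x: "x \<in> cyc m" and m: "m > 0" and p: "p > (1::nat)"
    and div: "\<And>j. \<exists>r\<in>cyc m. x = of_nat p ^ j * r"
  shows "x = 0"
proof (rule ccontr)
  assume "x \<noteq> 0"
  obtain p' where "poly (map_poly of_int p') x = 0" "lead_coeff p' = (1::int)"
    using cyc_algebraic_int[OF x m] unfolding algebraic_int_altdef_ipoly by blast
  then obtain q where q: "poly (map_poly of_int q) x = 0" "coeff q 0 \<noteq> (0::int)"
    using monic_root_nonzero_const \<open>x \<noteq> 0\<close> by blast
  obtain c q' where cq: "q = pCons c q'" by (cases q)
  define y where "y = poly (map_poly of_int q') x"
  have y: "y \<in> cyc m" unfolding y_def by (rule cyc_poly[OF x])
  have "poly (map_poly of_int q) x = of_int c + x * y"
    using q(2) by (cases "c = 0 \<and> q' = 0") (auto simp: cq map_poly_pCons y_def)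
  then have xy: "x * y = - of_int c" using q(1) by (simp add: eq_neg_iff_add_eq_0 add.commute)
  \<comment> \<open>The quotient \<open>c / p^j\<close> is rational, and it is integral because \<open>p^j\<close> divides \<open>x\<close>.\<close>
  have "int p ^ j dvd c" for j
  proof -
    obtain r where r: "r \<in> cyc m" "x = of_nat p ^ j * r" using div by blast
    have e: "of_nat p ^ j * (r * y) = - of_int c" using xy r by (simp add: mult.assoc)
    have "r * y = - of_int c / of_nat p ^ j" using e p by (simp add: field_simps)
    then have "r * y \<in> \<rat>" by auto
    then have "r * y \<in> \<int>" using cyc_rat_int[OF cyc_mult[OF y r(1)] m] by blast
    then obtain k where k: "r * y = of_int k" by (auto simp: Ints_def)
    have "of_int (int p ^ j * k) = (of_int (- c) :: complex)" using e k by simp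
    then have "int p ^ j * k = - c" by (simp only: of_int_eq_iff)
    then show ?thesis by (metis dvd_minus_iff dvd_triv_left)
  qed
  moreover have "c \<noteq> 0" using q(2) cq by simp
  moreover have "int p ^ nat \<bar>c\<bar> > \<bar>c\<bar>"
  proof -
    have "nat \<bar>c\<bar> < 2 ^ nat \<bar>c\<bar>" by (rule less_exp)
    also have "\<dots> \<le> p ^ nat \<bar>c\<bar>" using p by (intro power_mono) auto
    finally show ?thesis by (simp flip: of_nat_less_iff[where 'a = int])
  qed
  ultimately show False
    by (metis abs_ge_self abs_of_nat dvd_imp_le_int linorder_not_less of_nat_power zero_less_abs_iff)
qed

section \<open>Kernels and codegrees\<close>

context fin_group
begin

lemma Irr_cyc:
  assumes "\<chi> \<in> Irr G" and g: "g \<in> carrier G"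
  shows "\<chi> g \<in> cyc (card (carrier G))"
proof -
  obtain n \<rho> where *: "\<And>g. g \<in> carrier G \<Longrightarrow> \<chi> g = mat_trace (\<rho> g)" and r: "representation G n \<rho>"
    by (rule IrrE[OF assms(1)]) blast
  obtain es where es: "\<And>e m. e \<in> set es \<Longrightarrow> g [^] (m::nat) = \<one> \<Longrightarrow> e ^ m = 1"
    "\<And>k::nat. mat_trace (\<rho> (g [^] k)) = (\<Sum>e\<leftarrow>es. e ^ k)"
    using rep_eigenvalues[OF r g] by metis
  have "\<chi> g = (\<Sum>e\<leftarrow>es. e)" using es(2)[of 1] g by (simp add: *)
  then show ?thesis
    using es(1)[OF _ pow_card_eq_one[OF g]] cyc_sum_list[of es "\<lambda>e. e"] by (auto intro: cyc_root)
qed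

lemma kernel_subset: "character_kernel G \<chi> \<subseteq> carrier G"
  by (auto simp: character_kernel_def)

text \<open>For \<open>g\<close> in the kernel, the translate of \<open>\<chi>\<close> by \<open>g\<close> has the same norm as
  \<open>\<chi>\<close> and, by the convolution formula, the same inner product with \<open>\<chi>\<close>; so the two coincide.\<close>

lemma kernel_translate:
  assumes \<chi>: "\<chi> \<in> Irr G" and g: "g \<in> character_kernel G \<chi>" and h: "h \<in> carrier G"
  shows "\<chi> (g \<otimes> h) = \<chi> h"
proof -
  have gc: "g \<in> carrier G" and g1: "\<chi> g = \<chi> \<one>" using g by (auto simp: character_kernel_def)
  have "(\<Sum>h\<in>carrier G. \<chi> (g \<otimes> h) * cnj (\<chi> h)) = (\<Sum>h\<in>carrier G. \<chi> (g \<otimes> inv h) * \<chi> h)"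
    using sum.reindex_bij_betw[OF bij_inv, of "\<lambda>h. \<chi> (g \<otimes> h) * cnj (\<chi> h)"] 
    by (simp add: Irr_inverse[OF \<chi>] cong: sum.cong)
  also have "\<dots> = N"
    using Irr_convolution[OF \<chi> \<chi> gc] deg[OF \<chi>] deg_pos[OF \<chi>] g1 by simp
  finally have i: "(\<Sum>h\<in>carrier G. \<chi> (g \<otimes> h) * cnj (\<chi> h)) = N" .
  then have "cnj (\<Sum>h\<in>carrier G. \<chi> (g \<otimes> h) * cnj (\<chi> h)) = cnj N" by simp
  then have i': "(\<Sum>h\<in>carrier G. cnj (\<chi> (g \<otimes> h)) * \<chi> h) = N" by simp
  have n: "(\<Sum>h\<in>carrier G. cnj (\<chi> h) * \<chi> h) = N" using Irr_orthogonality[OF \<chi> \<chi>] by simp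
  then have n': "(\<Sum>h\<in>carrier G. cnj (\<chi> (g \<otimes> h)) * \<chi> (g \<otimes> h)) = N"
    using sum.reindex_bij_betw[OF bij_mult_left[OF gc], of "\<lambda>h. cnj (\<chi> h) * \<chi> h"] by simp
  have "complex_of_real (\<Sum>h\<in>carrier G. (cmod (\<chi> (g \<otimes> h) - \<chi> h))\<^sup>2)
      = (\<Sum>h\<in>carrier G. cnj (\<chi> (g \<otimes> h)) * \<chi> (g \<otimes> h) - cnj (\<chi> (g \<otimes> h)) * \<chi> h - \<chi> (g \<otimes> h) * cnj (\<chi> h) + cnj (\<chi> h) * \<chi> h)"
    unfolding of_real_sum complex_norm_square by (intro sum.cong refl) (simp add: algebra_simps)
  also have "\<dots> = 0" by (simp add: sum.distrib sum_subtractf i i' n n')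
  finally have "(\<Sum>h\<in>carrier G. (cmod (\<chi> (g \<otimes> h) - \<chi> h))\<^sup>2) = 0" by (simp only: of_real_eq_0_iff)
  then have "(cmod (\<chi> (g \<otimes> h) - \<chi> h))\<^sup>2 = 0"
    using h by (subst (asm) sum_nonneg_eq_0_iff) auto
  then show ?thesis by simp
qed

lemma kernel_normal:
  assumes \<chi>: "\<chi> \<in> Irr G"
  shows "character_kernel G \<chi> \<lhd> G"
proof (rule normal_invI)
  show "subgroup (character_kernel G \<chi>) G"
  proof
    fix x y assume "x \<in> character_kernel G \<chi>" "y \<in> character_kernel G \<chi>"
    then show "x \<otimes> y \<in> character_kernel G \<chi>"
      using kernel_translate[OF \<chi>, of x y] by (auto simp: character_kernel_def)
  next
    fix x assume "x \<in> character_kernel G \<chi>"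
    then show "inv x \<in> character_kernel G \<chi>"
      by (auto simp: character_kernel_def Irr_inverse[OF \<chi>] deg[OF \<chi>])
  qed (auto simp: character_kernel_def)
next
  fix x h assume "x \<in> carrier G" "h \<in> character_kernel G \<chi>"
  then show "x \<otimes> h \<otimes> inv x \<in> character_kernel G \<chi>"
    by (auto simp: character_kernel_def Irr_conj[OF \<chi>])
qed

lemma sum_over_cosets:
  assumes K: "subgroup K G" and f: "\<And>k h. k \<in> K \<Longrightarrow> h \<in> carrier G \<Longrightarrow> f (k \<otimes> h) = (f h :: complex)"
  shows "\<exists>T\<subseteq>carrier G. (\<Sum>h\<in>carrier G. f h) = of_nat (card K) * (\<Sum>t\<in>T. f t)"
proof -
  have Kc: "K \<subseteq> carrier G" using K by (rule subgroup.subset)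
  define rep where "rep C = (SOME x. x \<in> C)" for C :: "'a set"
  have rep: "rep C \<in> C" if C: "C \<in> rcosets K" for C
    using C rcos_self[OF _ K] unfolding rep_def by (auto simp: RCOSETS_def intro: someI[where P = "\<lambda>x. x \<in> _"])
  have Csub: "C \<subseteq> carrier G" if "C \<in> rcosets K" for C
    using that Kc by (auto simp: RCOSETS_def r_coset_def)
  have disj: "C = D" if "C \<in> rcosets K" "D \<in> rcosets K" "x \<in> C" "x \<in> D" for C D x
    using rcos_disjoint[OF K] that by (auto simp: pairwise_def disjnt_def)
  have "(\<Sum>h\<in>carrier G. f h) = (\<Sum>h\<in>\<Union>(rcosets K). f h)" by (simp add: rcosets_part_G[OF K])
  also have "\<dots> = (\<Sum>C\<in>rcosets K. \<Sum>h\<in>C. f h)"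
  proof (rule sum.Union_disjoint[unfolded comp_def])
    show "\<forall>A\<in>rcosets K. finite A" using Csub finite_subset[OF _ fin] by blast
    show "\<forall>A\<in>rcosets K. \<forall>B\<in>rcosets K. A \<noteq> B \<longrightarrow> A \<inter> B = {}" using disj by blast
  qed
  also have "\<dots> = (\<Sum>C\<in>rcosets K. of_nat (card K) * f (rep C))"
  proof (rule sum.cong[OF refl])
    fix C assume C: "C \<in> rcosets K"
    then obtain a where a: "a \<in> carrier G" "C = K #> a" by (auto simp: RCOSETS_def)
    then have eq: "C = K #> rep C" using repr_independence[OF _ a(1) K, of "rep C"] rep[OF C] by simp
    have "f h = f (rep C)" if "h \<in> C" for h
    proof -
      have "h \<in> K #> rep C" unfolding eq[symmetric] by (rule that)
      then obtain k where "k \<in> K" "h = k \<otimes> rep C" by (auto simp: r_coset_def)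
      then show ?thesis using f rep[OF C] Csub[OF C] by auto
    qed
    moreover have "card C = card K" using card_rcosets_equal[OF C Kc] by simp
    ultimately show "(\<Sum>h\<in>C. f h) = of_nat (card K) * f (rep C)" by simp
  qed
  also have "\<dots> = of_nat (card K) * (\<Sum>t\<in>rep ` (rcosets K). f t)"
  proof -
    have "inj_on rep (rcosets K)" using rep disj by (intro inj_onI) metis
    then show ?thesis by (simp add: sum.reindex sum_distrib_left)
  qed
  finally show ?thesis using rep Csub by (intro exI[of _ "rep ` (rcosets K)"]) blast
qed

lemma index_kernel:
  assumes \<chi>: "\<chi> \<in> Irr G"
  shows "card (rcosets (character_kernel G \<chi>)) * card (character_kernel G \<chi>) = card (carrier G)"
  using lagrange[OF normal_imp_subgroup[OF kernel_normal[OF \<chi>]]] by (simp add: Coset.order_def)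

lemma card_kernel_pos: "\<chi> \<in> Irr G \<Longrightarrow> card (character_kernel G \<chi>) > 0"
  using index_kernel card_pos by (metis mult_0_right neq0_conv)

text \<open>The quotient \<open>|G : ker \<chi>| / \<chi>(1)\<close> stabilises the module spanned by the products of
  roots of unity and values of \<open>\<chi>\<close>. This is the convolution formula, in which the terms
  belonging to one coset of the kernel coincide, so that a factor \<open>|ker \<chi>|\<close> cancels.\<close>

lemma codegree_integral:
  assumes \<chi>: "\<chi> \<in> Irr G"
  shows "algebraic_int (of_nat (card (rcosets (character_kernel G \<chi>))) / \<chi> \<one>)"
proof -
  define K where "K = character_kernel G \<chi>"
  define M where "M = card (carrier G)"
  have M: "M > 0" using card_pos by (simp add: M_def)
  have K: "subgroup K G" unfolding K_def by (rule normal_imp_subgroup[OF kernel_normal[OF \<chi>]])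
  define z where "z = of_nat (card (rcosets K)) / \<chi> \<one>"
  have cK: "card K > 0" unfolding K_def by (rule card_kernel_pos[OF \<chi>])
  have one: "\<chi> \<one> \<noteq> 0" using deg[OF \<chi>] deg_pos[OF \<chi>] by simp
  have NK: "N = of_nat (card (rcosets K)) * of_nat (card K)"
    using index_kernel[OF \<chi>] unfolding K_def by (metis of_nat_mult)
  have key: "\<exists>T\<subseteq>carrier G. z * \<chi> g = (\<Sum>t\<in>T. \<chi> (g \<otimes> inv t) * \<chi> t)" if g: "g \<in> carrier G" for g
  proof -
    have "\<chi> (g \<otimes> inv (k \<otimes> h)) * \<chi> (k \<otimes> h) = \<chi> (g \<otimes> inv h) * \<chi> h" if k: "k \<in> K" and h: "h \<in> carrier G" for k h
    proof -
      have kc: "k \<in> carrier G" "inv k \<in> K" using K k by (auto simp: subgroup.m_inv_closed subgroup.mem_carrier)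
      have "\<chi> (g \<otimes> inv (k \<otimes> h)) = \<chi> ((g \<otimes> inv h) \<otimes> inv k)" using g h kc by (simp add: inv_mult_group m_assoc)
      also have "\<dots> = \<chi> (inv k \<otimes> (g \<otimes> inv h))" using g h kc by (intro Irr_comm[OF \<chi>]) auto
      also have "\<dots> = \<chi> (g \<otimes> inv h)" using kc g h unfolding K_def by (intro kernel_translate[OF \<chi>]) auto
      finally show ?thesis using kernel_translate[OF \<chi>, of k h] k h by (simp add: K_def)
    qed
    from sum_over_cosets[OF K this] obtain T where T: "T \<subseteq> carrier G"
      "(\<Sum>h\<in>carrier G. \<chi> (g \<otimes> inv h) * \<chi> h) = of_nat (card K) * (\<Sum>t\<in>T. \<chi> (g \<otimes> inv t) * \<chi> t)" by blast
    have "of_nat (card K) * (z * \<chi> g) = N / \<chi> \<one> * \<chi> g" by (simp add: z_def NK)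
    also have "\<dots> = of_nat (card K) * (\<Sum>t\<in>T. \<chi> (g \<otimes> inv t) * \<chi> t)"
      using Irr_convolution[OF \<chi> \<chi> g] T(2) by simp
    finally show ?thesis using T(1) cK by auto
  qed
  then obtain T where T: "\<And>g. g \<in> carrier G \<Longrightarrow> T g \<subseteq> carrier G"
    "\<And>g. g \<in> carrier G \<Longrightarrow> z * \<chi> g = (\<Sum>t\<in>T g. \<chi> (g \<otimes> inv t) * \<chi> t)" by metis
  have ex: "\<exists>c::complex \<Rightarrow> int. \<chi> (g \<otimes> inv t) = (\<Sum>u | u ^ M = 1. of_int (c u) * u)"
    if "g \<in> carrier G" "t \<in> carrier G" for g t
  proof -
    have "\<chi> (g \<otimes> inv t) \<in> cyc M" unfolding M_def using that by (intro Irr_cyc[OF \<chi>]) auto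
    from cyc_combination[OF this M] show ?thesis by metis
  qed
  \<comment> \<open>Integer coefficients of \<open>\<chi>(gt\<^sup>-\<^sup>1)\<close> in terms of roots of unity; with them the action of \<open>z\<close> on
    the generators \<open>u \<chi>(h)\<close> is an integer matrix.\<close>
  define c where "c g t = (SOME c::complex \<Rightarrow> int. \<chi> (g \<otimes> inv t) = (\<Sum>u | u ^ M = 1. of_int (c u) * u))" for g t
  have c: "\<chi> (g \<otimes> inv t) = (\<Sum>u | u ^ M = 1. of_int (c g t u) * u)"
    if "g \<in> carrier G" "t \<in> carrier G" for g t
    using someI_ex[OF ex[OF that]] unfolding c_def .
  define U where "U = {u::complex. u ^ M = 1}"
  have finU: "finite U" unfolding U_def using M by (intro finite_roots_unity) auto
  have "algebraic_int z"
  proof (rule algebraic_int_family[where I = "U \<times> carrier G" and v = "\<lambda>(u, h). u * \<chi> h" and k = "(1, \<one>)"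
        and M = "\<lambda>(y, g) (u, h). if h \<in> T g then c g h (u / y) else 0"])
    fix i assume "i \<in> U \<times> carrier G"
    then obtain y g where i: "i = (y, g)" and y: "y ^ M = 1" and g: "g \<in> carrier G" by (auto simp: U_def)
    have "z * (y * \<chi> g) = (\<Sum>t\<in>T g. (\<chi> (g \<otimes> inv t) * y) * \<chi> t)"
      using T(2)[OF g] by (simp add: sum_distrib_left mult_ac)
    also have "\<dots> = (\<Sum>t\<in>T g. (\<Sum>u\<in>U. of_int (c g t (u / y)) * u) * \<chi> t)"
    proof (rule sum.cong[OF refl])
      fix t assume "t \<in> T g"
      then have t: "t \<in> carrier G" using T(1)[OF g] by blast
      show "(\<chi> (g \<otimes> inv t) * y) * \<chi> t = (\<Sum>u\<in>U. of_int (c g t (u / y)) * u) * \<chi> t"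
        unfolding c[OF g t] U_def by (simp only: root_mult_combination[OF y M])
    qed
    also have "\<dots> = (\<Sum>t\<in>carrier G. \<Sum>u\<in>U. of_int (if t \<in> T g then c g t (u / y) else 0) * (u * \<chi> t))"
      using T(1)[OF g]
      by (intro sum.mono_neutral_cong_left) (auto simp: sum_distrib_right mult.assoc intro: finite_subset)
    also have "\<dots> = (\<Sum>u\<in>U. \<Sum>t\<in>carrier G. of_int (if t \<in> T g then c g t (u / y) else 0) * (u * \<chi> t))"
      by (rule sum.swap)
    also have "\<dots> = (\<Sum>j\<in>U \<times> carrier G. of_int (case j of (u, h) \<Rightarrow> if h \<in> T g then c g h (u / y) else 0) * (case j of (u, h) \<Rightarrow> u * \<chi> h))"
      by (simp add: sum.cartesian_product case_prod_unfold)
    finally show "z * (case i of (u, h) \<Rightarrow> u * \<chi> h) = (\<Sum>j\<in>U \<times> carrier G. of_int ((case i of (y, g) \<Rightarrow> \<lambda>(u, h). if h \<in> T g then c g h (u / y) else 0) j) * (case j of (u, h) \<Rightarrow> u * \<chi> h))"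
      by (simp add: i)
  qed (use finU one in \<open>auto simp: U_def\<close>)
  then show ?thesis by (simp add: z_def K_def)
qed

text \<open>The codegree is rational and integral, hence the natural number that the definite
  description asks for.\<close>

lemma codegree:
  assumes \<chi>: "\<chi> \<in> Irr G"
  shows "codegree G \<chi> * deg \<chi> * card (character_kernel G \<chi>) = card (carrier G)"
proof -
  let ?i = "card (rcosets (character_kernel G \<chi>))"
  have "of_nat ?i / \<chi> \<one> \<in> \<rat>" by (simp add: deg[OF \<chi>])
  then have "of_nat ?i / \<chi> \<one> \<in> \<int>"
    using codegree_integral[OF \<chi>] rational_algebraic_int_is_int by blast
  then obtain k where k: "of_nat ?i / \<chi> \<one> = of_int k" by (auto simp: Ints_def)
  have "(of_nat ?i :: complex) = of_int k * of_nat (deg \<chi>)"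
    using k deg[OF \<chi>] deg_pos[OF \<chi>] by (simp add: field_simps)
  then have "(of_int (int ?i) :: complex) = of_int (k * int (deg \<chi>))" by simp
  then have kd: "int ?i = k * int (deg \<chi>)" by (simp only: of_int_eq_iff)
  then have "k \<ge> 0" using deg_pos[OF \<chi>] by (metis of_nat_0_le_iff of_nat_0_less_iff zero_le_mult_iff linorder_not_less)
  then obtain a where a: "k = int a" by (metis nonneg_int_cases)
  have "codegree G \<chi> = a" unfolding codegree_def k a by (rule the_equality) auto
  moreover have "?i = a * deg \<chi>" using kd a by (simp flip: of_nat_mult)
  ultimately show ?thesis using index_kernel[OF \<chi>] by simp
qed

lemma deg_dvd: "\<chi> \<in> Irr G \<Longrightarrow> deg \<chi> dvd card (carrier G)"
  by (metis codegree dvd_mult dvd_mult2 dvd_refl)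

lemma codegree_dvd: "\<chi> \<in> Irr G \<Longrightarrow> codegree G \<chi> dvd card (carrier G)"
  by (metis codegree dvd_mult2 dvd_refl)

end

section \<open>Invariant subspaces contain irreducible representations\<close>

definition adj :: "complex mat \<Rightarrow> complex mat" where
  "adj A = mat (dim_col A) (dim_row A) (\<lambda>(i, j). cnj (A $$ (j, i)))"

lemma adj_carrier [simp]: "A \<in> carrier_mat n k \<Longrightarrow> adj A \<in> carrier_mat k n"
  by (simp add: adj_def)

lemma adj_index: "A \<in> carrier_mat n k \<Longrightarrow> i < k \<Longrightarrow> j < n \<Longrightarrow> adj A $$ (i, j) = cnj (A $$ (j, i))"
  by (simp add: adj_def)

lemma adj_mult:
  assumes "A \<in> carrier_mat n k" "B \<in> carrier_mat k m"
  shows "adj (A * B) = adj B * adj A"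
proof (rule eq_matI)
  fix i j assume "i < dim_row (adj B * adj A)" "j < dim_col (adj B * adj A)"
  then have ij: "i < m" "j < n" using assms by (auto simp: adj_def)
  have c: "adj A \<in> carrier_mat k n" "adj B \<in> carrier_mat m k" "A * B \<in> carrier_mat n m" using assms by auto
  show "adj (A * B) $$ (i, j) = (adj B * adj A) $$ (i, j)"
    unfolding adj_index[OF c(3) ij] mult_mat_entry[OF c(2,1) ij] mult_mat_entry[OF assms ij(2,1)]
    by (simp add: adj_index[OF assms(1)] adj_index[OF assms(2)] ij mult.commute)
qed (use assms in \<open>auto simp: adj_def\<close>)

lemma mult_unit_vec:
  "(A :: complex mat) \<in> carrier_mat n m \<Longrightarrow> j < m \<Longrightarrow> A *\<^sub>v unit_vec m j = col A j"
  by (intro eq_vecI) (auto simp: scalar_prod_right_unit)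

text \<open>The columns of \<open>Q\<close> are an orthonormal system. Subspaces are handled through such matrices, so
  that restricting a matrix representation to an invariant subspace gives a matrix representation again.\<close>

definition isometry :: "nat \<Rightarrow> nat \<Rightarrow> complex mat \<Rightarrow> bool" where
  "isometry n k Q \<longleftrightarrow> Q \<in> carrier_mat n k \<and> adj Q * Q = 1\<^sub>m k"

text \<open>The projection \<open>P = Q Q*\<close> satisfies \<open>P = P P*\<close>, so its diagonal entries are at most 1,
  while its trace is \<open>k\<close>.\<close>

lemma isometry_le:
  assumes "isometry n k Q"
  shows "k \<le> n"
proof -
  have Q: "Q \<in> carrier_mat n k" and QQ: "adj Q * Q = 1\<^sub>m k" using assms by (auto simp: isometry_def)
  define P where "P = Q * adj Q"
  have P: "P \<in> carrier_mat n n" using Q by (simp add: P_def)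
  have "P * P = Q * (adj Q * (Q * adj Q))"
    unfolding P_def using Q by (intro assoc_mult_mat[of _ n k _ n _ n]) auto
  also have "adj Q * (Q * adj Q) = adj Q * Q * adj Q"
    using Q by (intro assoc_mult_mat[of _ k n _ k _ n, symmetric]) auto
  finally have "P * P = Q * (adj Q * Q * adj Q)" .
  then have PP: "P * P = P" using left_mult_one_mat[OF adj_carrier[OF Q]] by (simp add: QQ P_def)
  have sym: "P $$ (j, i) = cnj (P $$ (i, j))" if "i < n" "j < n" for i j
    unfolding P_def mult_mat_entry[OF Q adj_carrier[OF Q] that] mult_mat_entry[OF Q adj_carrier[OF Q] that(2,1)]
    using that by (simp add: adj_index[OF Q] mult.commute)
  have d: "Re (P $$ (i, i)) \<le> 1" if i: "i < n" for i
  proof -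
    have "P $$ (i, i) = (\<Sum>j<n. P $$ (i, j) * P $$ (j, i))"
      using mult_mat_entry[OF P P i i] PP by simp
    also have "\<dots> = (\<Sum>j<n. of_real ((cmod (P $$ (i, j)))\<^sup>2))"
    proof (rule sum.cong[OF refl])
      fix j assume "j \<in> {..<n}"
      then have "P $$ (j, i) = cnj (P $$ (i, j))" using sym[OF i] by simp
      then show "P $$ (i, j) * P $$ (j, i) = of_real ((cmod (P $$ (i, j)))\<^sup>2)"
        by (simp only: complex_norm_square)
    qed
    finally have e: "P $$ (i, i) = of_real (\<Sum>j<n. (cmod (P $$ (i, j)))\<^sup>2)" by simp
    have "(cmod (P $$ (i, i)))\<^sup>2 \<le> (\<Sum>j<n. (cmod (P $$ (i, j)))\<^sup>2)"
      using i by (intro member_le_sum[of i "{..<n}" "\<lambda>j. (cmod (P $$ (i, j)))\<^sup>2"]) auto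
    moreover define r where "r = (\<Sum>j<n. (cmod (P $$ (i, j)))\<^sup>2)"
    moreover have r0: "r \<ge> 0" unfolding r_def by (intro sum_nonneg) auto
    moreover have "cmod (P $$ (i, i)) = r" unfolding e r_def[symmetric] norm_of_real using r0 by simp
    ultimately have "r\<^sup>2 \<le> r" by simp
    then have "r \<le> 1" using mult_strict_right_mono[of 1 r r] by (cases "r > 1") (auto simp: power2_eq_square)
    then show ?thesis using e by (simp add: r_def)
  qed
  have "of_nat k = mat_trace (adj Q * Q)" by (simp add: QQ mat_trace_def)
  also have "\<dots> = mat_trace P" unfolding P_def by (rule mat_trace_comm[OF adj_carrier[OF Q] Q])
  also have "\<dots> = (\<Sum>i<n. P $$ (i, i))" using P by (rule mat_trace_carrier)
  finally have "real k = (\<Sum>i<n. Re (P $$ (i, i)))" by (metis Re_complex_of_real Re_sum of_real_of_nat_eq)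
  also have "\<dots> \<le> (\<Sum>i<n. 1)" using d by (intro sum_mono) auto
  finally show ?thesis by simp
qed

text \<open>The Gram-Schmidt step: \<open>w\<close>, normalised by the factor \<open>a\<close>, becomes a further column.\<close>

lemma isometry_extend:
  assumes Q: "isometry n k Q" and w: "w \<in> carrier_vec n" "w \<noteq> 0\<^sub>v n" and orth: "adj Q *\<^sub>v w = 0\<^sub>v k"
  shows "\<exists>Q' a. isometry n (Suc k) Q' \<and>
    (\<forall>u\<in>carrier_vec (Suc k). Q' *\<^sub>v u = Q *\<^sub>v vec k (\<lambda>i. u $ i) + (a * u $ k) \<cdot>\<^sub>v w)"
proof -
  have Qc: "Q \<in> carrier_mat n k" and QQ: "adj Q * Q = 1\<^sub>m k" using Q by (auto simp: isometry_def)
  define s where "s = (\<Sum>i<n. (cmod (w $ i))\<^sup>2)"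
  obtain i where i: "i < n" "w $ i \<noteq> 0" using w by (metis carrier_vecD eq_vecI index_zero_vec)
  have "(cmod (w $ i))\<^sup>2 \<le> s" unfolding s_def using i by (intro member_le_sum) auto
  then have s: "s > 0" using i by (smt (verit) zero_less_norm_iff zero_less_power)
  define a :: complex where "a = of_real (1 / sqrt s)"
  have cc: "cnj a * a * of_real s = 1" using s by (simp add: a_def field_simps flip: of_real_mult)
  define Q' where "Q' = mat n (Suc k) (\<lambda>(i, j). if j < k then Q $$ (i, j) else a * w $ i)"
  have Q'c: "Q' \<in> carrier_mat n (Suc k)" by (simp add: Q'_def)
  have ow: "(\<Sum>l<n. cnj (Q $$ (l, j)) * w $ l) = 0" if "j < k" for j
  proof -
    have "(adj Q *\<^sub>v w) $ j = (\<Sum>l<n. cnj (Q $$ (l, j)) * w $ l)"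
      using that Qc w by (auto simp: scalar_prod_def adj_def atLeast0LessThan)
    then show ?thesis using orth that by simp
  qed
  have ow': "(\<Sum>l<n. cnj (w $ l) * Q $$ (l, j)) = 0" if "j < k" for j
  proof -
    have "(\<Sum>l<n. cnj (w $ l) * Q $$ (l, j)) = cnj (\<Sum>l<n. cnj (Q $$ (l, j)) * w $ l)"
      by (simp add: mult.commute)
    then show ?thesis using ow[OF that] by simp
  qed
  have oq: "(\<Sum>l<n. cnj (Q $$ (l, i)) * Q $$ (l, j)) = (if i = j then 1 else 0)" if "i < k" "j < k" for i j
  proof -
    have "(adj Q * Q) $$ (i, j) = (\<Sum>l<n. cnj (Q $$ (l, i)) * Q $$ (l, j))"
      unfolding mult_mat_entry[OF adj_carrier[OF Qc] Qc that] using that by (simp add: adj_index[OF Qc])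
    then show ?thesis using that by (simp add: QQ)
  qed
  have ws: "(\<Sum>l<n. cnj (w $ l) * w $ l) = of_real s"
    by (simp add: s_def complex_norm_square mult.commute del: of_real_power)
  have "adj Q' * Q' = 1\<^sub>m (Suc k)"
  proof (rule eq_matI)
    fix i j assume "i < dim_row (1\<^sub>m (Suc k))" "j < dim_col (1\<^sub>m (Suc k))"
    then have ij: "i < Suc k" "j < Suc k" by auto
    have "(adj Q' * Q') $$ (i, j) = (\<Sum>l<n. cnj (Q' $$ (l, i)) * Q' $$ (l, j))"
      unfolding mult_mat_entry[OF adj_carrier[OF Q'c] Q'c ij] using ij by (simp add: adj_index[OF Q'c])
    also have "\<dots> = (if i = j then 1 else 0)"
    proof (cases "i < k"; cases "j < k")
      assume "i < k" "j < k"
      then show ?thesis using oq by (simp add: Q'_def)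
    next
      assume a: "i < k" "\<not> j < k"
      then have "(\<Sum>l<n. cnj (Q' $$ (l, i)) * Q' $$ (l, j)) = a * (\<Sum>l<n. cnj (Q $$ (l, i)) * w $ l)"
        using ij unfolding sum_distrib_left by (intro sum.cong) (auto simp: Q'_def)
      then show ?thesis using ow a by auto
    next
      assume a: "\<not> i < k" "j < k"
      then have "(\<Sum>l<n. cnj (Q' $$ (l, i)) * Q' $$ (l, j)) = cnj a * (\<Sum>l<n. cnj (w $ l) * Q $$ (l, j))"
        using ij unfolding sum_distrib_left by (intro sum.cong) (auto simp: Q'_def)
      then show ?thesis using ow' a by auto
    next
      assume a: "\<not> i < k" "\<not> j < k"
      then have "(\<Sum>l<n. cnj (Q' $$ (l, i)) * Q' $$ (l, j)) = cnj a * a * (\<Sum>l<n. cnj (w $ l) * w $ l)"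
        using ij unfolding sum_distrib_left by (intro sum.cong) (auto simp: Q'_def)
      then show ?thesis using a ij by (simp add: ws cc)
    qed
    finally show "(adj Q' * Q') $$ (i, j) = 1\<^sub>m (Suc k) $$ (i, j)" using ij by simp
  qed (use Q'c in \<open>auto simp: adj_def\<close>)
  moreover have "Q' *\<^sub>v u = Q *\<^sub>v vec k (\<lambda>i. u $ i) + (a * u $ k) \<cdot>\<^sub>v w" if u: "u \<in> carrier_vec (Suc k)" for u
  proof (rule eq_vecI)
    fix i assume "i < dim_vec (Q *\<^sub>v vec k (\<lambda>i. u $ i) + (a * u $ k) \<cdot>\<^sub>v w)"
    then have i: "i < n" using w by simp
    have "(Q' *\<^sub>v u) $ i = (\<Sum>j<Suc k. Q' $$ (i, j) * u $ j)"
      using i u Q'c by (auto simp: scalar_prod_def atLeast0LessThan)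
    also have "\<dots> = (\<Sum>j<k. Q $$ (i, j) * u $ j) + a * u $ k * w $ i"
      using i by (simp add: Q'_def mult_ac)
    also have "(\<Sum>j<k. Q $$ (i, j) * u $ j) = (Q *\<^sub>v vec k (\<lambda>i. u $ i)) $ i"
      using i Qc by (auto simp: scalar_prod_def atLeast0LessThan)
    finally show "(Q' *\<^sub>v u) $ i = (Q *\<^sub>v vec k (\<lambda>i. u $ i) + (a * u $ k) \<cdot>\<^sub>v w) $ i"
      using i w Qc by simp
  qed (use Q'c w in auto)
  ultimately show ?thesis using Q'c by (auto simp: isometry_def)
qed

text \<open>The columns are an orthonormal system in \<open>W\<close> of maximal size.\<close>

lemma subspace_isometry:
  assumes W: "subspace class_ring W (module_vec TYPE(complex) n)"
  shows "\<exists>k Q. isometry n k Q \<and> W = (\<lambda>u. Q *\<^sub>v u) ` carrier_vec k"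
proof -
  have Wc: "W \<subseteq> carrier_vec n" and W0: "0\<^sub>v n \<in> W" and Wadd: "\<And>v w. v \<in> W \<Longrightarrow> w \<in> W \<Longrightarrow> v + w \<in> W"
    and Wsm: "\<And>c v. v \<in> W \<Longrightarrow> c \<cdot>\<^sub>v v \<in> W"
    using W by (auto simp: subspace_vec_iff)
  define P where "P k \<longleftrightarrow> (\<exists>Q. isometry n k Q \<and> (\<forall>u\<in>carrier_vec k. Q *\<^sub>v u \<in> W))" for k
  have "P 0"
    unfolding P_def
  proof (intro exI conjI ballI)
    show "isometry n 0 (0\<^sub>m n 0)" by (auto simp: isometry_def adj_def)
    fix u :: "complex vec" assume "u \<in> carrier_vec 0"
    then have "0\<^sub>m n 0 *\<^sub>v u = 0\<^sub>v n" by (auto simp: scalar_prod_def)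
    then show "0\<^sub>m n 0 *\<^sub>v u \<in> W" using W0 by simp
  qed
  moreover have "\<forall>k. P k \<longrightarrow> k \<le> n" using isometry_le by (auto simp: P_def)
  ultimately obtain k where k: "P k" "\<And>l. P l \<Longrightarrow> l \<le> k"
    using GreatestI_nat[of P 0 n] Greatest_le_nat[of P _ n] by metis
  then obtain Q where Q: "isometry n k Q" "\<And>u. u \<in> carrier_vec k \<Longrightarrow> Q *\<^sub>v u \<in> W" by (auto simp: P_def)
  have Qc: "Q \<in> carrier_mat n k" and QQ: "adj Q * Q = 1\<^sub>m k" using Q by (auto simp: isometry_def)
  have "W \<subseteq> (\<lambda>u. Q *\<^sub>v u) ` carrier_vec k"
  proof (rule ccontr)
    assume "\<not> ?thesis"
    then obtain w where w: "w \<in> W" "w \<notin> (\<lambda>u. Q *\<^sub>v u) ` carrier_vec k" by blast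
    have wc: "w \<in> carrier_vec n" using w Wc by blast
    define u0 where "u0 = adj Q *\<^sub>v w"
    have u0: "u0 \<in> carrier_vec k" unfolding u0_def using adj_carrier[OF Qc] wc by simp
    define w' where "w' = w + (-1) \<cdot>\<^sub>v (Q *\<^sub>v u0)"
    have w'W: "w' \<in> W" unfolding w'_def using w(1) Q(2)[OF u0] Wadd Wsm by blast
    have w'c: "w' \<in> carrier_vec n" using w'W Wc by blast
    have "adj Q *\<^sub>v w' = u0 + (-1) \<cdot>\<^sub>v (adj Q *\<^sub>v (Q *\<^sub>v u0))"
      unfolding w'_def using adj_carrier[OF Qc] Qc wc u0 mult_mat_vec[OF adj_carrier[OF Qc], of "Q *\<^sub>v u0" "-1"]
      by (subst mult_add_distrib_mat_vec[of _ k n]) (auto simp: u0_def)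
    also have "adj Q *\<^sub>v (Q *\<^sub>v u0) = u0"
      using assoc_mult_mat_vec[OF adj_carrier[OF Qc] Qc u0] u0 by (simp add: QQ)
    also have "u0 + (-1) \<cdot>\<^sub>v u0 = 0\<^sub>v k" using u0 by (intro eq_vecI) auto
    finally have orth: "adj Q *\<^sub>v w' = 0\<^sub>v k" .
    have "w' \<noteq> 0\<^sub>v n"
    proof
      assume z: "w' = 0\<^sub>v n"
      have "w = Q *\<^sub>v u0"
      proof (rule eq_vecI)
        fix i assume "i < dim_vec (Q *\<^sub>v u0)"
        then have i: "i < n" using Qc by simp
        have "w' $ i = 0" using z i by simp
        then show "w $ i = (Q *\<^sub>v u0) $ i" using i Qc wc by (simp add: w'_def)
      qed (use Qc wc in auto)
      then show False using w(2) u0 by blast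
    qed
    from isometry_extend[OF Q(1) w'c this orth] obtain Q' a where Q': "isometry n (Suc k) Q'"
      "\<And>u. u \<in> carrier_vec (Suc k) \<Longrightarrow> Q' *\<^sub>v u = Q *\<^sub>v vec k (\<lambda>i. u $ i) + (a * u $ k) \<cdot>\<^sub>v w'" by blast
    have "P (Suc k)"
      unfolding P_def using Q' Q(2) w'W Wadd Wsm by (intro exI[of _ Q']) auto
    then show False using k(2) by fastforce
  qed
  then show ?thesis using Q by blast
qed

context fin_group
begin

text \<open>A proper nonzero invariant subspace is the column space of an isometry \<open>Q\<close>, and \<open>Q* \<tau> Q\<close> is
  a representation of smaller dimension, which contains an irreducible one by induction.\<close>

lemma irreducible_subrepresentation:
  assumes "representation G n \<tau>" "subspace class_ring W (module_vec TYPE(complex) n)"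
    "\<And>g w. g \<in> carrier G \<Longrightarrow> w \<in> W \<Longrightarrow> \<tau> g *\<^sub>v w \<in> W" "W \<noteq> {0\<^sub>v n}"
  shows "\<exists>k Q \<rho>. irreducible_representation G k \<rho> \<and> isometry n k Q \<and>
    (\<forall>u\<in>carrier_vec k. Q *\<^sub>v u \<in> W) \<and> (\<forall>g\<in>carrier G. \<tau> g * Q = Q * \<rho> g)"
  using assms
proof (induction n arbitrary: \<tau> W rule: less_induct)
  case (less n)
  note r = less.prems(1)
  have Wn: "W \<subseteq> carrier_vec n" "0\<^sub>v n \<in> W" using less.prems(2) by (auto simp: subspace_vec_iff)
  have n: "n > 0"
  proof (rule ccontr)
    assume "\<not> n > 0"
    then have "W \<subseteq> {0\<^sub>v n}" using Wn by (auto intro!: eq_vecI)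
    then show False using Wn less.prems(4) by blast
  qed
  show ?case
  proof (cases "irreducible_representation G n \<tau> \<and> W = carrier_vec n")
    case True
    have "isometry n n (1\<^sub>m n)" by (auto simp: isometry_def adj_def intro!: eq_matI)
    then show ?thesis
      using True left_mult_one_mat[OF rep_closed[OF r]] right_mult_one_mat[OF rep_closed[OF r]] by (intro exI[of _ n] exI[of _ "1\<^sub>m n"] exI[of _ \<tau>]) auto
  next
    case False
    have "\<exists>V. subspace class_ring V (module_vec TYPE(complex) n) \<and> (\<forall>g\<in>carrier G. \<forall>w\<in>V. \<tau> g *\<^sub>v w \<in> V) \<and>
      V \<subseteq> W \<and> V \<noteq> {0\<^sub>v n} \<and> V \<noteq> carrier_vec n"
    proof (cases "W = carrier_vec n")
      case True
      then have "\<not> irreducible_representation G n \<tau>" using False by blast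
      then obtain V where V: "subspace class_ring V (module_vec TYPE(complex) n)" "\<forall>g\<in>carrier G. \<forall>w\<in>V. \<tau> g *\<^sub>v w \<in> V"
        "V \<noteq> {0\<^sub>v n}" "V \<noteq> carrier_vec n"
        using r n unfolding irreducible_representation_def by blast
      then show ?thesis using True by (intro exI[of _ V]) (auto simp: subspace_vec_iff)
    qed (use less.prems in blast)
    then obtain V where V: "subspace class_ring V (module_vec TYPE(complex) n)"
      "\<And>g w. g \<in> carrier G \<Longrightarrow> w \<in> V \<Longrightarrow> \<tau> g *\<^sub>v w \<in> V" "V \<subseteq> W" "V \<noteq> {0\<^sub>v n}" "V \<noteq> carrier_vec n" by blast
    obtain k Q where Q: "isometry n k Q" and VQ: "V = (\<lambda>u. Q *\<^sub>v u) ` carrier_vec k"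
      using subspace_isometry[OF V(1)] by blast
    have Qc: "Q \<in> carrier_mat n k" and QQ: "adj Q * Q = 1\<^sub>m k" using Q by (auto simp: isometry_def)
    have aQ: "adj Q \<in> carrier_mat k n" using Qc by simp
    have "k \<noteq> n"
    proof
      assume "k = n"
      then have 1: "Q * adj Q = 1\<^sub>m n" using mat_mult_left_right_inverse[of "adj Q" n Q] aQ Qc QQ by simp
      have "v \<in> V" if "v \<in> carrier_vec n" for v
      proof -
        have "v = Q *\<^sub>v (adj Q *\<^sub>v v)" using assoc_mult_mat_vec[OF Qc aQ that] that 1 by simp
        then show ?thesis using aQ that unfolding VQ by (metis imageI mult_mat_vec_carrier)
      qed
      then show False using V(1,5) by (auto simp: subspace_vec_iff)
    qed
    then have kn: "k < n" using isometry_le[OF Q] by simp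
    define \<rho> where "\<rho> g = adj Q * \<tau> g * Q" for g
    have rc: "\<rho> g \<in> carrier_mat k k" if "g \<in> carrier G" for g
      unfolding \<rho>_def by (rule mult_carrier_mat[OF mult_carrier_mat[OF aQ rep_closed[OF r that]] Qc])
    have int: "\<tau> g * Q = Q * \<rho> g" if g: "g \<in> carrier G" for g
    proof (rule eq_matI)
      fix i j assume "i < dim_row (Q * \<rho> g)" "j < dim_col (Q * \<rho> g)"
      then have ij: "i < n" "j < k" using Qc rc[OF g] by auto
      note tc = rep_closed[OF r g]
      let ?v = "\<tau> g *\<^sub>v (Q *\<^sub>v unit_vec k j)"
      have "Q *\<^sub>v unit_vec k j \<in> V" unfolding VQ by simp
      then have "?v \<in> V" using V(2) g by blast
      then obtain u where u: "u \<in> carrier_vec k" "?v = Q *\<^sub>v u" unfolding VQ by blast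
      have e: "col (\<tau> g * Q) j = ?v"
        using col_mult2[OF tc Qc ij(2)] mult_unit_vec[OF Qc ij(2)] by simp
      have "col (Q * \<rho> g) j = Q *\<^sub>v (adj Q *\<^sub>v ?v)"
      proof -
        have "col (Q * \<rho> g) j = (Q * \<rho> g) *\<^sub>v unit_vec k j"
          using ij rc[OF g] Qc by (intro mult_unit_vec[symmetric]) auto
        also have "\<dots> = Q *\<^sub>v (\<rho> g *\<^sub>v unit_vec k j)" using Qc rc[OF g] by simp
        also have "\<rho> g *\<^sub>v unit_vec k j = adj Q *\<^sub>v ?v"
          unfolding \<rho>_def by (simp only: assoc_mult_mat_vec[OF mult_carrier_mat[OF aQ tc] Qc unit_vec_carrier]
              assoc_mult_mat_vec[OF aQ tc mult_mat_vec_carrier[OF Qc unit_vec_carrier]])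
        finally show ?thesis .
      qed
      also have "\<dots> = Q *\<^sub>v (adj Q *\<^sub>v (Q *\<^sub>v u))" by (simp add: u)
      also have "adj Q *\<^sub>v (Q *\<^sub>v u) = u" using assoc_mult_mat_vec[OF aQ Qc u(1)] u by (simp add: QQ)
      also have "Q *\<^sub>v u = col (\<tau> g * Q) j" by (simp add: e u)
      finally have "col (\<tau> g * Q) j $ i = col (Q * \<rho> g) j $ i" by simp
      then show "(\<tau> g * Q) $$ (i, j) = (Q * \<rho> g) $$ (i, j)"
        using ij tc Qc rc[OF g] by simp
    qed (use Qc rc[OF g] rep_closed[OF r g] in auto)
    have rr: "representation G k \<rho>"
      unfolding representation_iff[OF group_axioms]
    proof (intro conjI ballI)
      show "\<rho> \<one> = 1\<^sub>m k" using aQ QQ by (simp add: \<rho>_def rep_one[OF r])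
      fix g h assume g: "g \<in> carrier G" and h: "h \<in> carrier G"
      note c = rep_closed[OF r g] rep_closed[OF r h] aQ Qc rc[OF g] rc[OF h]
      have "\<rho> (g \<otimes> h) = adj Q * \<tau> g * (\<tau> h * Q)"
        using c by (simp add: \<rho>_def rep_mult[OF r g h] assoc_mult_mat[of _ k n _ n _ k] assoc_mult_mat[of _ k n _ n _ n] assoc_mult_mat[of _ n n _ n _ k])
      also have "\<dots> = adj Q * \<tau> g * Q * \<rho> h"
        by (simp only: int[OF h] assoc_mult_mat[OF mult_carrier_mat[OF aQ c(1)] Qc rc[OF h]])
      finally show "\<rho> (g \<otimes> h) = \<rho> g * \<rho> h" by (simp add: \<rho>_def)
    qed (rule rc)
    have full: "subspace class_ring (carrier_vec k) (module_vec TYPE(complex) k)"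
      by (auto simp: subspace_vec_iff)
    have "carrier_vec k \<noteq> {0\<^sub>v k :: complex vec}"
    proof
      assume "carrier_vec k = {0\<^sub>v k :: complex vec}"
      then have "V = {Q *\<^sub>v 0\<^sub>v k}" by (simp add: VQ)
      moreover have "0\<^sub>v n \<in> V" using V(1) by (auto simp: subspace_vec_iff)
      ultimately show False using V(4) by auto
    qed
    from less.IH[OF kn rr full _ this] rc obtain l Q2 \<rho>2 where
      l: "irreducible_representation G l \<rho>2" "isometry k l Q2" "\<And>g. g \<in> carrier G \<Longrightarrow> \<rho> g * Q2 = Q2 * \<rho>2 g"
      by (metis mult_mat_vec_carrier)
    have Q2c: "Q2 \<in> carrier_mat k l" and QQ2: "adj Q2 * Q2 = 1\<^sub>m l" using l by (auto simp: isometry_def)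
    have r2: "\<rho>2 g \<in> carrier_mat l l" if "g \<in> carrier G" for g using rep_closed[OF irr_rep[OF l(1)] that] .
    show ?thesis
    proof (intro exI conjI ballI)
      show "irreducible_representation G l \<rho>2" by fact
      have "adj (Q * Q2) * (Q * Q2) = adj Q2 * (adj Q * (Q * Q2))"
        unfolding adj_mult[OF Qc Q2c]
        by (rule assoc_mult_mat[OF adj_carrier[OF Q2c] aQ mult_carrier_mat[OF Qc Q2c]])
      also have "adj Q * (Q * Q2) = Q2"
        using assoc_mult_mat[OF aQ Qc Q2c] left_mult_one_mat[OF Q2c] by (simp add: QQ)
      also have "adj Q2 * Q2 = 1\<^sub>m l" by (rule QQ2)
      finally show "isometry n l (Q * Q2)" using Qc Q2c by (simp add: isometry_def)
      fix u :: "complex vec" assume u: "u \<in> carrier_vec l"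
      have "(Q * Q2) *\<^sub>v u = Q *\<^sub>v (Q2 *\<^sub>v u)" using Qc Q2c u by simp
      also have "\<dots> \<in> V" unfolding VQ using Q2c u by auto
      finally show "(Q * Q2) *\<^sub>v u \<in> W" using V(3) by blast
    next
      fix g assume g: "g \<in> carrier G"
      note c = rep_closed[OF r g] Qc Q2c rc[OF g] r2[OF g]
      have "\<tau> g * (Q * Q2) = (\<tau> g * Q) * Q2" using c by simp
      also have "\<dots> = Q * (\<rho> g * Q2)" using c by (simp add: int[OF g])
      also have "\<dots> = Q * Q2 * \<rho>2 g" using c by (simp add: l(3)[OF g])
      finally show "\<tau> g * (Q * Q2) = Q * Q2 * \<rho>2 g" .
    qed
  qed
qed

end

section \<open>Completeness and the column relations\<close>

context fin_group
begin

text \<open>In the regular representation, the functions annulled by every irreducible character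
  form an invariant subspace; on an irreducible subrepresentation
  with character \<open>\<chi>\<close>, the character \<open>\<chi>\<close> itself acts as a nonzero scalar.\<close>

lemma Irr_complete:
  fixes f :: "'a \<Rightarrow> complex"
  assumes f: "\<And>\<chi> g. \<chi> \<in> Irr G \<Longrightarrow> g \<in> carrier G \<Longrightarrow> (\<Sum>h\<in>carrier G. \<chi> h * f (h \<otimes> g)) = 0"
    and x: "x \<in> carrier G"
  shows "f x = 0"
proof -
  define m where "m = card (carrier G)"
  obtain en where en: "bij_betw en {0..<m} (carrier G)"
    using ex_bij_betw_nat_finite[OF fin] unfolding m_def by blast
  define idx where "idx = the_inv_into {0..<m} en"
  have en_in: "en i \<in> carrier G" if "i < m" for i using en that by (auto simp: bij_betw_def)
  have idx_lt: "idx g < m" if "g \<in> carrier G" for g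
    using the_inv_into_into[of en "{0..<m}" g "{0..<m}"] en that by (auto simp: idx_def bij_betw_def)
  have en_idx [simp]: "en (idx g) = g" if "g \<in> carrier G" for g
    using f_the_inv_into_f[of en "{0..<m}" g] en that by (auto simp: idx_def bij_betw_def)
  have idx_en [simp]: "idx (en i) = i" if "i < m" for i
    using the_inv_into_f_f[of en "{0..<m}" i] en that by (auto simp: idx_def bij_betw_def)
  \<comment> \<open>The regular representation, on coordinates numbered by \<open>en\<close>.\<close>
  define L :: "'a \<Rightarrow> complex mat" where "L g = mat m m (\<lambda>(i, j). if en i = g \<otimes> en j then 1 else 0)" for g
  have Lc: "L g \<in> carrier_mat m m" for g by (simp add: L_def)
  have Lmult: "(L g * A) $$ (i, j) = A $$ (idx (inv g \<otimes> en i), j)"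
    if "g \<in> carrier G" "A \<in> carrier_mat m k" "i < m" "j < k" for g A i j k
  proof -
    have "(L g * A) $$ (i, j) = (\<Sum>l<m. if l = idx (inv g \<otimes> en i) then A $$ (l, j) else 0)"
      unfolding mult_mat_entry[OF Lc that(2,3,4)]
    proof (rule sum.cong[OF refl])
      fix l assume "l \<in> {..<m}"
      then have l: "l < m" by simp
      have "en i = g \<otimes> en l \<longleftrightarrow> l = idx (inv g \<otimes> en i)"
      proof
        assume "en i = g \<otimes> en l"
        then show "l = idx (inv g \<otimes> en i)" using l that(1) en_in by simp
      next
        assume "l = idx (inv g \<otimes> en i)"
        then show "en i = g \<otimes> en l" using that(1,3) en_in by simp
      qed
      then show "L g $$ (i, l) * A $$ (l, j) = (if l = idx (inv g \<otimes> en i) then A $$ (l, j) else 0)"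
        using l that(3) by (simp add: L_def)
    qed
    also have "\<dots> = A $$ (idx (inv g \<otimes> en i), j)"
      using idx_lt[of "inv g \<otimes> en i"] en_in that by simp
    finally show ?thesis .
  qed
  have Lvec: "(L g *\<^sub>v v) $ i = v $ idx (inv g \<otimes> en i)"
    if "g \<in> carrier G" "v \<in> carrier_vec m" "i < m" for g v i
  proof -
    define A where "A = mat m 1 (\<lambda>(i, j). v $ i)"
    have A: "A \<in> carrier_mat m 1" by (simp add: A_def)
    have "(L g *\<^sub>v v) $ i = (L g * A) $$ (i, 0)"
      using that Lc[of g] by (auto simp: A_def scalar_prod_def)
    also have "\<dots> = A $$ (idx (inv g \<otimes> en i), 0)" using Lmult[OF that(1) A that(3)] by simp
    finally show ?thesis using idx_lt[of "inv g \<otimes> en i"] en_in that by (simp add: A_def)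
  qed
  have rL: "representation G m L"
    unfolding representation_iff[OF group_axioms]
  proof (intro conjI ballI)
    show "L \<one> = 1\<^sub>m m"
    proof (rule eq_matI)
      fix i j assume "i < dim_row (1\<^sub>m m)" "j < dim_col (1\<^sub>m m)"
      then have ij: "i < m" "j < m" by auto
      then show "L \<one> $$ (i, j) = 1\<^sub>m m $$ (i, j)"
        using en_in idx_en by (auto simp: L_def) (metis idx_en)
    qed (auto simp: L_def)
    fix g h assume g: "g \<in> carrier G" and h: "h \<in> carrier G"
    show "L (g \<otimes> h) = L g * L h"
    proof (rule eq_matI)
      fix i j assume "i < dim_row (L g * L h)" "j < dim_col (L g * L h)"
      then have ij: "i < m" "j < m" by (auto simp: L_def)
      have "(L g * L h) $$ (i, j) = (if inv g \<otimes> en i = h \<otimes> en j then 1 else 0)"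
        unfolding Lmult[OF g Lc ij] using ij g h en_in idx_lt[of "inv g \<otimes> en i"] by (simp add: L_def)
      also have "inv g \<otimes> en i = h \<otimes> en j \<longleftrightarrow> en i = g \<otimes> h \<otimes> en j"
        using g h ij en_in by (metis inv_closed inv_solve_left m_assoc m_closed mult_inv_cancel)
      finally show "L (g \<otimes> h) $$ (i, j) = (L g * L h) $$ (i, j)" using ij by (simp add: L_def)
    qed (auto simp: L_def)
  qed (rule Lc)
  define W where "W = {v \<in> carrier_vec m. \<forall>\<chi>\<in>Irr G. \<forall>g\<in>carrier G. (\<Sum>h\<in>carrier G. \<chi> h * v $ idx (h \<otimes> g)) = 0}"
  have subW: "subspace class_ring W (module_vec TYPE(complex) m)"
    unfolding subspace_vec_iff
  proof (intro conjI ballI allI)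
    show "W \<subseteq> carrier_vec m" by (auto simp: W_def)
    show "0\<^sub>v m \<in> W" using idx_lt by (simp add: W_def)
    fix v w assume vw: "v \<in> W" "w \<in> W"
    show "v + w \<in> W"
      using vw idx_lt by (auto simp: W_def distrib_left sum.distrib)
  next
    fix c v assume v: "v \<in> W"
    have "(\<Sum>h\<in>carrier G. \<chi> h * (c \<cdot>\<^sub>v v) $ idx (h \<otimes> g)) = c * (\<Sum>h\<in>carrier G. \<chi> h * v $ idx (h \<otimes> g))"
      if "g \<in> carrier G" for \<chi> g
      unfolding sum_distrib_left using v that idx_lt by (intro sum.cong) (auto simp: W_def)
    then show "c \<cdot>\<^sub>v v \<in> W" using v by (auto simp: W_def)
  qed
  have inv: "L g *\<^sub>v w \<in> W" if g: "g \<in> carrier G" and w: "w \<in> W" for g w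
  proof -
    have wc: "w \<in> carrier_vec m" using w by (simp add: W_def)
    have "(\<Sum>h\<in>carrier G. \<chi> h * (L g *\<^sub>v w) $ idx (h \<otimes> a)) = 0" if \<chi>: "\<chi> \<in> Irr G" and a: "a \<in> carrier G" for \<chi> a
    proof -
      have "(\<Sum>h\<in>carrier G. \<chi> h * (L g *\<^sub>v w) $ idx (h \<otimes> a)) = (\<Sum>h\<in>carrier G. \<chi> h * w $ idx (inv g \<otimes> (h \<otimes> a)))"
        using a g idx_lt by (intro sum.cong) (auto simp: Lvec[OF g wc])
      also have "\<dots> = (\<Sum>h\<in>carrier G. \<chi> (g \<otimes> h \<otimes> inv g) * w $ idx (inv g \<otimes> ((g \<otimes> h \<otimes> inv g) \<otimes> a)))"
        by (rule sum.reindex_bij_betw[OF bij_conj[OF g], symmetric])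
      also have "\<dots> = (\<Sum>h\<in>carrier G. \<chi> h * w $ idx (h \<otimes> (inv g \<otimes> a)))"
        using a g by (intro sum.cong refl) (simp only: Irr_conj[OF \<chi>], simp add: m_assoc)
      also have "\<dots> = 0" using w \<chi> a g by (auto simp: W_def)
      finally show ?thesis .
    qed
    then show ?thesis using wc Lc[of g] by (auto simp: W_def)
  qed
  \<comment> \<open>An irreducible subrepresentation of \<open>W\<close> with character \<open>\<chi>\<close> is annulled by \<open>\<chi>\<close>, while Schur
    orthogonality gives the factor \<open>|G| / \<chi>(1)\<close>.\<close>
  have "W = {0\<^sub>v m}"
  proof (rule ccontr)
    assume "W \<noteq> {0\<^sub>v m}"
    from irreducible_subrepresentation[OF rL subW inv this] obtain k Q \<rho> where
      ir: "irreducible_representation G k \<rho>" and Q: "isometry m k Q"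
      and QW: "\<And>u. u \<in> carrier_vec k \<Longrightarrow> Q *\<^sub>v u \<in> W" and int: "\<And>g. g \<in> carrier G \<Longrightarrow> L g * Q = Q * \<rho> g" by blast
    have Qc: "Q \<in> carrier_mat m k" and QQ: "adj Q * Q = 1\<^sub>m k" using Q by (auto simp: isometry_def)
    have k: "k > 0" by (rule irr_pos[OF ir])
    note r = irr_rep[OF ir]
    define \<chi> where "\<chi> = character_of G \<rho>"
    have \<chi>: "\<chi> \<in> Irr G" using ir by (auto simp: \<chi>_def Irr_def)
    have "Q *\<^sub>v unit_vec k 0 \<in> W" using k by (intro QW) auto
    then have cW: "col Q 0 \<in> W" using mult_unit_vec[OF Qc k] by simp
    have "Q $$ (i, 0) = 0" if i: "i < m" for i
    proof -
      have "0 = (\<Sum>h\<in>carrier G. \<chi> h * col Q 0 $ idx (h \<otimes> en i))"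
        using cW \<chi> en_in[OF i] by (simp add: W_def)
      also have "\<dots> = (\<Sum>h\<in>carrier G. \<chi> h * (\<Sum>a<k. Q $$ (i, a) * \<rho> (inv h) $$ (a, 0)))"
      proof (rule sum.cong[OF refl])
        fix h assume h: "h \<in> carrier G"
        have "(\<Sum>a<k. Q $$ (i, a) * \<rho> (inv h) $$ (a, 0)) = (Q * \<rho> (inv h)) $$ (i, 0)"
          using h by (intro mult_mat_entry[OF Qc _ i k, symmetric] rep_closed[OF r]) auto
        also have "\<dots> = (L (inv h) * Q) $$ (i, 0)" using h by (simp add: int)
        also have "\<dots> = Q $$ (idx (h \<otimes> en i), 0)" using Lmult[OF _ Qc i k, of "inv h"] h by simp
        finally show "\<chi> h * col Q 0 $ idx (h \<otimes> en i) = \<chi> h * (\<Sum>a<k. Q $$ (i, a) * \<rho> (inv h) $$ (a, 0))"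
          using Qc k h en_in[OF i] idx_lt by simp
      qed
      also have "\<dots> = (\<Sum>h\<in>carrier G. \<Sum>a<k. \<Sum>c<k. Q $$ (i, a) * (\<rho> (inv h) $$ (a, 0) * \<rho> h $$ (c, c)))"
      proof (rule sum.cong[OF refl])
        fix h assume h: "h \<in> carrier G"
        have "\<chi> h = (\<Sum>c<k. \<rho> h $$ (c, c))"
          using h by (simp add: \<chi>_def character_of_def mat_trace_carrier[OF rep_closed[OF r h]])
        then show "\<chi> h * (\<Sum>a<k. Q $$ (i, a) * \<rho> (inv h) $$ (a, 0)) = (\<Sum>a<k. \<Sum>c<k. Q $$ (i, a) * (\<rho> (inv h) $$ (a, 0) * \<rho> h $$ (c, c)))"
          by (simp add: sum_distrib_left sum_distrib_right mult_ac)
      qed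
      also have "\<dots> = (\<Sum>a<k. \<Sum>c<k. \<Sum>h\<in>carrier G. Q $$ (i, a) * (\<rho> (inv h) $$ (a, 0) * \<rho> h $$ (c, c)))"
        by (simp only: sum.swap[of _ _ "carrier G"])
      also have "\<dots> = (\<Sum>a<k. \<Sum>c<k. Q $$ (i, a) * (\<Sum>h\<in>carrier G. \<rho> (inv h) $$ (a, 0) * \<rho> h $$ (c, c)))"
        by (simp only: sum_distrib_left)
      also have "\<dots> = (\<Sum>a<k. \<Sum>c<k. if c = 0 then if a = 0 then Q $$ (i, a) * (N / of_nat k) else 0 else 0)"
        using k by (intro sum.cong refl) (auto simp: schur_orthogonality_same[OF ir])
      also have "\<dots> = Q $$ (i, 0) * (N / of_nat k)"
        using k by simp
      finally show ?thesis using k card_pos by auto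
    qed
    then have "(adj Q * Q) $$ (0, 0) = 0"
      unfolding mult_mat_entry[OF adj_carrier[OF Qc] Qc k k] by simp
    then show False using QQ k by simp
  qed
  moreover have "vec m (\<lambda>i. f (en i)) \<in> W"
    using f idx_lt by (auto simp: W_def)
  ultimately have "vec m (\<lambda>i. f (en i)) $ idx x = 0" using idx_lt[OF x] by simp
  then show ?thesis using idx_lt[OF x] x by simp
qed

text \<open>The function \<open>\<Sum>\<chi>(1)\<chi>\<close> over \<open>F\<close> has squared norm \<open>|G| s\<close> and value \<open>s\<close> at \<open>\<one>\<close>, where \<open>s\<close> is the
  sum in question; the square of a single value is at most the squared norm.\<close>

lemma sum_deg_squares_le:
  assumes F: "F \<subseteq> Irr G" "finite F"
  shows "(\<Sum>\<chi>\<in>F. (deg \<chi>)\<^sup>2) \<le> card (carrier G)"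
proof -
  define P where "P g = (\<Sum>\<chi>\<in>F. of_nat (deg \<chi>) * \<chi> g)" for g
  define s where "s = (\<Sum>\<chi>\<in>F. (deg \<chi>)\<^sup>2)"
  have P1: "P \<one> = of_nat s" unfolding P_def s_def using F deg by (simp add: power2_eq_square subset_iff)
  have "complex_of_real (\<Sum>g\<in>carrier G. (cmod (P g))\<^sup>2) = (\<Sum>g\<in>carrier G. cnj (P g) * P g)"
    by (simp add: complex_norm_square mult.commute del: of_real_power)
  also have "\<dots> = (\<Sum>g\<in>carrier G. \<Sum>\<chi>\<in>F. \<Sum>\<psi>\<in>F. of_nat (deg \<chi>) * of_nat (deg \<psi>) * (cnj (\<chi> g) * \<psi> g))"
    unfolding P_def cnj_sum sum_product by (intro sum.cong refl) (simp add: mult_ac)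
  also have "\<dots> = (\<Sum>\<chi>\<in>F. \<Sum>\<psi>\<in>F. of_nat (deg \<chi>) * of_nat (deg \<psi>) * (\<Sum>g\<in>carrier G. cnj (\<chi> g) * \<psi> g))"
    by (simp only: sum.swap[of _ _ "carrier G"] sum_distrib_left)
  also have "\<dots> = (\<Sum>\<chi>\<in>F. \<Sum>\<psi>\<in>F. if \<psi> = \<chi> then of_nat (deg \<chi>) * of_nat (deg \<psi>) * N else 0)"
    using F by (intro sum.cong refl) (auto simp: Irr_orthogonality subset_iff)
  also have "\<dots> = of_real (real s * card (carrier G))"
    using F by (simp add: s_def sum_distrib_right power2_eq_square)
  finally have e: "(\<Sum>g\<in>carrier G. (cmod (P g))\<^sup>2) = real s * card (carrier G)" by (simp only: of_real_eq_iff)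
  have "(cmod (P \<one>))\<^sup>2 \<le> (\<Sum>g\<in>carrier G. (cmod (P g))\<^sup>2)"
    by (intro member_le_sum) auto
  then have "real s * real s \<le> real s * real (card (carrier G))" unfolding e P1 by (simp add: power2_eq_square)
  then have "s * s \<le> s * card (carrier G)" by (simp flip: of_nat_mult)
  then show ?thesis unfolding s_def[symmetric] by (cases "s = 0") auto
qed

lemma finite_Irr [simp, intro]: "finite (Irr G)"
proof -
  have "card F \<le> card (carrier G)" if F: "F \<subseteq> Irr G" "finite F" for F
  proof -
    have "card F = (\<Sum>\<chi>\<in>F. 1)" by simp
    also have "\<dots> \<le> (\<Sum>\<chi>\<in>F. (deg \<chi>)\<^sup>2)"
      using F deg_pos by (intro sum_mono) (auto simp: Suc_le_eq)
    also have "\<dots> \<le> card (carrier G)" by (rule sum_deg_squares_le[OF F])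
    finally show ?thesis .
  qed
  then show ?thesis using finite_if_finite_subsets_card_bdd by blast
qed

text \<open>The regular character: its difference from \<open>|G|\<close> times the indicator of \<open>\<one>\<close> is annulled by
  every irreducible character, by the convolution formula, so it is zero by completeness.\<close>

lemma column_identity:
  assumes g: "g \<in> carrier G"
  shows "(\<Sum>\<chi>\<in>Irr G. \<chi> \<one> * \<chi> g) = (if g = \<one> then N else 0)"
proof -
  define f where "f g = (if g = \<one> then 1 else 0) - (\<Sum>\<chi>\<in>Irr G. \<chi> \<one> * \<chi> (inv g)) / N" for g
  have "f (inv g) = 0"
  proof (rule Irr_complete)
    fix \<psi> x assume \<psi>: "\<psi> \<in> Irr G" and x: "x \<in> carrier G"
    have "(\<Sum>h\<in>carrier G. \<psi> h * f (h \<otimes> x)) =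
        (\<Sum>h\<in>carrier G. \<psi> h * (if h = inv x then 1 else 0)) -
        (\<Sum>h\<in>carrier G. \<psi> h * ((\<Sum>\<chi>\<in>Irr G. \<chi> \<one> * \<chi> (inv x \<otimes> inv h)) / N))"
      unfolding sum_subtractf[symmetric]
    proof (rule sum.cong[OF refl])
      fix h assume h: "h \<in> carrier G"
      have "h \<otimes> x = \<one> \<longleftrightarrow> h = inv x" using h x by (metis inv_equality l_inv)
      then show "\<psi> h * f (h \<otimes> x) = \<psi> h * (if h = inv x then 1 else 0) - \<psi> h * ((\<Sum>\<chi>\<in>Irr G. \<chi> \<one> * \<chi> (inv x \<otimes> inv h)) / N)"
        using h x by (simp add: f_def inv_mult_group right_diff_distrib)
    qed
    also have "(\<Sum>h\<in>carrier G. \<psi> h * (if h = inv x then 1 else 0)) = \<psi> (inv x)"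
      using x by (simp add: if_distrib[of "\<lambda>a. _ * a"] cong: if_cong)
    also have "(\<Sum>h\<in>carrier G. \<psi> h * ((\<Sum>\<chi>\<in>Irr G. \<chi> \<one> * \<chi> (inv x \<otimes> inv h)) / N)) =
      (\<Sum>h\<in>carrier G. \<Sum>\<chi>\<in>Irr G. \<chi> \<one> / N * (\<chi> (inv x \<otimes> inv h) * \<psi> h))"
      by (simp add: sum_distrib_left sum_divide_distrib mult_ac)
    also have "\<dots> = (\<Sum>\<chi>\<in>Irr G. \<chi> \<one> / N * (\<Sum>h\<in>carrier G. \<chi> (inv x \<otimes> inv h) * \<psi> h))"
      by (simp only: sum.swap[of _ _ "carrier G"] sum_distrib_left)
    also have "\<dots> = (\<Sum>\<chi>\<in>Irr G. if \<chi> = \<psi> then \<chi> (inv x) else 0)"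
    proof (rule sum.cong[OF refl])
      fix \<chi> assume \<chi>: "\<chi> \<in> Irr G"
      have "\<chi> \<one> \<noteq> 0" using deg[OF \<chi>] deg_pos[OF \<chi>] by simp
      then show "\<chi> \<one> / N * (\<Sum>h\<in>carrier G. \<chi> (inv x \<otimes> inv h) * \<psi> h) = (if \<chi> = \<psi> then \<chi> (inv x) else 0)"
        using Irr_convolution[OF \<chi> \<psi>, of "inv x"] x card_pos by auto
    qed
    also have "\<dots> = \<psi> (inv x)" using \<psi> by simp
    finally show "(\<Sum>h\<in>carrier G. \<psi> h * f (h \<otimes> x)) = 0" by simp
  qed (use g in simp)
  then show ?thesis using g card_pos by (auto simp: f_def split: if_splits)
qed

lemma sum_deg_squares: "(\<Sum>\<chi>\<in>Irr G. (deg \<chi>)\<^sup>2) = card (carrier G)"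
proof -
  have "(\<Sum>\<chi>\<in>Irr G. \<chi> \<one> * \<chi> \<one>) = of_nat (\<Sum>\<chi>\<in>Irr G. (deg \<chi>)\<^sup>2)"
    by (simp add: deg power2_eq_square)
  then have "(of_nat (\<Sum>\<chi>\<in>Irr G. (deg \<chi>)\<^sup>2) :: complex) = of_nat (card (carrier G))"
    using column_identity[OF one_closed] by simp
  then show ?thesis by (simp only: of_nat_eq_iff)
qed

text \<open>The average of the matrices conjugate to \<open>\<rho>(y)\<close> is a scalar.\<close>

lemma Irr_product:
  assumes \<chi>: "\<chi> \<in> Irr G" and x: "x \<in> carrier G" and y: "y \<in> carrier G"
  shows "(\<Sum>h\<in>carrier G. \<chi> (x \<otimes> (inv h \<otimes> y \<otimes> h))) = N / \<chi> \<one> * (\<chi> x * \<chi> y)"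
proof -
  obtain n \<rho> where c: "\<And>g. g \<in> carrier G \<Longrightarrow> \<chi> g = mat_trace (\<rho> g)" and r: "representation G n \<rho>"
    and ir: "irreducible_representation G n \<rho>" and n: "\<chi> \<one> = of_nat n"
    by (rule IrrE[OF \<chi>]) blast
  note cl = rep_closed[OF r]
  have "(\<Sum>h\<in>carrier G. \<chi> (x \<otimes> (inv h \<otimes> y \<otimes> h))) = (\<Sum>h\<in>carrier G. mat_trace (\<rho> x * (\<rho> (inv h) * \<rho> y * \<rho> h)))"
    using x y by (intro sum.cong) (auto simp: c rep_mult[OF r])
  also have "\<dots> = mat_trace (msum n n (\<lambda>h. \<rho> x * (\<rho> (inv h) * \<rho> y * \<rho> h)) (carrier G))"
    by (rule mat_trace_msum[symmetric]) (intro mult_carrier_mat[of _ n n _ n] cl x y inv_closed; assumption)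
  also have "msum n n (\<lambda>h. \<rho> x * (\<rho> (inv h) * \<rho> y * \<rho> h)) (carrier G) = \<rho> x * average n n \<rho> \<rho> (\<rho> y)"
    unfolding average_def
    by (rule mult_msum_left[symmetric]) (intro mult_carrier_mat[of _ n n _ n] cl x y inv_closed; assumption)+
  also have "\<dots> = (N * mat_trace (\<rho> y) / of_nat n) \<cdot>\<^sub>m \<rho> x"
    unfolding average_scalar[OF ir cl[OF y]]
    using mult_smult_distrib[OF cl[OF x] one_carrier_mat] right_mult_one_mat[OF cl[OF x]] by simp
  also have "mat_trace \<dots> = N / \<chi> \<one> * (\<chi> x * \<chi> y)"
    using mat_trace_smult[OF cl[OF x]] by (simp add: c[OF x] c[OF y] n)
  finally show ?thesis .
qed

definition centralizer :: "'a \<Rightarrow> 'a set" where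
  "centralizer x = {h \<in> carrier G. x \<otimes> h = h \<otimes> x}"

text \<open>With \<open>y = x\<^sup>-\<^sup>1\<close>, the sum over \<open>\<chi>\<close> of the product formula is evaluated by the column identity,
  which detects the \<open>h\<close> that commute with \<open>x\<close>.\<close>

lemma column_norm:
  assumes x: "x \<in> carrier G"
  shows "(\<Sum>\<chi>\<in>Irr G. (cmod (\<chi> x))\<^sup>2) = card (centralizer x)"
proof -
  have "N * (\<Sum>\<chi>\<in>Irr G. complex_of_real ((cmod (\<chi> x))\<^sup>2)) = (\<Sum>\<chi>\<in>Irr G. \<chi> \<one> * (\<Sum>h\<in>carrier G. \<chi> (x \<otimes> (inv h \<otimes> inv x \<otimes> h))))"
    unfolding sum_distrib_left
  proof (rule sum.cong[OF refl])
    fix \<chi> assume \<chi>: "\<chi> \<in> Irr G"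
    have "\<chi> \<one> \<noteq> 0" using deg[OF \<chi>] deg_pos[OF \<chi>] by simp
    moreover have "complex_of_real ((cmod (\<chi> x))\<^sup>2) = \<chi> x * \<chi> (inv x)"
      by (simp only: Irr_inverse[OF \<chi> x] complex_norm_square)
    ultimately show "N * complex_of_real ((cmod (\<chi> x))\<^sup>2) = (\<Sum>h\<in>carrier G. \<chi> \<one> * \<chi> (x \<otimes> (inv h \<otimes> inv x \<otimes> h)))"
      unfolding sum_distrib_left[symmetric] using Irr_product[OF \<chi> x inv_closed[OF x]] by simp
  qed
  also have "\<dots> = (\<Sum>h\<in>carrier G. \<Sum>\<chi>\<in>Irr G. \<chi> \<one> * \<chi> (x \<otimes> (inv h \<otimes> inv x \<otimes> h)))"
    unfolding sum_distrib_left by (rule sum.swap)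
  also have "\<dots> = (\<Sum>h\<in>carrier G. if h \<in> centralizer x then N else 0)"
  proof (rule sum.cong[OF refl])
    fix h assume h: "h \<in> carrier G"
    have "x \<otimes> (inv h \<otimes> inv x \<otimes> h) = \<one> \<longleftrightarrow> inv h \<otimes> inv x \<otimes> h = inv x"
      using x h by (metis inv_closed inv_equality inv_inv m_closed r_inv inv_comm)
    also have "\<dots> \<longleftrightarrow> inv x \<otimes> h = h \<otimes> inv x"
      using x h by (metis inv_closed inv_solve_left m_assoc m_closed)
    also have "\<dots> \<longleftrightarrow> x \<otimes> h = h \<otimes> x"
      using x h by (metis inv_closed inv_solve_left inv_solve_right m_assoc m_closed)
    finally show "(\<Sum>\<chi>\<in>Irr G. \<chi> \<one> * \<chi> (x \<otimes> (inv h \<otimes> inv x \<otimes> h))) = (if h \<in> centralizer x then N else 0)"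
      using column_identity[of "x \<otimes> (inv h \<otimes> inv x \<otimes> h)"] x h by (simp add: centralizer_def)
  qed
  also have "\<dots> = N * of_nat (card (centralizer x))"
  proof -
    have "{h \<in> carrier G. h \<in> centralizer x} = centralizer x" by (auto simp: centralizer_def)
    then show ?thesis by (simp add: sum.If_cases Int_def)
  qed
  finally have "(\<Sum>\<chi>\<in>Irr G. complex_of_real ((cmod (\<chi> x))\<^sup>2)) = of_nat (card (centralizer x))"
    using card_pos by (subst (asm) mult_left_cancel) (auto simp del: of_real_power)
  then have "complex_of_real (\<Sum>\<chi>\<in>Irr G. (cmod (\<chi> x))\<^sup>2) = complex_of_real (real (card (centralizer x)))" by simp
  then show ?thesis by (simp only: of_real_eq_iff)
qed

text \<open>Both sides are the sum of \<open>|\<chi>(g)|\<^sup>2\<close> over all \<open>\<chi>\<close> and \<open>g\<close>.\<close>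

lemma card_Irr_sum_centralizers: "card (Irr G) * card (carrier G) = (\<Sum>g\<in>carrier G. card (centralizer g))"
proof -
  have "real (\<Sum>g\<in>carrier G. card (centralizer g)) = (\<Sum>g\<in>carrier G. \<Sum>\<chi>\<in>Irr G. (cmod (\<chi> g))\<^sup>2)"
    by (simp add: column_norm)
  also have "\<dots> = (\<Sum>\<chi>\<in>Irr G. \<Sum>g\<in>carrier G. (cmod (\<chi> g))\<^sup>2)" by (rule sum.swap)
  also have "\<dots> = real (card (Irr G) * card (carrier G))" by (simp add: Irr_norm)
  finally show ?thesis by (simp only: of_nat_eq_iff)
qed

subsection \<open>Conjugacy classes\<close>

definition conj_class :: "'a \<Rightarrow> 'a set" where
  "conj_class x = (\<lambda>g. g \<otimes> x \<otimes> inv g) ` carrier G"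

lemma conj_class_self: "x \<in> carrier G \<Longrightarrow> x \<in> conj_class x"
  unfolding conj_class_def by (rule image_eqI[of _ _ \<one>]) auto

lemma conj_class_subset: "x \<in> carrier G \<Longrightarrow> conj_class x \<subseteq> carrier G"
  by (auto simp: conj_class_def)

lemma conj_mult: "g \<in> carrier G \<Longrightarrow> h \<in> carrier G \<Longrightarrow> x \<in> carrier G \<Longrightarrow>
    g \<otimes> (h \<otimes> x \<otimes> inv h) \<otimes> inv g = (g \<otimes> h) \<otimes> x \<otimes> inv (g \<otimes> h)"
  by (simp add: inv_mult_group m_assoc)

lemma conj_class_sym: "x \<in> carrier G \<Longrightarrow> y \<in> conj_class x \<Longrightarrow> x \<in> conj_class y"
proof -
  assume x: "x \<in> carrier G" and "y \<in> conj_class x"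
  then obtain g where g: "g \<in> carrier G" "y = g \<otimes> x \<otimes> inv g" by (auto simp: conj_class_def)
  then have "x = inv g \<otimes> y \<otimes> inv (inv g)" using x by (simp add: m_assoc)
  then show ?thesis using g(1) unfolding conj_class_def by blast
qed

lemma conj_class_trans: "x \<in> carrier G \<Longrightarrow> y \<in> conj_class x \<Longrightarrow> z \<in> conj_class y \<Longrightarrow> z \<in> conj_class x"
  unfolding conj_class_def by (auto simp: conj_mult)

lemma conj_class_eq: "x \<in> carrier G \<Longrightarrow> y \<in> conj_class x \<Longrightarrow> conj_class y = conj_class x"
  using conj_class_trans conj_class_sym conj_class_subset by blast

lemma card_conj_class:
  assumes x: "x \<in> carrier G"
  shows "card (conj_class x) * card (centralizer x) = card (carrier G)"
proof -
  have "card {h \<in> carrier G. h \<otimes> x \<otimes> inv h = c} = card (centralizer x)" if "c \<in> conj_class x" for c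
  proof -
    obtain g where g: "g \<in> carrier G" "c = g \<otimes> x \<otimes> inv g" using \<open>c \<in> conj_class x\<close> by (auto simp: conj_class_def)
    have "bij_betw (\<lambda>h. g \<otimes> h) (centralizer x) {h \<in> carrier G. h \<otimes> x \<otimes> inv h = c}"
    proof (rule bij_betwI[where g = "\<lambda>h. inv g \<otimes> h"])
      show "(\<otimes>) g \<in> centralizer x \<rightarrow> {h \<in> carrier G. h \<otimes> x \<otimes> inv h = c}"
      proof
        fix h assume "h \<in> centralizer x"
        then have h: "h \<in> carrier G" "x \<otimes> h = h \<otimes> x" by (auto simp: centralizer_def)
        have "(g \<otimes> h) \<otimes> x \<otimes> inv (g \<otimes> h) = g \<otimes> (h \<otimes> x \<otimes> inv h) \<otimes> inv g"
          by (rule conj_mult[symmetric]) (use g h x in auto)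
        also have "h \<otimes> x \<otimes> inv h = x" using h x by (simp flip: h(2) add: m_assoc)
        finally show "g \<otimes> h \<in> {h \<in> carrier G. h \<otimes> x \<otimes> inv h = c}" using g h by simp
      qed
      show "(\<otimes>) (inv g) \<in> {h \<in> carrier G. h \<otimes> x \<otimes> inv h = c} \<rightarrow> centralizer x"
      proof
        fix h assume "h \<in> {h \<in> carrier G. h \<otimes> x \<otimes> inv h = c}"
        then have h: "h \<in> carrier G" "h \<otimes> x \<otimes> inv h = g \<otimes> x \<otimes> inv g" using g by auto
        have "(inv g \<otimes> h) \<otimes> x \<otimes> inv (inv g \<otimes> h) = inv g \<otimes> (h \<otimes> x \<otimes> inv h) \<otimes> inv (inv g)"
          by (rule conj_mult[symmetric]) (use g h x in auto)
        also have "\<dots> = x" using g x by (simp add: h(2) m_assoc)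
        finally have "(inv g \<otimes> h) \<otimes> x = x \<otimes> (inv g \<otimes> h)"
          using g h x by (metis inv_closed inv_solve_right m_closed)
        then show "inv g \<otimes> h \<in> centralizer x" using g h x by (simp add: centralizer_def)
      qed
    qed (use g in \<open>auto simp: centralizer_def\<close>)
    then show ?thesis by (simp add: bij_betw_same_card)
  qed
  then have "(\<Sum>c\<in>conj_class x. card {h \<in> carrier G. h \<otimes> x \<otimes> inv h = c}) = card (conj_class x) * card (centralizer x)"
    by simp
  moreover have "(\<Sum>c\<in>conj_class x. card {h \<in> carrier G. h \<otimes> x \<otimes> inv h = c}) = card (carrier G)"
    using card_eq_sum sum.image_gen[OF fin, of "\<lambda>_. 1::nat" "\<lambda>h. h \<otimes> x \<otimes> inv h"]
    by (simp add: conj_class_def)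
  ultimately show ?thesis by simp
qed

lemma card_centralizer_conj:
  assumes "x \<in> carrier G" "y \<in> conj_class x"
  shows "card (centralizer y) = card (centralizer x)"
proof -
  have y: "y \<in> carrier G" using assms conj_class_subset by blast
  have "card (conj_class x) > 0"
    using assms conj_class_subset[OF assms(1)] fin by (auto simp: card_gt_0_iff intro: finite_subset)
  then show ?thesis
    using card_conj_class[OF assms(1)] card_conj_class[OF y] conj_class_eq[OF assms]
    by (metis mult_cancel1 neq0_conv)
qed

text \<open>Each conjugacy class contributes \<open>|G|\<close> to the sum of the centralizer orders.\<close>

lemma nonconjugate_card_le:
  assumes A: "A \<subseteq> carrier G" and nc: "\<And>a b. a \<in> A \<Longrightarrow> b \<in> A \<Longrightarrow> a \<noteq> b \<Longrightarrow> b \<notin> conj_class a"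
  shows "card A \<le> card (Irr G)"
proof -
  have "card A * card (carrier G) = (\<Sum>a\<in>A. \<Sum>c\<in>conj_class a. card (centralizer c))"
  proof -
    have "(\<Sum>c\<in>conj_class a. card (centralizer c)) = card (carrier G)" if "a \<in> A" for a
      using A that card_centralizer_conj[of a] card_conj_class[of a] by auto
    then show ?thesis by simp
  qed
  also have "\<dots> = (\<Sum>c\<in>(\<Union>a\<in>A. conj_class a). card (centralizer c))"
  proof (rule sum.UNION_disjoint[symmetric])
    show "finite A" using A fin finite_subset by blast
    show "\<forall>a\<in>A. finite (conj_class a)" by (simp add: conj_class_def)
    show "\<forall>i\<in>A. \<forall>j\<in>A. i \<noteq> j \<longrightarrow> conj_class i \<inter> conj_class j = {}"
    proof (intro ballI impI, rule ccontr)
      fix i j assume ij: "i \<in> A" "j \<in> A" "i \<noteq> j" and "conj_class i \<inter> conj_class j \<noteq> {}"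
      then obtain c where "c \<in> conj_class i" "c \<in> conj_class j" by blast
      then have "conj_class i = conj_class j" using conj_class_eq ij A by blast
      then show False using nc[OF ij] conj_class_self[of j] ij A by blast
    qed
  qed
  also have "\<dots> \<le> (\<Sum>c\<in>carrier G. card (centralizer c))"
    using A conj_class_subset by (intro sum_mono2) auto
  also have "\<dots> = card (Irr G) * card (carrier G)" by (rule card_Irr_sum_centralizers[symmetric])
  finally show ?thesis using card_pos by simp
qed

end

section \<open>Linear, conjugate and inflated characters\<close>

context fin_group
begin

lemma carrier_ne [simp]: "carrier G \<noteq> {}"
  by auto

lemma linear_character:
  assumes mult: "\<And>g h. g \<in> carrier G \<Longrightarrow> h \<in> carrier G \<Longrightarrow> f (g \<otimes> h) = f g * f h"
    and one: "f \<one> = (1 :: complex)"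
  shows "restrict f (carrier G) \<in> Irr G"
proof -
  define \<rho> where "\<rho> g = mat 1 1 (\<lambda>_. f g)" for g
  have "representation G 1 \<rho>"
    unfolding representation_iff[OF group_axioms] using mult one
    by (auto simp: \<rho>_def scalar_prod_def intro!: eq_matI)
  moreover have "W = {0\<^sub>v 1} \<or> W = carrier_vec 1"
    if W: "subspace class_ring W (module_vec TYPE(complex) 1)" for W
  proof (cases "W = {0\<^sub>v 1}")
    case False
    have Wc: "W \<subseteq> carrier_vec 1" "0\<^sub>v 1 \<in> W" "\<And>c v. v \<in> W \<Longrightarrow> c \<cdot>\<^sub>v v \<in> W"
      using W by (auto simp: subspace_vec_iff)
    then obtain w where w: "w \<in> W" "w \<noteq> 0\<^sub>v 1" using False by blast
    have wc: "w \<in> carrier_vec 1" using w Wc by blast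
    have w0: "w $ 0 \<noteq> 0"
    proof
      assume "w $ 0 = 0"
      then have "w = 0\<^sub>v 1" using wc by (intro eq_vecI) auto
      then show False using w by simp
    qed
    have "v \<in> W" if "v \<in> carrier_vec 1" for v
    proof -
      have "v = (v $ 0 / w $ 0) \<cdot>\<^sub>v w" using that wc w0 by (intro eq_vecI) auto
      then show ?thesis using Wc(3)[OF w(1)] by metis
    qed
    then show ?thesis using Wc by blast
  qed simp
  ultimately have "irreducible_representation G 1 \<rho>" by (auto simp: irreducible_representation_def)
  moreover have "character_of G \<rho> = restrict f (carrier G)"
    by (auto simp: character_of_def \<rho>_def mat_trace_def)
  ultimately show ?thesis unfolding Irr_def by (metis (mono_tags, lifting) mem_Collect_eq)
qed

lemma principal_Irr [simp]: "principal_character G \<in> Irr G"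
  using linear_character[of "\<lambda>_. 1"] by (simp add: principal_character_def)

lemma principal_apply [simp]: "g \<in> carrier G \<Longrightarrow> principal_character G g = 1"
  by (simp add: principal_character_def)

lemma deg_one_mult:
  assumes \<chi>: "\<chi> \<in> Irr G" and d: "deg \<chi> = 1" and g: "g \<in> carrier G" and h: "h \<in> carrier G"
  shows "\<chi> (g \<otimes> h) = \<chi> g * \<chi> h"
proof -
  obtain n \<rho> where c: "\<And>g. g \<in> carrier G \<Longrightarrow> \<chi> g = mat_trace (\<rho> g)" and r: "representation G n \<rho>"
    and n: "\<chi> \<one> = of_nat n"
    by (rule IrrE[OF \<chi>]) blast
  have n1: "n = 1" using n deg[OF \<chi>] d by simp
  have "mat_trace (\<rho> g * \<rho> h) = mat_trace (\<rho> g) * mat_trace (\<rho> h)"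
    using rep_closed[OF r g] rep_closed[OF r h] mult_mat_entry[of "\<rho> g" 1 1 "\<rho> h" 1 0 0] unfolding n1
    by (simp add: mat_trace_def)
  then show ?thesis using g h by (simp add: c rep_mult[OF r])
qed

lemma Irr_sum_zero:
  assumes \<chi>: "\<chi> \<in> Irr G" "\<chi> \<noteq> principal_character G"
  shows "(\<Sum>g\<in>carrier G. \<chi> g) = 0"
  using Irr_orthogonality[OF principal_Irr \<chi>(1)] \<chi>(2) by auto

text \<open>If \<open>|G| = \<chi>(1) |ker \<chi>|\<close>, then the kernel alone contributes \<open>\<chi>(1) |G|\<close> to the norm
  \<open>|G|\<close> of \<open>\<chi>\<close>, which forces \<open>\<chi>(1) = 1\<close> and \<open>ker \<chi> = G\<close>.\<close>

lemma codegree_eq_1: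
  assumes \<chi>: "\<chi> \<in> Irr G" and a: "codegree G \<chi> = 1"
  shows "\<chi> = principal_character G"
proof -
  let ?K = "character_kernel G \<chi>"
  have dK: "deg \<chi> * card ?K = card (carrier G)" using codegree[OF \<chi>] a by simp
  have "(\<Sum>h\<in>?K. (cmod (\<chi> h))\<^sup>2) \<le> (\<Sum>h\<in>carrier G. (cmod (\<chi> h))\<^sup>2)"
    by (intro sum_mono2) (auto simp: kernel_subset)
  also have "\<dots> = real (deg \<chi> * card ?K)" using Irr_norm[OF \<chi>] dK by simp
  also have "(\<Sum>h\<in>?K. (cmod (\<chi> h))\<^sup>2) = (\<Sum>h\<in>?K. (real (deg \<chi>))\<^sup>2)"
    by (intro sum.cong refl) (auto simp: character_kernel_def deg[OF \<chi>])
  finally have "real (card ?K * (deg \<chi> * deg \<chi>)) \<le> real (deg \<chi> * card ?K)" by (simp add: power2_eq_square)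
  then have "card ?K * (deg \<chi> * deg \<chi>) \<le> deg \<chi> * card ?K" by (simp only: of_nat_le_iff)
  then have "deg \<chi> = 1" using card_kernel_pos[OF \<chi>] deg_pos[OF \<chi>] by simp
  then have "?K = carrier G" using dK kernel_subset by (metis card_subset_eq fin mult_1)
  then show ?thesis
    using \<open>deg \<chi> = 1\<close> deg[OF \<chi>] by (intro Irr_ext[OF \<chi> principal_Irr]) (auto simp: character_kernel_def)
qed

lemma deg_principal: "deg (principal_character G) = 1"
  using deg[OF principal_Irr] by simp

lemma codegree_principal: "codegree G (principal_character G) = 1"
proof -
  have "character_kernel G (principal_character G) = carrier G" by (auto simp: character_kernel_def)
  then show ?thesis using codegree[OF principal_Irr] deg_principal by simp
qed

definition conj_char :: "('a \<Rightarrow> complex) \<Rightarrow> 'a \<Rightarrow> complex" where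
  "conj_char \<chi> = (\<lambda>g\<in>carrier G. cnj (\<chi> g))"

lemma conj_char_Irr:
  assumes \<chi>: "\<chi> \<in> Irr G"
  shows "conj_char \<chi> \<in> Irr G"
proof -
  obtain n \<rho> where c: "\<And>g. g \<in> carrier G \<Longrightarrow> \<chi> g = mat_trace (\<rho> g)" and r: "representation G n \<rho>"
    and ir: "irreducible_representation G n \<rho>"
    by (rule IrrE[OF \<chi>]) blast
  define \<sigma> where "\<sigma> g = map_mat cnj (\<rho> g)" for g
  have mm: "map_mat cnj (A * B) = map_mat cnj A * map_mat cnj B"
    if "A \<in> carrier_mat n n" "B \<in> carrier_mat n n" for A B
    using that by (auto intro!: eq_matI simp: scalar_prod_def)
  have mv: "map_vec cnj (A *\<^sub>v v) = map_mat cnj A *\<^sub>v map_vec cnj v"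
    if "A \<in> carrier_mat n n" "v \<in> carrier_vec n" for A v
    using that by (auto intro!: eq_vecI simp: scalar_prod_def)
  have s: "representation G n \<sigma>"
    using r unfolding representation_iff[OF group_axioms] \<sigma>_def by (auto simp: mm intro!: eq_matI)
  have vv [simp]: "map_vec cnj (map_vec cnj v) = v" for v by (auto intro!: eq_vecI)
  have mmm [simp]: "map_mat cnj (map_mat cnj A) = A" for A by (auto intro!: eq_matI)
  have z [simp]: "map_vec cnj (0\<^sub>v n) = 0\<^sub>v n" by (auto intro!: eq_vecI)
  have "W = {0\<^sub>v n} \<or> W = carrier_vec n"
    if W: "subspace class_ring W (module_vec TYPE(complex) n)" and inv: "\<forall>g\<in>carrier G. \<forall>w\<in>W. \<sigma> g *\<^sub>v w \<in> W" for W
  proof -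
    have Wc: "W \<subseteq> carrier_vec n" "0\<^sub>v n \<in> W" "\<And>c v. v \<in> W \<Longrightarrow> c \<cdot>\<^sub>v v \<in> W"
      "\<And>v w. v \<in> W \<Longrightarrow> w \<in> W \<Longrightarrow> v + w \<in> W"
      using W by (auto simp: subspace_vec_iff)
    define V where "V = {v \<in> carrier_vec n. map_vec cnj v \<in> W}"
    have "V = {0\<^sub>v n} \<or> V = carrier_vec n"
    proof (rule irreducible_representationD[OF ir])
      fix v w assume vw: "v \<in> V" "w \<in> V"
      then have "map_vec cnj (v + w) = map_vec cnj v + map_vec cnj w" by (auto simp: V_def intro!: eq_vecI)
      then show "v + w \<in> V" using vw Wc(4) by (auto simp: V_def)
    next
      fix c v assume v: "v \<in> V"
      have "map_vec cnj (c \<cdot>\<^sub>v v) = cnj c \<cdot>\<^sub>v map_vec cnj v" by (auto intro!: eq_vecI)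
      then show "c \<cdot>\<^sub>v v \<in> V" using v Wc(3) by (auto simp: V_def)
    next
      fix g w assume g: "g \<in> carrier G" and w: "w \<in> V"
      then show "\<rho> g *\<^sub>v w \<in> V"
        using inv mv[OF rep_closed[OF r g], of w] rep_closed[OF r g] by (auto simp: V_def \<sigma>_def)
    qed (use Wc in \<open>auto simp: V_def\<close>)
    moreover have "W = map_vec cnj ` V"
    proof
      show "W \<subseteq> map_vec cnj ` V"
      proof
        fix w assume "w \<in> W"
        then have "map_vec cnj w \<in> V" using Wc by (auto simp: V_def)
        then show "w \<in> map_vec cnj ` V" by (rule rev_image_eqI) simp
      qed
    qed (auto simp: V_def)
    moreover have "map_vec cnj ` carrier_vec n = carrier_vec n"
    proof
      show "carrier_vec n \<subseteq> map_vec cnj ` carrier_vec n"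
        by (rule subsetI, rule_tac x = "map_vec cnj x" in rev_image_eqI) auto
    qed auto
    ultimately show ?thesis by auto
  qed
  then have "irreducible_representation G n \<sigma>"
    using s irr_pos[OF ir] by (auto simp: irreducible_representation_def)
  moreover have "mat_trace (map_mat cnj A) = cnj (mat_trace A)" if "A \<in> carrier_mat n n" for A
    using that by (simp add: mat_trace_def)
  then have "character_of G \<sigma> = conj_char \<chi>"
    using rep_closed[OF r] by (auto simp: character_of_def conj_char_def c \<sigma>_def fun_eq_iff restrict_def)
  ultimately show ?thesis unfolding Irr_def by (metis (mono_tags, lifting) mem_Collect_eq)
qed

lemma conj_char_facts:
  assumes \<chi>: "\<chi> \<in> Irr G"
  shows "deg (conj_char \<chi>) = deg \<chi>" "codegree G (conj_char \<chi>) = codegree G \<chi>"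
    "conj_char \<chi> = principal_character G \<longleftrightarrow> \<chi> = principal_character G"
proof -
  have d: "of_nat (deg (conj_char \<chi>)) = (of_nat (deg \<chi>) :: complex)"
    using deg[OF \<chi>] deg[OF conj_char_Irr[OF \<chi>]] by (simp add: conj_char_def)
  then show "deg (conj_char \<chi>) = deg \<chi>" by (simp only: of_nat_eq_iff)
  have "character_kernel G (conj_char \<chi>) = character_kernel G \<chi>"
    by (auto simp: character_kernel_def conj_char_def)
  then show cd: "codegree G (conj_char \<chi>) = codegree G \<chi>"
    unfolding codegree_def by (simp add: conj_char_def deg[OF \<chi>])
  then show "conj_char \<chi> = principal_character G \<longleftrightarrow> \<chi> = principal_character G"
    using codegree_eq_1[OF \<chi>] codegree_eq_1[OF conj_char_Irr[OF \<chi>]] codegree_principal by metis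
qed

lemma signs_list:
  assumes "\<And>e. e \<in> set es \<Longrightarrow> e = 1 \<or> e = (-1 :: complex)"
  shows "\<exists>m. sum_list es = of_int (int (length es) - 2 * int m) \<and> prod_list es = (-1) ^ m"
  using assms
proof (induction es)
  case (Cons e es)
  then obtain m where m: "sum_list es = of_int (int (length es) - 2 * int m)" "prod_list es = (-1) ^ m" by auto
  from Cons.prems consider "e = 1" | "e = -1" by auto
  then show ?case
  proof cases
    case 1
    then show ?thesis using m by (intro exI[of _ m]) auto
  next
    case 2
    then show ?thesis using m by (intro exI[of _ "Suc m"]) auto
  qed
qed simp

text \<open>On an involution, a character of degree \<open>n\<close> takes the value \<open>n - 2m\<close>, where \<open>m\<close> is the
  multiplicity of the eigenvalue \<open>-1\<close>, and the determinant is \<open>(-1)^m\<close>. The determinant is a linear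
  character; so \<open>m\<close> is even when all linear characters are trivial.\<close>

lemma involution_value:
  assumes \<chi>: "\<chi> \<in> Irr G" and x: "x \<in> carrier G" "x \<otimes> x = \<one>"
  shows "\<exists>m. \<chi> x = of_int (int (deg \<chi>) - 2 * int m)"
    and "(\<And>f g. (\<And>g h. g \<in> carrier G \<Longrightarrow> h \<in> carrier G \<Longrightarrow> f (g \<otimes> h) = f g * (f h :: complex)) \<Longrightarrow>
        f \<one> = 1 \<Longrightarrow> g \<in> carrier G \<Longrightarrow> f g = 1) \<Longrightarrow> \<exists>m. \<chi> x = of_int (int (deg \<chi>) - 4 * m)"
proof -
  obtain n \<rho> where c: "\<And>g. g \<in> carrier G \<Longrightarrow> \<chi> g = mat_trace (\<rho> g)" and r: "representation G n \<rho>"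
    and n: "\<chi> \<one> = of_nat n"
    by (rule IrrE[OF \<chi>]) blast
  have nd: "n = deg \<chi>" using n deg[OF \<chi>] by simp
  obtain es where es: "length es = n" "\<And>e m. e \<in> set es \<Longrightarrow> x [^] (m::nat) = \<one> \<Longrightarrow> e ^ m = 1"
    "\<And>k::nat. mat_trace (\<rho> (x [^] k)) = (\<Sum>e\<leftarrow>es. e ^ k)" "det (\<rho> x) = prod_list es"
    using rep_eigenvalues[OF r x(1)] by metis
  have "x [^] (2::nat) = \<one>" using x by (simp add: numeral_2_eq_2)
  then have "e\<^sup>2 = 1" if "e \<in> set es" for e using es(2) that by blast
  then have "e = 1 \<or> e = -1" if "e \<in> set es" for e using that power2_eq_1_iff by blast
  from signs_list[OF this] obtain m where
    m: "sum_list es = of_int (int (length es) - 2 * int m)" "prod_list es = (-1) ^ m" by blast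
  have \<chi>x: "\<chi> x = of_int (int (deg \<chi>) - 2 * int m)"
    using es(3)[of 1] x m(1) es(1) nd by (simp add: c)
  then show "\<exists>m. \<chi> x = of_int (int (deg \<chi>) - 2 * int m)" by blast
  assume triv: "\<And>f g. (\<And>g h. g \<in> carrier G \<Longrightarrow> h \<in> carrier G \<Longrightarrow> f (g \<otimes> h) = f g * (f h :: complex)) \<Longrightarrow>
        f \<one> = 1 \<Longrightarrow> g \<in> carrier G \<Longrightarrow> f g = 1"
  have "det (\<rho> x) = 1"
    by (rule triv[of "\<lambda>g. det (\<rho> g)"]) (use rep_one[OF r] x in \<open>auto simp: rep_mult[OF r] det_mult[OF rep_closed[OF r] rep_closed[OF r]]\<close>)
  then have "even m" using es(4) m(2) by (cases "even m") auto
  then obtain l where "m = 2 * l" by (auto elim: evenE)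
  then have "\<chi> x = of_int (int (deg \<chi>) - 4 * int l)" using \<chi>x by simp
  then show "\<exists>m. \<chi> x = of_int (int (deg \<chi>) - 4 * m)" by blast
qed

end

subsection \<open>Inflation along surjective homomorphisms\<close>

lemma fin_groupI: "group G \<Longrightarrow> finite (carrier G) \<Longrightarrow> fin_group G"
  by (simp add: fin_group_def fin_group_axioms_def)

lemma hom_fibre_card:
  assumes G: "group G" "finite (carrier G)" and H: "group H" and \<phi>: "\<phi> \<in> hom G H" "\<phi> ` carrier G = carrier H"
    and S: "S \<subseteq> carrier H"
  shows "card {g \<in> carrier G. \<phi> g \<in> S} * card (carrier H) = card S * card (carrier G)"
proof -
  interpret G: group G by fact
  interpret H: group H by fact
  interpret group_hom G H \<phi> using \<phi>(1) by unfold_locales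
  define c where "c = card {g \<in> carrier G. \<phi> g = \<one>\<^bsub>H\<^esub>}"
  have finH: "finite (carrier H)" using \<phi>(2) G(2) by (metis finite_imageI)
  have fib: "card {g \<in> carrier G. \<phi> g = y} = c" if y: "y \<in> carrier H" for y
  proof -
    obtain a where a: "a \<in> carrier G" "\<phi> a = y" using y \<phi>(2) by (metis imageE)
    have "bij_betw (\<lambda>g. a \<otimes>\<^bsub>G\<^esub> g) {g \<in> carrier G. \<phi> g = \<one>\<^bsub>H\<^esub>} {g \<in> carrier G. \<phi> g = y}"
      by (rule bij_betwI[where g = "\<lambda>g. inv\<^bsub>G\<^esub> a \<otimes>\<^bsub>G\<^esub> g"]) (use a y in \<open>auto simp: G.m_assoc[symmetric]\<close>)
    then show ?thesis unfolding c_def by (simp add: bij_betw_same_card)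
  qed
  have *: "card {g \<in> carrier G. \<phi> g \<in> S} = card S * c" if S: "S \<subseteq> carrier H" for S
  proof -
    have "{g \<in> carrier G. \<phi> g \<in> S} = (\<Union>y\<in>S. {g \<in> carrier G. \<phi> g = y})" by auto
    also have "card \<dots> = (\<Sum>y\<in>S. card {g \<in> carrier G. \<phi> g = y})"
      using S finH G(2) by (intro card_UN_disjoint) (auto intro: finite_subset)
    also have "\<dots> = card S * c" using S fib by (simp add: subset_iff)
    finally show ?thesis .
  qed
  have "{g \<in> carrier G. \<phi> g \<in> carrier H} = carrier G" by auto
  then show ?thesis using *[OF S] *[of "carrier H"] by simp
qed

definition inflate :: "('a, 'c) monoid_scheme \<Rightarrow> ('a \<Rightarrow> 'b) \<Rightarrow> ('b \<Rightarrow> complex) \<Rightarrow> 'a \<Rightarrow> complex" where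
  "inflate G \<phi> \<chi> = (\<lambda>g\<in>carrier G. \<chi> (\<phi> g))"

text \<open>The codegree does not change because \<open>|G : ker \<chi>|\<close> and \<open>\<chi>(1)\<close> do not. This makes
  triangle-freeness pass to quotients.\<close>

lemma inflate_Irr:
  assumes G: "fin_group G" and H: "fin_group H" and \<phi>: "\<phi> \<in> hom G H" "\<phi> ` carrier G = carrier H"
    and \<chi>: "\<chi> \<in> Irr H"
  shows "inflate G \<phi> \<chi> \<in> Irr G" "codegree G (inflate G \<phi> \<chi>) = codegree H \<chi>"
    "fin_group.deg G (inflate G \<phi> \<chi>) = fin_group.deg H \<chi>"
    "inflate G \<phi> \<chi> = principal_character G \<longleftrightarrow> \<chi> = principal_character H"
proof -
  interpret G: fin_group G by fact
  interpret H: fin_group H by fact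
  interpret group_hom G H \<phi> using \<phi>(1) by unfold_locales
  have surj: "y \<in> carrier H \<Longrightarrow> \<exists>g\<in>carrier G. \<phi> g = y" for y using \<phi>(2) by (metis imageE)
  obtain n \<rho> where c: "\<And>g. g \<in> carrier H \<Longrightarrow> \<chi> g = mat_trace (\<rho> g)" and r: "representation H n \<rho>"
    and ir: "irreducible_representation H n \<rho>"
    by (rule H.IrrE[OF \<chi>]) blast
  define \<sigma> where "\<sigma> g = \<rho> (\<phi> g)" for g
  have s: "representation G n \<sigma>"
    using r unfolding representation_iff[OF G.group_axioms] representation_iff[OF H.group_axioms] \<sigma>_def by auto
  have "irreducible_representation G n \<sigma>"
    unfolding irreducible_representation_def
  proof (intro conjI allI impI)
    fix W assume W: "subspace class_ring W (module_vec TYPE(complex) n)" and inv: "\<forall>g\<in>carrier G. \<forall>w\<in>W. \<sigma> g *\<^sub>v w \<in> W"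
    have "\<forall>g\<in>carrier H. \<forall>w\<in>W. \<rho> g *\<^sub>v w \<in> W" using inv surj unfolding \<sigma>_def by metis
    then show "W = {0\<^sub>v n} \<or> W = carrier_vec n" using ir W by (auto simp: irreducible_representation_def)
  qed (use s H.irr_pos[OF ir] in auto)
  moreover have "character_of G \<sigma> = inflate G \<phi> \<chi>"
    by (auto simp: character_of_def inflate_def c \<sigma>_def fun_eq_iff restrict_def)
  ultimately show I: "inflate G \<phi> \<chi> \<in> Irr G" unfolding Irr_def by (metis (mono_tags, lifting) mem_Collect_eq)
  have "(of_nat (G.deg (inflate G \<phi> \<chi>)) :: complex) = of_nat (H.deg \<chi>)"
    using G.deg[OF I] H.deg[OF \<chi>] by (simp add: inflate_def)
  then show d: "G.deg (inflate G \<phi> \<chi>) = H.deg \<chi>" by (simp only: of_nat_eq_iff)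
  have "character_kernel G (inflate G \<phi> \<chi>) = {g \<in> carrier G. \<phi> g \<in> character_kernel H \<chi>}"
    by (auto simp: character_kernel_def inflate_def)
  then have k: "card (character_kernel G (inflate G \<phi> \<chi>)) * card (carrier H) = card (character_kernel H \<chi>) * card (carrier G)"
    using hom_fibre_card[OF G.group_axioms G.fin H.group_axioms \<phi> H.kernel_subset[of \<chi>]] by simp
  let ?k = "card (character_kernel G (inflate G \<phi> \<chi>))" and ?kH = "card (character_kernel H \<chi>)"
  have "codegree G (inflate G \<phi> \<chi>) * H.deg \<chi> * (?k * card (carrier H)) = card (carrier G) * card (carrier H)"
    using G.codegree[OF I] d by (simp add: mult_ac)
  also have "\<dots> = codegree H \<chi> * H.deg \<chi> * ?kH * card (carrier G)"
    unfolding H.codegree[OF \<chi>] by (rule mult.commute)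
  also have "\<dots> = codegree H \<chi> * H.deg \<chi> * (?k * card (carrier H))"
    by (simp only: k mult.assoc)
  finally show cd: "codegree G (inflate G \<phi> \<chi>) = codegree H \<chi>"
    using H.deg_pos[OF \<chi>] G.card_kernel_pos[OF I] H.card_pos by simp
  show "inflate G \<phi> \<chi> = principal_character G \<longleftrightarrow> \<chi> = principal_character H"
    using G.codegree_eq_1[OF I] H.codegree_eq_1[OF \<chi>] cd G.codegree_principal H.codegree_principal by metis
qed

lemma inflate_inj:
  assumes "fin_group H" and \<phi>: "\<phi> ` carrier G = carrier H"
    and \<chi>: "\<chi> \<in> Irr H" "\<psi> \<in> Irr H" and eq: "inflate G \<phi> \<chi> = inflate G \<phi> \<psi>"
  shows "\<chi> = \<psi>"
proof (rule fin_group.Irr_ext[OF assms(1) \<chi>])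
  fix y assume "y \<in> carrier H"
  then obtain g where g: "g \<in> carrier G" "y = \<phi> g" using \<phi> by blast
  then show "\<chi> y = \<psi> y" using fun_cong[OF eq, of g] by (simp add: inflate_def)
qed

section \<open>Triangles in the codegree graph\<close>

definition codegree_triangle :: "('a, 'b) monoid_scheme \<Rightarrow> ('a \<Rightarrow> complex) set \<Rightarrow> bool" where
  "codegree_triangle G T \<longleftrightarrow> T \<subseteq> Irr G - {principal_character G} \<and> card T = 3 \<and>
     (\<forall>\<chi>\<in>T. \<forall>\<psi>\<in>T. \<chi> \<noteq> \<psi> \<longrightarrow> gcd (codegree G \<chi>) (codegree G \<psi>) \<noteq> 1)"

lemma triangle_free_iff: "triangle_free (codegree_graph G) \<longleftrightarrow> \<not> (\<exists>T. codegree_triangle G T)"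
proof -
  have "{x, y} \<in> snd (codegree_graph G) \<longleftrightarrow> gcd (codegree G x) (codegree G y) \<noteq> 1"
    if "x \<in> Irr G - {principal_character G}" "y \<in> Irr G - {principal_character G}" "x \<noteq> y" for x y
    using that by (auto simp: codegree_graph_def Let_def doubleton_eq_iff gcd.commute)
  then have "is_triangle (codegree_graph G) T \<longleftrightarrow> codegree_triangle G T" for T
    unfolding is_triangle_def codegree_triangle_def
    by (auto simp: codegree_graph_def Let_def subset_iff)
  then show ?thesis by (simp add: triangle_free_def)
qed

lemma triangle_free_image:
  assumes G: "fin_group G" and H: "fin_group H" and \<phi>: "\<phi> \<in> hom G H" "\<phi> ` carrier G = carrier H"
    and tf: "triangle_free (codegree_graph G)"
  shows "triangle_free (codegree_graph H)"
proof (rule ccontr)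
  assume "\<not> ?thesis"
  then obtain T where T: "codegree_triangle H T" by (auto simp: triangle_free_iff)
  note i = inflate_Irr[OF G H \<phi>]
  have TI: "T \<subseteq> Irr H" using T by (auto simp: codegree_triangle_def)
  then have inj: "inj_on (inflate G \<phi>) T" using inflate_inj[OF H \<phi>(2)] by (auto simp: inj_on_def)
  have "codegree_triangle G (inflate G \<phi> ` T)"
    unfolding codegree_triangle_def
  proof (intro conjI ballI impI)
    show "inflate G \<phi> ` T \<subseteq> Irr G - {principal_character G}"
      using T i by (auto simp: codegree_triangle_def)
    show "card (inflate G \<phi> ` T) = 3" using T inj by (simp add: card_image codegree_triangle_def)
    fix x y assume "x \<in> inflate G \<phi> ` T" "y \<in> inflate G \<phi> ` T" and ne: "x \<noteq> y"
    then obtain \<chi> \<psi> where "x = inflate G \<phi> \<chi>" "y = inflate G \<phi> \<psi>" "\<chi> \<in> T" "\<psi> \<in> T" by blast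
    moreover from this have "\<chi> \<noteq> \<psi>" using ne by blast
    ultimately show "gcd (codegree G x) (codegree G y) \<noteq> 1"
      using T TI i(2) by (auto simp: codegree_triangle_def subset_iff)
  qed
  then show False using tf by (auto simp: triangle_free_iff)
qed

context fin_group
begin

definition chars_with :: "nat \<Rightarrow> ('a \<Rightarrow> complex) set" where
  "chars_with p = {\<chi> \<in> Irr G. \<chi> \<noteq> principal_character G \<and> p dvd codegree G \<chi>}"

lemma finite_chars_with [simp]: "finite (chars_with p)"
  by (simp add: chars_with_def)

lemma card_chars_with:
  assumes "triangle_free (codegree_graph G)" and p: "Factorial_Ring.prime p"
  shows "card (chars_with p) \<le> 2"
proof (rule ccontr)
  assume "\<not> ?thesis"
  then obtain T where T: "T \<subseteq> chars_with p" "card T = 3"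
    using obtain_subset_with_card_n[of 3 "chars_with p"] by (metis not_less_eq_eq numeral_2_eq_2 numeral_3_eq_3)
  have "codegree_triangle G T"
    unfolding codegree_triangle_def
  proof (intro conjI ballI impI)
    fix \<chi> \<psi> assume "\<chi> \<in> T" "\<psi> \<in> T"
    then have "p dvd gcd (codegree G \<chi>) (codegree G \<psi>)" using T by (auto simp: chars_with_def)
    then show "gcd (codegree G \<chi>) (codegree G \<psi>) \<noteq> 1" using p by (metis not_prime_unit)
  qed (use T in \<open>auto simp: chars_with_def\<close>)
  then show False using assms(1) by (auto simp: triangle_free_iff)
qed

end

section \<open>Vanishing of characters of defect zero\<close>

text \<open>If a permutation of \<open>p\<close>-power order moves every point under its \<open>p^j\<close>-th power, then
  all orbit lengths are divisible by \<open>p^(j+1)\<close>, and so are sums of invariant functions.\<close>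

lemma orbit_sum_divisible:
  fixes r :: "'s \<Rightarrow> 's" and w :: "'s \<Rightarrow> complex"
  assumes "finite S" "\<And>s. s \<in> S \<Longrightarrow> r s \<in> S" "\<And>s. s \<in> S \<Longrightarrow> (r ^^ (p ^ k)) s = s"
    "\<And>s. s \<in> S \<Longrightarrow> (r ^^ (p ^ j)) s \<noteq> s" "\<And>s. s \<in> S \<Longrightarrow> w (r s) = w s"
    "\<And>s. s \<in> S \<Longrightarrow> w s \<in> cyc m" and p: "Factorial_Ring.prime (p::nat)"
  shows "\<exists>y\<in>cyc m. sum w S = of_nat (p ^ Suc j) * y"
  using assms(1-6)
proof (induction "card S" arbitrary: S rule: less_induct)
  case less
  show ?case
  proof (cases "S = {}")
    case True
    then show ?thesis by (intro bexI[of _ 0]) (auto intro: cyc.zero)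
  next
    case False
    then obtain s where s: "s \<in> S" by blast
    have p0: "p > 0" using p by (simp add: prime_gt_0_nat)
    define d where "d = (LEAST d. 0 < d \<and> (r ^^ d) s = s)"
    have ex: "0 < p ^ k \<and> (r ^^ (p ^ k)) s = s" using less.prems(3)[OF s] p0 by simp
    have d: "0 < d \<and> (r ^^ d) s = s" unfolding d_def using ex by (rule LeastI)
    have dmin: "d \<le> e" if "0 < e" "(r ^^ e) s = s" for e
      unfolding d_def using that by (intro Least_le) auto
    have md: "(r ^^ (e mod d)) s = (r ^^ e) s" for e using d by (intro funpow_mod_eq) auto
    have "p ^ k mod d = 0"
      using dmin[of "p ^ k mod d"] md[of "p ^ k"] ex d by (metis mod_less_divisor not_gr_zero linorder_not_le)
    then have "d dvd p ^ k" by auto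
    then obtain i where i: "d = p ^ i" using divides_primepow_nat[OF p] by blast
    have "\<not> i \<le> j"
    proof
      assume "i \<le> j"
      then have "p ^ j mod d = 0" by (simp add: i le_imp_power_dvd)
      then show False using md[of "p ^ j"] less.prems(4)[OF s] by simp
    qed
    then have pd: "p ^ Suc j dvd d" unfolding i by (intro le_imp_power_dvd) auto
    \<comment> \<open>The orbit of \<open>s\<close>; removing it leaves an invariant set.\<close>
    define Orb where "Orb = (\<lambda>i. (r ^^ i) s) ` {..<d}"
    have Orb_all: "(r ^^ e) s \<in> Orb" for e
      unfolding Orb_def using md[of e] d by (intro image_eqI[of _ _ "e mod d"]) auto
    have rS: "(r ^^ e) u \<in> S" if "u \<in> S" for e u using that less.prems(2) by (induction e) auto
    have Orb_sub: "Orb \<subseteq> S" using rS[OF s] by (auto simp: Orb_def)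
    have inj: "inj_on (\<lambda>i. (r ^^ i) s) {..<d}"
    proof (rule linorder_inj_onI)
      fix a b assume ab: "a < b" "a \<in> {..<d}" "b \<in> {..<d}"
      show "(r ^^ a) s \<noteq> (r ^^ b) s"
      proof
        assume e: "(r ^^ a) s = (r ^^ b) s"
        have "(r ^^ (d - b + a)) s = (r ^^ (d - b)) ((r ^^ b) s)" by (simp add: funpow_add e)
        also have "\<dots> = (r ^^ (d - b + b)) s" by (simp only: funpow_add o_apply)
        also have "\<dots> = s" using ab d by simp
        finally have "d \<le> d - b + a" using ab by (intro dmin) auto
        then show False using ab by auto
      qed
    qed auto
    have wr: "w ((r ^^ e) s) = w s" for e
      by (induction e) (use less.prems(5) rS[OF s] in auto)
    have "sum w Orb = of_nat d * w s"
      unfolding Orb_def by (simp add: sum.reindex[OF inj] wr)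
    moreover obtain d' where "d = p ^ Suc j * d'" using pd by blast
    ultimately have sO: "sum w Orb = of_nat (p ^ Suc j) * (of_nat d' * w s)" by simp
    have "\<exists>y\<in>cyc m. sum w (S - Orb) = of_nat (p ^ Suc j) * y"
    proof (rule less.hyps)
      have "s \<in> Orb" using Orb_all[of 0] by simp
      then show "card (S - Orb) < card S" using s less.prems(1) by (intro psubset_card_mono) auto
      fix u assume u: "u \<in> S - Orb"
      show "r u \<in> S - Orb"
      proof
        show "r u \<in> S" using u less.prems(2) by blast
        show "r u \<notin> Orb"
        proof
          assume "r u \<in> Orb"
          then obtain a where a: "r u = (r ^^ a) s" by (auto simp: Orb_def)
          have "u = (r ^^ Suc (p ^ k - 1)) u" using less.prems(3)[of u] u p0 by simp
          also have "\<dots> = (r ^^ (p ^ k - 1)) (r u)" by (simp only: funpow_Suc_right o_apply)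
          also have "\<dots> = (r ^^ (p ^ k - 1 + a)) s" by (simp only: a funpow_add o_apply)
          finally show False using Orb_all u by auto
        qed
      qed
    qed (use less.prems in auto)
    then obtain y where y: "y \<in> cyc m" "sum w (S - Orb) = of_nat (p ^ Suc j) * y" by blast
    have "sum w S = sum w (S - Orb) + sum w Orb" using Orb_sub less.prems(1) by (rule sum.subset_diff)
    also have "\<dots> = of_nat (p ^ Suc j) * (y + of_nat d' * w s)" by (simp only: y sO distrib_left)
    finally show ?thesis
      using y(1) less.prems(6)[OF s] by (intro bexI[of _ "y + of_nat d' * w s"]) (auto intro: cyc_add cyc_mult cyc_of_nat)
  qed
qed

context fin_group
begin

definition lprod :: "'a list \<Rightarrow> 'a" where
  "lprod hs = foldr (\<otimes>) hs \<one>"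

lemma lprod_simps [simp]: "lprod [] = \<one>" "lprod (h # hs) = h \<otimes> lprod hs"
  by (simp_all add: lprod_def)

lemma lprod_closed [simp]: "set hs \<subseteq> carrier G \<Longrightarrow> lprod hs \<in> carrier G"
  by (induction hs) auto

lemma lprod_append: "set us \<subseteq> carrier G \<Longrightarrow> set vs \<subseteq> carrier G \<Longrightarrow> lprod (us @ vs) = lprod us \<otimes> lprod vs"
  by (induction us) (auto simp: m_assoc)

text \<open>If \<open>vs\<close> commutes with \<open>us\<close> and its length is a multiple of that of \<open>us\<close>, then \<open>vs\<close> is a
  concatenation of copies of \<open>us\<close>.\<close>

lemma lprod_commuting_list:
  "vs @ us = us @ vs \<Longrightarrow> length vs = length us * q \<Longrightarrow> set us \<subseteq> carrier G \<Longrightarrow> lprod vs = lprod us [^] (q::nat)"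
proof (induction q arbitrary: vs)
  case (Suc q)
  define vs' where "vs' = drop (length us) vs"
  have "take (length us) (vs @ us) = us" using Suc.prems(1) by simp
  then have vs: "vs = us @ vs'" using Suc.prems(2) by (simp add: vs'_def) (metis append_take_drop_id)
  then have "vs' @ us = us @ vs'" using Suc.prems(1) by simp
  moreover have "length vs' = length us * q" using Suc.prems(2) by (simp add: vs'_def)
  ultimately have IH: "lprod vs' = lprod us [^] q" using Suc.IH Suc.prems(3) by blast
  have "set vs' \<subseteq> set us"
  proof -
    from \<open>vs' @ us = us @ vs'\<close> \<open>length vs' = length us * q\<close> show ?thesis
    proof (induction q arbitrary: vs')
      case (Suc q)
      define ws where "ws = drop (length us) vs'"
      have "take (length us) (vs' @ us) = us" using Suc.prems(1) by simp
      then have v: "vs' = us @ ws" using Suc.prems(2) by (simp add: ws_def) (metis append_take_drop_id)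
      then have "ws @ us = us @ ws" using Suc.prems(1) by simp
      moreover have "length ws = length us * q" using Suc.prems(2) by (simp add: ws_def)
      ultimately have "set ws \<subseteq> set us" by (rule Suc.IH)
      then show ?case by (simp add: v)
    qed simp
  qed
  then have "lprod vs = lprod us \<otimes> lprod us [^] q"
    using Suc.prems(3) by (simp add: vs lprod_append IH)
  then show ?case using Suc.prems(3) by (metis nat_pow_Suc2 lprod_closed)
qed simp

lemma conj_pow:
  assumes "g \<in> carrier G" "x \<in> carrier G"
  shows "(g \<otimes> x \<otimes> inv g) [^] (n::nat) = g \<otimes> x [^] n \<otimes> inv g"
proof (induction n)
  case (Suc n)
  then show ?case using assms by (simp add: m_assoc)
qed (use assms in simp)

lemma conj_class_pow_one_iff:
  assumes x: "x \<in> carrier G" and y: "y \<in> conj_class x"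
  shows "y [^] (n::nat) = \<one> \<longleftrightarrow> x [^] n = \<one>"
proof -
  have "y [^] n = \<one>" if x: "x \<in> carrier G" and y: "y \<in> conj_class x" and "x [^] n = \<one>" for x y
    using that by (auto simp: conj_class_def conj_pow)
  then show ?thesis using x y conj_class_sym conj_class_subset by blast
qed

abbreviation words :: "nat \<Rightarrow> 'a set \<Rightarrow> 'a list set" where
  "words M A \<equiv> {hs. set hs \<subseteq> carrier G \<and> length hs = M \<and> lprod hs \<in> A}"

lemma finite_words: "finite (words M A)"
  by (rule finite_subset[OF _ finite_lists_length_eq[OF fin, of M]]) auto

text \<open>The left-hand side is the convolution of \<open>M + 1\<close> copies of \<open>\<chi>\<close>, evaluated at \<open>g\<close>.\<close>

lemma convolution_power:
  assumes \<chi>: "\<chi> \<in> Irr G" and "g \<in> carrier G"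
  shows "(\<Sum>hs\<in>words (Suc M) {g}. prod_list (map \<chi> hs)) = (N / \<chi> \<one>) ^ M * \<chi> g"
  using assms(2)
proof (induction M arbitrary: g)
  case 0
  then have "words (Suc 0) {g} = {[g]}" by (auto simp: length_Suc_conv)
  then show ?case by simp
next
  case (Suc M)
  let ?D = "Sigma (carrier G) (\<lambda>h. words (Suc M) {inv h \<otimes> g})"
  have eq: "words (Suc (Suc M)) {g} = (\<lambda>(h, hs). h # hs) ` ?D"
  proof (intro equalityI subsetI)
    fix hs' assume "hs' \<in> words (Suc (Suc M)) {g}"
    then obtain h hs where hs: "hs' = h # hs" "h \<in> carrier G" "set hs \<subseteq> carrier G" "length hs = Suc M" "h \<otimes> lprod hs = g"
      by (cases hs') auto
    then have "lprod hs = inv h \<otimes> g" by auto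
    then have "(h, hs) \<in> ?D" using hs by simp
    then show "hs' \<in> (\<lambda>(h, hs). h # hs) ` ?D" using hs(1) by (intro image_eqI[of _ _ "(h, hs)"]) auto
  next
    fix hs' assume "hs' \<in> (\<lambda>(h, hs). h # hs) ` ?D"
    then show "hs' \<in> words (Suc (Suc M)) {g}" using Suc.prems by auto
  qed
  have finw: "finite (words (Suc M) {y})" for y by (rule finite_words)
  have inj: "inj_on (\<lambda>(h, hs). h # hs) ?D" by (auto simp: inj_on_def)
  have "(\<Sum>hs\<in>words (Suc (Suc M)) {g}. prod_list (map \<chi> hs)) = (\<Sum>x\<in>?D. prod_list (map \<chi> ((\<lambda>(h, hs). h # hs) x)))"
    unfolding eq by (simp only: sum.reindex[OF inj] o_def)
  also have "\<dots> = (\<Sum>x\<in>?D. case x of (h, hs) \<Rightarrow> \<chi> h * prod_list (map \<chi> hs))"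
    by (intro sum.cong) auto
  also have "\<dots> = (\<Sum>h\<in>carrier G. \<Sum>hs\<in>words (Suc M) {inv h \<otimes> g}. \<chi> h * prod_list (map \<chi> hs))"
    using finw by (subst sum.Sigma) auto
  also have "\<dots> = (\<Sum>h\<in>carrier G. (N / \<chi> \<one>) ^ M * (\<chi> (g \<otimes> inv h) * \<chi> h))"
  proof (rule sum.cong[OF refl])
    fix h assume h: "h \<in> carrier G"
    have "(\<Sum>hs\<in>words (Suc M) {inv h \<otimes> g}. \<chi> h * prod_list (map \<chi> hs)) = \<chi> h * ((N / \<chi> \<one>) ^ M * \<chi> (inv h \<otimes> g))"
      unfolding sum_distrib_left[symmetric] using Suc.IH[of "inv h \<otimes> g"] Suc.prems h by simp
    also have "\<chi> (inv h \<otimes> g) = \<chi> (g \<otimes> inv h)" using Irr_comm[OF \<chi>] h Suc.prems by simp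
    finally show "(\<Sum>hs\<in>words (Suc M) {inv h \<otimes> g}. \<chi> h * prod_list (map \<chi> hs)) = (N / \<chi> \<one>) ^ M * (\<chi> (g \<otimes> inv h) * \<chi> h)"
      by simp
  qed
  also have "\<dots> = (N / \<chi> \<one>) ^ Suc M * \<chi> g"
    using Irr_convolution[OF \<chi> \<chi> Suc.prems] by (simp flip: sum_distrib_left)
  finally show ?case .
qed

text \<open>Let \<open>a = |G| / \<chi>(1)\<close> be prime to \<open>p\<close>. Summing the \<open>p^k\<close>-fold convolution of \<open>\<chi>\<close> over the
  class of \<open>x\<close> gives \<open>a^(p^k - 1) |C| \<chi>(x)\<close>, where \<open>C\<close> is the class. The sum runs over words of
  length \<open>p^k\<close> with product in \<open>C\<close>, on which cyclic rotation acts. A word fixed by rotation through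
  \<open>p^j\<close> places has as its product a \<open>p^(k-j)\<close>-th power, which cannot have order \<open>p\<close> when
  \<open>k - j\<close> is large. So all orbits have lengths divisible by \<open>p^(j+1)\<close>. Since \<open>a\<close> is prime to \<open>p\<close>,
  the number \<open>|C| \<chi>(x)\<close> is divisible by every power of \<open>p\<close>, hence zero.\<close>

lemma defect_zero_vanish:
  assumes \<chi>: "\<chi> \<in> Irr G" and p: "Factorial_Ring.prime p" and a: "N / \<chi> \<one> = of_nat a" "\<not> p dvd a"
    and x: "x \<in> carrier G" "x \<noteq> \<one>" "x [^] p = \<one>"
  shows "\<chi> x = 0"
proof -
  define n where "n = card (carrier G)"
  define \<gamma> where "\<gamma> = of_nat (card (conj_class x)) * \<chi> x"
  have n: "n > 0" unfolding n_def by (rule card_pos)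
  have p1: "p > 1" using p by (rule prime_gt_1_nat)
  have \<gamma>: "\<gamma> \<in> cyc n" unfolding \<gamma>_def n_def using Irr_cyc[OF \<chi> x(1)] by (intro cyc_mult cyc_of_nat)
  \<comment> \<open>Here \<open>k = j + n\<close> with \<open>n = |G|\<close>. An element of \<open>p\<close>-power order has order less than \<open>p^n\<close>, so the
    only \<open>p^n\<close>-th power of \<open>p\<close>-power order is \<open>\<one>\<close>.\<close>
  have fixed: "rotate (p ^ j) hs \<noteq> hs" if hs: "hs \<in> words (p ^ (j + n)) (conj_class x)" for j hs
  proof
    assume rot: "rotate (p ^ j) hs = hs"
    have len: "length hs = p ^ (j + n)" and hc: "set hs \<subseteq> carrier G" and hx: "lprod hs \<in> conj_class x" using hs by auto
    define us where "us = take (p ^ j) hs"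
    define vs where "vs = drop (p ^ j) hs"
    have lt: "p ^ j < p ^ (j + n)" using p1 n by (intro power_strict_increasing) auto
    have uv: "us @ vs = hs" by (simp add: us_def vs_def)
    have "vs @ us = hs" using rot lt len by (simp add: rotate_drop_take us_def vs_def)
    moreover have lu: "length us = p ^ j" using lt len by (simp add: us_def)
    moreover have "length vs = length us * (p ^ n - 1)"
      unfolding lu using len by (simp add: vs_def power_add diff_mult_distrib2)
    moreover have uc: "set us \<subseteq> carrier G" "set vs \<subseteq> carrier G"
      using hc by (auto simp: us_def vs_def dest: in_set_takeD in_set_dropD)
    ultimately have "lprod vs = lprod us [^] (p ^ n - 1)" using uv by (intro lprod_commuting_list) auto
    define y where "y = lprod us"
    have y: "y \<in> carrier G" using uc by (simp add: y_def)
    have "lprod hs = y \<otimes> y [^] (p ^ n - 1)"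
      using uc \<open>lprod vs = _\<close> by (simp add: uv[symmetric] lprod_append y_def)
    also have "\<dots> = y [^] Suc (p ^ n - 1)" using y by (simp only: nat_pow_Suc2)
    also have "Suc (p ^ n - 1) = p ^ n" using p1 by simp
    finally have hy: "lprod hs = y [^] (p ^ n)" .
    have "(lprod hs) [^] p = \<one>" using conj_class_pow_one_iff[OF x(1) hx] x(3) by simp
    then have "y [^] (p ^ Suc n) = \<one>" using y by (simp add: hy nat_pow_pow mult.commute)
    then have "ord y dvd p ^ Suc n" using y by (simp add: pow_eq_id)
    then obtain i where i: "ord y = p ^ i" using divides_primepow_nat[OF p] by blast
    have "ord y dvd n" using ord_dvd_group_order[OF y] by (simp add: n_def Coset.order_def)
    then have "p ^ i \<le> n" using i n by (simp add: dvd_imp_le)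
    also have "n < p ^ n" using p1 power_gt_expt[of p n] by simp
    finally have "i < n" by (rule power_less_imp_less_exp[OF p1])
    then have "ord y dvd p ^ n" unfolding i by (intro le_imp_power_dvd) simp
    then have "y [^] (p ^ n) = \<one>" using y by (simp add: pow_eq_id)
    then have "lprod hs = \<one>" by (simp add: hy)
    moreover have "(lprod hs) [^] (1::nat) \<noteq> \<one>" using conj_class_pow_one_iff[OF x(1) hx, of 1] x by simp
    ultimately show False by simp
  qed
  have "\<exists>r\<in>cyc n. \<gamma> = of_nat p ^ j * r" for j
  proof -
    define k where "k = j + n"
    let ?S = "words (p ^ k) (conj_class x)"
    let ?w = "\<lambda>hs. prod_list (map \<chi> hs)"
    have "\<exists>y\<in>cyc n. sum ?w ?S = of_nat (p ^ Suc j) * y"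
    proof (rule orbit_sum_divisible[where r = rotate1 and k = k])
      show "finite ?S" by (rule finite_words)
      fix hs assume hs: "hs \<in> ?S"
      show "rotate1 hs \<in> ?S"
      proof (cases hs)
        case (Cons h t)
        then have h: "h \<in> carrier G" "set t \<subseteq> carrier G" using hs by auto
        have "lprod (rotate1 hs) = inv h \<otimes> lprod hs \<otimes> inv (inv h)"
          using h by (simp add: Cons lprod_append)
        then have "lprod (rotate1 hs) \<in> conj_class (lprod hs)"
          using h unfolding conj_class_def by blast
        then show ?thesis using hs conj_class_trans[OF x(1)] by auto
      qed (use hs in simp)
      show "(rotate1 ^^ (p ^ k)) hs = hs" using hs unfolding rotate_def[symmetric] by (simp add: rotate_id)
      show "(rotate1 ^^ (p ^ j)) hs \<noteq> hs" using fixed[of hs j] hs unfolding rotate_def[symmetric] k_def by blast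
      show "?w (rotate1 hs) = ?w hs" by (cases hs) auto
      show "?w hs \<in> cyc n" using hs Irr_cyc[OF \<chi>] unfolding n_def by (intro cyc_prod_list) auto
    qed (rule p)
    then obtain y where y: "y \<in> cyc n" "sum ?w ?S = of_nat (p ^ Suc j) * y" by blast
    define M where "M = p ^ k - 1"
    have M: "p ^ k = Suc M" using p1 by (simp add: M_def)
    have "?S = (\<Union>g\<in>conj_class x. words (Suc M) {g})" using M by auto
    then have "sum ?w ?S = (\<Sum>g\<in>conj_class x. sum ?w (words (Suc M) {g}))"
      using finite_words[of "Suc M" "{_}"] fin by (simp only:) (intro sum.UNION_disjoint; auto simp: conj_class_def)
    also have "\<dots> = (\<Sum>g\<in>conj_class x. of_nat a ^ M * \<chi> x)"
    proof (rule sum.cong[OF refl])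
      fix g assume "g \<in> conj_class x"
      then have g: "g \<in> carrier G" "\<chi> g = \<chi> x" using x Irr_conj[OF \<chi> x(1)] by (auto simp: conj_class_def)
      show "sum ?w (words (Suc M) {g}) = of_nat a ^ M * \<chi> x"
        using convolution_power[OF \<chi> g(1), of M] by (simp add: g(2) a(1))
    qed
    also have "\<dots> = of_nat (a ^ M) * \<gamma>" by (simp add: \<gamma>_def)
    finally have e: "of_nat (a ^ M) * \<gamma> = of_nat (p ^ Suc j) * y" using y(2) by simp
    have "Rings.coprime (a ^ M) (p ^ Suc j)"
      using prime_imp_coprime[OF p a(2)] by (simp add: coprime_commute)
    then have "gcd (int (a ^ M)) (int (p ^ Suc j)) = 1" by (simp only: gcd_int_int_eq coprime_iff_gcd_eq_1 of_nat_1)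
    then obtain u v where uv: "u * int (a ^ M) + v * int (p ^ Suc j) = 1" using bezout_int by metis
    have "\<gamma> = of_int (u * int (a ^ M) + v * int (p ^ Suc j)) * \<gamma>" by (simp only: uv) simp
    also have "\<dots> = of_int u * (of_nat (a ^ M) * \<gamma>) + of_int v * of_nat (p ^ Suc j) * \<gamma>"
      by (simp add: algebra_simps)
    also have "\<dots> = of_nat p ^ j * (of_nat p * (of_int u * y + of_int v * \<gamma>))"
      unfolding e by (simp add: algebra_simps)
    finally show ?thesis
      using y(1) \<gamma> by (intro bexI[of _ "of_nat p * (of_int u * y + of_int v * \<gamma>)"])
        (auto intro!: cyc_mult cyc_add cyc_of_nat cyc_of_int)
  qed
  then have "\<gamma> = 0" using cyc_infinitely_divisible[OF \<gamma> n p1] by blast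
  moreover have "card (conj_class x) > 0" using conj_class_self[OF x(1)] by (auto simp: card_gt_0_iff conj_class_def)
  ultimately show ?thesis by (auto simp: \<gamma>_def)
qed

subsection \<open>Passing to the quotient by the kernel\<close>

text \<open>Schur orthogonality recovers \<open>\<rho>(g)\<close> from the translate \<open>h \<mapsto> \<chi>(gh)\<close>, which for \<open>g\<close> in the kernel
  is \<open>\<chi>\<close> itself.\<close>

lemma kernel_rep:
  assumes ir: "irreducible_representation G n \<rho>" and k: "k \<in> character_kernel G (character_of G \<rho>)"
  shows "\<rho> k = 1\<^sub>m n"
proof -
  define \<chi> where "\<chi> = character_of G \<rho>"
  have \<chi>: "\<chi> \<in> Irr G" using ir by (auto simp: \<chi>_def Irr_def)
  note r = irr_rep[OF ir] and n = irr_pos[OF ir]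
  have kc: "k \<in> carrier G" using k kernel_subset by blast
  have e: "(\<Sum>h\<in>carrier G. \<chi> (g \<otimes> h) * \<rho> (inv h) $$ (i, j)) = \<rho> g $$ (i, j) * (N / of_nat n)"
    if g: "g \<in> carrier G" and ij: "i < n" "j < n" for g i j
  proof -
    have "(\<Sum>h\<in>carrier G. \<chi> (g \<otimes> h) * \<rho> (inv h) $$ (i, j)) =
        (\<Sum>h\<in>carrier G. \<Sum>a<n. \<Sum>b<n. \<rho> g $$ (a, b) * (\<rho> (inv h) $$ (i, j) * \<rho> h $$ (b, a)))"
    proof (rule sum.cong[OF refl])
      fix h assume h: "h \<in> carrier G"
      have "\<chi> (g \<otimes> h) = (\<Sum>a<n. \<Sum>b<n. \<rho> g $$ (a, b) * \<rho> h $$ (b, a))"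
        using g h by (simp add: \<chi>_def character_of_def rep_mult[OF r] mat_trace_mult[OF rep_closed[OF r g] rep_closed[OF r h]])
      then show "\<chi> (g \<otimes> h) * \<rho> (inv h) $$ (i, j) = (\<Sum>a<n. \<Sum>b<n. \<rho> g $$ (a, b) * (\<rho> (inv h) $$ (i, j) * \<rho> h $$ (b, a)))"
        by (simp only: sum_distrib_right) (intro sum.cong refl, simp)
    qed
    also have "\<dots> = (\<Sum>a<n. \<Sum>b<n. \<rho> g $$ (a, b) * (\<Sum>h\<in>carrier G. \<rho> (inv h) $$ (i, j) * \<rho> h $$ (b, a)))"
      by (simp only: sum.swap[of _ _ "carrier G"] sum_distrib_left)
    also have "\<dots> = (\<Sum>a<n. \<Sum>b<n. if b = j then if a = i then \<rho> g $$ (a, b) * (N / of_nat n) else 0 else 0)"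
      using ij by (intro sum.cong refl) (auto simp: schur_orthogonality_same[OF ir])
    also have "\<dots> = (\<Sum>a<n. if a = i then \<rho> g $$ (a, j) * (N / of_nat n) else 0)"
      using ij by (intro sum.cong refl) auto
    also have "\<dots> = \<rho> g $$ (i, j) * (N / of_nat n)" using ij by simp
    finally show ?thesis .
  qed
  show ?thesis
  proof (rule eq_matI)
    fix i j assume "i < dim_row (1\<^sub>m n)" "j < dim_col (1\<^sub>m n)"
    then have ij: "i < n" "j < n" by auto
    have "\<rho> k $$ (i, j) * (N / of_nat n) = \<rho> \<one> $$ (i, j) * (N / of_nat n)"
      unfolding e[OF kc ij, symmetric] e[OF one_closed ij, symmetric]
      using kernel_translate[OF \<chi>] k by (intro sum.cong refl) (auto simp: \<chi>_def)
    then show "\<rho> k $$ (i, j) = 1\<^sub>m n $$ (i, j)" using n card_pos by (simp add: rep_one[OF r])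
  qed (use rep_closed[OF r kc] in auto)
qed

lemma quotient_character:
  assumes \<chi>: "\<chi> \<in> Irr G"
  defines "K \<equiv> character_kernel G \<chi>"
  shows "\<exists>\<chi>'\<in>Irr (G Mod K). \<forall>g\<in>carrier G. \<chi>' (K #> g) = \<chi> g"
proof -
  interpret K: normal K G unfolding K_def by (rule kernel_normal[OF \<chi>])
  obtain n \<rho> where c: "\<And>g. g \<in> carrier G \<Longrightarrow> \<chi> g = mat_trace (\<rho> g)" and r: "representation G n \<rho>"
    and ir: "irreducible_representation G n \<rho>" and ch: "\<chi> = character_of G \<rho>"
    by (rule IrrE[OF \<chi>]) blast
  have gM: "group (G Mod K)" by (rule K.factorgroup_is_group)
  define \<sigma> where "\<sigma> C = \<rho> (SOME g. g \<in> C)" for C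
  have cong: "\<rho> g = \<rho> h" if "h \<in> carrier G" "g \<in> K #> h" for g h
  proof -
    note gh = that
    obtain k where k: "k \<in> K" "g = k \<otimes> h" using gh(2) unfolding r_coset_def by auto
    then have "\<rho> k = 1\<^sub>m n" using kernel_rep[OF ir, of k] by (simp add: K_def ch)
    then show ?thesis using k gh rep_mult[OF r] rep_closed[OF r gh(1)] K.subset by auto
  qed
  have \<sigma>: "\<sigma> (K #> h) = \<rho> h" if h: "h \<in> carrier G" for h
  proof -
    have "(SOME g. g \<in> K #> h) \<in> K #> h"
      using rcos_self[OF h K.subgroup_axioms] by (rule someI[where P = "\<lambda>g. g \<in> K #> h"])
    then show ?thesis unfolding \<sigma>_def using cong[OF h] by blast
  qed
  have carr: "carrier (G Mod K) = (\<lambda>h. K #> h) ` carrier G" by (auto simp: FactGroup_def RCOSETS_def)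
  have s: "representation (G Mod K) n \<sigma>"
    unfolding representation_iff[OF gM]
  proof (intro conjI ballI)
    have "\<one>\<^bsub>G Mod K\<^esub> = K #> \<one>" using K.subset by (simp add: FactGroup_def coset_mult_one)
    then show "\<sigma> \<one>\<^bsub>G Mod K\<^esub> = 1\<^sub>m n" using \<sigma>[OF one_closed] rep_one[OF r] by simp
    fix C assume C: "C \<in> carrier (G Mod K)"
    then show "\<sigma> C \<in> carrier_mat n n" using rep_closed[OF r] by (auto simp: carr \<sigma>)
    fix D assume D: "D \<in> carrier (G Mod K)"
    obtain g h where gh: "g \<in> carrier G" "h \<in> carrier G" "C = K #> g" "D = K #> h" using C D by (auto simp: carr)
    then have "C \<otimes>\<^bsub>G Mod K\<^esub> D = K #> (g \<otimes> h)" by (simp add: FactGroup_def K.rcos_sum)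
    then show "\<sigma> (C \<otimes>\<^bsub>G Mod K\<^esub> D) = \<sigma> C * \<sigma> D" using gh rep_mult[OF r] by (simp add: \<sigma>)
  qed
  have "irreducible_representation (G Mod K) n \<sigma>"
    unfolding irreducible_representation_def
  proof (intro conjI allI impI)
    fix W assume W: "subspace class_ring W (module_vec TYPE(complex) n)" and inv: "\<forall>g\<in>carrier (G Mod K). \<forall>w\<in>W. \<sigma> g *\<^sub>v w \<in> W"
    have "\<forall>g\<in>carrier G. \<forall>w\<in>W. \<rho> g *\<^sub>v w \<in> W" using inv unfolding carr by (auto simp: \<sigma>)
    then show "W = {0\<^sub>v n} \<or> W = carrier_vec n" using ir W by (auto simp: irreducible_representation_def)
  qed (use s irr_pos[OF ir] in auto)
  then have "character_of (G Mod K) \<sigma> \<in> Irr (G Mod K)" unfolding Irr_def by blast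
  moreover have "character_of (G Mod K) \<sigma> (K #> g) = \<chi> g" if "g \<in> carrier G" for g
    using that by (auto simp: character_of_def carr \<sigma> c)
  ultimately show ?thesis by blast
qed

lemma fin_group_Mod: "K \<lhd> G \<Longrightarrow> fin_group (G Mod K)"
  by (intro fin_groupI normal.factorgroup_is_group) (auto simp: FactGroup_def RCOSETS_def)

lemma card_Mod: "K \<lhd> G \<Longrightarrow> card (carrier (G Mod K)) * card K = card (carrier G)"
  using lagrange[OF normal_imp_subgroup] by (simp add: FactGroup_def Coset.order_def)

lemma hom_Mod:
  assumes "K \<lhd> G"
  shows "(\<lambda>g. K #> g) \<in> hom G (G Mod K)" "(\<lambda>g. K #> g) ` carrier G = carrier (G Mod K)"
  using normal.r_coset_hom_Mod[OF assms] by (auto simp: FactGroup_def RCOSETS_def)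

text \<open>As a character of \<open>G / ker \<chi>\<close>, the character \<open>\<chi>\<close> has \<open>|G / ker \<chi>| / \<chi>(1)\<close> equal to its
  codegree, so it has defect zero there.\<close>

lemma vanish_outside_kernel:
  assumes \<chi>: "\<chi> \<in> Irr G" and p: "Factorial_Ring.prime p" and a: "\<not> p dvd codegree G \<chi>"
    and x: "x \<in> carrier G" "x [^] p = \<one>" "\<chi> x \<noteq> \<chi> \<one>"
  shows "\<chi> x = 0"
proof -
  define K where "K = character_kernel G \<chi>"
  have K: "K \<lhd> G" unfolding K_def by (rule kernel_normal[OF \<chi>])
  interpret K: normal K G by fact
  interpret M: fin_group "G Mod K" by (rule fin_group_Mod[OF K])
  interpret h: group_hom G "G Mod K" "\<lambda>g. K #> g" using hom_Mod(1)[OF K] by unfold_locales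
  obtain \<chi>' where \<chi>': "\<chi>' \<in> Irr (G Mod K)" "\<And>g. g \<in> carrier G \<Longrightarrow> \<chi>' (K #> g) = \<chi> g"
    using quotient_character[OF \<chi>] unfolding K_def by blast
  have 1: "K #> \<one> = \<one>\<^bsub>G Mod K\<^esub>" by (rule h.hom_one)
  have "\<chi>' (K #> x) = 0"
  proof (rule M.defect_zero_vanish[OF \<chi>'(1) p _ a])
    have "codegree G \<chi> * deg \<chi> * card K = card (carrier (G Mod K)) * card K"
      using codegree[OF \<chi>] card_Mod[OF K] by (simp add: K_def)
    then have "card (carrier (G Mod K)) = codegree G \<chi> * deg \<chi>"
      using card_kernel_pos[OF \<chi>] by (simp add: K_def)
    then show "M.N / \<chi>' \<one>\<^bsub>G Mod K\<^esub> = of_nat (codegree G \<chi>)"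
      using \<chi>'(2)[OF one_closed] deg[OF \<chi>] deg_pos[OF \<chi>] by (simp add: 1)
    show "K #> x \<in> carrier (G Mod K)" using x by simp
    show "(K #> x) [^]\<^bsub>G Mod K\<^esub> p = \<one>\<^bsub>G Mod K\<^esub>" using x h.hom_nat_pow[of x p] by (simp add: 1)
    show "K #> x \<noteq> \<one>\<^bsub>G Mod K\<^esub>" using x \<chi>'(2)[OF x(1)] \<chi>'(2)[OF one_closed] 1 by auto
  qed
  then show ?thesis using \<chi>'(2)[OF x(1)] by simp
qed

end

section \<open>Triangle-free groups have linear characters of order two or three\<close>

lemma roots_of_unity_coprime:
  fixes z :: complex
  assumes "z ^ a = 1" "z ^ b = 1" "gcd a b = 1"
  shows "z = 1"
proof (cases "z = 0")
  case True
  then show ?thesis using assms by (cases "a = 0") (auto simp: power_0_left)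
next
  case False
  obtain u v where uv: "u * int a + v * int b = 1"
    using bezout_int[of "int a" "int b"] assms(3) by (metis gcd_int_int_eq of_nat_1)
  have "z = z powi (int a * u + int b * v)" using uv by (simp add: mult.commute)
  also have "\<dots> = (z powi int a) powi u * (z powi int b) powi v"
    using False by (simp only: power_int_add power_int_mult simp_thms)
  finally show ?thesis using assms(1,2) by simp
qed

context fin_group
begin

lemma exists_prime_order_element:
  assumes p: "Factorial_Ring.prime p" and d: "p dvd card (carrier G)"
  shows "\<exists>x\<in>carrier G. x \<noteq> \<one> \<and> x [^] p = \<one>"
proof -
  obtain m where "card (carrier G) = p * m" using d by (elim dvdE)
  then have "Coset.order G = p ^ 1 * m" by (simp add: Coset.order_def)
  from sylow_thm[OF p group_axioms this fin] obtain H where H: "subgroup H G" "card H = p" by auto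
  interpret H: subgroup H G by fact
  have "p > 1" using p by (rule prime_gt_1_nat)
  then have "H \<noteq> {\<one>}" using H(2) by auto
  then obtain x where x: "x \<in> H" "x \<noteq> \<one>" using H.one_closed by blast
  interpret HG: group "G\<lparr>carrier := H\<rparr>" by (rule subgroup_imp_group[OF H(1)])
  have "x [^]\<^bsub>G\<lparr>carrier := H\<rparr>\<^esub> p = \<one>"
    using HG.pow_order_eq_1[of x] x H(2) by (simp add: Coset.order_def)
  then have "x [^] p = \<one>" using nat_pow_consistent[of x p H] by simp
  then show ?thesis using x H.subset by blast
qed

lemma subgroup_pow_card:
  assumes H: "subgroup H G" and x: "x \<in> H"
  shows "x [^] card H = \<one>"
proof -
  interpret HG: group "G\<lparr>carrier := H\<rparr>" by (rule subgroup_imp_group[OF H])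
  have "x [^]\<^bsub>G\<lparr>carrier := H\<rparr>\<^esub> card H = \<one>"
    using HG.pow_order_eq_1[of x] x by (simp add: Coset.order_def)
  then show ?thesis using nat_pow_consistent[of x "card H" H] by simp
qed

lemma ord_prime:
  assumes "Factorial_Ring.prime p" "x \<in> carrier G" "x \<noteq> \<one>" "x [^] p = \<one>"
  shows "ord x = p"
  using assms by (metis ord_eq_1 pow_eq_id prime_nat_iff)

lemma column_sum_zero:
  assumes x: "x \<in> carrier G" "x \<noteq> \<one>"
  shows "(\<Sum>\<chi>\<in>Irr G - {principal_character G}. \<chi> \<one> * \<chi> x) = -1"
proof -
  have "0 = (\<Sum>\<chi>\<in>Irr G. \<chi> \<one> * \<chi> x)" using column_identity[OF x(1)] x(2) by simp
  also have "\<dots> = 1 + (\<Sum>\<chi>\<in>Irr G - {principal_character G}. \<chi> \<one> * \<chi> x)"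
    using x by (subst sum.remove[OF finite_Irr principal_Irr]) simp
  finally show ?thesis by (simp add: eq_neg_iff_add_eq_0 add.commute)
qed

lemma sum_involution_even:
  fixes f :: "'s \<Rightarrow> complex"
  assumes "finite S" "\<And>s. s \<in> S \<Longrightarrow> i s \<in> S" "\<And>s. s \<in> S \<Longrightarrow> i (i s) = s" "\<And>s. s \<in> S \<Longrightarrow> i s \<noteq> s"
    "\<And>s. s \<in> S \<Longrightarrow> f (i s) = f s"
  shows "\<exists>T\<subseteq>S. sum f S = 2 * sum f T"
  using assms
proof (induction "card S" arbitrary: S rule: less_induct)
  case less
  show ?case
  proof (cases "S = {}")
    case False
    then obtain s where s: "s \<in> S" by blast
    let ?S' = "S - {s, i s}"
    have "\<exists>T\<subseteq>?S'. sum f ?S' = 2 * sum f T"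
    proof (rule less.hyps)
      show "card ?S' < card S" using s less.prems(1) by (intro psubset_card_mono) auto
      fix u assume u: "u \<in> ?S'"
      have "i u \<noteq> s" "i u \<noteq> i s" using u less.prems(3)[of u] less.prems(3)[OF s] by auto
      then show "i u \<in> ?S'" using u less.prems(2) by blast
    qed (use less.prems in auto)
    then obtain T where T: "T \<subseteq> ?S'" "sum f ?S' = 2 * sum f T" by blast
    have fT: "finite T" using T(1) less.prems(1) by (meson finite_Diff finite_subset)
    have "sum f S = sum f ?S' + sum f {s, i s}"
      using s less.prems(1,2) by (intro sum.subset_diff) auto
    also have "sum f {s, i s} = 2 * f s" using less.prems(4,5)[OF s] by simp
    also have "sum f ?S' + 2 * f s = 2 * sum f (insert s T)"
      using T fT by (subst sum.insert) auto
    finally show ?thesis using T s by (intro exI[of _ "insert s T"]) auto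
  qed auto
qed

text \<open>In a group of odd order the inverses pair off the nonidentity elements, so for a real
  nonprincipal character the relation \<open>\<Sum>\<chi>(g) = 0\<close> would make the degree even.\<close>

lemma odd_order_real:
  assumes odd: "odd (card (carrier G))" and \<chi>: "\<chi> \<in> Irr G" and real: "conj_char \<chi> = \<chi>"
  shows "\<chi> = principal_character G"
proof (rule ccontr)
  assume "\<chi> \<noteq> principal_character G"
  then have "(\<Sum>g\<in>carrier G. \<chi> g) = 0" using Irr_sum_zero \<chi> by blast
  then have s: "\<chi> \<one> + (\<Sum>g\<in>carrier G - {\<one>}. \<chi> g) = 0"
    by (subst (asm) sum.remove[OF fin one_closed])
  have "\<exists>T\<subseteq>carrier G - {\<one>}. (\<Sum>g\<in>carrier G - {\<one>}. \<chi> g) = 2 * (\<Sum>g\<in>T. \<chi> g)"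
  proof (rule sum_involution_even[where i = "\<lambda>g. inv g"])
    fix g assume g: "g \<in> carrier G - {\<one>}"
    show "inv g \<in> carrier G - {\<one>}" using g by auto
    show "inv g \<noteq> g"
    proof
      assume "inv g = g"
      then have "g [^] (2::nat) = \<one>" using g by (metis Diff_iff numeral_2_eq_2 nat_pow_Suc nat_pow_0 l_one r_inv)
      then have "ord g dvd 2" using g by (simp add: pow_eq_id)
      moreover have "ord g dvd card (carrier G)" using ord_dvd_group_order[of g] g by (simp add: Coset.order_def)
      then have "odd (ord g)" using odd by (meson dvd_trans)
      ultimately have "ord g = 1" by (metis two_is_prime_nat prime_nat_iff even_numeral)
      then show False using g ord_eq_1[of g] by auto
    qed
    show "\<chi> (inv g) = \<chi> g" using g Irr_inverse[OF \<chi>] fun_cong[OF real, of g] by (simp add: conj_char_def)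
  qed auto
  then obtain T where T: "T \<subseteq> carrier G" "(\<Sum>g\<in>carrier G - {\<one>}. \<chi> g) = 2 * (\<Sum>g\<in>T. \<chi> g)" by blast
  have "(\<Sum>g\<in>T. \<chi> g) = - of_nat (deg \<chi>) / 2"
    using s T(2) deg[OF \<chi>] by (simp add: field_simps eq_neg_iff_add_eq_0)
  moreover have "(\<Sum>g\<in>T. \<chi> g) \<in> cyc (card (carrier G))"
    using T(1) Irr_cyc[OF \<chi>] by (intro cyc_sum) auto
  ultimately have "- of_nat (deg \<chi>) / 2 \<in> cyc (card (carrier G))" by simp
  moreover have "- of_nat (deg \<chi>) / 2 \<in> (\<rat> :: complex set)" by (intro Rats_divide Rats_minus_iff[THEN iffD2]) simp_all
  ultimately have "- of_nat (deg \<chi>) / 2 \<in> (\<int> :: complex set)" using cyc_rat_int[OF _ card_pos] by blast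
  then obtain k where "- of_nat (deg \<chi>) / 2 = (of_int k :: complex)" by (auto simp: Ints_def)
  then have "of_int (- int (deg \<chi>)) = (of_int (2 * k) :: complex)" by (simp add: field_simps)
  then have "- int (deg \<chi>) = 2 * k" by (simp only: of_int_eq_iff)
  then have "even (deg \<chi>)" by (metis dvd_minus_iff dvd_triv_left even_of_nat)
  then show False using odd deg_dvd[OF \<chi>] by (meson dvd_trans)
qed

text \<open>All other characters vanish at \<open>x\<close>, being faithful.\<close>

lemma chars_with_nonempty_sum:
  assumes faithful: "\<And>\<chi>. \<chi> \<in> Irr G \<Longrightarrow> \<chi> \<noteq> principal_character G \<Longrightarrow> character_kernel G \<chi> = {\<one>}"
    and p: "Factorial_Ring.prime p" and x: "x \<in> carrier G" "x \<noteq> \<one>" "x [^] p = \<one>"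
  shows "(\<Sum>\<chi>\<in>chars_with p. \<chi> \<one> * \<chi> x) = -1"
proof -
  have "(\<Sum>\<chi>\<in>Irr G - {principal_character G}. \<chi> \<one> * \<chi> x) = (\<Sum>\<chi>\<in>chars_with p. \<chi> \<one> * \<chi> x)"
  proof (rule sum.mono_neutral_right)
    show "\<forall>\<chi>\<in>Irr G - {principal_character G} - chars_with p. \<chi> \<one> * \<chi> x = 0"
    proof
      fix \<chi> assume c: "\<chi> \<in> Irr G - {principal_character G} - chars_with p"
      then have "\<chi> x \<noteq> \<chi> \<one>" using faithful[of \<chi>] x by (auto simp: character_kernel_def)
      then show "\<chi> \<one> * \<chi> x = 0" using c vanish_outside_kernel[OF _ p _ x(1,3)] by (auto simp: chars_with_def)
    qed
  qed (auto simp: chars_with_def)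
  then show ?thesis using column_sum_zero[OF x(1,2)] by simp
qed

lemma square_mod_4: "(d::int) * d mod 4 \<in> {0, 1}"
proof -
  have "d mod 4 \<in> {0, 1, 2, 3}" by auto
  moreover have "d * d mod 4 = (d mod 4) * (d mod 4) mod 4" by (simp add: mod_mult_eq)
  ultimately show ?thesis by auto
qed

text \<open>Suppose that all linear characters are trivial. If \<open>|G|\<close> is even and \<open>x\<close> is an
  involution, triviality of the determinants gives \<open>\<chi>(x) \<equiv> \<chi>(1)\<close> modulo 4, so the column relation
  makes \<open>-1\<close> a sum of at most two squares modulo 4. If \<open>|G|\<close> is odd and \<open>p\<close> divides it, the characters
  with codegree divisible by \<open>p\<close> are a conjugate pair, and the column relation makes their degree a
  unit, so they are linear.\<close>

lemma linear_character_faithful_case: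
  assumes tf: "triangle_free (codegree_graph G)" and nt: "carrier G \<noteq> {\<one>}"
    and faithful: "\<And>\<chi>. \<chi> \<in> Irr G \<Longrightarrow> \<chi> \<noteq> principal_character G \<Longrightarrow> character_kernel G \<chi> = {\<one>}"
  shows "\<exists>f. (\<forall>g\<in>carrier G. \<forall>h\<in>carrier G. f (g \<otimes> h) = f g * f h) \<and> f \<one> = (1::complex) \<and> (\<exists>g\<in>carrier G. f g \<noteq> 1)"
proof (rule ccontr)
  assume no: "\<not> ?thesis"
  have d2: "deg \<chi> \<noteq> 1" if "\<chi> \<in> Irr G" "\<chi> \<noteq> principal_character G" for \<chi>
  proof
    assume d: "deg \<chi> = 1"
    have "\<chi> \<one> = 1" using deg[OF that(1)] d by simp
    then have "\<forall>g\<in>carrier G. \<chi> g = 1" using no deg_one_mult[OF that(1) d] by blast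
    then show False using that Irr_ext[OF that(1) principal_Irr] by auto
  qed
  show False
  proof (cases "even (card (carrier G))")
    case True
    obtain x where x: "x \<in> carrier G" "x \<noteq> \<one>" "x [^] (2::nat) = \<one>"
      using exists_prime_order_element[OF two_is_prime_nat True] by blast
    have xx: "x \<otimes> x = \<one>" using x by (simp add: numeral_2_eq_2)
    define S where "S = chars_with 2"
    have SI: "S \<subseteq> Irr G" by (auto simp: S_def chars_with_def)
    have S2: "card S \<le> 2" unfolding S_def by (rule card_chars_with[OF tf two_is_prime_nat])
    have fS: "finite S" by (simp add: S_def)
    have triv: "f g = 1" if "\<And>g h. g \<in> carrier G \<Longrightarrow> h \<in> carrier G \<Longrightarrow> f (g \<otimes> h) = f g * (f h :: complex)"
      "f \<one> = 1" "g \<in> carrier G" for f g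
      using no that by blast
    have "\<exists>m. \<chi> x = of_int (int (deg \<chi>) - 4 * m)" if "\<chi> \<in> S" for \<chi>
    proof (rule involution_value(2)[OF _ x(1) xx])
      show "\<chi> \<in> Irr G" using that SI by blast
      fix f :: "'a \<Rightarrow> complex" and g
      assume "\<And>g h. g \<in> carrier G \<Longrightarrow> h \<in> carrier G \<Longrightarrow> f (g \<otimes> h) = f g * f h" "f \<one> = 1" "g \<in> carrier G"
      then show "f g = 1" by (rule triv)
    qed
    then obtain m where m: "\<And>\<chi>. \<chi> \<in> S \<Longrightarrow> \<chi> x = of_int (int (deg \<chi>) - 4 * m \<chi>)" by metis
    have "(\<Sum>\<chi>\<in>S. \<chi> \<one> * \<chi> x) = -1"
      unfolding S_def by (rule chars_with_nonempty_sum[OF faithful two_is_prime_nat x])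
    also have "(\<Sum>\<chi>\<in>S. \<chi> \<one> * \<chi> x) = of_int (\<Sum>\<chi>\<in>S. int (deg \<chi>) * (int (deg \<chi>) - 4 * m \<chi>))"
      unfolding of_int_sum using SI m deg by (intro sum.cong) (auto simp: subset_iff)
    finally have "(of_int (\<Sum>\<chi>\<in>S. int (deg \<chi>) * (int (deg \<chi>) - 4 * m \<chi>)) :: complex) = of_int (-1)" by simp
    then have "(\<Sum>\<chi>\<in>S. int (deg \<chi>) * (int (deg \<chi>) - 4 * m \<chi>)) = -1" by (simp only: of_int_eq_iff)
    then have e: "(\<Sum>\<chi>\<in>S. int (deg \<chi>) * int (deg \<chi>)) = 4 * (\<Sum>\<chi>\<in>S. int (deg \<chi>) * m \<chi>) - 1"
      by (simp add: right_diff_distrib sum_subtractf sum_distrib_left mult_ac)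
    have "(\<Sum>\<chi>\<in>S. int (deg \<chi>) * int (deg \<chi>)) mod 4 \<in> {0, 1, 2}"
    proof -
      consider "S = {}" | a where "S = {a}" | a b where "S = {a, b}" "a \<noteq> b"
      proof -
        have "card S = 0 \<or> card S = 1 \<or> card S = 2" using S2 by auto
        then show thesis using that fS by (metis card_0_eq card_1_singletonE card_2_iff)
      qed
      then show ?thesis
      proof cases
        case 3
        have "(\<Sum>\<chi>\<in>S. int (deg \<chi>) * int (deg \<chi>)) mod 4 = (int (deg a) * int (deg a) mod 4 + int (deg b) * int (deg b) mod 4) mod 4"
          using 3 by (simp add: mod_add_eq)
        then show ?thesis using square_mod_4[of "int (deg a)"] square_mod_4[of "int (deg b)"] by auto
      qed (use square_mod_4 in auto)
    qed
    moreover have "(4 * t - 1) mod 4 = 3" for t :: int by presburger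
    ultimately show False unfolding e by simp
  next
    case odd: False
    have "card (carrier G) \<noteq> 1" using nt one_closed by (metis card_1_singletonE singletonD)
    then obtain p where p: "Factorial_Ring.prime p" "p dvd card (carrier G)" using prime_factor_nat by blast
    obtain x where x: "x \<in> carrier G" "x \<noteq> \<one>" "x [^] p = \<one>"
      using exists_prime_order_element[OF p] by blast
    define S where "S = chars_with p"
    have sS: "(\<Sum>\<chi>\<in>S. \<chi> \<one> * \<chi> x) = -1"
      unfolding S_def by (rule chars_with_nonempty_sum[OF faithful p(1) x])
    then have "S \<noteq> {}" by auto
    then obtain \<chi> where \<chi>S: "\<chi> \<in> S" by blast
    then have \<chi>: "\<chi> \<in> Irr G" "\<chi> \<noteq> principal_character G" by (auto simp: S_def chars_with_def)
    have cS: "conj_char \<chi> \<in> S"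
      using \<chi>S conj_char_Irr[OF \<chi>(1)] conj_char_facts[OF \<chi>(1)] by (auto simp: S_def chars_with_def)
    have ne: "conj_char \<chi> \<noteq> \<chi>" using odd_order_real[OF odd \<chi>(1)] \<chi>(2) by blast
    have "S = {\<chi>, conj_char \<chi>}"
      using card_chars_with[OF tf p(1)] \<chi>S cS ne card_seteq[of S "{\<chi>, conj_char \<chi>}"] by (simp add: S_def)
    then have "(\<Sum>\<chi>\<in>S. \<chi> \<one> * \<chi> x) = of_nat (deg \<chi>) * (\<chi> x + cnj (\<chi> x))"
      using ne x deg[OF \<chi>(1)] by (simp add: conj_char_def distrib_left)
    then have e: "of_nat (deg \<chi>) * (\<chi> x + cnj (\<chi> x)) = -1" using sS by simp
    then have "\<chi> x + cnj (\<chi> x) = -1 / of_nat (deg \<chi>)" using deg_pos[OF \<chi>(1)] by (simp add: field_simps)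
    then have rat: "\<chi> x + cnj (\<chi> x) \<in> \<rat>" by simp
    have "\<chi> x + cnj (\<chi> x) \<in> cyc (card (carrier G))"
      using Irr_cyc[OF \<chi>(1) x(1)] Irr_cyc[OF \<chi>(1), of "inv x"] x Irr_inverse[OF \<chi>(1) x(1)] by (intro cyc_add) auto
    then obtain k where "\<chi> x + cnj (\<chi> x) = of_int k"
      using cyc_rat_int[OF _ card_pos rat] by (auto simp: Ints_def)
    then have "(of_int (int (deg \<chi>) * k) :: complex) = of_int (-1)" using e by simp
    then have "int (deg \<chi>) * k = -1" by (simp only: of_int_eq_iff)
    then have "deg \<chi> = 1" by (simp add: zmult_eq_neg1_iff)
    then show False using d2[OF \<chi>] by simp
  qed
qed

text \<open>Dividing out a maximal kernel of a nonprincipal character leads to the faithful case.\<close>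

lemma exists_linear_character:
  assumes tf: "triangle_free (codegree_graph G)" and nt: "carrier G \<noteq> {\<one>}"
  shows "\<exists>f. (\<forall>g\<in>carrier G. \<forall>h\<in>carrier G. f (g \<otimes> h) = f g * f h) \<and> f \<one> = (1::complex) \<and> (\<exists>g\<in>carrier G. f g \<noteq> 1)"
proof -
  have card1: "card (carrier G) > 1"
    using nt card_pos one_closed by (metis One_nat_def card_1_singletonE less_one linorder_neqE_nat singletonD not_less_zero)
  have "\<exists>\<chi>. \<chi> \<in> Irr G \<and> \<chi> \<noteq> principal_character G"
  proof (rule ccontr)
    assume "\<not> ?thesis"
    then have "Irr G = {principal_character G}" using principal_Irr by blast
    then show False using sum_deg_squares card1 deg_principal by simp
  qed
  then have ne: "Irr G - {principal_character G} \<noteq> {}" by blast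
  let ?c = "\<lambda>\<chi>. card (character_kernel G \<chi>)"
  have "Max (?c ` (Irr G - {principal_character G})) \<in> ?c ` (Irr G - {principal_character G})"
    using ne by (intro Max_in) auto
  then obtain \<chi> where "\<chi> \<in> Irr G - {principal_character G}" and m: "?c \<chi> = Max (?c ` (Irr G - {principal_character G}))"
    by fastforce
  then have \<chi>: "\<chi> \<in> Irr G" "\<chi> \<noteq> principal_character G" by auto
  have max: "?c \<psi> \<le> ?c \<chi>" if "\<psi> \<in> Irr G" "\<psi> \<noteq> principal_character G" for \<psi>
    unfolding m using that by (intro Max_ge) auto
  define K where "K = character_kernel G \<chi>"
  have K: "K \<lhd> G" unfolding K_def by (rule kernel_normal[OF \<chi>(1)])
  interpret M: fin_group "G Mod K" by (rule fin_group_Mod[OF K])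
  note h = hom_Mod[OF K] and fg = fin_group_axioms M.fin_group_axioms
  interpret h: group_hom G "G Mod K" "\<lambda>g. K #> g" using h(1) by unfold_locales
  have cM: "card (carrier (G Mod K)) * card K = card (carrier G)" by (rule card_Mod[OF K])
  have cK: "card K > 0" unfolding K_def by (rule card_kernel_pos[OF \<chi>(1)])
  have "\<exists>f. (\<forall>g\<in>carrier (G Mod K). \<forall>h\<in>carrier (G Mod K). f (g \<otimes>\<^bsub>G Mod K\<^esub> h) = f g * f h) \<and> f \<one>\<^bsub>G Mod K\<^esub> = (1::complex) \<and> (\<exists>g\<in>carrier (G Mod K). f g \<noteq> 1)"
  proof (rule M.linear_character_faithful_case)
    show "triangle_free (codegree_graph (G Mod K))" by (rule triangle_free_image[OF fg h tf])
    show "carrier (G Mod K) \<noteq> {\<one>\<^bsub>G Mod K\<^esub>}"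
    proof
      assume "carrier (G Mod K) = {\<one>\<^bsub>G Mod K\<^esub>}"
      then have "card K = card (carrier G)" using cM by simp
      then have "K = carrier G" using kernel_subset by (metis K_def card_subset_eq fin)
      then have "codegree G \<chi> * deg \<chi> = 1" using codegree[OF \<chi>(1)] cK by (simp add: K_def)
      then show False using codegree_eq_1[OF \<chi>(1)] \<chi>(2) by simp
    qed
    fix \<psi> assume \<psi>: "\<psi> \<in> Irr (G Mod K)" "\<psi> \<noteq> principal_character (G Mod K)"
    let ?i = "inflate G (\<lambda>g. K #> g) \<psi>"
    note i = inflate_Irr[OF fg h \<psi>(1)]
    have "card (character_kernel G ?i) \<le> ?c \<chi>" using i \<psi> by (intro max) auto
    then have "card (character_kernel G ?i) \<le> card K" by (simp add: K_def)
    moreover have "card (character_kernel G ?i) * card (carrier (G Mod K)) = card (character_kernel (G Mod K) \<psi>) * card (carrier G)"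
    proof -
      have "character_kernel G ?i = {g \<in> carrier G. K #> g \<in> character_kernel (G Mod K) \<psi>}"
        using h.hom_one by (auto simp: character_kernel_def inflate_def)
      then show ?thesis using hom_fibre_card[OF group_axioms fin M.group_axioms h M.kernel_subset[of \<psi>]] by simp
    qed
    then have "card (character_kernel G ?i) * card (carrier (G Mod K)) = (card (character_kernel (G Mod K) \<psi>) * card K) * card (carrier (G Mod K))"
      unfolding cM[symmetric] by (simp only: mult_ac)
    then have "card (character_kernel G ?i) = card (character_kernel (G Mod K) \<psi>) * card K"
      using M.card_pos by (subst (asm) mult_right_cancel) auto
    ultimately have "card (character_kernel (G Mod K) \<psi>) \<le> 1" using cK by simp
    moreover have "\<one>\<^bsub>G Mod K\<^esub> \<in> character_kernel (G Mod K) \<psi>"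
      using M.one_closed unfolding character_kernel_def by blast
    moreover have "finite (character_kernel (G Mod K) \<psi>)" using M.kernel_subset M.fin by (rule finite_subset)
    ultimately have "\<forall>a\<in>character_kernel (G Mod K) \<psi>. a = \<one>\<^bsub>G Mod K\<^esub>"
      using card_le_Suc0_iff_eq[of "character_kernel (G Mod K) \<psi>"] unfolding One_nat_def by blast
    then show "character_kernel (G Mod K) \<psi> = {\<one>\<^bsub>G Mod K\<^esub>}"
      using \<open>\<one>\<^bsub>G Mod K\<^esub> \<in> character_kernel (G Mod K) \<psi>\<close> by blast
  qed
  then obtain f where f: "(\<forall>g\<in>carrier (G Mod K). \<forall>h\<in>carrier (G Mod K). f (g \<otimes>\<^bsub>G Mod K\<^esub> h) = f g * f h) \<and>
      f \<one>\<^bsub>G Mod K\<^esub> = (1::complex) \<and> (\<exists>g\<in>carrier (G Mod K). f g \<noteq> 1)" ..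
  show ?thesis
  proof (intro exI[of _ "\<lambda>g. f (K #> g)"] conjI ballI)
    show "f (K #> \<one>) = 1" using h.hom_one f by simp
    show "\<exists>g\<in>carrier G. f (K #> g) \<noteq> 1" proof -
      obtain C where C: "C \<in> carrier (G Mod K)" "f C \<noteq> 1" using f by blast
      then obtain g where "g \<in> carrier G" "C = K #> g" using h(2) by (metis imageE)
      then show ?thesis using C(2) by blast
    qed
    fix g g' assume g: "g \<in> carrier G" "g' \<in> carrier G"
    have "K #> (g \<otimes> g') = (K #> g) \<otimes>\<^bsub>G Mod K\<^esub> (K #> g')" using g by (rule h.hom_mult)
    then show "f (K #> (g \<otimes> g')) = f (K #> g) * f (K #> g')" using f g by simp
  qed
qed

text \<open>Only the values on the carrier are constrained, so that powers and pullbacks are again of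
  this kind; the irreducible character in question is the restriction of \<open>f\<close> to the carrier.\<close>

definition linear_of_exponent :: "nat \<Rightarrow> ('a \<Rightarrow> complex) \<Rightarrow> bool" where
  "linear_of_exponent q f \<longleftrightarrow> (\<forall>g\<in>carrier G. \<forall>h\<in>carrier G. f (g \<otimes> h) = f g * f h) \<and> f \<one> = 1 \<and>
     (\<exists>g\<in>carrier G. f g \<noteq> 1) \<and> (\<forall>g\<in>carrier G. f g ^ q = 1)"

lemma mult_pow:
  assumes "\<forall>g\<in>carrier G. \<forall>h\<in>carrier G. f (g \<otimes> h) = f g * (f h :: complex)" "f \<one> = 1" "g \<in> carrier G"
  shows "f (g [^] (n::nat)) = f g ^ n"
  using assms by (induction n) auto

text \<open>A linear character factors through \<open>G / ker \<chi>\<close>, whose order is its codegree.\<close>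

lemma linear_pow_codegree:
  assumes \<chi>: "\<chi> \<in> Irr G" and d: "deg \<chi> = 1" and g: "g \<in> carrier G"
  shows "\<chi> g ^ codegree G \<chi> = 1"
proof -
  define K where "K = character_kernel G \<chi>"
  have K: "K \<lhd> G" unfolding K_def by (rule kernel_normal[OF \<chi>])
  interpret K: normal K G by fact
  interpret M: fin_group "G Mod K" by (rule fin_group_Mod[OF K])
  interpret h: group_hom G "G Mod K" "\<lambda>g. K #> g" using hom_Mod(1)[OF K] by unfold_locales
  have one: "\<chi> \<one> = 1" using deg[OF \<chi>] d by simp
  have "codegree G \<chi> * card K = card (carrier (G Mod K)) * card K"
    using codegree[OF \<chi>] card_Mod[OF K] by (simp add: K_def d)
  then have a: "codegree G \<chi> = card (carrier (G Mod K))" using card_kernel_pos[OF \<chi>] by (simp add: K_def)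
  have "(K #> g) [^]\<^bsub>G Mod K\<^esub> codegree G \<chi> = \<one>\<^bsub>G Mod K\<^esub>"
    unfolding a using g by (intro M.pow_card_eq_one) simp
  moreover have "\<one>\<^bsub>G Mod K\<^esub> = K" by (simp add: FactGroup_def)
  ultimately have "K #> (g [^] codegree G \<chi>) = K" using h.hom_nat_pow[OF g, of "codegree G \<chi>"] by simp
  then have "g [^] codegree G \<chi> \<in> K" using g rcos_self[OF _ K.subgroup_axioms, of "g [^] codegree G \<chi>"] by simp
  then have 1: "\<chi> (g [^] codegree G \<chi>) = \<chi> \<one>" unfolding K_def character_kernel_def by blast
  have "\<chi> (g [^] codegree G \<chi>) = \<chi> g ^ codegree G \<chi>"
    by (rule mult_pow) (use deg_one_mult[OF \<chi> d] one g in auto)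
  then show ?thesis using 1 one by simp
qed

lemma linear_of_exponent_Irr:
  assumes q: "Factorial_Ring.prime q" and f: "linear_of_exponent q f"
  shows "restrict f (carrier G) \<in> chars_with q" "deg (restrict f (carrier G)) = 1"
proof -
  let ?r = "restrict f (carrier G)"
  have I: "?r \<in> Irr G" using f by (intro linear_character) (auto simp: linear_of_exponent_def)
  show d: "deg ?r = 1" using deg[OF I] f by (simp add: linear_of_exponent_def)
  obtain g where g: "g \<in> carrier G" "f g \<noteq> 1" using f by (auto simp: linear_of_exponent_def)
  have "?r \<noteq> principal_character G" using g by (auto simp: principal_character_def fun_eq_iff restrict_def)
  moreover have "q dvd codegree G ?r"
  proof (rule ccontr)
    assume "\<not> ?thesis"
    then have "gcd q (codegree G ?r) = 1" using prime_imp_coprime[OF q] by simp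
    moreover have "f g ^ q = 1" using f g by (simp add: linear_of_exponent_def)
    moreover have "f g ^ codegree G ?r = 1" using linear_pow_codegree[OF I d g(1)] g by simp
    ultimately have "f g = 1" using roots_of_unity_coprime[of "f g" q "codegree G ?r"] by simp
    then show False using g(2) by blast
  qed
  ultimately show "?r \<in> chars_with q" using I by (simp add: chars_with_def)
qed

lemma linear_of_exponent_pow:
  assumes q: "Factorial_Ring.prime q" and f: "linear_of_exponent q f" and i: "0 < i" "i < q"
  shows "linear_of_exponent q (\<lambda>g. f g ^ i)" "f g ^ i = 1 \<Longrightarrow> g \<in> carrier G \<Longrightarrow> f g = 1"
proof -
  show *: "f g = 1" if "f g ^ i = 1" "g \<in> carrier G" for g
  proof -
    have "\<not> q dvd i" using i by (auto dest: dvd_imp_le)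
    then have "gcd q i = 1" using prime_imp_coprime[OF q] by simp
    moreover have "f g ^ q = 1" using f that by (simp add: linear_of_exponent_def)
    ultimately show ?thesis using that(1) roots_of_unity_coprime[of "f g" q i] by simp
  qed
  show "linear_of_exponent q (\<lambda>g. f g ^ i)"
    unfolding linear_of_exponent_def
  proof (intro conjI ballI)
    show "\<exists>g\<in>carrier G. f g ^ i \<noteq> 1" using f * unfolding linear_of_exponent_def by blast
    fix g assume "g \<in> carrier G"
    then have "(f g ^ q) ^ i = 1" using f by (simp add: linear_of_exponent_def)
    then show "(f g ^ i) ^ q = 1" by (simp only: power_mult[symmetric] mult.commute)
  qed (use f in \<open>auto simp: linear_of_exponent_def power_mult_distrib\<close>)
qed

text \<open>A power of a nontrivial linear character has prime order \<open>q\<close>. If \<open>q > 3\<close>, its first three powers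
  are distinct, nonprincipal and have codegrees divisible by \<open>q\<close>.\<close>

lemma linear_exponent_2_or_3:
  assumes tf: "triangle_free (codegree_graph G)" and nt: "carrier G \<noteq> {\<one>}"
  shows "(\<exists>f. linear_of_exponent 2 f) \<or> (\<exists>f. linear_of_exponent 3 f)"
proof -
  obtain f where f: "\<forall>g\<in>carrier G. \<forall>h\<in>carrier G. f (g \<otimes> h) = f g * f h" "f \<one> = (1::complex)" "\<exists>g\<in>carrier G. f g \<noteq> 1"
    using exists_linear_character[OF tf nt] by blast
  define M where "M = (LEAST m. m > 0 \<and> (\<forall>g\<in>carrier G. f g ^ m = 1))"
  have ex: "card (carrier G) > 0 \<and> (\<forall>g\<in>carrier G. f g ^ card (carrier G) = 1)"
    using card_pos mult_pow[OF f(1,2)] pow_card_eq_one f(2) by metis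
  have M: "M > 0 \<and> (\<forall>g\<in>carrier G. f g ^ M = 1)" unfolding M_def using ex by (rule LeastI)
  have Mmin: "M \<le> m" if "m > 0" "\<forall>g\<in>carrier G. f g ^ m = 1" for m
    unfolding M_def using that by (intro Least_le) auto
  have "M \<noteq> 1" using M f(3) by auto
  then obtain q where q: "Factorial_Ring.prime q" "q dvd M" using prime_factor_nat by blast
  then obtain l where l: "M = q * l" by (elim dvdE)
  have q1: "q > 1" using q(1) by (rule prime_gt_1_nat)
  have lM: "l > 0" "l < M" using M l q1 by auto
  define f' where "f' g = f g ^ l" for g
  have "\<exists>g\<in>carrier G. f' g \<noteq> 1" using Mmin[of l] lM by (auto simp: f'_def)
  then have f': "linear_of_exponent q f'"
    unfolding linear_of_exponent_def
  proof (intro conjI ballI)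
    fix g assume "g \<in> carrier G"
    then show "f' g ^ q = 1" using M by (simp add: f'_def l power_mult[symmetric] mult.commute)
  qed (use f in \<open>auto simp: f'_def power_mult_distrib\<close>)
  have "q \<le> 3"
  proof (rule ccontr)
    assume "\<not> q \<le> 3"
    then have q3: "q > 3" by simp
    define r where "r i = restrict (\<lambda>g. f' g ^ i) (carrier G)" for i :: nat
    have r: "r i \<in> chars_with q" if "i \<in> {1, 2, 3}" for i
      unfolding r_def using that q3
      by (intro linear_of_exponent_Irr[OF q(1)] linear_of_exponent_pow(1)[OF q(1) f']) auto
    obtain g where g: "g \<in> carrier G" "f' g \<noteq> 1" using f' by (auto simp: linear_of_exponent_def)
    have g0: "f' g \<noteq> 0" using f' g q1 by (auto simp: linear_of_exponent_def power_0_left split: if_splits)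
    have g2: "f' g ^ 2 \<noteq> 1" using linear_of_exponent_pow(2)[OF q(1) f', of 2 g] g q3 by auto
    have "r 1 g \<noteq> r 2 g" "r 1 g \<noteq> r 3 g" "r 2 g \<noteq> r 3 g"
      using g g0 g2 by (auto simp: r_def power2_eq_square power3_eq_cube)
    then have "card {r 1, r 2, r 3} = 3" by (auto simp: card_insert_if)
    moreover have "card {r 1, r 2, r 3} \<le> card (chars_with q)" using r by (intro card_mono) auto
    ultimately show False using card_chars_with[OF tf q(1)] by simp
  qed
  then have "q = 2 \<or> q = 3" using q1 by auto
  then show ?thesis using f' by auto
qed

end

section \<open>The structure of triangle-free groups\<close>

context fin_group
begin

text \<open>For prime \<open>q\<close> these are the Frobenius groups with abelian kernel \<open>K\<close> and complement of order \<open>q\<close>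
  generated by \<open>x\<close>, together with the cyclic group of order \<open>q\<close>, for which \<open>K\<close> is trivial.\<close>

definition split_by :: "nat \<Rightarrow> 'a set \<Rightarrow> 'a \<Rightarrow> bool" where
  "split_by q K x \<longleftrightarrow> K \<lhd> G \<and> (\<forall>a\<in>K. \<forall>b\<in>K. a \<otimes> b = b \<otimes> a) \<and> card (carrier G) = q * card K \<and>
     x \<in> carrier G \<and> x \<notin> K \<and> x [^] q = \<one> \<and> (\<forall>y\<in>K. y \<otimes> x = x \<otimes> y \<longrightarrow> y = \<one>)"

lemma linear_inv:
  assumes f: "linear_of_exponent q f" and g: "g \<in> carrier G"
  shows "f (inv g) * f g = 1"
proof -
  have "f (inv g \<otimes> g) = f (inv g) * f g" using f g unfolding linear_of_exponent_def by blast
  then show ?thesis using f g by (simp add: linear_of_exponent_def)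
qed

lemma linear_mult: "linear_of_exponent q f \<Longrightarrow> g \<in> carrier G \<Longrightarrow> h \<in> carrier G \<Longrightarrow> f (g \<otimes> h) = f g * f h"
  by (simp add: linear_of_exponent_def)

lemma linear_conj:
  assumes f: "linear_of_exponent q f" and g: "g \<in> carrier G" "h \<in> carrier G"
  shows "f (h \<otimes> g \<otimes> inv h) = f g"
proof -
  have "f h * f (inv h) = 1" using linear_inv[OF f g(2)] by (simp add: mult.commute)
  moreover have "f (h \<otimes> g \<otimes> inv h) = f g * (f h * f (inv h))" using g by (simp add: linear_mult[OF f] mult_ac)
  ultimately show ?thesis by simp
qed

lemma linear_kernel_normal:
  assumes f: "linear_of_exponent q f"
  shows "{g \<in> carrier G. f g = 1} \<lhd> G"
proof (rule normal_invI)
  show "subgroup {g \<in> carrier G. f g = 1} G"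
  proof
    fix g assume "g \<in> {g \<in> carrier G. f g = 1}"
    then show "inv g \<in> {g \<in> carrier G. f g = 1}" using linear_inv[OF f, of g] by auto
  qed (use f in \<open>auto simp: linear_of_exponent_def\<close>)
qed (auto simp: linear_conj[OF f])

lemma linear_fibre_card:
  assumes f: "linear_of_exponent q f" and a: "a \<in> carrier G"
  shows "card {g \<in> carrier G. f g = f a} = card {g \<in> carrier G. f g = 1}"
proof -
  have "bij_betw (\<lambda>g. a \<otimes> g) {g \<in> carrier G. f g = 1} {g \<in> carrier G. f g = f a}"
    by (rule bij_betwI[where g = "\<lambda>g. inv a \<otimes> g"]) (use a linear_inv[OF f a] in \<open>auto simp: linear_mult[OF f]\<close>)
  then show ?thesis by (simp add: bij_betw_same_card)
qed

lemma centralizer_subgroup: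
  assumes y: "y \<in> carrier G"
  shows "subgroup (centralizer y) G"
proof
  fix a assume "a \<in> centralizer y"
  then have a: "a \<in> carrier G" "y \<otimes> a = a \<otimes> y" by (auto simp: centralizer_def)
  have "y \<otimes> inv a = inv a \<otimes> (a \<otimes> y) \<otimes> inv a" using a y by (simp add: m_assoc)
  also have "\<dots> = inv a \<otimes> y" using a(1) y by (simp add: a(2)[symmetric] m_assoc)
  finally show "inv a \<in> centralizer y" using a by (simp add: centralizer_def)
next
  fix a b assume "a \<in> centralizer y" "b \<in> centralizer y"
  then have a: "a \<in> carrier G" "y \<otimes> a = a \<otimes> y" and b: "b \<in> carrier G" "y \<otimes> b = b \<otimes> y" by (auto simp: centralizer_def)
  have "y \<otimes> (a \<otimes> b) = a \<otimes> (y \<otimes> b)" using a(1) b(1) y a(2) by (simp add: m_assoc[symmetric])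
  also have "\<dots> = a \<otimes> b \<otimes> y" using a(1) b y by (simp add: m_assoc)
  finally show "a \<otimes> b \<in> centralizer y" using a b by (simp add: centralizer_def)
qed (use y in \<open>auto simp: centralizer_def\<close>)

lemma centralizer_sym: "x \<in> carrier G \<Longrightarrow> y \<in> centralizer x \<Longrightarrow> x \<in> centralizer y"
  by (auto simp: centralizer_def)

text \<open>If \<open>u\<close>, \<open>yu\<close> and \<open>yu\<^sup>-\<^sup>1\<close> have order dividing 3, then the product of the three conjugates of
  \<open>y\<close> under \<open>\<langle>u\<rangle>\<close> is trivial in either cyclic order, so \<open>y\<close> commutes with \<open>uyu\<^sup>-\<^sup>1\<close>.\<close>

lemma three_cubes:
  assumes u: "u \<in> carrier G" and y: "y \<in> carrier G" and c: "u [^] (3::nat) = \<one>" "(y \<otimes> u) [^] (3::nat) = \<one>" "(y \<otimes> inv u) [^] (3::nat) = \<one>"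
  shows "y \<otimes> (u \<otimes> y \<otimes> inv u) \<otimes> (inv u \<otimes> y \<otimes> u) = \<one>" "(u \<otimes> y \<otimes> inv u) \<otimes> y \<otimes> (inv u \<otimes> y \<otimes> u) = \<one>"
proof -
  have uuu: "u \<otimes> (u \<otimes> u) = \<one>" using c(1) u by (simp add: numeral_3_eq_3 m_assoc)
  then have iu: "inv u = u \<otimes> u" using u by (metis inv_equality m_closed inv_comm)
  have r: "u \<otimes> (u \<otimes> (u \<otimes> z)) = z" if "z \<in> carrier G" for z
  proof -
    have "u \<otimes> (u \<otimes> (u \<otimes> z)) = (u \<otimes> (u \<otimes> u)) \<otimes> z" using u that by (simp add: m_assoc)
    then show ?thesis using uuu that by simp
  qed
  have 1: "y \<otimes> (u \<otimes> (y \<otimes> (u \<otimes> (y \<otimes> u)))) = \<one>" using c(2) u y by (simp add: numeral_3_eq_3 m_assoc)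
  have 2: "y \<otimes> (u \<otimes> (u \<otimes> (y \<otimes> (u \<otimes> (u \<otimes> (y \<otimes> (u \<otimes> u))))))) = \<one>"
    using c(3) u y by (simp add: numeral_3_eq_3 m_assoc iu)
  show "y \<otimes> (u \<otimes> y \<otimes> inv u) \<otimes> (inv u \<otimes> y \<otimes> u) = \<one>"
    using u y 1 by (simp add: iu m_assoc r)
  have "\<one> = u \<otimes> (y \<otimes> (u \<otimes> (u \<otimes> (y \<otimes> (u \<otimes> (u \<otimes> (y \<otimes> (u \<otimes> u)))))))) \<otimes> (u \<otimes> u)"
    using u uuu by (simp only: 2) (simp add: m_assoc)
  also have "\<dots> = (u \<otimes> y \<otimes> inv u) \<otimes> y \<otimes> (inv u \<otimes> y \<otimes> u)"
    using u y uuu by (simp add: iu m_assoc r)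
  finally show "(u \<otimes> y \<otimes> inv u) \<otimes> y \<otimes> (inv u \<otimes> y \<otimes> u) = \<one>" by simp
qed

text \<open>The number of characters comes from summing centralizer orders: \<open>q\<close> outside \<open>K\<close>, \<open>|K|\<close> inside
  \<open>K\<close> except at \<open>\<one>\<close>.\<close>

lemma card_Irr_split:
  assumes K: "subgroup K G" and ab: "\<And>a b. a \<in> K \<Longrightarrow> b \<in> K \<Longrightarrow> a \<otimes> b = b \<otimes> a"
    and cG: "card (carrier G) = q * card K"
    and out: "\<And>g. g \<in> carrier G \<Longrightarrow> g \<notin> K \<Longrightarrow> card (centralizer g) = q"
    and fpf: "\<And>g y. g \<in> carrier G \<Longrightarrow> g \<notin> K \<Longrightarrow> y \<in> K \<Longrightarrow> y \<otimes> g = g \<otimes> y \<Longrightarrow> y = \<one>"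
  shows "card (Irr G) * q = q + (card K - 1) + (q - 1) * q"
proof -
  have KG: "K \<subseteq> carrier G" and oK: "\<one> \<in> K" using K by (auto simp: subgroup_def)
  have fK: "finite K" using KG fin by (rule finite_subset)
  have k: "card K > 0" using fK oK by (auto simp: card_gt_0_iff)
  have "(\<Sum>g\<in>carrier G. card (centralizer g)) = (\<Sum>g\<in>carrier G - K. card (centralizer g)) + (\<Sum>g\<in>K. card (centralizer g))"
    using KG by (intro sum.subset_diff) auto
  also have "(\<Sum>g\<in>carrier G - K. card (centralizer g)) = card (carrier G - K) * q" using out by simp
  also have "card (carrier G - K) = (q - 1) * card K"
    using card_Diff_subset[OF fK KG] cG by (simp add: diff_mult_distrib)
  also have "(\<Sum>g\<in>K. card (centralizer g)) = card (centralizer \<one>) + (\<Sum>g\<in>K - {\<one>}. card (centralizer g))"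
    using fK oK by (rule sum.remove)
  also have "centralizer \<one> = carrier G" by (auto simp: centralizer_def)
  also have "(\<Sum>g\<in>K - {\<one>}. card (centralizer g)) = (\<Sum>g\<in>K - {\<one>}. card K)"
  proof (rule sum.cong[OF refl])
    fix y assume y: "y \<in> K - {\<one>}"
    have "centralizer y = K"
    proof
      show "centralizer y \<subseteq> K" using fpf y by (auto simp: centralizer_def)
      show "K \<subseteq> centralizer y" using ab y KG by (auto simp: centralizer_def)
    qed
    then show "card (centralizer y) = card K" by simp
  qed
  also have "\<dots> = (card K - 1) * card K" using fK oK by simp
  finally have "card (Irr G) * (q * card K) = (q - 1) * card K * q + (q * card K + (card K - 1) * card K)"
    using card_Irr_sum_centralizers cG by simp
  then have "(card (Irr G) * q) * card K = (q + (card K - 1) + (q - 1) * q) * card K"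
  proof -
    have "q > 0" using cG card_pos by (cases q) auto
    then obtain k' q' where "card K = Suc k'" "q = Suc q'" using k by (metis gr0_implies_Suc)
    then show ?thesis using \<open>card (Irr G) * (q * card K) = _\<close> by (simp add: algebra_simps)
  qed
  then show ?thesis using k by simp
qed

text \<open>Each prime accounts for at most two characters.\<close>

lemma card_Irr_le:
  assumes tf: "triangle_free (codegree_graph G)" and p: "\<And>p. p \<in> P \<Longrightarrow> Factorial_Ring.prime p"
    and L: "finite L" and P: "finite P"
    and cov: "\<And>\<chi>. \<chi> \<in> Irr G - L \<Longrightarrow> \<exists>p\<in>P. \<chi> \<in> chars_with p"
  shows "card (Irr G) \<le> card L + 2 * card P"
proof -
  have "Irr G - L \<subseteq> (\<Union>p\<in>P. chars_with p)" using cov by blast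
  then have "card (Irr G - L) \<le> card (\<Union>p\<in>P. chars_with p)" using P by (intro card_mono) auto
  also have "\<dots> \<le> (\<Sum>p\<in>P. card (chars_with p))" using P by (rule card_UN_le)
  also have "\<dots> \<le> (\<Sum>p\<in>P. 2)" using card_chars_with[OF tf p] by (intro sum_mono) auto
  finally have "card (Irr G - L) \<le> 2 * card P" by simp
  moreover have "card (Irr G) \<le> card L + card (Irr G - L)"
    using card_Un_le[of L "Irr G - L"] card_mono[of "L \<union> (Irr G - L)" "Irr G"] L by auto
  ultimately show ?thesis by simp
qed

lemma chars_with_exists:
  assumes \<chi>: "\<chi> \<in> Irr G" "\<chi> \<noteq> principal_character G"
  shows "\<exists>p\<in>prime_factors (card (carrier G)). \<chi> \<in> chars_with p"
proof -
  have "codegree G \<chi> \<noteq> 1" using codegree_eq_1 \<chi> by blast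
  then obtain p where p: "Factorial_Ring.prime p" "p dvd codegree G \<chi>" using prime_factor_nat by blast
  then have "p dvd card (carrier G)" using codegree_dvd[OF \<chi>(1)] by (meson dvd_trans)
  then have "p \<in> prime_factors (card (carrier G))" using p(1) card_pos by (simp add: prime_factors_dvd)
  then show ?thesis using p \<chi> by (auto simp: chars_with_def)
qed

subsection \<open>A character of order three\<close>

lemma cube_root_split:
  fixes z :: complex
  assumes "w ^ 3 = 1" "w \<noteq> 1"
  shows "w\<^sup>2 + w = -1" "z ^ 3 = 1 \<Longrightarrow> z = 1 \<or> z = w \<or> z = w\<^sup>2"
proof -
  have "(w - 1) * (w\<^sup>2 + w + 1) = w ^ 3 - 1" by (simp add: algebra_simps power2_eq_square power3_eq_cube)
  then have "w\<^sup>2 + w + 1 = 0" using assms by simp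
  then show e: "w\<^sup>2 + w = -1" by (simp add: eq_neg_iff_add_eq_0)
  assume z: "z ^ 3 = 1"
  have "(z - w) * (z - w\<^sup>2) = z\<^sup>2 - (w\<^sup>2 + w) * z + w ^ 3" by (simp add: algebra_simps power2_eq_square power3_eq_cube)
  also have "\<dots> = z\<^sup>2 + z + 1" by (simp only: e assms(1)) simp
  finally have "(z - 1) * ((z - w) * (z - w\<^sup>2)) = z ^ 3 - 1" by (simp add: algebra_simps power2_eq_square power3_eq_cube)
  then have "(z - 1) * ((z - w) * (z - w\<^sup>2)) = 0" using z by simp
  then show "z = 1 \<or> z = w \<or> z = w\<^sup>2" by simp
qed

context
  fixes f :: "'a \<Rightarrow> complex"
  assumes tf: "triangle_free (codegree_graph G)" and f: "linear_of_exponent 3 f"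
begin

private definition r1 where "r1 = restrict f (carrier G)"
private definition r2 where "r2 = restrict (\<lambda>g. f g ^ 2) (carrier G)"
private definition K where "K = {g \<in> carrier G. f g = 1}"

private lemma prime3: "Factorial_Ring.prime (3::nat)" by simp

private lemma f2: "linear_of_exponent 3 (\<lambda>g. f g ^ 2)"
  by (rule linear_of_exponent_pow(1)[OF prime3 f]) auto

private lemma f_cube: "g \<in> carrier G \<Longrightarrow> f g ^ 3 = 1"
  using f by (simp add: linear_of_exponent_def)

private lemma r12: "r1 \<noteq> r2" "r1 \<in> Irr G" "r2 \<in> Irr G" "r1 \<noteq> principal_character G" "r2 \<noteq> principal_character G"
  "chars_with 3 = {r1, r2}"
proof -
  obtain g where g: "g \<in> carrier G" "f g \<noteq> 1" using f by (auto simp: linear_of_exponent_def)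
  then have "f g \<noteq> 0" using f_cube[OF g(1)] by auto
  then have "r1 g \<noteq> r2 g" using g by (simp add: r1_def r2_def power2_eq_square)
  then show ne: "r1 \<noteq> r2" by auto
  have c: "r1 \<in> chars_with 3" "r2 \<in> chars_with 3"
    unfolding r1_def r2_def using linear_of_exponent_Irr[OF prime3 f] linear_of_exponent_Irr[OF prime3 f2] by auto
  then show "r1 \<in> Irr G" "r2 \<in> Irr G" "r1 \<noteq> principal_character G" "r2 \<noteq> principal_character G" by (auto simp: chars_with_def)
  show "chars_with 3 = {r1, r2}"
    using card_seteq[of "chars_with 3" "{r1, r2}"] c ne card_chars_with[OF tf prime3] by auto
qed

text \<open>The other characters take on an element \<open>x\<close> of order 3 the value 0 or their degree; the
  column relation then leaves only the value 0, and shows that \<open>x\<close> lies outside the kernel.\<close>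

private lemma order3:
  assumes x: "x \<in> carrier G" "x \<noteq> \<one>" "x [^] (3::nat) = \<one>"
  shows "f x \<noteq> 1" "card (centralizer x) = 3"
proof -
  define L where "L = {principal_character G, r1, r2}"
  have LI: "L \<subseteq> Irr G" using r12 by (auto simp: L_def)
  have val: "\<chi> x = 0 \<or> \<chi> x = of_nat (deg \<chi>)" if "\<chi> \<in> Irr G - L" for \<chi>
  proof -
    have "\<not> 3 dvd codegree G \<chi>" using that r12(6) by (auto simp: L_def chars_with_def)
    then show ?thesis using vanish_outside_kernel[OF _ prime3 _ x(1,3)] that deg[of \<chi>] by auto
  qed
  \<comment> \<open>The contribution of \<open>\<chi>\<close> to the column relation, a natural number.\<close>
  define t where "t \<chi> = (if \<chi> x = 0 then 0 else (deg \<chi>)\<^sup>2)" for \<chi>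
  have "-1 = (\<Sum>\<chi>\<in>Irr G - {principal_character G}. \<chi> \<one> * \<chi> x)" using column_sum_zero[OF x(1,2)] by simp
  also have "Irr G - {principal_character G} = insert r1 (insert r2 (Irr G - L))"
    using r12 by (auto simp: L_def)
  also have "(\<Sum>\<chi>\<in>insert r1 (insert r2 (Irr G - L)). \<chi> \<one> * \<chi> x) = r1 \<one> * r1 x + (r2 \<one> * r2 x + (\<Sum>\<chi>\<in>Irr G - L. \<chi> \<one> * \<chi> x))"
    using r12(1) by (subst sum.insert; simp add: L_def)+
  also have "r1 \<one> * r1 x + (r2 \<one> * r2 x + (\<Sum>\<chi>\<in>Irr G - L. \<chi> \<one> * \<chi> x)) = (f x ^ 2 + f x) + (\<Sum>\<chi>\<in>Irr G - L. \<chi> \<one> * \<chi> x)"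
    using x f by (simp add: r1_def r2_def linear_of_exponent_def)
  also have "(\<Sum>\<chi>\<in>Irr G - L. \<chi> \<one> * \<chi> x) = (\<Sum>\<chi>\<in>Irr G - L. of_nat (t \<chi>))"
    using val deg by (intro sum.cong) (auto simp: t_def power2_eq_square)
  finally have e: "(f x ^ 2 + f x) + of_nat (\<Sum>\<chi>\<in>Irr G - L. t \<chi>) = -1" by simp
  show f1: "f x \<noteq> 1"
  proof
    assume "f x = 1"
    then have "of_nat (3 + (\<Sum>\<chi>\<in>Irr G - L. t \<chi>)) = (0 :: complex)" using e by (simp add: algebra_simps add_eq_0_iff)
    then have "3 + (\<Sum>\<chi>\<in>Irr G - L. t \<chi>) = 0" by (simp only: of_nat_eq_0_iff)
    then show False by simp
  qed
  have "(of_nat (\<Sum>\<chi>\<in>Irr G - L. t \<chi>) :: complex) = 0"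
    using e cube_root_split(1)[OF f_cube[OF x(1)] f1] by simp
  then have "(\<Sum>\<chi>\<in>Irr G - L. t \<chi>) = 0" by (simp only: of_nat_eq_0_iff)
  then have "t \<chi> = 0" if "\<chi> \<in> Irr G - L" for \<chi> using that by simp
  then have z: "\<chi> x = 0" if "\<chi> \<in> Irr G - L" for \<chi>
    using that deg_pos[of \<chi>] by (fastforce simp: t_def split: if_splits)
  have "cmod (f x) ^ 3 = 1" using f_cube[OF x(1)] by (metis norm_one norm_power)
  then have n: "cmod (f x) = 1" using power_eq_iff_eq_base[of 3 "cmod (f x)" 1] by simp
  have "real (card (centralizer x)) = (\<Sum>\<chi>\<in>Irr G. (cmod (\<chi> x))\<^sup>2)" using column_norm[OF x(1)] by simp
  also have "\<dots> = (\<Sum>\<chi>\<in>L. (cmod (\<chi> x))\<^sup>2)" using LI z by (intro sum.mono_neutral_right) auto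
  also have "\<dots> = 3" unfolding L_def using r12 x n by (simp add: r1_def r2_def norm_power sum.insert_if)
  finally show "card (centralizer x) = 3" by simp
qed

private lemma Kn: "K \<lhd> G"
  unfolding K_def by (rule linear_kernel_normal[OF f])

private lemma Ks: "subgroup K G"
  by (rule normal_imp_subgroup[OF Kn])

private lemma exists_order3: "\<exists>x\<in>carrier G. x \<noteq> \<one> \<and> x [^] (3::nat) = \<one>"
proof (rule exists_prime_order_element[OF prime3])
  have "3 dvd codegree G r1" using r12(6) by (auto simp: chars_with_def)
  then show "3 dvd card (carrier G)" using codegree_dvd[OF r12(2)] by (meson dvd_trans)
qed

text \<open>The classes of \<open>x\<close> and \<open>x\<^sup>-\<^sup>1\<close> have \<open>|G| / 3 = |K|\<close> elements each, so they fill the two cosets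
  of \<open>K\<close> other than \<open>K\<close> itself. Representatives of classes inside \<open>K\<close>, together with \<open>\<one>\<close>, \<open>x\<close> and
  \<open>x\<^sup>-\<^sup>1\<close>, are pairwise not conjugate.\<close>

private lemma card_G: "card (carrier G) = 3 * card K"
  and outside_cube: "g \<in> carrier G \<Longrightarrow> g \<notin> K \<Longrightarrow> g [^] (3::nat) = \<one>"
  and nonconj_bound: "A \<subseteq> K - {\<one>} \<Longrightarrow> (\<And>a b. a \<in> A \<Longrightarrow> b \<in> A \<Longrightarrow> a \<noteq> b \<Longrightarrow> b \<notin> conj_class a) \<Longrightarrow> card A + 3 \<le> card (Irr G)"
proof -
  obtain x where x: "x \<in> carrier G" "x \<noteq> \<one>" "x [^] (3::nat) = \<one>" using exists_order3 by blast
  define w where "w = f x"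
  have w: "w ^ 3 = 1" "w \<noteq> 1" using f_cube[OF x(1)] order3(1)[OF x] by (auto simp: w_def)
  have w0: "w \<noteq> 0" using w by auto
  have w2: "w\<^sup>2 \<noteq> 1" "w\<^sup>2 \<noteq> w" using w w0 by (auto simp: power2_eq_square power3_eq_cube)
  have ix: "inv x \<in> carrier G" "inv x \<noteq> \<one>" "(inv x) [^] (3::nat) = \<one>" using x by (auto simp: inv_eq_1_iff nat_pow_inv)
  have fix': "f (inv x) = w\<^sup>2"
  proof -
    have "f (inv x) * w = w\<^sup>2 * w" using linear_inv[OF f x(1)] w by (simp add: w_def power2_eq_square power3_eq_cube mult.assoc)
    then show ?thesis using w0 by simp
  qed
  have cov: "carrier G = (K \<union> {g \<in> carrier G. f g = w}) \<union> {g \<in> carrier G. f g = w\<^sup>2}"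
    using cube_root_split(2)[OF w] f_cube by (auto simp: K_def)
  have c1: "card {g \<in> carrier G. f g = w} = card K" unfolding K_def w_def by (rule linear_fibre_card[OF f x(1)])
  have c2: "card {g \<in> carrier G. f g = w\<^sup>2} = card K" unfolding K_def fix'[symmetric] by (rule linear_fibre_card[OF f ix(1)])
  have fK: "finite K" by (simp add: K_def)
  have "card (carrier G) = card (K \<union> {g \<in> carrier G. f g = w}) + card {g \<in> carrier G. f g = w\<^sup>2}"
    by (subst cov, rule card_Un_disjoint) (use w w2 fK in \<open>auto simp: K_def\<close>)
  also have "card (K \<union> {g \<in> carrier G. f g = w}) = card K + card {g \<in> carrier G. f g = w}"
    by (rule card_Un_disjoint) (use w fK in \<open>auto simp: K_def\<close>)
  finally show cG: "card (carrier G) = 3 * card K" using c1 c2 by simp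
  have cl: "conj_class y = {g \<in> carrier G. f g = f y}" if "y \<in> carrier G" "y \<noteq> \<one>" "y [^] (3::nat) = \<one>" for y
  proof (rule card_seteq)
    show "conj_class y \<subseteq> {g \<in> carrier G. f g = f y}" using that linear_conj[OF f that(1)] by (auto simp: conj_class_def)
    have "card (conj_class y) * 3 = 3 * card K" using card_conj_class[OF that(1)] order3(2)[OF that] cG by simp
    then show "card {g \<in> carrier G. f g = f y} \<le> card (conj_class y)"
      using linear_fibre_card[OF f that(1)] by (simp add: K_def)
  qed simp
  have out: "g \<in> conj_class x \<or> g \<in> conj_class (inv x)" if "g \<in> carrier G" "g \<notin> K" for g
    unfolding cl[OF x] cl[OF ix] fix' using cov that by (auto simp: w_def)
  show "g [^] (3::nat) = \<one>" if "g \<in> carrier G" "g \<notin> K" for g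
    using out[OF that] conj_class_pow_one_iff[OF x(1), of g 3] conj_class_pow_one_iff[OF ix(1), of g 3] x ix by auto
  show "card A + 3 \<le> card (Irr G)" if A: "A \<subseteq> K - {\<one>}"
    and nc: "\<And>a b. a \<in> A \<Longrightarrow> b \<in> A \<Longrightarrow> a \<noteq> b \<Longrightarrow> b \<notin> conj_class a"
  proof -
    have AG: "A \<subseteq> carrier G" using A by (auto simp: K_def)
    have fA: "finite A" using AG fin by (rule finite_subset)
    have nf: "f \<one> = 1" using f by (simp add: linear_of_exponent_def)
    have fa: "f a = 1" if "a \<in> A" for a using A that by (auto simp: K_def)
    have conj_f: "f b = f a" if "a \<in> carrier G" "b \<in> conj_class a" for a b
      using that linear_conj[OF f that(1)] by (auto simp: conj_class_def)
    have o: "conj_class \<one> = {\<one>}" by (auto simp: conj_class_def)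
    let ?B = "insert \<one> (insert x (insert (inv x) A))"
    have "x \<noteq> inv x" using fix' w2 by (auto simp: w_def)
    then have "card ?B = card A + 3"
      using fA fa w w2 fix' x ix A x(2)[symmetric] ix(2)[symmetric] by (auto simp: w_def card_insert_if)
    moreover have "card ?B \<le> card (Irr G)"
    proof (rule nonconjugate_card_le)
      show "?B \<subseteq> carrier G" using AG x by auto
      fix a b assume ab: "a \<in> ?B" "b \<in> ?B" "a \<noteq> b"
      show "b \<notin> conj_class a"
      proof
        assume b: "b \<in> conj_class a"
        have ac: "a \<in> carrier G" using ab(1) AG x by auto
        have eq: "f b = f a" by (rule conj_f[OF ac b])
        have ne1: "a \<noteq> \<one>" using b ab(3) o by auto
        have ne2: "b \<noteq> \<one>" using conj_class_sym[OF ac b] ab(3) o by auto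
        show False
          using ab ne1 ne2 eq fa w w2 fix' nc[OF _ _ ab(3)] b unfolding w_def by auto
      qed
    qed
    ultimately show ?thesis by simp
  qed
qed

text \<open>The centralizer consists of the powers of \<open>g\<close>, and only \<open>\<one>\<close> among them lies in \<open>K\<close>.\<close>

private lemma outside_centralizer:
  assumes g: "g \<in> carrier G" "g \<notin> K"
  shows "card (centralizer g) = 3" "y \<in> K \<Longrightarrow> y \<otimes> g = g \<otimes> y \<Longrightarrow> y = \<one>"
proof -
  have "g \<noteq> \<one>" using g subgroup.one_closed[OF Ks] by blast
  then show c3: "card (centralizer g) = 3" using order3(2) outside_cube g by blast
  assume y: "y \<in> K" "y \<otimes> g = g \<otimes> y"
  have fg: "f g ^ 3 = 1" "f g \<noteq> 1" using f_cube g by (auto simp: K_def)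
  have "f g \<noteq> 0" using fg by auto
  then have ff: "f g * f g \<noteq> 1" "f g * f g \<noteq> f g" using fg by (auto simp: power3_eq_cube)
  have "g \<otimes> g \<noteq> \<one>" "g \<otimes> g \<noteq> g" using ff f g by (auto simp: linear_of_exponent_def dest: arg_cong[of _ _ f])
  then have "card {\<one>, g, g \<otimes> g} = 3" using \<open>g \<noteq> \<one>\<close> by (auto simp: card_insert_if)
  moreover have "{\<one>, g, g \<otimes> g} \<subseteq> centralizer g" using g by (auto simp: centralizer_def m_assoc)
  moreover have "finite (centralizer g)" by (simp add: centralizer_def)
  ultimately have "centralizer g = {\<one>, g, g \<otimes> g}" using c3 by (metis card_seteq order_refl)
  moreover have "y \<in> centralizer g" using y g by (auto simp: centralizer_def K_def)
  moreover have "g \<otimes> g \<notin> K" using ff g by (auto simp: K_def linear_mult[OF f])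
  ultimately show "y = \<one>" using y(1) g(2) by auto
qed

text \<open>Every element outside \<open>K\<close> has order 3, so \<open>three_cubes\<close> applies to all of them; hence the
  conjugates of an element of \<open>K\<close> commute with one another.\<close>

private lemma conjugates_commute:
  assumes y: "y \<in> K" and g: "g \<in> carrier G"
  shows "g \<otimes> y \<otimes> inv g \<in> centralizer y"
proof -
  have yc: "y \<in> carrier G" "f y = 1" using y by (auto simp: K_def)
  have notK: "u \<notin> K \<Longrightarrow> u \<in> carrier G \<Longrightarrow> inv u \<notin> K" for u using Ks by (metis inv_inv subgroup.m_inv_closed)
  have tc: "u [^] (3::nat) = \<one>" "(y \<otimes> u) [^] (3::nat) = \<one>" "(y \<otimes> inv u) [^] (3::nat) = \<one>"
    if u: "u \<in> carrier G" "u \<notin> K" for u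
  proof -
    show "u [^] (3::nat) = \<one>" using outside_cube u by blast
    have "y \<otimes> u \<notin> K" using u yc by (auto simp: K_def linear_mult[OF f])
    then show "(y \<otimes> u) [^] (3::nat) = \<one>" using u yc by (intro outside_cube) auto
    have "y \<otimes> inv u \<notin> K" using notK[OF u(2,1)] u yc by (auto simp: K_def linear_mult[OF f])
    then show "(y \<otimes> inv u) [^] (3::nat) = \<one>" using u yc by (intro outside_cube) auto
  qed
  have out: "u \<otimes> y \<otimes> inv u \<in> centralizer y" if u: "u \<in> carrier G" "u \<notin> K" for u
  proof -
    note t = three_cubes[OF u(1) yc(1) tc[OF u]]
    have "y \<otimes> (u \<otimes> y \<otimes> inv u) = (u \<otimes> y \<otimes> inv u) \<otimes> y"
      by (rule r_cancel[of _ "inv u \<otimes> y \<otimes> u"]) (use t u yc in auto)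
    then show ?thesis using u yc by (simp add: centralizer_def)
  qed
  show ?thesis
  proof (cases "g \<in> K")
    case True
    \<comment> \<open>For \<open>g\<close> in \<open>K\<close>, the conjugate by \<open>g\<close> is the inverse of the product of the conjugates by \<open>gu\<close> and
      \<open>gu\<^sup>-\<^sup>1\<close>, which lie outside \<open>K\<close>.\<close>
    obtain u where u: "u \<in> carrier G" "u \<notin> K"
      using exists_order3 order3(1) by (auto simp: K_def)
    have gu: "g \<otimes> u \<notin> K" "g \<otimes> inv u \<notin> K"
      using True u notK[OF u(2,1)] by (auto simp: K_def linear_mult[OF f])
    let ?a = "(g \<otimes> u) \<otimes> y \<otimes> inv (g \<otimes> u)" and ?b = "(g \<otimes> inv u) \<otimes> y \<otimes> inv (g \<otimes> inv u)"
    have ab: "?a \<in> centralizer y" "?b \<in> centralizer y" using out gu g u by auto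
    have "(g \<otimes> y \<otimes> inv g) \<otimes> (?a \<otimes> ?b) = g \<otimes> (y \<otimes> (u \<otimes> y \<otimes> inv u) \<otimes> (inv u \<otimes> y \<otimes> u)) \<otimes> inv g"
      using g u yc by (simp add: m_assoc inv_mult_group)
    also have "\<dots> = \<one>" using three_cubes(1)[OF u(1) yc(1) tc[OF u]] g by simp
    finally have "g \<otimes> y \<otimes> inv g = inv (?a \<otimes> ?b)"
      using g u yc by (intro inv_equality[symmetric]) auto
    then show ?thesis
      using ab subgroup.m_closed[OF centralizer_subgroup[OF yc(1)]] subgroup.m_inv_closed[OF centralizer_subgroup[OF yc(1)]] by simp
  qed (use out g in blast)
qed

private lemma conj_class_commute: "y \<in> K \<Longrightarrow> z \<in> conj_class y \<Longrightarrow> y \<otimes> z = z \<otimes> y"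
  using conjugates_commute by (auto simp: conj_class_def centralizer_def)

text \<open>Let \<open>g\<close> invert \<open>z\<close>. Outside \<open>K\<close>, the element \<open>g\<close> has order 3, so \<open>z\<close> is its own inverse. Inside
  \<open>K\<close>, the element \<open>g\<close> commutes with its conjugate \<open>zgz\<^sup>-\<^sup>1 = z\<^sup>2 g\<close>, hence with \<open>z\<^sup>2\<close>, which it also
  inverts.\<close>

private lemma inverted_pow_4:
  assumes z: "z \<in> K" and r: "inv z \<in> conj_class z"
  shows "z [^] (4::nat) = \<one>"
proof -
  have zc: "z \<in> carrier G" using z by (simp add: K_def)
  obtain g where g: "g \<in> carrier G" "g \<otimes> z \<otimes> inv g = inv z" using r by (auto simp: conj_class_def)
  have gi: "g \<otimes> inv z \<otimes> inv g = z"
  proof -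
    have "g \<otimes> inv z \<otimes> inv g = inv (g \<otimes> z \<otimes> inv g)" using g(1) zc by (simp add: inv_mult_group m_assoc)
    then show ?thesis using g zc by simp
  qed
  have zz: "z \<otimes> z = inv z \<otimes> inv z"
  proof (cases "g \<in> K")
    case False
    have "z = (g [^] (3::nat)) \<otimes> z \<otimes> inv (g [^] (3::nat))" using outside_cube[OF g(1) False] zc by simp
    also have "\<dots> = g \<otimes> (g \<otimes> (g \<otimes> z \<otimes> inv g) \<otimes> inv g) \<otimes> inv g"
      using g(1) zc by (simp add: numeral_3_eq_3 m_assoc inv_mult_group)
    also have "\<dots> = inv z" using g(2) gi by simp
    finally show ?thesis by simp
  next
    case True
    have "z \<otimes> g \<otimes> inv z \<in> conj_class g" using zc by (auto simp: conj_class_def)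
    then have c: "g \<otimes> (z \<otimes> g \<otimes> inv z) = (z \<otimes> g \<otimes> inv z) \<otimes> g" by (rule conj_class_commute[OF True])
    have "z \<otimes> g \<otimes> inv z = z \<otimes> (g \<otimes> inv z \<otimes> inv g) \<otimes> g" using g(1) zc by (simp add: m_assoc)
    then have e: "z \<otimes> g \<otimes> inv z = z \<otimes> z \<otimes> g" by (simp only: gi)
    have "g \<otimes> (z \<otimes> z) \<otimes> g = z \<otimes> z \<otimes> g \<otimes> g" using c g(1) zc unfolding e by (simp add: m_assoc)
    then have "g \<otimes> (z \<otimes> z) = z \<otimes> z \<otimes> g" using g(1) zc by (metis m_closed r_cancel)
    then have "z \<otimes> z = g \<otimes> (z \<otimes> z) \<otimes> inv g" using g(1) zc by (simp add: m_assoc)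
    also have "\<dots> = (g \<otimes> z \<otimes> inv g) \<otimes> (g \<otimes> z \<otimes> inv g)" using g(1) zc by (simp add: m_assoc)
    finally show ?thesis by (simp only: g(2))
  qed
  have "z [^] (4::nat) = (z \<otimes> z) \<otimes> (z \<otimes> z)" using zc by (simp add: eval_nat_numeral m_assoc)
  also have "\<dots> = (inv z \<otimes> inv z) \<otimes> (z \<otimes> z)" by (simp only: zz[symmetric])
  also have "\<dots> = \<one>" using zc by (simp add: m_assoc)
  finally show ?thesis .
qed

text \<open>Let \<open>s\<close> be the number of primes other than 3 dividing \<open>|G|\<close>. For each of them \<open>K\<close> has an element of that
  order, and elements belonging to different primes commute; so if \<open>s \<ge> 2\<close> there is also an element of
  order \<open>pq\<close>. These \<open>s + 1\<close> elements and their inverses, except the inverse of an involution, are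
  pairwise not conjugate. That makes at least \<open>2s + 1\<close> classes in \<open>K\<close> besides that of \<open>\<one>\<close>, and at least \<open>2s + 4\<close>
  in \<open>G\<close>, while there are at most \<open>2s + 3\<close> characters.\<close>

private lemma at_most_one_prime: "card (prime_factors (card (carrier G)) - {3}) \<le> 1"
proof (rule ccontr)
  define P where "P = prime_factors (card (carrier G)) - {3}"
  assume "\<not> ?thesis"
  then have P2: "card P \<ge> 2" by (simp add: P_def)
  then obtain T where "T \<subseteq> P" "card T = 2" using obtain_subset_with_card_n[OF P2] by metis
  then obtain p0 q0 where pq: "p0 \<in> P" "q0 \<in> P" "p0 \<noteq> q0" by (auto simp: card_2_iff)
  have Pp: "Factorial_Ring.prime p" "p dvd card (carrier G)" "p \<noteq> 3" if "p \<in> P" for p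
    using that by (auto simp: P_def prime_factors_dvd)
  have fP: "finite P" by (simp add: P_def)
  have "\<exists>y. y \<in> K \<and> ord y = p" if p: "p \<in> P" for p
  proof -
    obtain y where y: "y \<in> carrier G" "y \<noteq> \<one>" "y [^] p = \<one>" using exists_prime_order_element[OF Pp(1,2)[OF p]] by blast
    have "gcd p 3 = 1" using primes_coprime[OF Pp(1)[OF p] prime3 Pp(3)[OF p]] by simp
    moreover have "f y ^ p = 1" using mult_pow[of f y p] f y by (simp add: linear_of_exponent_def)
    ultimately have "f y = 1" using roots_of_unity_coprime[of "f y" p 3] f_cube[OF y(1)] by simp
    then show ?thesis using y ord_prime[OF Pp(1)[OF p] y] by (auto simp: K_def)
  qed
  then obtain e where e: "\<And>p. p \<in> P \<Longrightarrow> e p \<in> K \<and> ord (e p) = p" by metis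
  have KG: "K \<subseteq> carrier G" by (auto simp: K_def)
  have ec: "e p \<in> carrier G" if "p \<in> P" for p using e that KG by blast
  have ep: "e p [^] p = \<one>" if "p \<in> P" for p using e[OF that] pow_ord_eq_1[OF ec[OF that]] by simp
  \<comment> \<open>The commutator \<open>c\<close> of \<open>y\<close> and \<open>z\<close> is a product of two commuting conjugates of \<open>y\<close> and \<open>y\<^sup>-\<^sup>1\<close>, and
    likewise of \<open>z\<close> and \<open>z\<^sup>-\<^sup>1\<close>; so its order divides both \<open>p\<close> and \<open>q\<close>.\<close>
  have comm: "e p \<otimes> e q = e q \<otimes> e p" if pq: "p \<in> P" "q \<in> P" "p \<noteq> q" for p q
  proof -
    let ?y = "e p" and ?z = "e q"
    let ?c = "?y \<otimes> (?z \<otimes> inv ?y \<otimes> inv ?z)"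
    have yz: "?y \<in> carrier G" "?z \<in> carrier G" using ec pq by auto
    have conj_inv: "g \<otimes> inv y \<otimes> inv g = inv (g \<otimes> y \<otimes> inv g)" if "g \<in> carrier G" "y \<in> carrier G" for g y
      using that by (simp add: inv_mult_group m_assoc)
    have 1: "?z \<otimes> inv ?y \<otimes> inv ?z \<in> centralizer ?y"
      unfolding conj_inv[OF yz(2,1)] using conjugates_commute[of ?y ?z] e[OF pq(1)] yz
      by (intro subgroup.m_inv_closed[OF centralizer_subgroup]) auto
    have "?c [^] p = ?y [^] p \<otimes> (?z \<otimes> inv ?y \<otimes> inv ?z) [^] p"
      using 1 yz by (intro pow_mult_distrib) (auto simp: centralizer_def)
    also have "\<dots> = \<one>" using ep[OF pq(1)] yz by (simp add: conj_pow nat_pow_inv)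
    finally have c1: "?c [^] p = \<one>" .
    have 2: "?y \<otimes> ?z \<otimes> inv ?y \<in> centralizer ?z"
      using conjugates_commute[of ?z ?y] e[OF pq(2)] yz by auto
    then have "inv ?z \<in> centralizer (?y \<otimes> ?z \<otimes> inv ?y)"
      using yz subgroup.m_inv_closed[OF centralizer_subgroup[of "?y \<otimes> ?z \<otimes> inv ?y"]] centralizer_sym[OF _ 2] by auto
    then have "((?y \<otimes> ?z \<otimes> inv ?y) \<otimes> inv ?z) [^] q = (?y \<otimes> ?z \<otimes> inv ?y) [^] q \<otimes> (inv ?z) [^] q"
      using yz by (intro pow_mult_distrib) (auto simp: centralizer_def)
    also have "\<dots> = \<one>" using ep[OF pq(2)] yz by (simp add: conj_pow nat_pow_inv)
    also have "(?y \<otimes> ?z \<otimes> inv ?y) \<otimes> inv ?z = ?c" using yz by (simp add: m_assoc)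
    finally have c2: "?c [^] q = \<one>" .
    have cc: "?c \<in> carrier G" using yz by simp
    have "ord ?c dvd p" "ord ?c dvd q" using c1 c2 cc by (simp_all add: pow_eq_id)
    then have "ord ?c dvd gcd p q" by simp
    moreover have "gcd p q = 1" using primes_coprime[OF Pp(1)[OF pq(1)] Pp(1)[OF pq(2)] pq(3)] by simp
    ultimately have "ord ?c = 1" by simp
    then have "?c = \<one>" using ord_eq_1[OF cc] by simp
    then have "(?y \<otimes> ?z) \<otimes> inv (?z \<otimes> ?y) = \<one>" using yz by (simp add: inv_mult_group m_assoc)
    then show ?thesis using yz by (metis inv_closed inv_equality inv_inv m_closed)
  qed
  define w where "w = e p0 \<otimes> e q0"
  have wc: "w \<in> carrier G" and wK: "w \<in> K"
    using pq ec e subgroup.m_closed[OF Ks] by (auto simp: w_def)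
  have powd: "p dvd d" if pq: "p \<in> P" "q \<in> P" "p \<noteq> q" and w1: "e p [^] d \<otimes> e q [^] d = \<one>" for p q and d :: nat
  proof -
    have c: "e p [^] d \<in> carrier G" "e q [^] d \<in> carrier G" using ec pq by auto
    have "e p [^] d = inv (e q [^] d)" using w1 c by (simp add: inv_equality)
    then have "(e p [^] d) [^] q = inv ((e q [^] d) [^] q)" using c by (simp add: nat_pow_inv)
    also have "(e q [^] d) [^] q = (e q [^] q) [^] d" using ec pq by (simp add: nat_pow_pow mult.commute)
    finally have "e p [^] (d * q) = \<one>" using ep pq ec by (simp add: nat_pow_pow)
    then have "p dvd d * q" using e[OF pq(1)] ec[OF pq(1)] by (simp add: pow_eq_id)
    moreover have "Rings.coprime p q" using primes_coprime[OF Pp(1)[OF pq(1)] Pp(1)[OF pq(2)] pq(3)] .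
    ultimately show ?thesis by (simp add: coprime_dvd_mult_left_iff)
  qed
  have ow: "ord w = p0 * q0"
  proof (rule dvd_antisym)
    have "w [^] (p0 * q0) = e p0 [^] (p0 * q0) \<otimes> e q0 [^] (p0 * q0)"
      unfolding w_def using comm[OF pq] ec pq by (intro pow_mult_distrib) auto
    also have "\<dots> = \<one>"
    proof -
      have "e p0 [^] (p0 * q0) = \<one>" "e q0 [^] (p0 * q0) = \<one>"
        using pow_eq_id[OF ec[OF pq(1)]] pow_eq_id[OF ec[OF pq(2)]] e[OF pq(1)] e[OF pq(2)] by simp_all
      then show ?thesis by simp
    qed
    finally show "ord w dvd p0 * q0" using wc by (simp add: pow_eq_id)
    have "w [^] ord w = e p0 [^] ord w \<otimes> e q0 [^] ord w"
      unfolding w_def using comm[OF pq] ec pq by (intro pow_mult_distrib) auto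
    then have 1: "e p0 [^] ord w \<otimes> e q0 [^] ord w = \<one>" using pow_ord_eq_1[OF wc] by simp
    have 2: "e q0 [^] ord w \<otimes> e p0 [^] ord w = \<one>" by (rule inv_comm[OF 1]) (use ec pq in auto)
    have "q0 dvd ord w" by (rule powd[OF pq(2,1) _ 2]) (use pq in simp)
    moreover have "p0 dvd ord w" by (rule powd[OF pq 1])
    ultimately show "p0 * q0 dvd ord w"
      using primes_coprime[OF Pp(1)[OF pq(1)] Pp(1)[OF pq(2)] pq(3)] by (intro divides_mult) auto
  qed
  define D where "D = insert (p0 * q0) P"
  have npq: "p0 * q0 \<notin> P"
  proof
    assume "p0 * q0 \<in> P"
    then have "Factorial_Ring.prime (p0 * q0)" using Pp by blast
    then show False using Pp(1) pq by (metis prime_product not_prime_1)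
  qed
  define el where "el n = (if n = p0 * q0 then w else e n)" for n
  have el: "el n \<in> K" "ord (el n) = n" if "n \<in> D" for n
    using that e wK ow npq by (auto simp: D_def el_def)
  have elc: "el n \<in> carrier G" if "n \<in> D" for n using el that KG by blast
  have n4: "\<not> n dvd 4" if n: "n \<in> D" "n \<noteq> 2" for n
  proof
    assume d: "n dvd 4"
    show False
    proof (cases "n \<in> P")
      case True
      have "n dvd 2 ^ 2" using d by simp
      then have "n dvd 2" using Pp(1)[OF True] prime_dvd_power by blast
      then show False using Pp(1)[OF True] n(2) primes_dvd_imp_eq two_is_prime_nat by blast
    next
      case False
      then have "n = p0 * q0" using n by (simp add: D_def)
      then have "p0 dvd 2 ^ 2" "q0 dvd 2 ^ 2" using d by (auto intro: dvd_trans[OF dvd_triv_left] dvd_trans[OF dvd_triv_right])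
      then have "p0 dvd 2" "q0 dvd 2" using Pp(1) pq prime_dvd_power by blast+
      then show False using Pp(1) pq primes_dvd_imp_eq two_is_prime_nat by blast
    qed
  qed
  have ordc: "ord b = ord a" if "a \<in> carrier G" "b \<in> conj_class a" for a b
  proof -
    have bc: "b \<in> carrier G" using that conj_class_subset by blast
    have "ord a dvd n \<longleftrightarrow> ord b dvd n" for n
      using conj_class_pow_one_iff[OF that, of n] that bc by (simp add: pow_eq_id)
    then show ?thesis by (meson dvd_antisym dvd_refl)
  qed
  let ?A1 = "el ` D" and ?A2 = "(\<lambda>n. inv (el n)) ` (D - {2})"
  have o2: "ord (inv (el n)) = n" if "n \<in> D" for n using el that elc by simp
  have fD: "finite D" using fP by (simp add: D_def)
  have nr: "inv (el n) \<notin> conj_class (el n)" if n: "n \<in> D" "n \<noteq> 2" for n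
  proof
    assume "inv (el n) \<in> conj_class (el n)"
    then have "el n [^] (4::nat) = \<one>" by (rule inverted_pow_4[OF el(1)[OF n(1)]])
    then show False using n4[OF n] el[OF n(1)] elc[OF n(1)] by (simp add: pow_eq_id)
  qed
  have inj1: "inj_on el D"
  proof (rule inj_onI)
    fix n m assume "n \<in> D" "m \<in> D" "el n = el m"
    then show "n = m" using el(2)[of n] el(2)[of m] by argo
  qed
  have inj2: "inj_on (\<lambda>n. inv (el n)) (D - {2})"
  proof (rule inj_onI)
    fix n m assume "n \<in> D - {2}" "m \<in> D - {2}" "inv (el n) = inv (el m)"
    then show "n = m" using o2[of n] o2[of m] by (metis DiffD1)
  qed
  have disj: "?A1 \<inter> ?A2 = {}"
  proof (rule ccontr)
    assume "?A1 \<inter> ?A2 \<noteq> {}"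
    then obtain n m where nm: "n \<in> D" "m \<in> D" "m \<noteq> 2" "el n = inv (el m)" by auto
    then have "n = m" using el(2)[OF nm(1)] o2[OF nm(2)] by metis
    then have "inv (el m) \<in> conj_class (el m)" using nm(4) conj_class_self[OF elc[OF nm(2)]] by metis
    then show False using nr[OF nm(2,3)] by blast
  qed
  have "card (?A1 \<union> ?A2) + 3 \<le> card (Irr G)"
  proof (rule nonconj_bound)
    show "?A1 \<union> ?A2 \<subseteq> K - {\<one>}"
    proof
      fix a assume a: "a \<in> ?A1 \<union> ?A2"
      then obtain n where n: "n \<in> D" "a = el n \<or> a = inv (el n)" by auto
      then have "a \<in> K" using el(1)[OF n(1)] subgroup.m_inv_closed[OF Ks] by auto
      moreover have "ord a = n" using n(2) el(2)[OF n(1)] o2[OF n(1)] by metis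
      moreover have "n \<noteq> 1" using n(1) Pp(1)[of 1] Pp(1)[OF pq(1)] by (auto simp: D_def)
      ultimately show "a \<in> K - {\<one>}" by auto
    qed
    fix a b assume ab: "a \<in> ?A1 \<union> ?A2" "b \<in> ?A1 \<union> ?A2" "a \<noteq> b"
    show "b \<notin> conj_class a"
    proof
      assume b: "b \<in> conj_class a"
      obtain n where n: "n \<in> D" "a = el n \<or> (n \<noteq> 2 \<and> a = inv (el n))" using ab(1) by auto
      obtain m where m: "m \<in> D" "b = el m \<or> (m \<noteq> 2 \<and> b = inv (el m))" using ab(2) by auto
      have ac: "a \<in> carrier G" using n elc by auto
      have "ord a = n" using n(2) el(2)[OF n(1)] o2[OF n(1)] by metis
      moreover have "ord b = m" using m(2) el(2)[OF m(1)] o2[OF m(1)] by metis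
      ultimately have "n = m" using ordc[OF ac b] by metis
      then have "n \<noteq> 2" "(a = el n \<and> b = inv (el n)) \<or> (a = inv (el n) \<and> b = el n)" using n m ab(3) by metis+
      then show False using nr[OF n(1)] b conj_class_sym[OF ac b] by metis
    qed
  qed
  moreover have "card (?A1 \<union> ?A2) = card D + card (D - {2})"
    using fD by (simp add: card_Un_disjoint[OF _ _ disj] card_image[OF inj1] card_image[OF inj2])
  moreover have "card D = card P + 1" using npq fP by (simp add: D_def)
  moreover have "card (D - {2}) \<ge> card D - 1" using fD by (simp add: card_Diff_singleton_if)
  moreover have "card (Irr G) \<le> card {principal_character G, r1, r2} + 2 * card P"
  proof (rule card_Irr_le[OF tf _ _ fP])
    fix \<chi> assume c: "\<chi> \<in> Irr G - {principal_character G, r1, r2}"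
    then obtain p where p: "p \<in> prime_factors (card (carrier G))" "\<chi> \<in> chars_with p" using chars_with_exists by blast
    then have "p \<noteq> 3" using c r12(6) by auto
    then show "\<exists>p\<in>P. \<chi> \<in> chars_with p" using p by (auto simp: P_def)
  qed (use Pp in auto)
  moreover have "card {principal_character G, r1, r2} \<le> 3" by (simp add: card_insert_if)
  ultimately show False by linarith
qed

text \<open>There are at most five characters, so at most two classes in \<open>K\<close> besides that of \<open>\<one>\<close>. If \<open>a\<close> and \<open>b\<close>
  in \<open>K\<close> did not commute, then \<open>a\<close>, \<open>b\<close> and \<open>ab\<close> would lie in three different classes, because conjugate elements
  of \<open>K\<close> commute. So \<open>K\<close> is abelian, and \<open>|K| = 3 |Irr G| - 8\<close>.\<close>

lemma exponent3_structure: "\<exists>K x. split_by 3 K x \<and> card K \<in> {1, 4, 7}"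
proof -
  define P where "P = prime_factors (card (carrier G)) - {3}"
  have "card (Irr G) \<le> card {principal_character G, r1, r2} + 2 * card P"
  proof (rule card_Irr_le[OF tf])
    fix \<chi> assume c: "\<chi> \<in> Irr G - {principal_character G, r1, r2}"
    then obtain p where p: "p \<in> prime_factors (card (carrier G))" "\<chi> \<in> chars_with p" using chars_with_exists by blast
    then have "p \<noteq> 3" using c r12(6) by auto
    then show "\<exists>p\<in>P. \<chi> \<in> chars_with p" using p by (auto simp: P_def)
  qed (auto simp: P_def)
  moreover have "card {principal_character G, r1, r2} = 3" using r12 by (auto simp: card_insert_if)
  ultimately have I5: "card (Irr G) \<le> 5" using at_most_one_prime by (simp add: P_def)
  have "{principal_character G, r1, r2} \<subseteq> Irr G" using r12 by simp
  then have I3: "card (Irr G) \<ge> 3"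
    using card_mono[OF finite_Irr, of "{principal_character G, r1, r2}"] \<open>card {principal_character G, r1, r2} = 3\<close> by simp
  have KG: "K \<subseteq> carrier G" by (auto simp: K_def)
  have ab: "a \<otimes> b = b \<otimes> a" if "a \<in> K" "b \<in> K" for a b
  proof (rule ccontr)
    assume nc: "a \<otimes> b \<noteq> b \<otimes> a"
    have c: "a \<in> carrier G" "b \<in> carrier G" using that KG by auto
    have abK: "a \<otimes> b \<in> K" using that subgroup.m_closed[OF Ks] by blast
    have 1: "b \<notin> conj_class a" using conj_class_commute[OF that(1)] nc by blast
    have 2: "a \<otimes> b \<notin> conj_class a"
    proof
      assume "a \<otimes> b \<in> conj_class a"
      then have "a \<otimes> (a \<otimes> b) = a \<otimes> b \<otimes> a" by (rule conj_class_commute[OF that(1)])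
      then have "a \<otimes> (a \<otimes> b) = a \<otimes> (b \<otimes> a)" using c by (simp add: m_assoc)
      then show False using nc c by (metis l_cancel m_closed)
    qed
    have 3: "a \<otimes> b \<notin> conj_class b"
    proof
      assume "a \<otimes> b \<in> conj_class b"
      then have "b \<otimes> (a \<otimes> b) = a \<otimes> b \<otimes> b" by (rule conj_class_commute[OF that(2)])
      then have "(b \<otimes> a) \<otimes> b = (a \<otimes> b) \<otimes> b" using c by (simp add: m_assoc)
      then show False using nc c by (metis r_cancel m_closed)
    qed
    have "a \<noteq> \<one>" "b \<noteq> \<one>" "a \<noteq> b" using nc c by auto
    moreover have "a \<otimes> b \<noteq> \<one>" using nc c inv_comm by metis
    moreover have "a \<otimes> b \<noteq> a" "a \<otimes> b \<noteq> b" using \<open>a \<noteq> \<one>\<close> \<open>b \<noteq> \<one>\<close> c by auto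
    ultimately have "card {a, b, a \<otimes> b} = 3" "{a, b, a \<otimes> b} \<subseteq> K - {\<one>}" using that abK by (auto simp: card_insert_if)
    moreover have "card {a, b, a \<otimes> b} + 3 \<le> card (Irr G)"
      by (rule nonconj_bound[OF calculation(2)]) (use 1 2 3 c conj_class_sym in auto)
    ultimately show False using I5 by simp
  qed
  have "card (Irr G) * 3 = 3 + (card K - 1) + (3 - 1) * 3"
    by (rule card_Irr_split[OF Ks ab card_G]) (use outside_centralizer in auto)
  moreover have "card K > 0" using subgroup.one_closed[OF Ks] finite_subset[OF KG fin] by (auto simp: card_gt_0_iff)
  ultimately have k: "card K \<in> {1, 4, 7}" using I3 I5 by (simp add: numeral_eq_Suc) presburger
  obtain x where x: "x \<in> carrier G" "x \<noteq> \<one>" "x [^] (3::nat) = \<one>" using exists_order3 by blast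
  have "x \<notin> K" using order3(1)[OF x] by (simp add: K_def)
  then have "split_by 3 K x"
    unfolding split_by_def using Kn ab card_G x outside_centralizer(2)[OF x(1)] by auto
  then show ?thesis using k by blast
qed

end

end

subsection \<open>A character of order two\<close>

lemma odd_if_not_4_dvd: "\<not> 4 dvd 2 * m \<Longrightarrow> odd (m::nat)"
  by presburger

lemma three_power_le:
  assumes "odd (k::nat)"
  shows "3 ^ card (prime_factors k) \<le> k"
proof -
  have k: "k > 0" using assms by (auto intro: Nat.gr0I)
  have "3 ^ card (prime_factors k) = (\<Prod>p\<in>prime_factors k. 3)" by simp
  also have "\<dots> \<le> (\<Prod>p\<in>prime_factors k. p ^ multiplicity p k)"
  proof (rule prod_mono, intro conjI)
    fix p assume p: "p \<in> prime_factors k"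
    then have pp: "Factorial_Ring.prime p" "p dvd k" by (auto simp: prime_factors_dvd)
    then have "p \<noteq> 2" using assms by auto
    then have "p \<ge> 3" using prime_ge_2_nat[OF pp(1)] by auto
    also have "p \<le> p ^ multiplicity p k"
      using p pp by (intro self_le_power) (auto simp: prime_factors_multiplicity prime_ge_1_nat Suc_leI prime_gt_0_nat)
    finally show "3 \<le> p ^ multiplicity p k" .
  qed simp
  also have "\<dots> = k" using prime_factorization_nat[of k] k by simp
  finally show ?thesis .
qed

text \<open>An odd number with \<open>s\<close> prime factors is at least \<open>3^s\<close>, which exceeds \<open>4s + 1\<close> for \<open>s \<ge> 3\<close>.\<close>

lemma odd_few_primes:
  assumes odd: "odd (k::nat)" and le: "k \<le> 4 * card (prime_factors k) + 1"
  shows "k \<in> {1, 3, 5}"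
proof -
  define s where "s = card (prime_factors k)"
  have 3: "3 ^ s \<le> k" unfolding s_def by (rule three_power_le[OF odd])
  have "27 * 3 ^ n > 4 * n + (13::nat)" for n by (induction n) auto
  then have big: "3 ^ (n + 3) > 4 * (n + 3) + (1::nat)" for n by (simp add: power_add mult.commute add.commute)
  have "s < 3"
  proof (rule ccontr)
    assume "\<not> s < 3"
    then obtain n where "s = n + 3" by (metis add.commute le_iff_add not_less)
    then show False using big[of n] 3 le by (simp add: s_def[symmetric])
  qed
  moreover have "s \<noteq> 2"
  proof
    assume s2: "s = 2"
    then have "k \<le> 9" "k \<ge> 9" using le 3 by (simp_all add: s_def)
    then have k9: "k = 3 ^ 2" by simp
    have "p = 3" if "p \<in> prime_factors (3 ^ 2)" for p :: nat
    proof -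
      have p: "Factorial_Ring.prime p" "p dvd 3 ^ 2" using that in_prime_factors_imp_prime in_prime_factors_imp_dvd by blast+
      have "p dvd 3" by (rule prime_dvd_power[OF p])
      then show ?thesis by (rule primes_dvd_imp_eq[OF p(1), rotated]) simp
    qed
    then have "prime_factors k \<subseteq> {3}" unfolding k9 by blast
    then have "s \<le> 1" unfolding s_def using card_mono[of "{3}" "prime_factors k"] by simp
    then show False using s2 by simp
  qed
  ultimately have "k \<le> 5" using le by (simp add: s_def)
  then have "k = 0 \<or> k = 1 \<or> k = 2 \<or> k = 3 \<or> k = 4 \<or> k = 5" by auto
  then show ?thesis using odd by auto
qed

context fin_group
begin

text \<open>The left-hand side is \<open>|G / ker \<chi>|\<close>. This quotient is nontrivial and triangle-free, so it has a linear
  character of exponent 2, one of exponent 3 being excluded by inflation.\<close>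

lemma even_quotient_order:
  assumes tf: "triangle_free (codegree_graph G)" and no3: "\<not> (\<exists>f. linear_of_exponent 3 f)"
    and \<chi>: "\<chi> \<in> Irr G" "\<chi> \<noteq> principal_character G"
  shows "even (codegree G \<chi> * deg \<chi>)"
proof -
  define K where "K = character_kernel G \<chi>"
  have K: "K \<lhd> G" unfolding K_def by (rule kernel_normal[OF \<chi>(1)])
  interpret K: normal K G by fact
  interpret M: fin_group "G Mod K" by (rule fin_group_Mod[OF K])
  note h = hom_Mod[OF K]
  interpret h: group_hom G "G Mod K" "\<lambda>g. K #> g" using h(1) by unfold_locales
  have "codegree G \<chi> * deg \<chi> * card K = card (carrier (G Mod K)) * card K"
    using codegree[OF \<chi>(1)] card_Mod[OF K] by (simp add: K_def)
  then have cM: "codegree G \<chi> * deg \<chi> = card (carrier (G Mod K))" using card_kernel_pos[OF \<chi>(1)] by (simp add: K_def)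
  have "carrier (G Mod K) \<noteq> {\<one>\<^bsub>G Mod K\<^esub>}"
  proof
    assume "carrier (G Mod K) = {\<one>\<^bsub>G Mod K\<^esub>}"
    then have "codegree G \<chi> * deg \<chi> = 1" using cM by simp
    then show False using codegree_eq_1[OF \<chi>(1)] \<chi>(2) by simp
  qed
  then have "(\<exists>f. M.linear_of_exponent 2 f) \<or> (\<exists>f. M.linear_of_exponent 3 f)"
    by (rule M.linear_exponent_2_or_3[OF triangle_free_image[OF fin_group_axioms M.fin_group_axioms h tf]])
  moreover have "linear_of_exponent 3 (\<lambda>g. f (K #> g))" if f: "M.linear_of_exponent 3 f" for f
    unfolding linear_of_exponent_def
  proof (intro conjI ballI)
    show "f (K #> \<one>) = 1" using f h.hom_one by (simp add: M.linear_of_exponent_def)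
    obtain C where C: "C \<in> carrier (G Mod K)" "f C \<noteq> 1" using f by (auto simp: M.linear_of_exponent_def)
    then obtain g where "g \<in> carrier G" "C = K #> g" using h(2) by (metis imageE)
    then show "\<exists>g\<in>carrier G. f (K #> g) \<noteq> 1" using C(2) by blast
    fix g assume g: "g \<in> carrier G"
    show "f (K #> g) ^ 3 = 1" using f h.hom_closed[OF g] by (simp add: M.linear_of_exponent_def)
    fix g' assume g': "g' \<in> carrier G"
    have "K #> (g \<otimes> g') = (K #> g) \<otimes>\<^bsub>G Mod K\<^esub> (K #> g')" by (rule h.hom_mult[OF g g'])
    then show "f (K #> (g \<otimes> g')) = f (K #> g) * f (K #> g')"
      using f h.hom_closed[OF g] h.hom_closed[OF g'] by (simp add: M.linear_of_exponent_def)
  qed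
  ultimately obtain f where f: "M.linear_of_exponent 2 f" using no3 by blast
  then obtain C where C: "C \<in> carrier (G Mod K)" "f C \<noteq> 1" by (auto simp: M.linear_of_exponent_def)
  have "(f C)\<^sup>2 = 1" using f C(1) by (simp add: M.linear_of_exponent_def)
  then have m1: "f C = -1" using C(2) by (simp add: power2_eq_1_iff)
  have "f C ^ card (carrier (G Mod K)) = f (C [^]\<^bsub>G Mod K\<^esub> card (carrier (G Mod K)))"
    using f C(1) by (intro M.mult_pow[symmetric]) (auto simp: M.linear_of_exponent_def)
  also have "\<dots> = 1" using f M.pow_card_eq_one[OF C(1)] by (simp add: M.linear_of_exponent_def)
  finally have "(-1 :: complex) ^ card (carrier (G Mod K)) = 1" by (simp add: m1)
  then have "even (card (carrier (G Mod K)))" by (cases "even (card (carrier (G Mod K)))") auto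
  then show ?thesis by (simp add: cM)
qed

context
  fixes f :: "'a \<Rightarrow> complex"
  assumes tf: "triangle_free (codegree_graph G)" and f: "linear_of_exponent 2 f"
    and no3: "\<not> (\<exists>f. linear_of_exponent 3 f)"
begin

private definition r where "r = restrict f (carrier G)"
private definition Ker where "Ker = {g \<in> carrier G. f g = 1}"

private lemma r_facts: "r \<in> Irr G" "r \<noteq> principal_character G" "r \<in> chars_with 2" "deg r = 1"
  using linear_of_exponent_Irr[OF two_is_prime_nat f] by (auto simp: r_def chars_with_def)

private lemma f_sign: "g \<in> carrier G \<Longrightarrow> f g = 1 \<or> f g = -1"
  using f by (simp add: linear_of_exponent_def power2_eq_1_iff)

private lemma Ker_subgroup: "subgroup Ker G" and Ker_normal: "Ker \<lhd> G"
  unfolding Ker_def using linear_kernel_normal[OF f] normal_imp_subgroup by auto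

private lemma card_carrier: "card (carrier G) = 2 * card Ker"
  and fibre: "card {g \<in> carrier G. f g = -1} = card Ker"
proof -
  obtain x where x: "x \<in> carrier G" "f x \<noteq> 1" using f by (auto simp: linear_of_exponent_def)
  then have fx: "f x = -1" using f_sign by blast
  show 1: "card {g \<in> carrier G. f g = -1} = card Ker"
    unfolding Ker_def fx[symmetric] by (rule linear_fibre_card[OF f x(1)])
  have "carrier G = Ker \<union> {g \<in> carrier G. f g = -1}" using f_sign by (auto simp: Ker_def)
  moreover have "card (Ker \<union> {g \<in> carrier G. f g = -1}) = card Ker + card {g \<in> carrier G. f g = -1}"
    by (rule card_Un_disjoint) (auto simp: Ker_def)
  ultimately show "card (carrier G) = 2 * card Ker" using 1 by simp
qed

text \<open>As the product of degree and codegree is even, degrees of characters of odd codegree are even. Besides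
  \<open>r\<close> there is at most one character of even codegree, and its degree is even because \<open>|G| = \<Sum>\<chi>(1)\<^sup>2\<close>
  is.\<close>

private lemma even_deg:
  assumes "\<chi> \<in> Irr G" "\<chi> \<noteq> principal_character G" "\<chi> \<noteq> r"
  shows "even (deg \<chi>)"
proof -
  have ev: "even (deg \<psi>)" if "\<psi> \<in> Irr G" "\<psi> \<noteq> principal_character G" "\<psi> \<notin> chars_with 2" for \<psi>
    using even_quotient_order[OF tf no3 that(1,2)] that by (auto simp: chars_with_def)
  show ?thesis
  proof (cases "\<chi> \<in> chars_with 2")
    case True
    have S: "chars_with 2 = {r, \<chi>}"
      using card_seteq[of "chars_with 2" "{r, \<chi>}"] True r_facts(3) assms(3) card_chars_with[OF tf two_is_prime_nat] by auto
    define R where "R = Irr G - {principal_character G, r, \<chi>}"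
    have I: "Irr G = insert (principal_character G) (insert r (insert \<chi> R))"
      using assms r_facts by (auto simp: R_def)
    have "card (carrier G) = (\<Sum>\<chi>\<in>Irr G. (deg \<chi>)\<^sup>2)" by (rule sum_deg_squares[symmetric])
    also have "\<dots> = 1 + (1 + ((deg \<chi>)\<^sup>2 + (\<Sum>\<chi>\<in>R. (deg \<chi>)\<^sup>2)))"
      unfolding I using assms r_facts deg_principal by (subst sum.insert; simp add: R_def)+
    finally have e: "card (carrier G) = 2 + (deg \<chi>)\<^sup>2 + (\<Sum>\<chi>\<in>R. (deg \<chi>)\<^sup>2)" by simp
    have "even (\<Sum>\<chi>\<in>R. (deg \<chi>)\<^sup>2)" using ev S by (intro dvd_sum) (auto simp: R_def)
    moreover have "even (card (carrier G))" by (simp add: card_carrier)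
    ultimately have "even ((deg \<chi>)\<^sup>2)" unfolding e by simp
    then show ?thesis by simp
  qed (use ev assms in blast)
qed

private lemma card_carrier_mod_4: "\<not> 4 dvd card (carrier G)"
proof -
  define R where "R = Irr G - {principal_character G, r}"
  have I: "Irr G = insert (principal_character G) (insert r R)" using r_facts by (auto simp: R_def)
  have "card (carrier G) = (\<Sum>\<chi>\<in>Irr G. (deg \<chi>)\<^sup>2)" by (rule sum_deg_squares[symmetric])
  also have "\<dots> = 1 + (1 + (\<Sum>\<chi>\<in>R. (deg \<chi>)\<^sup>2))"
    unfolding I using r_facts deg_principal by (subst sum.insert; simp add: R_def)+
  finally have e: "card (carrier G) = 2 + (\<Sum>\<chi>\<in>R. (deg \<chi>)\<^sup>2)" by simp
  have "4 dvd (\<Sum>\<chi>\<in>R. (deg \<chi>)\<^sup>2)"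
  proof (rule dvd_sum)
    fix \<chi> assume "\<chi> \<in> R"
    then obtain d where "deg \<chi> = 2 * d" using even_deg[of \<chi>] by (auto simp: R_def elim: evenE)
    then show "4 dvd (deg \<chi>)\<^sup>2" by (simp add: power2_eq_square)
  qed
  then show ?thesis unfolding e by presburger
qed

private lemma odd_card_Ker: "odd (card Ker)"
  using card_carrier_mod_4 unfolding card_carrier by (rule odd_if_not_4_dvd)

private lemma other_odd:
  assumes "\<chi> \<in> Irr G" "\<chi> \<noteq> principal_character G" "\<chi> \<noteq> r"
  shows "odd (codegree G \<chi>)" "odd (card (character_kernel G \<chi>))"
proof -
  obtain d where d: "deg \<chi> = 2 * d" using even_deg[OF assms] by (auto elim: evenE)
  have e: "card (carrier G) = 2 * (codegree G \<chi> * d * card (character_kernel G \<chi>))"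
    using codegree[OF assms(1)] d by (simp add: mult_ac)
  have "odd (codegree G \<chi> * d * card (character_kernel G \<chi>))"
    using card_carrier_mod_4 unfolding e by (rule odd_if_not_4_dvd)
  then show "odd (codegree G \<chi>)" "odd (card (character_kernel G \<chi>))" by auto
qed

private lemma involution_odd_subgroup:
  assumes "subgroup H G" "odd (card H)" "t \<in> H" "t [^] (2::nat) = \<one>"
  shows "t = \<one>"
proof -
  have t: "t \<in> carrier G" by (rule subgroup.mem_carrier[OF assms(1,3)])
  have "ord t dvd card H" "ord t dvd 2" using subgroup_pow_card[OF assms(1,3)] assms(4) t by (simp_all add: pow_eq_id)
  then have "ord t = 1" using assms(2) by (metis dvd_trans two_is_prime_nat prime_nat_iff)
  then show ?thesis using ord_eq_1[OF t] by simp
qed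

text \<open>Normal subgroups of odd order contain no involution, so all characters but the two linear ones
  vanish at \<open>t\<close>.\<close>

private lemma order2:
  assumes t: "t \<in> carrier G" "t \<noteq> \<one>" "t [^] (2::nat) = \<one>"
  shows "f t = -1" "card (centralizer t) = 2"
proof -
  have "t \<notin> Ker" using involution_odd_subgroup[OF Ker_subgroup odd_card_Ker] t by blast
  then show ft: "f t = -1" using f_sign t by (auto simp: Ker_def)
  have z: "\<chi> t = 0" if "\<chi> \<in> Irr G - {principal_character G, r}" for \<chi>
  proof -
    have \<chi>: "\<chi> \<in> Irr G" "\<chi> \<noteq> principal_character G" "\<chi> \<noteq> r" using that by auto
    have "t \<notin> character_kernel G \<chi>"
      using involution_odd_subgroup[OF normal_imp_subgroup[OF kernel_normal[OF \<chi>(1)]] other_odd(2)[OF \<chi>]] t by blast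
    then have "\<chi> t \<noteq> \<chi> \<one>" using t by (simp add: character_kernel_def)
    then show ?thesis using vanish_outside_kernel[OF \<chi>(1) two_is_prime_nat _ t(1,3)] other_odd(1)[OF \<chi>] by blast
  qed
  have "real (card (centralizer t)) = (\<Sum>\<chi>\<in>Irr G. (cmod (\<chi> t))\<^sup>2)" using column_norm[OF t(1)] by simp
  also have "\<dots> = (\<Sum>\<chi>\<in>{principal_character G, r}. (cmod (\<chi> t))\<^sup>2)"
    using z r_facts by (intro sum.mono_neutral_right) auto
  also have "\<dots> = 2" using r_facts(2) t ft by (simp add: r_def)
  finally show "card (centralizer t) = 2" by simp
qed

private lemma exists_involution: "\<exists>t\<in>carrier G. t \<noteq> \<one> \<and> t [^] (2::nat) = \<one>"
  by (rule exists_prime_order_element[OF two_is_prime_nat]) (simp add: card_carrier)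

text \<open>The class of an involution has \<open>|G| / 2 = |Ker|\<close> elements, so it is the whole complement of \<open>Ker\<close>.\<close>

private lemma outside:
  assumes g: "g \<in> carrier G" "g \<notin> Ker"
  shows "g [^] (2::nat) = \<one>" "card (centralizer g) = 2" "y \<in> Ker \<Longrightarrow> y \<otimes> g = g \<otimes> y \<Longrightarrow> y = \<one>"
proof -
  obtain t where t: "t \<in> carrier G" "t \<noteq> \<one>" "t [^] (2::nat) = \<one>" using exists_involution by blast
  have "conj_class t = {g \<in> carrier G. f g = -1}"
  proof (rule card_seteq)
    show "conj_class t \<subseteq> {g \<in> carrier G. f g = -1}"
      using t linear_conj[OF f t(1)] order2(1)[OF t] by (auto simp: conj_class_def)
    show "card {g \<in> carrier G. f g = -1} \<le> card (conj_class t)"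
      using card_conj_class[OF t(1)] order2(2)[OF t] card_carrier fibre by simp
  qed simp
  then have "g \<in> conj_class t" using g f_sign by (auto simp: Ker_def)
  then show g2: "g [^] (2::nat) = \<one>" using conj_class_pow_one_iff[OF t(1)] t(3) by blast
  have g1: "g \<noteq> \<one>" using g subgroup.one_closed[OF Ker_subgroup] by blast
  show c2: "card (centralizer g) = 2" by (rule order2(2)[OF g(1) g1 g2])
  assume y: "y \<in> Ker" "y \<otimes> g = g \<otimes> y"
  have "{\<one>, g} \<subseteq> centralizer g" using g by (auto simp: centralizer_def)
  moreover have "finite (centralizer g)" by (simp add: centralizer_def)
  ultimately have "centralizer g = {\<one>, g}" using c2 g1 card_seteq[of "centralizer g" "{\<one>, g}"] by auto
  moreover have "y \<in> centralizer g" using y by (auto simp: centralizer_def Ker_def)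
  ultimately show "y = \<one>" using y g by auto
qed

text \<open>The involutions outside the kernel invert it elementwise, so it is abelian, and
  \<open>|Ker| = 2 |Irr G| - 3\<close>. There are at most two characters for each odd prime besides the two linear
  ones.\<close>

lemma exponent2_structure: "\<exists>K x. split_by 2 K x \<and> card K \<in> {1, 3, 5}"
proof -
  have KG: "Ker \<subseteq> carrier G" by (auto simp: Ker_def)
  obtain u where u: "u \<in> carrier G" "u \<notin> Ker"
    using exists_involution order2(1) by (auto simp: Ker_def)
  have inverts: "u \<otimes> a \<otimes> u = inv a" if a: "a \<in> Ker" for a
  proof -
    have ac: "a \<in> carrier G" using a KG by blast
    have "u \<otimes> a \<notin> Ker" using u a by (auto simp: Ker_def linear_mult[OF f])
    then have "(u \<otimes> a) \<otimes> (u \<otimes> a) = \<one>" using outside(1)[of "u \<otimes> a"] u ac by (simp add: numeral_2_eq_2)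
    then have "(u \<otimes> a \<otimes> u) \<otimes> a = \<one>" using u ac by (simp add: m_assoc)
    then show ?thesis using u ac by (simp add: inv_equality)
  qed
  have uu: "u \<otimes> u = \<one>" using outside(1)[OF u] u by (simp add: numeral_2_eq_2)
  have ab: "a \<otimes> b = b \<otimes> a" if ab: "a \<in> Ker" "b \<in> Ker" for a b
  proof -
    have c: "a \<in> carrier G" "b \<in> carrier G" using ab KG by auto
    have "inv (a \<otimes> b) = u \<otimes> (a \<otimes> b) \<otimes> u" using inverts[of "a \<otimes> b"] subgroup.m_closed[OF Ker_subgroup ab] by simp
    also have "\<dots> = u \<otimes> a \<otimes> (u \<otimes> u) \<otimes> b \<otimes> u" using u c by (simp add: uu m_assoc)
    also have "\<dots> = inv a \<otimes> inv b" using u c by (simp add: inverts[symmetric] ab m_assoc)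
    also have "\<dots> = inv (b \<otimes> a)" using c by (simp add: inv_mult_group)
    finally show ?thesis using c by (metis inv_inv m_closed)
  qed
  define P where "P = prime_factors (card (carrier G)) - {2}"
  have "card (Irr G) \<le> card {principal_character G, r} + 2 * card P"
  proof (rule card_Irr_le[OF tf])
    fix \<chi> assume c: "\<chi> \<in> Irr G - {principal_character G, r}"
    then obtain p where p: "p \<in> prime_factors (card (carrier G))" "\<chi> \<in> chars_with p" using chars_with_exists by blast
    moreover have "p \<noteq> 2" using c p(2) other_odd(1)[of \<chi>] by (auto simp: chars_with_def)
    ultimately show "\<exists>p\<in>P. \<chi> \<in> chars_with p" by (auto simp: P_def)
  qed (auto simp: P_def)
  then have I: "card (Irr G) \<le> 2 + 2 * card P" using r_facts(2) by (simp add: card_insert_if)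
  have "P \<subseteq> prime_factors (card Ker)"
  proof
    fix p assume "p \<in> P"
    then have p: "Factorial_Ring.prime p" "p dvd 2 * card Ker" "p \<noteq> 2" by (auto simp: P_def prime_factors_dvd card_carrier)
    then have "p dvd card Ker" using prime_dvd_mult_iff primes_dvd_imp_eq two_is_prime_nat by blast
    then show "p \<in> prime_factors (card Ker)" using p(1) odd_card_Ker by (cases "card Ker = 0") (simp_all add: prime_factors_dvd)
  qed
  then have "card P \<le> card (prime_factors (card Ker))" by (intro card_mono) auto
  moreover have "card (Irr G) * 2 = 2 + (card Ker - 1) + (2 - 1) * 2"
    by (rule card_Irr_split[OF Ker_subgroup ab card_carrier]) (use outside in auto)
  ultimately have "card Ker \<le> 4 * card (prime_factors (card Ker)) + 1" using I by simp
  then have k: "card Ker \<in> {1, 3, 5}" by (rule odd_few_primes[OF odd_card_Ker])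
  have "split_by 2 Ker u"
    unfolding split_by_def using Ker_normal ab card_carrier u outside[OF u] by auto
  then show ?thesis using k by blast
qed

end

theorem triangle_free_structure:
  assumes tf: "triangle_free (codegree_graph G)" and nt: "carrier G \<noteq> {\<one>}"
  shows "\<exists>K x. (split_by 2 K x \<and> card K \<in> {1, 3, 5}) \<or> (split_by 3 K x \<and> card K \<in> {1, 4, 7})"
proof (cases "\<exists>f. linear_of_exponent 3 f")
  case True
  then show ?thesis using exponent3_structure[OF tf] by blast
next
  case False
  then obtain f where "linear_of_exponent 2 f" using linear_exponent_2_or_3[OF tf nt] by blast
  then show ?thesis using exponent2_structure[OF tf _ False] by blast
qed

end

section \<open>Split groups\<close>

context fin_group
begin

lemma split_byD:
  assumes "split_by q K x"
  shows "K \<lhd> G" "subgroup K G" "\<And>a b. a \<in> K \<Longrightarrow> b \<in> K \<Longrightarrow> a \<otimes> b = b \<otimes> a" "card (carrier G) = q * card K"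
    "x \<in> carrier G" "x \<notin> K" "x [^] q = \<one>" "\<And>y. y \<in> K \<Longrightarrow> y \<otimes> x = x \<otimes> y \<Longrightarrow> y = \<one>"
    "K \<subseteq> carrier G" "finite K" "card K > 0"
proof -
  show n: "K \<lhd> G" and x: "x \<in> carrier G" "x \<notin> K" "x [^] q = \<one>" and c: "card (carrier G) = q * card K"
    and "\<And>a b. a \<in> K \<Longrightarrow> b \<in> K \<Longrightarrow> a \<otimes> b = b \<otimes> a" "\<And>y. y \<in> K \<Longrightarrow> y \<otimes> x = x \<otimes> y \<Longrightarrow> y = \<one>"
    using assms unfolding split_by_def by blast+
  show s: "subgroup K G" by (rule normal_imp_subgroup[OF n])
  then show K: "K \<subseteq> carrier G" by (rule subgroup.subset)
  then show "finite K" using fin by (rule finite_subset)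
  show "card K > 0" using c card_pos by (cases "card K") auto
qed

lemma power_in_subgroup_23:
  assumes q: "q \<in> {2, 3}" and K: "subgroup K G" and x: "x \<in> carrier G" "x \<notin> K" "x [^] q = \<one>" and d: "0 < d" "d < q"
  shows "x [^] (d::nat) \<notin> K"
proof
  assume m: "x [^] d \<in> K"
  have "d = 1 \<or> (d = 2 \<and> q = 3)" using q d by auto
  then show False
  proof
    assume "d = 1"
    then show False using m x by simp
  next
    assume dq: "d = 2 \<and> q = 3"
    then have "x [^] (2::nat) \<otimes> x = \<one>" using x by (simp add: numeral_3_eq_3 numeral_2_eq_2)
    then have "inv (x [^] (2::nat)) = x" using x by (metis inv_equality inv_inv nat_pow_closed)
    then show False using subgroup.m_inv_closed[OF K m] dq x by simp
  qed
qed

text \<open>No power of \<open>x\<close> between \<open>x\<close> and \<open>x^(q-1)\<close> lies in \<open>K\<close>, so the cosets \<open>K x^i\<close> are distinct.\<close>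

lemma split_bij:
  assumes q: "q \<in> {2, 3}" and K: "subgroup K G" and c: "card (carrier G) = q * card K"
    and x: "x \<in> carrier G" "x \<notin> K" "x [^] q = \<one>"
  shows "bij_betw (\<lambda>(k, i). k \<otimes> x [^] i) (K \<times> {..<q}) (carrier G)"
proof -
  have KG: "K \<subseteq> carrier G" using K by (rule subgroup.subset)
  have fK: "finite K" using KG fin by (rule finite_subset)
  have inj0: "i = j" if "k \<in> K" "k' \<in> K" "i \<le> j" "j < q" "k \<otimes> x [^] i = k' \<otimes> x [^] j" for k k' and i j :: nat
  proof (rule ccontr)
    assume ne: "i \<noteq> j"
    have kc: "k \<in> carrier G" "k' \<in> carrier G" using that KG by auto
    have "x [^] j = x [^] (j - i) \<otimes> x [^] i" using x that(3) by (simp add: nat_pow_mult)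
    then have "k \<otimes> x [^] i = (k' \<otimes> x [^] (j - i)) \<otimes> x [^] i" using that(5) x kc by (simp add: m_assoc)
    then have "k = k' \<otimes> x [^] (j - i)" by (rule r_cancel) (use x kc in auto)
    then have "inv k' \<otimes> k = x [^] (j - i)" using x kc by simp
    moreover have "inv k' \<otimes> k \<in> K" using that K by (simp add: subgroup.m_closed subgroup.m_inv_closed)
    moreover have "x [^] (j - i) \<notin> K" using ne that by (intro power_in_subgroup_23[OF q K x]) auto
    ultimately show False by simp
  qed
  have "inj_on (\<lambda>(k, i). k \<otimes> x [^] i) (K \<times> {..<q})"
  proof (rule inj_onI, clarsimp)
    fix k k' and i j :: nat
    assume a: "k \<in> K" "k' \<in> K" "i < q" "j < q" and e: "k \<otimes> x [^] i = k' \<otimes> x [^] j"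
    have "i = j"
    proof (cases "i \<le> j")
      case True
      then show ?thesis using inj0[OF a(1,2) _ a(4) e] by blast
    next
      case False
      then show ?thesis using inj0[OF a(2,1) _ a(3) e[symmetric]] by simp
    qed
    moreover have "k \<in> carrier G" "k' \<in> carrier G" using a KG by auto
    ultimately show "k = k' \<and> i = j" using e x by simp
  qed
  moreover have "(\<lambda>(k, i). k \<otimes> x [^] i) ` (K \<times> {..<q}) = carrier G"
  proof (rule card_seteq)
    show "(\<lambda>(k, i). k \<otimes> x [^] i) ` (K \<times> {..<q}) \<subseteq> carrier G" using KG x by auto
    show "card (carrier G) \<le> card ((\<lambda>(k, i). k \<otimes> x [^] i) ` (K \<times> {..<q}))"
      using card_image[OF calculation] c by (simp add: card_cartesian_product mult.commute)
  qed simp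
  ultimately show ?thesis by (simp add: bij_betw_def)
qed

text \<open>Normality need only be checked for \<open>x\<close>, since \<open>K\<close> is abelian and \<open>G\<close> consists of the \<open>k x^i\<close>.\<close>

lemma split_byI:
  assumes q: "q \<in> {2, 3}" and K: "subgroup K G" and ab: "\<And>a b. a \<in> K \<Longrightarrow> b \<in> K \<Longrightarrow> a \<otimes> b = b \<otimes> a"
    and c: "card (carrier G) = q * card K" and x: "x \<in> carrier G" "x \<notin> K" "x [^] q = \<one>"
    and nrm: "\<And>k. k \<in> K \<Longrightarrow> x \<otimes> k \<otimes> inv x \<in> K" and fpf: "\<And>y. y \<in> K \<Longrightarrow> y \<otimes> x = x \<otimes> y \<Longrightarrow> y = \<one>"
  shows "split_by q K x"
proof -
  have KG: "K \<subseteq> carrier G" using K by (rule subgroup.subset)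
  have "K \<lhd> G"
  proof (rule normal_invI[OF K])
    fix g h assume g: "g \<in> carrier G" and h: "h \<in> K"
    have "g \<in> (\<lambda>(k, i). k \<otimes> x [^] i) ` (K \<times> {..<q})" using split_bij[OF q K c x] g by (simp add: bij_betw_def)
    then obtain k i where k: "k \<in> K" "g = k \<otimes> x [^] (i::nat)" by auto
    have hc: "h \<in> carrier G" "k \<in> carrier G" using h k KG by auto
    have xi: "x [^] i \<otimes> h \<otimes> inv (x [^] i) \<in> K" for i :: nat
    proof (induction i)
      case (Suc i)
      have "x [^] Suc i \<otimes> h \<otimes> inv (x [^] Suc i) = x \<otimes> (x [^] i \<otimes> h \<otimes> inv (x [^] i)) \<otimes> inv x"
        using x hc by (simp only: nat_pow_Suc2[OF x(1)]) (simp add: m_assoc inv_mult_group)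
      then show ?case using nrm[OF Suc] by simp
    qed (use h hc in simp)
    have "g \<otimes> h \<otimes> inv g = k \<otimes> (x [^] i \<otimes> h \<otimes> inv (x [^] i)) \<otimes> inv k"
      using k(2) x hc by (simp add: m_assoc inv_mult_group)
    then show "g \<otimes> h \<otimes> inv g \<in> K"
      using xi[of i] k(1) subgroup.m_closed[OF K] subgroup.m_inv_closed[OF K] by simp
  qed
  then show ?thesis unfolding split_by_def using assms by blast
qed

lemma pow_mod:
  assumes "y \<in> carrier G" "y [^] n = \<one>"
  shows "y [^] (m mod n :: nat) = y [^] m"
proof -
  have "y [^] m = y [^] (n * (m div n) + m mod n)" by simp
  also have "\<dots> = (y [^] n) [^] (m div n) \<otimes> y [^] (m mod n)" using assms(1) by (simp only: nat_pow_mult[symmetric] nat_pow_pow)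
  finally show ?thesis using assms by simp
qed

lemma split_normal: "split_by q K x \<Longrightarrow> g \<in> carrier G \<Longrightarrow> k \<in> K \<Longrightarrow> g \<otimes> k \<otimes> inv g \<in> K"
  using normal_invE(2)[OF split_byD(1)] by blast

subsection \<open>Split groups are triangle-free\<close>

text \<open>As \<open>x\<close> centralizes no nontrivial element of \<open>K\<close>, its centralizer embeds into \<open>G/K\<close>.\<close>

lemma split_centralizer_le:
  assumes s: "split_by q K x"
  shows "card (centralizer x) \<le> q"
proof -
  note S = split_byD[OF s]
  have "inj_on (\<lambda>c. K #> c) (centralizer x)"
  proof (rule inj_onI)
    fix c d assume cd: "c \<in> centralizer x" "d \<in> centralizer x" "K #> c = K #> d"
    then have cc: "c \<in> carrier G" "d \<in> carrier G" by (auto simp: centralizer_def)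
    have "c \<in> K #> d" using rcos_self[OF cc(1) S(2)] cd(3) by simp
    then obtain k where k: "k \<in> K" "c = k \<otimes> d" unfolding r_coset_def by auto
    have kc: "k \<in> carrier G" using k S(9) by blast
    have "k = c \<otimes> inv d" using k cc kc by (simp add: m_assoc)
    then have "k \<in> centralizer x"
      using cd subgroup.m_closed[OF centralizer_subgroup[OF S(5)]] subgroup.m_inv_closed[OF centralizer_subgroup[OF S(5)]] by simp
    then have "k = \<one>" using S(8)[OF k(1)] by (simp add: centralizer_def)
    then show "c = d" using k cc by simp
  qed
  then have "card (centralizer x) \<le> card (carrier (G Mod K))"
    by (rule card_inj_on_le) (auto simp: FactGroup_def RCOSETS_def centralizer_def)
  moreover have "card (carrier (G Mod K)) * card K = q * card K" using card_Mod[OF S(1)] S(4) by simp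
  ultimately show ?thesis using S(11) by simp
qed

lemma linear_norm_one:
  assumes \<chi>: "\<chi> \<in> Irr G" "deg \<chi> = 1" and g: "g \<in> carrier G"
  shows "cmod (\<chi> g) = 1"
proof -
  have one: "\<chi> \<one> = 1" using deg[OF \<chi>(1)] \<chi>(2) by simp
  have "\<chi> g * \<chi> (inv g) = 1" using deg_one_mult[OF \<chi> g inv_closed[OF g]] g one by simp
  then have "complex_of_real ((cmod (\<chi> g))\<^sup>2) = complex_of_real 1" by (simp only: Irr_inverse[OF \<chi>(1) g] complex_norm_square) simp
  then have "(cmod (\<chi> g))\<^sup>2 = 1" by (simp only: of_real_eq_iff)
  then show ?thesis by (simp add: power2_eq_1_iff) (metis norm_ge_zero not_one_le_zero neg_0_le_iff_le order_trans zero_le_one)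
qed

lemma deg_eq_1_if_small:
  assumes "card (carrier G) < 4" "\<chi> \<in> Irr G"
  shows "deg \<chi> = 1"
proof -
  have "(deg \<chi>)\<^sup>2 \<le> card (carrier G)"
    unfolding sum_deg_squares[symmetric] using assms by (intro member_le_sum) auto
  then have "(deg \<chi>)\<^sup>2 < 2\<^sup>2" using assms by simp
  then have "deg \<chi> < 2" by (rule power_less_imp_less_base) simp
  then show ?thesis using deg_pos[OF assms(2)] by simp
qed

text \<open>The \<open>q\<close> linear characters inflated from \<open>G/K\<close> already exhaust the column norm of \<open>x\<close>, so
  the other characters vanish_outside_kernel at \<open>x\<close> and are nonlinear; their squared degrees sum to \<open>q(|K| - 1)\<close>,
  which leaves at most two of them, all of degree \<open>q\<close>. Their codegrees divide \<open>|K|\<close> and those of the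
  linear characters divide \<open>q\<close>, so the two kinds are never adjacent, and each kind has at most two
  nonprincipal members.\<close>

lemma split_triangle_free:
  assumes s: "split_by q K x" and qk: "(q, card K) \<in> {(2, 1), (2, 3), (2, 5), (3, 1), (3, 4), (3, 7)}"
  shows "triangle_free (codegree_graph G)"
proof -
  note S = split_byD[OF s]
  interpret M: fin_group "G Mod K" by (rule fin_group_Mod[OF S(1)])
  have cM: "card (carrier (G Mod K)) = q" using card_Mod[OF S(1)] S(4,11) by simp
  have q4: "q < 4" using qk by auto
  define L where "L = inflate G (\<lambda>g. K #> g) ` Irr (G Mod K)"
  note i = inflate_Irr[OF fin_group_axioms M.fin_group_axioms hom_Mod[OF S(1)]]
  have dM: "M.deg \<psi> = 1" if "\<psi> \<in> Irr (G Mod K)" for \<psi> using M.deg_eq_1_if_small that cM q4 by simp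
  have "card (Irr (G Mod K)) = q" using M.sum_deg_squares dM cM by simp
  moreover have "inj_on (inflate G (\<lambda>g. K #> g)) (Irr (G Mod K))"
    using inflate_inj[OF M.fin_group_axioms hom_Mod(2)[OF S(1)]] by (auto simp: inj_on_def)
  ultimately have cL: "card L = q" by (simp add: L_def card_image)
  have LI: "L \<subseteq> Irr G" using i(1) by (auto simp: L_def)
  have dL: "deg \<chi> = 1" if "\<chi> \<in> L" for \<chi> using that i(3) dM by (auto simp: L_def)
  have aL: "codegree G \<chi> dvd q" if "\<chi> \<in> L" for \<chi> using that i(2) M.codegree_dvd cM by (auto simp: L_def)
  have fL: "finite L" using LI by (rule finite_subset) simp
  have pL: "principal_character G \<in> L"
  proof -
    have "inflate G (\<lambda>g. K #> g) (principal_character (G Mod K)) = principal_character G" using i(4)[OF M.principal_Irr] by simp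
    then show ?thesis unfolding L_def by (metis M.principal_Irr imageI)
  qed
  define R where "R = Irr G - L"
  have fR: "finite R" by (simp add: R_def)
  have "real (card (centralizer x)) = (\<Sum>\<chi>\<in>R. (cmod (\<chi> x))\<^sup>2) + (\<Sum>\<chi>\<in>L. (cmod (\<chi> x))\<^sup>2)"
    unfolding column_norm[OF S(5), symmetric] R_def using LI by (intro sum.subset_diff) auto
  also have "(\<Sum>\<chi>\<in>L. (cmod (\<chi> x))\<^sup>2) = (\<Sum>\<chi>\<in>L. 1)"
    using linear_norm_one[OF _ dL S(5)] LI by (intro sum.cong) (auto simp: subset_iff)
  also have "\<dots> = real q" by (simp add: cL)
  finally have "(\<Sum>\<chi>\<in>R. (cmod (\<chi> x))\<^sup>2) \<le> 0" using split_centralizer_le[OF s] by simp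
  then have "(\<Sum>\<chi>\<in>R. (cmod (\<chi> x))\<^sup>2) = 0" by (simp add: antisym sum_nonneg)
  then have zR: "\<chi> x = 0" if "\<chi> \<in> R" for \<chi> using that fR by (simp add: sum_nonneg_eq_0_iff)
  have dR2: "deg \<chi> \<ge> 2" if "\<chi> \<in> R" for \<chi>
  proof -
    have "deg \<chi> \<noteq> 1" using linear_norm_one[of \<chi> x] zR[OF that] that S(5) by (auto simp: R_def)
    then show ?thesis using deg_pos[of \<chi>] that by (auto simp: R_def)
  qed
  have "(\<Sum>\<chi>\<in>Irr G. (deg \<chi>)\<^sup>2) = (\<Sum>\<chi>\<in>R. (deg \<chi>)\<^sup>2) + (\<Sum>\<chi>\<in>L. (deg \<chi>)\<^sup>2)"
    unfolding R_def using LI by (intro sum.subset_diff) auto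
  then have sumR: "(\<Sum>\<chi>\<in>R. (deg \<chi>)\<^sup>2) = q * card K - q"
    using sum_deg_squares S(4) by (simp add: dL cL)
  have le: "(deg \<chi>)\<^sup>2 \<le> q * card K - q" if "\<chi> \<in> R" for \<chi>
    unfolding sumR[symmetric] using that fR by (intro member_le_sum) auto
  have dvd: "deg \<chi> dvd q * card K" if "\<chi> \<in> R" for \<chi> using deg_dvd[of \<chi>] that S(4) by (simp add: R_def)
  have sm: "deg \<chi> \<in> {2, 3, 4}" if "\<chi> \<in> R" for \<chi>
  proof -
    have "q * card K - q < 25" using qk by auto
    then have "(deg \<chi>)\<^sup>2 < 5\<^sup>2" using le[OF that] by simp
    then have "deg \<chi> < 5" by (rule power_less_imp_less_base) simp
    then show ?thesis using dR2[OF that] by auto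
  qed
  have dR: "deg \<chi> = q" if c: "\<chi> \<in> R" for \<chi>
  proof -
    consider "(q, card K) = (2, 1)" | "(q, card K) = (2, 3)" | "(q, card K) = (2, 5)" | "(q, card K) = (3, 1)" | "(q, card K) = (3, 4)" | "(q, card K) = (3, 7)"
      using qk by auto
    then show ?thesis
    proof cases
      \<comment> \<open>For \<open>|G| = 12\<close> the squared degrees sum to 9, so degree 2 would force all of them to be 2.\<close>
      case 5
      then have "deg \<chi> \<noteq> 4" using le[OF c] by auto
      moreover have "deg \<chi> \<noteq> 2"
      proof
        assume d2: "deg \<chi> = 2"
        have "deg \<psi> = 2" if \<psi>: "\<psi> \<in> R" for \<psi>
        proof (rule ccontr)
          assume n: "deg \<psi> \<noteq> 2"
          then have "\<psi> \<noteq> \<chi>" using d2 by auto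
          then have "(\<Sum>\<chi>\<in>{\<psi>, \<chi>}. (deg \<chi>)\<^sup>2) \<le> (\<Sum>\<chi>\<in>R. (deg \<chi>)\<^sup>2)" using c \<psi> fR by (intro sum_mono2) auto
          then show False using \<open>\<psi> \<noteq> \<chi>\<close> sm[OF \<psi>] n d2 sumR 5 by auto
        qed
        then have "(\<Sum>\<chi>\<in>R. (deg \<chi>)\<^sup>2) = 4 * card R" by simp
        then have "4 * card R = 9" using sumR 5 by simp
        then show False by presburger
      qed
      ultimately show ?thesis using sm[OF c] 5 by auto
    qed (use sm[OF c] le[OF c] dvd[OF c] in auto)
  qed
  then have "q\<^sup>2 * card R = q * card K - q" using sumR by (simp add: mult.commute)
  then have cR: "card R \<le> 2" using qk by auto
  have aR: "codegree G \<chi> dvd card K" if "\<chi> \<in> R" for \<chi>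
  proof -
    have "q * (codegree G \<chi> * card (character_kernel G \<chi>)) = q * card K"
      using codegree[of \<chi>] dR[OF that] that S(4) by (simp add: R_def mult_ac)
    then have "codegree G \<chi> * card (character_kernel G \<chi>) = card K" using qk by auto
    then show ?thesis by (metis dvd_triv_left)
  qed
  have cop: "gcd (codegree G \<chi>) (codegree G \<psi>) = 1" if "\<chi> \<in> L" "\<psi> \<in> R" for \<chi> \<psi>
  proof -
    have "gcd (codegree G \<chi>) (codegree G \<psi>) dvd gcd q (card K)" using aL[OF that(1)] aR[OF that(2)] by (meson gcd_mono)
    moreover have "gcd 2 (3::nat) = 1" "gcd 2 (5::nat) = 1" "gcd 3 (4::nat) = 1" "gcd 3 (7::nat) = 1"
      by (simp_all add: gcd_non_0_nat)
    then have "gcd q (card K) = 1" using qk by fastforce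
    ultimately show ?thesis by simp
  qed
  show ?thesis
    unfolding triangle_free_iff
  proof
    assume "\<exists>T. codegree_triangle G T"
    then obtain T where "codegree_triangle G T" ..
    then have T: "T \<subseteq> Irr G - {principal_character G}" "card T = 3"
      and adj: "\<And>\<chi> \<psi>. \<chi> \<in> T \<Longrightarrow> \<psi> \<in> T \<Longrightarrow> \<chi> \<noteq> \<psi> \<Longrightarrow> gcd (codegree G \<chi>) (codegree G \<psi>) \<noteq> 1"
      unfolding codegree_triangle_def by simp_all
    show False
    proof (cases "\<exists>\<chi>\<in>T. \<chi> \<in> L")
      case True
      then obtain \<chi> where \<chi>: "\<chi> \<in> T" "\<chi> \<in> L" by blast
      have "T \<subseteq> L - {principal_character G}"
      proof
        fix \<psi> assume \<psi>: "\<psi> \<in> T"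
        have "\<psi> \<notin> R"
        proof
          assume r: "\<psi> \<in> R"
          then have "\<chi> \<noteq> \<psi>" using \<chi>(2) unfolding R_def by blast
          then show False using adj[OF \<chi>(1) \<psi>] cop[OF \<chi>(2) r] by blast
        qed
        then show "\<psi> \<in> L - {principal_character G}" using \<psi> T(1) unfolding R_def by blast
      qed
      then have "card T \<le> card (L - {principal_character G})" using fL by (intro card_mono) auto
      moreover have "card (L - {principal_character G}) = q - 1" using card_Diff_singleton[OF pL] cL by simp
      ultimately show False using T(2) q4 by linarith
    next
      case False
      then have "T \<subseteq> R" using T(1) unfolding R_def by blast
      then have "card T \<le> card R" using fR by (intro card_mono) auto
      then show False using T(2) cR by linarith
    qed
  qed
qed

end

subsection \<open>Split groups with the same invariants are isomorphic\<close>

text \<open>The isomorphism sends \<open>k x^i\<close> to \<open>\<theta>(k) x'^i\<close>.\<close>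

lemma split_iso:
  assumes G: "fin_group G" and H: "fin_group H" and q: "q \<in> {2, 3}"
    and s: "fin_group.split_by G q K x" and s': "fin_group.split_by H q K' x'"
    and \<theta>: "bij_betw \<theta> K K'" "\<And>a b. a \<in> K \<Longrightarrow> b \<in> K \<Longrightarrow> \<theta> (a \<otimes>\<^bsub>G\<^esub> b) = \<theta> a \<otimes>\<^bsub>H\<^esub> \<theta> b"
      "\<And>a. a \<in> K \<Longrightarrow> \<theta> (x \<otimes>\<^bsub>G\<^esub> a \<otimes>\<^bsub>G\<^esub> inv\<^bsub>G\<^esub> x) = x' \<otimes>\<^bsub>H\<^esub> \<theta> a \<otimes>\<^bsub>H\<^esub> inv\<^bsub>H\<^esub> x'"
  shows "G \<cong> H"
proof -
  interpret G: fin_group G by fact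
  interpret H: fin_group H by fact
  note S = G.split_byD[OF s] and S' = H.split_byD[OF s']
  define \<alpha> where "\<alpha> = (\<lambda>(k, i). k \<otimes>\<^bsub>G\<^esub> x [^]\<^bsub>G\<^esub> (i::nat))"
  define \<beta> where "\<beta> = (\<lambda>(k, i). \<theta> k \<otimes>\<^bsub>H\<^esub> x' [^]\<^bsub>H\<^esub> (i::nat))"
  have ba: "bij_betw \<alpha> (K \<times> {..<q}) (carrier G)" unfolding \<alpha>_def by (rule G.split_bij[OF q S(2,4,5,6,7)])
  have "bij_betw (\<lambda>(k, i). (\<theta> k, i)) (K \<times> {..<q}) (K' \<times> {..<q})"
    using \<theta>(1) by (auto simp: bij_betw_def inj_on_def image_def)
  from bij_betw_trans[OF this H.split_bij[OF q S'(2,4,5,6,7)]]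
  have bb: "bij_betw \<beta> (K \<times> {..<q}) (carrier H)"
    unfolding \<beta>_def by (rule bij_betw_cong[THEN iffD1, rotated]) auto
  define \<phi> where "\<phi> = \<beta> \<circ> inv_into (K \<times> {..<q}) \<alpha>"
  have b: "bij_betw \<phi> (carrier G) (carrier H)"
    unfolding \<phi>_def by (rule bij_betw_trans[OF bij_betw_inv_into[OF ba] bb])
  have \<phi>\<alpha>: "\<phi> (\<alpha> p) = \<beta> p" if "p \<in> K \<times> {..<q}" for p
    using that ba by (simp add: \<phi>_def bij_betw_def)
  have \<theta>K: "\<theta> a \<in> carrier H" "\<theta> a \<in> K'" if "a \<in> K" for a using \<theta>(1) that S'(9) by (auto simp: bij_betw_def)
  have act: "x [^]\<^bsub>G\<^esub> i \<otimes>\<^bsub>G\<^esub> a \<otimes>\<^bsub>G\<^esub> inv\<^bsub>G\<^esub> (x [^]\<^bsub>G\<^esub> i) \<in> K"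
    "\<theta> (x [^]\<^bsub>G\<^esub> i \<otimes>\<^bsub>G\<^esub> a \<otimes>\<^bsub>G\<^esub> inv\<^bsub>G\<^esub> (x [^]\<^bsub>G\<^esub> i)) = x' [^]\<^bsub>H\<^esub> i \<otimes>\<^bsub>H\<^esub> \<theta> a \<otimes>\<^bsub>H\<^esub> inv\<^bsub>H\<^esub> (x' [^]\<^bsub>H\<^esub> i)"
    if a: "a \<in> K" for a and i :: nat
  proof (induction i)
    case 0
    show "x [^]\<^bsub>G\<^esub> (0::nat) \<otimes>\<^bsub>G\<^esub> a \<otimes>\<^bsub>G\<^esub> inv\<^bsub>G\<^esub> (x [^]\<^bsub>G\<^esub> (0::nat)) \<in> K"
      "\<theta> (x [^]\<^bsub>G\<^esub> (0::nat) \<otimes>\<^bsub>G\<^esub> a \<otimes>\<^bsub>G\<^esub> inv\<^bsub>G\<^esub> (x [^]\<^bsub>G\<^esub> (0::nat))) = x' [^]\<^bsub>H\<^esub> (0::nat) \<otimes>\<^bsub>H\<^esub> \<theta> a \<otimes>\<^bsub>H\<^esub> inv\<^bsub>H\<^esub> (x' [^]\<^bsub>H\<^esub> (0::nat))"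
      using a S(9) \<theta>K[OF a] by auto
  next
    case (Suc i)
    have ac: "a \<in> carrier G" using a S(9) by blast
    let ?c = "x [^]\<^bsub>G\<^esub> i \<otimes>\<^bsub>G\<^esub> a \<otimes>\<^bsub>G\<^esub> inv\<^bsub>G\<^esub> (x [^]\<^bsub>G\<^esub> i)"
    have e: "x [^]\<^bsub>G\<^esub> Suc i \<otimes>\<^bsub>G\<^esub> a \<otimes>\<^bsub>G\<^esub> inv\<^bsub>G\<^esub> (x [^]\<^bsub>G\<^esub> Suc i) = x \<otimes>\<^bsub>G\<^esub> ?c \<otimes>\<^bsub>G\<^esub> inv\<^bsub>G\<^esub> x"
      using S(5) ac by (simp only: G.nat_pow_Suc2) (simp add: G.m_assoc G.inv_mult_group)
    have e': "x' [^]\<^bsub>H\<^esub> Suc i \<otimes>\<^bsub>H\<^esub> \<theta> a \<otimes>\<^bsub>H\<^esub> inv\<^bsub>H\<^esub> (x' [^]\<^bsub>H\<^esub> Suc i) =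
        x' \<otimes>\<^bsub>H\<^esub> (x' [^]\<^bsub>H\<^esub> i \<otimes>\<^bsub>H\<^esub> \<theta> a \<otimes>\<^bsub>H\<^esub> inv\<^bsub>H\<^esub> (x' [^]\<^bsub>H\<^esub> i)) \<otimes>\<^bsub>H\<^esub> inv\<^bsub>H\<^esub> x'"
      using S'(5) \<theta>K(1)[OF a] by (simp only: H.nat_pow_Suc2) (simp add: H.m_assoc H.inv_mult_group)
    show "x [^]\<^bsub>G\<^esub> Suc i \<otimes>\<^bsub>G\<^esub> a \<otimes>\<^bsub>G\<^esub> inv\<^bsub>G\<^esub> (x [^]\<^bsub>G\<^esub> Suc i) \<in> K"
      unfolding e by (rule G.split_normal[OF s S(5) Suc(1)])
    show "\<theta> (x [^]\<^bsub>G\<^esub> Suc i \<otimes>\<^bsub>G\<^esub> a \<otimes>\<^bsub>G\<^esub> inv\<^bsub>G\<^esub> (x [^]\<^bsub>G\<^esub> Suc i)) = x' [^]\<^bsub>H\<^esub> Suc i \<otimes>\<^bsub>H\<^esub> \<theta> a \<otimes>\<^bsub>H\<^esub> inv\<^bsub>H\<^esub> (x' [^]\<^bsub>H\<^esub> Suc i)"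
      unfolding e e' \<theta>(3)[OF Suc(1)] Suc(2) ..
  qed
  have q0: "q > 0" using q by auto
  have pm: "x [^]\<^bsub>G\<^esub> (n mod q) = x [^]\<^bsub>G\<^esub> n" "x' [^]\<^bsub>H\<^esub> (n mod q) = x' [^]\<^bsub>H\<^esub> n" for n :: nat
    by (rule G.pow_mod[OF S(5,7)], rule H.pow_mod[OF S'(5,7)])
  have "\<phi> (g \<otimes>\<^bsub>G\<^esub> h) = \<phi> g \<otimes>\<^bsub>H\<^esub> \<phi> h" if gh: "g \<in> carrier G" "h \<in> carrier G" for g h
  proof -
    have "g \<in> \<alpha> ` (K \<times> {..<q})" "h \<in> \<alpha> ` (K \<times> {..<q})" using ba gh by (simp_all add: bij_betw_def)
    then obtain k i l j where k: "k \<in> K" "i < q" "g = \<alpha> (k, i)" and l: "l \<in> K" "j < q" "h = \<alpha> (l, j)" by blast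
    let ?c = "x [^]\<^bsub>G\<^esub> i \<otimes>\<^bsub>G\<^esub> l \<otimes>\<^bsub>G\<^esub> inv\<^bsub>G\<^esub> (x [^]\<^bsub>G\<^esub> i)"
    have kl: "k \<in> carrier G" "l \<in> carrier G" using k l S(9) by auto
    have c: "?c \<in> K" by (rule act(1)[OF l(1)])
    have kc: "k \<otimes>\<^bsub>G\<^esub> ?c \<in> K" using subgroup.m_closed[OF S(2) k(1) c] .
    have "g \<otimes>\<^bsub>G\<^esub> h = k \<otimes>\<^bsub>G\<^esub> ?c \<otimes>\<^bsub>G\<^esub> x [^]\<^bsub>G\<^esub> (i + j)"
      using kl S(5) by (simp add: k l \<alpha>_def G.m_assoc G.nat_pow_mult[symmetric])
    also have "\<dots> = \<alpha> (k \<otimes>\<^bsub>G\<^esub> ?c, (i + j) mod q)" by (simp add: \<alpha>_def pm)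
    finally have "\<phi> (g \<otimes>\<^bsub>G\<^esub> h) = \<beta> (k \<otimes>\<^bsub>G\<^esub> ?c, (i + j) mod q)" using \<phi>\<alpha>[of "(k \<otimes>\<^bsub>G\<^esub> ?c, (i + j) mod q)"] kc q0 by simp
    also have "\<dots> = \<theta> k \<otimes>\<^bsub>H\<^esub> (x' [^]\<^bsub>H\<^esub> i \<otimes>\<^bsub>H\<^esub> \<theta> l \<otimes>\<^bsub>H\<^esub> inv\<^bsub>H\<^esub> (x' [^]\<^bsub>H\<^esub> i)) \<otimes>\<^bsub>H\<^esub> x' [^]\<^bsub>H\<^esub> (i + j)"
      by (simp add: \<beta>_def pm \<theta>(2)[OF k(1) c] act(2)[OF l(1)])
    also have "\<dots> = \<beta> (k, i) \<otimes>\<^bsub>H\<^esub> \<beta> (l, j)"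
      using \<theta>K(1)[OF k(1)] \<theta>K(1)[OF l(1)] S'(5) by (simp add: \<beta>_def H.m_assoc H.nat_pow_mult[symmetric])
    finally show ?thesis using \<phi>\<alpha>[of "(k, i)"] \<phi>\<alpha>[of "(l, j)"] k l by simp
  qed
  then have "\<phi> \<in> iso G H" using b by (auto simp: iso_def hom_def bij_betw_def)
  then show ?thesis by (rule is_isoI)
qed

context fin_group
begin

lemma cyclic_bij:
  assumes K: "subgroup K G" and y: "y \<in> K" "ord y = card K"
  shows "bij_betw (\<lambda>i. y [^] (i::nat)) {..<card K} K"
proof -
  have KG: "K \<subseteq> carrier G" using K by (rule subgroup.subset)
  have fK: "finite K" using KG fin by (rule finite_subset)
  have yc: "y \<in> carrier G" using y KG by blast
  have k: "card K > 0" using y fK by (auto simp: card_gt_0_iff)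
  have "{0..card K - 1} = {..<card K}" using k by auto
  then have inj: "inj_on (\<lambda>i. y [^] (i::nat)) {..<card K}" using ord_inj[OF yc] y(2) by simp
  have pK: "y [^] i \<in> K" for i :: nat
    using K y by (induction i) (auto simp: subgroup.one_closed subgroup.m_closed)
  have "(\<lambda>i. y [^] (i::nat)) ` {..<card K} = K"
    by (rule card_seteq[OF fK]) (use pK card_image[OF inj] in auto)
  then show ?thesis using inj by (simp add: bij_betw_def)
qed

lemma prime_subgroup_generator:
  assumes K: "subgroup K G" and p: "card K = 1 \<or> Factorial_Ring.prime (card K)"
  shows "\<exists>y\<in>K. ord y = card K"
proof (cases "card K = 1")
  case True
  then have "ord \<one> = card K" by simp
  then show ?thesis using subgroup.one_closed[OF K] by blast
next
  case False
  then have pr: "Factorial_Ring.prime (card K)" using p by blast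
  then have "K \<noteq> {\<one>}" by auto
  then obtain y where y: "y \<in> K" "y \<noteq> \<one>" using subgroup.one_closed[OF K] by blast
  then have "ord y = card K"
    using ord_prime[OF pr _ y(2) subgroup_pow_card[OF K y(1)]] subgroup.mem_carrier[OF K] by blast
  then show ?thesis using y by blast
qed

lemma prime_subgroup_commute:
  assumes K: "subgroup K G" and p: "card K = 1 \<or> Factorial_Ring.prime (card K)" and ab: "a \<in> K" "b \<in> K"
  shows "a \<otimes> b = b \<otimes> a"
proof -
  obtain y where y: "y \<in> K" "ord y = card K" using prime_subgroup_generator[OF K p] by blast
  have yc: "y \<in> carrier G" by (rule subgroup.mem_carrier[OF K y(1)])
  have "a \<in> (\<lambda>i. y [^] (i::nat)) ` {..<card K}" "b \<in> (\<lambda>i. y [^] (i::nat)) ` {..<card K}"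
    using cyclic_bij[OF K y] ab by (simp_all add: bij_betw_def)
  then obtain i j :: nat where "a = y [^] i" "b = y [^] j" by blast
  then show ?thesis using yc by (simp add: nat_pow_mult add.commute)
qed

text \<open>For \<open>q = 2\<close>, the element \<open>y \<cdot> xyx\<^sup>-\<^sup>1\<close> is fixed by \<open>x\<close>, hence trivial.\<close>

lemma split_2_generator:
  assumes s: "split_by 2 K x" and p: "card K = 1 \<or> Factorial_Ring.prime (card K)"
  shows "\<exists>y\<in>K. ord y = card K \<and> x \<otimes> y \<otimes> inv x = y [^] (card K - 1)"
proof -
  note S = split_byD[OF s]
  obtain y where y: "y \<in> K" "ord y = card K" using prime_subgroup_generator[OF S(2) p] by blast
  have yc: "y \<in> carrier G" using y S(9) by blast
  have xx: "x \<otimes> x = \<one>" using S(5,7) by (simp add: numeral_2_eq_2)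
  then have ix: "inv x = x" using S(5) by (simp add: inv_equality)
  define z where "z = x \<otimes> y \<otimes> inv x"
  have z: "z \<in> K" unfolding z_def by (rule split_normal[OF s S(5) y(1)])
  have zc: "z \<in> carrier G" using z S(9) by blast
  have xz: "x \<otimes> z = y \<otimes> x" and xy: "x \<otimes> y = z \<otimes> x"
    using S(5) yc by (simp_all add: z_def ix m_assoc[symmetric] xx) (simp add: m_assoc xx)
  have "(y \<otimes> z) \<otimes> x = (z \<otimes> y) \<otimes> x" using S(3)[OF y(1) z] by simp
  also have "\<dots> = z \<otimes> (x \<otimes> z)" using zc yc S(5) by (simp add: m_assoc xz)
  also have "\<dots> = x \<otimes> (y \<otimes> z)" using zc yc S(5) by (simp add: m_assoc[symmetric] xy)
  finally have "y \<otimes> z = \<one>" using S(8) subgroup.m_closed[OF S(2) y(1) z] by blast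
  moreover have "y \<otimes> y [^] (card K - 1) = \<one>"
  proof -
    have "y \<otimes> y [^] (card K - 1) = y [^] Suc (card K - 1)" using yc by (simp only: nat_pow_Suc2)
    also have "\<dots> = \<one>" using S(11) subgroup_pow_card[OF S(2) y(1)] by simp
    finally show ?thesis .
  qed
  ultimately have "z = y [^] (card K - 1)" using zc yc by (metis l_cancel nat_pow_closed)
  then show ?thesis using y by (auto simp: z_def)
qed

lemma split_inverse:
  assumes s: "split_by q K x"
  shows "split_by q K (inv x)"
proof -
  note S = split_byD[OF s]
  have "y = \<one>" if y: "y \<in> K" "y \<otimes> inv x = inv x \<otimes> y" for y
  proof -
    have yc: "y \<in> carrier G" using y S(9) by blast
    have "x \<otimes> (y \<otimes> inv x) \<otimes> x = x \<otimes> (inv x \<otimes> y) \<otimes> x" by (simp only: y(2))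
    then have "y \<otimes> x = x \<otimes> y" using yc S(5) by (simp add: m_assoc)
    then show ?thesis by (rule S(8)[OF y(1)])
  qed
  moreover have "inv x \<notin> K"
    using subgroup.m_inv_closed[OF S(2), of "inv x"] S(5,6) by auto
  moreover have "inv x [^] q = \<one>" using S(5,7) by (simp add: nat_pow_inv)
  ultimately show ?thesis using S(1-5) unfolding split_by_def by auto
qed

text \<open>An automorphism of order 3 of a cyclic group of order 7 is multiplication by 2 or by 4, and
  its inverse is the other of the two.\<close>

lemma split_3_generator:
  assumes s: "split_by 3 K x" and p: "card K \<in> {1, 7}"
  shows "\<exists>x' y. split_by 3 K x' \<and> y \<in> K \<and> ord y = card K \<and> x' \<otimes> y \<otimes> inv x' = y [^] (2::nat)"
proof -
  note S = split_byD[OF s]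
  have pr: "card K = 1 \<or> Factorial_Ring.prime (card K)" using p by auto
  obtain y where y: "y \<in> K" "ord y = card K" using prime_subgroup_generator[OF S(2) pr] by blast
  have yc: "y \<in> carrier G" using y S(9) by blast
  show ?thesis
  proof (cases "card K = 1")
    case True
    then have "y = \<one>" using y(2) ord_eq_1[OF yc] by simp
    then show ?thesis using s y S(5) by (intro exI[of _ x] exI[of _ y]) simp
  next
    case False
    then have k7: "card K = 7" using p by simp
    note cb = cyclic_bij[OF S(2) y]
    have z: "x \<otimes> y \<otimes> inv x \<in> K" by (rule split_normal[OF s S(5) y(1)])
    then have "x \<otimes> y \<otimes> inv x \<in> (\<lambda>i. y [^] (i::nat)) ` {..<7}" using cb k7 by (simp add: bij_betw_def)
    then obtain t where t: "t < 7" "x \<otimes> y \<otimes> inv x = y [^] (t::nat)" by auto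
    have y7: "y [^] (7::nat) = \<one>" using subgroup_pow_card[OF S(2) y(1)] k7 by simp
    have act: "x \<otimes> y [^] i \<otimes> inv x = y [^] (t * i)" for i :: nat
      using conj_pow[OF S(5) yc, of i] t(2) yc by (simp add: nat_pow_pow)
    have "y [^] (1::nat) = (x [^] (3::nat)) \<otimes> y \<otimes> inv (x [^] (3::nat))" using S(5,7) yc by simp
    also have "\<dots> = x \<otimes> (x \<otimes> (x \<otimes> y \<otimes> inv x) \<otimes> inv x) \<otimes> inv x"
      using S(5) yc by (simp add: numeral_3_eq_3 m_assoc inv_mult_group)
    also have "\<dots> = y [^] (t * (t * t))" by (simp only: t(2) act)
    also have "\<dots> = y [^] ((t * (t * t)) mod 7)" by (rule pow_mod[OF yc y7, symmetric])
    finally have e: "y [^] (1::nat) = y [^] ((t * (t * t)) mod 7)" .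
    have "1 = (t * (t * t)) mod 7"
      by (rule inj_onD[OF bij_betw_imp_inj_on[OF cb] e]) (use k7 in auto)
    moreover have "t = 0 \<or> t = 1 \<or> t = 2 \<or> t = 3 \<or> t = 4 \<or> t = 5 \<or> t = 6" using t(1) by auto
    ultimately have "t = 1 \<or> t = 2 \<or> t = 4" by auto
    moreover have "t \<noteq> 1"
    proof
      assume "t = 1"
      then have "x \<otimes> y \<otimes> inv x = y" using t(2) yc by simp
      then have "y \<otimes> x = x \<otimes> y" using S(5) yc by (metis inv_solve_right m_closed)
      then have "y = \<one>" by (rule S(8)[OF y(1)])
      then show False using y(2) k7 by simp
    qed
    ultimately consider "t = 2" | "t = 4" by blast
    then show ?thesis
    proof cases
      case 1
      then show ?thesis using s y t(2) by auto
    next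
      case 2
      have x3: "x \<otimes> (x \<otimes> x) = \<one>" using S(5,7) by (simp add: numeral_3_eq_3 m_assoc)
      then have ix: "inv x = x \<otimes> x" using S(5) by (metis inv_comm inv_equality m_closed)
      have iix: "inv (x \<otimes> x) = inv x \<otimes> inv x" using S(5) by (simp add: inv_mult_group)
      have "inv x \<otimes> y \<otimes> inv (inv x) = x \<otimes> (x \<otimes> y \<otimes> inv x) \<otimes> inv x"
      proof -
        have "inv x \<otimes> y \<otimes> inv (inv x) = (x \<otimes> x) \<otimes> y \<otimes> inv (x \<otimes> x)" by (simp only: ix)
        then show ?thesis using S(5) yc by (simp add: iix m_assoc)
      qed
      also have "\<dots> = y [^] (16::nat)" by (simp only: t(2) act 2) simp
      also have "\<dots> = y [^] (16 mod 7 :: nat)" by (rule pow_mod[OF yc y7, symmetric])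
      finally have "inv x \<otimes> y \<otimes> inv (inv x) = y [^] (2::nat)" by simp
      then show ?thesis using split_inverse[OF s] y by blast
    qed
  qed
qed

text \<open>The three nontrivial elements are permuted cyclically by \<open>x\<close>, so their product is fixed by \<open>x\<close> and therefore
  trivial.\<close>

lemma split_3_klein:
  assumes s: "split_by 3 K x" and k4: "card K = 4"
  shows "\<exists>a b c. K = {\<one>, a, b, c} \<and> distinct [\<one>, a, b, c] \<and>
    x \<otimes> a \<otimes> inv x = b \<and> x \<otimes> b \<otimes> inv x = c \<and> x \<otimes> c \<otimes> inv x = a \<and>
    a \<otimes> a = \<one> \<and> b \<otimes> b = \<one> \<and> c \<otimes> c = \<one> \<and> a \<otimes> b = c \<and> b \<otimes> c = a \<and> c \<otimes> a = b"
proof -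
  note S = split_byD[OF s]
  have "K \<noteq> {\<one>}" using k4 by auto
  then obtain a where a: "a \<in> K" "a \<noteq> \<one>" using subgroup.one_closed[OF S(2)] by blast
  define \<phi> where "\<phi> k = x \<otimes> k \<otimes> inv x" for k
  have \<phi>K: "\<phi> k \<in> K" if "k \<in> K" for k unfolding \<phi>_def by (rule split_normal[OF s S(5) that])
  have \<phi>m: "\<phi> (k \<otimes> l) = \<phi> k \<otimes> \<phi> l" if "k \<in> K" "l \<in> K" for k l
    using that S(5,9) unfolding \<phi>_def by (simp add: subset_iff m_assoc)
  have \<phi>3: "\<phi> (\<phi> (\<phi> k)) = k" if "k \<in> K" for k
  proof -
    have kc: "k \<in> carrier G" using that S(9) by blast
    have "\<phi> (\<phi> (\<phi> k)) = (x [^] (3::nat)) \<otimes> k \<otimes> inv (x [^] (3::nat))"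
      using S(5) kc by (simp add: \<phi>_def numeral_3_eq_3 m_assoc inv_mult_group)
    then show ?thesis using S(7) kc by simp
  qed
  have \<phi>f: "k = \<one>" if "k \<in> K" "\<phi> k = k" for k
  proof -
    have kc: "k \<in> carrier G" using that S(9) by blast
    have "k \<otimes> x = x \<otimes> k" using that(2) S(5) kc unfolding \<phi>_def by (metis inv_solve_right m_closed)
    then show ?thesis by (rule S(8)[OF that(1)])
  qed
  have \<phi>1: "\<phi> \<one> = \<one>" using S(5) by (simp add: \<phi>_def)
  define b where "b = \<phi> a"
  define c where "c = \<phi> b"
  have bK: "b \<in> K" and cK: "c \<in> K" using a \<phi>K by (auto simp: b_def c_def)
  have ca: "\<phi> c = a" using \<phi>3[OF a(1)] by (simp add: b_def c_def)
  have carr: "a \<in> carrier G" "b \<in> carrier G" "c \<in> carrier G" using a bK cK S(9) by auto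
  have ab: "a \<noteq> b" using \<phi>f[OF a(1)] a(2) by (auto simp: b_def)
  have bc: "b \<noteq> c" using ab ca \<phi>3[OF a(1)] by (metis b_def c_def)
  have ac: "a \<noteq> c" using ab ca by (metis b_def)
  have b1: "b \<noteq> \<one>" using \<phi>1 ca c_def a(2) by metis
  have c1: "c \<noteq> \<one>" using \<phi>1 ca a(2) by metis
  have d: "distinct [\<one>, a, b, c]" using ab bc ac b1 c1 a(2) by auto
  have KE: "K = {\<one>, a, b, c}"
  proof (rule card_seteq[OF S(10), symmetric])
    show "{\<one>, a, b, c} \<subseteq> K" using a bK cK subgroup.one_closed[OF S(2)] by auto
    show "card K \<le> card {\<one>, a, b, c}" using d k4 by simp
  qed
  have abK: "a \<otimes> b \<in> K" using subgroup.m_closed[OF S(2) a(1) bK] .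
  have "\<phi> (a \<otimes> b \<otimes> c) = b \<otimes> c \<otimes> a" using \<phi>m[OF abK cK] \<phi>m[OF a(1) bK] ca by (simp add: b_def[symmetric] c_def[symmetric])
  also have "\<dots> = a \<otimes> b \<otimes> c" using S(3)[OF a(1) subgroup.m_closed[OF S(2) bK cK]] carr by (simp add: m_assoc)
  finally have abc: "a \<otimes> b \<otimes> c = \<one>" using \<phi>f subgroup.m_closed[OF S(2) abK cK] by blast
  have "a \<otimes> b \<noteq> \<one>" using abc c1 carr by auto
  moreover have "a \<otimes> b \<noteq> a" "a \<otimes> b \<noteq> b" using carr b1 a(2) by auto
  ultimately have pab: "a \<otimes> b = c" using abK KE by auto
  then have pbc: "b \<otimes> c = a" using \<phi>m[OF a(1) bK] ca by (simp add: b_def[symmetric] c_def[symmetric])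
  then have pca: "c \<otimes> a = b" using \<phi>m[OF bK cK] ca by (simp add: b_def[symmetric] c_def[symmetric])
  have cc: "c \<otimes> c = \<one>" using abc pab by simp
  then have aa: "a \<otimes> a = \<one>" using \<phi>m[OF cK cK] ca \<phi>1 by simp
  then have bb: "b \<otimes> b = \<one>" using \<phi>m[OF a(1) a(1)] \<phi>1 by (simp add: b_def[symmetric])
  show ?thesis
    using KE d aa bb cc pab pbc pca ca by (intro exI[of _ a] exI[of _ b] exI[of _ c]) (auto simp: b_def c_def \<phi>_def)
qed

end

text \<open>A cyclic \<open>K\<close> is mapped by sending the generator \<open>y\<close> to \<open>y'\<close>, which is compatible with the actions
  because both are the \<open>t\<close>-th power map.\<close>

lemma cyclic_split_iso:
  assumes G: "fin_group G" and H: "fin_group H" and q: "q \<in> {2, 3}"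
    and s: "fin_group.split_by G q K x" and s': "fin_group.split_by H q K' x'" and k: "card K' = card K"
    and y: "y \<in> K" "group.ord G y = card K" "x \<otimes>\<^bsub>G\<^esub> y \<otimes>\<^bsub>G\<^esub> inv\<^bsub>G\<^esub> x = y [^]\<^bsub>G\<^esub> (t::nat)"
    and y': "y' \<in> K'" "group.ord H y' = card K'" "x' \<otimes>\<^bsub>H\<^esub> y' \<otimes>\<^bsub>H\<^esub> inv\<^bsub>H\<^esub> x' = y' [^]\<^bsub>H\<^esub> t"
  shows "G \<cong> H"
proof -
  interpret G: fin_group G by fact
  interpret H: fin_group H by fact
  note S = G.split_byD[OF s] and S' = H.split_byD[OF s']
  let ?n = "card K"
  have yc: "y \<in> carrier G" "y' \<in> carrier H" using y y' S(9) S'(9) by auto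
  have yn: "y [^]\<^bsub>G\<^esub> ?n = \<one>\<^bsub>G\<^esub>" "y' [^]\<^bsub>H\<^esub> ?n = \<one>\<^bsub>H\<^esub>"
    using G.subgroup_pow_card[OF S(2) y(1)] H.subgroup_pow_card[OF S'(2) y'(1)] k by auto
  have b: "bij_betw (\<lambda>i. y [^]\<^bsub>G\<^esub> (i::nat)) {..<?n} K" by (rule G.cyclic_bij[OF S(2) y(1,2)])
  have b': "bij_betw (\<lambda>i. y' [^]\<^bsub>H\<^esub> (i::nat)) {..<?n} K'" using H.cyclic_bij[OF S'(2) y'(1,2)] k by simp
  define \<theta> where "\<theta> = (\<lambda>i. y' [^]\<^bsub>H\<^esub> (i::nat)) \<circ> inv_into {..<?n} (\<lambda>i. y [^]\<^bsub>G\<^esub> (i::nat))"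
  have b\<theta>: "bij_betw \<theta> K K'" unfolding \<theta>_def by (rule bij_betw_trans[OF bij_betw_inv_into[OF b] b'])
  have \<theta>: "\<theta> (y [^]\<^bsub>G\<^esub> i) = y' [^]\<^bsub>H\<^esub> i" for i :: nat
  proof -
    have "i mod ?n \<in> {..<?n}" using S(11) by simp
    then have "\<theta> (y [^]\<^bsub>G\<^esub> (i mod ?n)) = y' [^]\<^bsub>H\<^esub> (i mod ?n)"
      unfolding \<theta>_def comp_def using inv_into_f_f[OF bij_betw_imp_inj_on[OF b]] by simp
    then show ?thesis by (simp add: G.pow_mod[OF yc(1) yn(1)] H.pow_mod[OF yc(2) yn(2)])
  qed
  have pw: "\<exists>i::nat. a = y [^]\<^bsub>G\<^esub> i" if "a \<in> K" for a
  proof -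
    have "a \<in> (\<lambda>i. y [^]\<^bsub>G\<^esub> (i::nat)) ` {..<?n}" using b that by (simp add: bij_betw_def)
    then show ?thesis by blast
  qed
  show ?thesis
  proof (rule split_iso[OF G H q s s' b\<theta>])
    fix a b assume "a \<in> K" "b \<in> K"
    then obtain i j :: nat where "a = y [^]\<^bsub>G\<^esub> i" "b = y [^]\<^bsub>G\<^esub> j" using pw by blast
    then show "\<theta> (a \<otimes>\<^bsub>G\<^esub> b) = \<theta> a \<otimes>\<^bsub>H\<^esub> \<theta> b" using yc by (simp add: G.nat_pow_mult H.nat_pow_mult \<theta>)
  next
    fix a assume "a \<in> K"
    then obtain i :: nat where i: "a = y [^]\<^bsub>G\<^esub> i" using pw by blast
    have "x \<otimes>\<^bsub>G\<^esub> a \<otimes>\<^bsub>G\<^esub> inv\<^bsub>G\<^esub> x = y [^]\<^bsub>G\<^esub> (t * i)"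
      unfolding i using G.conj_pow[OF S(5) yc(1), of i] yc by (simp add: y(3) G.nat_pow_pow)
    moreover have "x' \<otimes>\<^bsub>H\<^esub> \<theta> a \<otimes>\<^bsub>H\<^esub> inv\<^bsub>H\<^esub> x' = y' [^]\<^bsub>H\<^esub> (t * i)"
      unfolding i \<theta> using H.conj_pow[OF S'(5) yc(2), of i] yc by (simp add: y'(3) H.nat_pow_pow)
    ultimately show "\<theta> (x \<otimes>\<^bsub>G\<^esub> a \<otimes>\<^bsub>G\<^esub> inv\<^bsub>G\<^esub> x) = x' \<otimes>\<^bsub>H\<^esub> \<theta> a \<otimes>\<^bsub>H\<^esub> inv\<^bsub>H\<^esub> x'" by (simp add: \<theta>)
  qed
qed

text \<open>For \<open>q = 2\<close> the action is inversion; for \<open>|K| = 7\<close> the generator of order 3 can be chosen to act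
  as squaring; for \<open>|K| = 4\<close> it permutes the three involutions cyclically.\<close>

lemma split_unique:
  assumes G: "fin_group G" and H: "fin_group H"
    and qk: "(q, card K) \<in> {(2, 1), (2, 3), (2, 5), (3, 1), (3, 4), (3, 7)}"
    and s: "fin_group.split_by G q K x" and s': "fin_group.split_by H q K' x'" and k: "card K' = card K"
  shows "G \<cong> H"
proof -
  interpret G: fin_group G by fact
  interpret H: fin_group H by fact
  consider (two) "q = 2" "card K = 1 \<or> Factorial_Ring.prime (card K)" | (three) "q = 3" "card K \<in> {1, 7}" | (klein) "q = 3" "card K = 4"
    using qk by auto
  then show ?thesis
  proof cases
    case two
    obtain y where y: "y \<in> K" "G.ord y = card K" "x \<otimes>\<^bsub>G\<^esub> y \<otimes>\<^bsub>G\<^esub> inv\<^bsub>G\<^esub> x = y [^]\<^bsub>G\<^esub> (card K - 1)"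
      using G.split_2_generator[of K x] s two by blast
    obtain y' where y': "y' \<in> K'" "H.ord y' = card K'" "x' \<otimes>\<^bsub>H\<^esub> y' \<otimes>\<^bsub>H\<^esub> inv\<^bsub>H\<^esub> x' = y' [^]\<^bsub>H\<^esub> (card K - 1)"
      using H.split_2_generator[of K' x'] s' two k by auto
    show ?thesis by (rule cyclic_split_iso[OF G H _ s s' k y y']) (use two in simp)
  next
    case three
    obtain x1 y where y: "G.split_by q K x1" "y \<in> K" "G.ord y = card K" "x1 \<otimes>\<^bsub>G\<^esub> y \<otimes>\<^bsub>G\<^esub> inv\<^bsub>G\<^esub> x1 = y [^]\<^bsub>G\<^esub> (2::nat)"
      using G.split_3_generator[of K x] s three by blast
    obtain x2 y' where y': "H.split_by q K' x2" "y' \<in> K'" "H.ord y' = card K'" "x2 \<otimes>\<^bsub>H\<^esub> y' \<otimes>\<^bsub>H\<^esub> inv\<^bsub>H\<^esub> x2 = y' [^]\<^bsub>H\<^esub> (2::nat)"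
      using H.split_3_generator[of K' x'] s' three k by auto
    show ?thesis by (rule cyclic_split_iso[OF G H _ y(1) y'(1) k y(2-4) y'(2-4)]) (use three in simp)
  next
    case klein
    have s3: "G.split_by 3 K x" "H.split_by 3 K' x'" "card K' = 4" using s s' klein k by auto
    obtain a b c where g: "K = {\<one>\<^bsub>G\<^esub>, a, b, c} \<and> distinct [\<one>\<^bsub>G\<^esub>, a, b, c] \<and>
      x \<otimes>\<^bsub>G\<^esub> a \<otimes>\<^bsub>G\<^esub> inv\<^bsub>G\<^esub> x = b \<and> x \<otimes>\<^bsub>G\<^esub> b \<otimes>\<^bsub>G\<^esub> inv\<^bsub>G\<^esub> x = c \<and> x \<otimes>\<^bsub>G\<^esub> c \<otimes>\<^bsub>G\<^esub> inv\<^bsub>G\<^esub> x = a \<and>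
      a \<otimes>\<^bsub>G\<^esub> a = \<one>\<^bsub>G\<^esub> \<and> b \<otimes>\<^bsub>G\<^esub> b = \<one>\<^bsub>G\<^esub> \<and> c \<otimes>\<^bsub>G\<^esub> c = \<one>\<^bsub>G\<^esub> \<and> a \<otimes>\<^bsub>G\<^esub> b = c \<and> b \<otimes>\<^bsub>G\<^esub> c = a \<and> c \<otimes>\<^bsub>G\<^esub> a = b"
      using G.split_3_klein[OF s3(1) klein(2)] by blast
    obtain a' b' c' where h: "K' = {\<one>\<^bsub>H\<^esub>, a', b', c'} \<and> distinct [\<one>\<^bsub>H\<^esub>, a', b', c'] \<and>
      x' \<otimes>\<^bsub>H\<^esub> a' \<otimes>\<^bsub>H\<^esub> inv\<^bsub>H\<^esub> x' = b' \<and> x' \<otimes>\<^bsub>H\<^esub> b' \<otimes>\<^bsub>H\<^esub> inv\<^bsub>H\<^esub> x' = c' \<and> x' \<otimes>\<^bsub>H\<^esub> c' \<otimes>\<^bsub>H\<^esub> inv\<^bsub>H\<^esub> x' = a' \<and>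
      a' \<otimes>\<^bsub>H\<^esub> a' = \<one>\<^bsub>H\<^esub> \<and> b' \<otimes>\<^bsub>H\<^esub> b' = \<one>\<^bsub>H\<^esub> \<and> c' \<otimes>\<^bsub>H\<^esub> c' = \<one>\<^bsub>H\<^esub> \<and> a' \<otimes>\<^bsub>H\<^esub> b' = c' \<and> b' \<otimes>\<^bsub>H\<^esub> c' = a' \<and> c' \<otimes>\<^bsub>H\<^esub> a' = b'"
      using H.split_3_klein[OF s3(2,3)] by blast
    note S = G.split_byD[OF s] and S' = H.split_byD[OF s']
    have gc: "a \<in> carrier G" "b \<in> carrier G" "c \<in> carrier G" using g S(9) by auto
    have hc: "a' \<in> carrier H" "b' \<in> carrier H" "c' \<in> carrier H" using h S'(9) by auto
    have g2: "b \<otimes>\<^bsub>G\<^esub> a = c" "c \<otimes>\<^bsub>G\<^esub> b = a" "a \<otimes>\<^bsub>G\<^esub> c = b"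
      using S(3)[of b a] S(3)[of c b] S(3)[of a c] g by auto
    have h2: "b' \<otimes>\<^bsub>H\<^esub> a' = c'" "c' \<otimes>\<^bsub>H\<^esub> b' = a'" "a' \<otimes>\<^bsub>H\<^esub> c' = b'"
      using S'(3)[of b' a'] S'(3)[of c' b'] S'(3)[of a' c'] h by auto
    define \<theta> where "\<theta> z = (if z = a then a' else if z = b then b' else if z = c then c' else \<one>\<^bsub>H\<^esub>)" for z
    have \<theta>: "\<theta> \<one>\<^bsub>G\<^esub> = \<one>\<^bsub>H\<^esub>" "\<theta> a = a'" "\<theta> b = b'" "\<theta> c = c'" using g by (auto simp: \<theta>_def)
    show ?thesis
    proof (rule split_iso[OF G H _ s s', of \<theta>])
      show "q \<in> {2, 3}" using klein by simp
      have "inj_on \<theta> K" using g h by (auto simp: inj_on_def \<theta>)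
      moreover have "\<theta> ` K = K'" using g h by (auto simp: \<theta>)
      ultimately show "bij_betw \<theta> K K'" by (simp add: bij_betw_def)
      fix u assume "u \<in> K"
      then consider "u = \<one>\<^bsub>G\<^esub>" | "u = a" | "u = b" | "u = c" using g by blast
      then show "\<theta> (x \<otimes>\<^bsub>G\<^esub> u \<otimes>\<^bsub>G\<^esub> inv\<^bsub>G\<^esub> x) = x' \<otimes>\<^bsub>H\<^esub> \<theta> u \<otimes>\<^bsub>H\<^esub> inv\<^bsub>H\<^esub> x'"
        by cases (use g h S(5) S'(5) in \<open>simp_all add: \<theta>\<close>)
      note u = this
    next
      fix u v assume uv: "u \<in> K" "v \<in> K"
      have uc: "u = \<one>\<^bsub>G\<^esub> \<or> u = a \<or> u = b \<or> u = c" and vc: "v = \<one>\<^bsub>G\<^esub> \<or> v = a \<or> v = b \<or> v = c" using uv g by blast+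
      have gm: "a \<otimes>\<^bsub>G\<^esub> a = \<one>\<^bsub>G\<^esub>" "b \<otimes>\<^bsub>G\<^esub> b = \<one>\<^bsub>G\<^esub>" "c \<otimes>\<^bsub>G\<^esub> c = \<one>\<^bsub>G\<^esub>" "a \<otimes>\<^bsub>G\<^esub> b = c" "b \<otimes>\<^bsub>G\<^esub> c = a" "c \<otimes>\<^bsub>G\<^esub> a = b"
        using g by auto
      have hm: "a' \<otimes>\<^bsub>H\<^esub> a' = \<one>\<^bsub>H\<^esub>" "b' \<otimes>\<^bsub>H\<^esub> b' = \<one>\<^bsub>H\<^esub>" "c' \<otimes>\<^bsub>H\<^esub> c' = \<one>\<^bsub>H\<^esub>" "a' \<otimes>\<^bsub>H\<^esub> b' = c'" "b' \<otimes>\<^bsub>H\<^esub> c' = a'" "c' \<otimes>\<^bsub>H\<^esub> a' = b'"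
        using h by auto
      show "\<theta> (u \<otimes>\<^bsub>G\<^esub> v) = \<theta> u \<otimes>\<^bsub>H\<^esub> \<theta> v"
        using uc vc by (elim disjE) (simp_all only: \<theta> gm hm g2 h2 G.l_one G.r_one H.l_one H.r_one gc hc G.one_closed H.one_closed)
    qed
  qed
qed

section \<open>The six groups\<close>

lemma split_integer_mod_group:
  assumes q: "q \<in> {2, 3}"
  shows "fin_group (integer_mod_group q)" "fin_group.split_by (integer_mod_group q) q {0} 1"
proof -
  show F: "fin_group (integer_mod_group q)" using q by (intro fin_groupI) (auto simp: carrier_integer_mod_group)
  interpret fin_group "integer_mod_group q" by fact
  have c: "card (carrier (integer_mod_group q)) = q" using q by (auto simp: carrier_integer_mod_group)
  show "split_by q {0} 1"
  proof (rule split_byI[OF q])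
    show "subgroup {0} (integer_mod_group q)" using triv_subgroup by simp
    have "1 \<in> carrier (integer_mod_group q)" using q by auto
    then show "1 [^]\<^bsub>integer_mod_group q\<^esub> q = \<one>\<^bsub>integer_mod_group q\<^esub>" using pow_card_eq_one[of 1] c by simp
    show "1 \<in> carrier (integer_mod_group q)" "1 \<notin> {0::int}" by fact simp
    show "card (carrier (integer_mod_group q)) = q * card {0::int}" using c by simp
    fix k :: int assume "k \<in> {0}"
    then have k: "k = \<one>\<^bsub>integer_mod_group q\<^esub>" by simp
    then show "k = \<one>\<^bsub>integer_mod_group q\<^esub>" .
    have "1 \<otimes>\<^bsub>integer_mod_group q\<^esub> k \<otimes>\<^bsub>integer_mod_group q\<^esub> inv\<^bsub>integer_mod_group q\<^esub> 1 = \<one>\<^bsub>integer_mod_group q\<^esub>"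
      unfolding k using \<open>1 \<in> carrier (integer_mod_group q)\<close> by (simp only: r_one r_inv)
    then show "1 \<otimes>\<^bsub>integer_mod_group q\<^esub> k \<otimes>\<^bsub>integer_mod_group q\<^esub> inv\<^bsub>integer_mod_group q\<^esub> 1 \<in> {0}" by simp
  qed simp
qed

lemma split_cyclic_semidirect:
  assumes q: "q \<in> {2, 3}" and n: "n > 0" and r: "[r ^ q = 1] (mod int n)"
    and fpf: "\<And>a. 0 \<le> a \<Longrightarrow> a < int n \<Longrightarrow> (r * a) mod int n = a \<Longrightarrow> a = 0"
  shows "fin_group (cyclic_semidirect n q r)"
    "fin_group.split_by (cyclic_semidirect n q r) q ({0..<int n} \<times> {0}) (0, 1)"
proof -
  let ?G = "cyclic_semidirect n q r" and ?K = "{0..<int n} \<times> {0::int}"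
  have q1: "q > 1" using q by auto
  have carr: "carrier ?G = {0..<int n} \<times> {0..<int q}"
    using n q1 by (simp add: cyclic_semidirect_def carrier_integer_mod_group)
  have mult: "(a, b) \<otimes>\<^bsub>?G\<^esub> (c, d) = ((a + r ^ nat b * c) mod int n, (b + d) mod int q)" for a b c d
    by (simp add: cyclic_semidirect_def)
  have one: "\<one>\<^bsub>?G\<^esub> = (0, 0)" by (simp add: cyclic_semidirect_def)
  show F: "fin_group ?G"
    using group_cyclic_semidirect[OF n _ r] q1 by (intro fin_groupI) (auto simp: carr)
  interpret fin_group ?G by fact
  have x: "(0, 1) \<in> carrier ?G" using n q1 by (simp add: carr)
  show "split_by q ?K (0, 1)"
  proof (rule split_byI[OF q])
    show "subgroup ?K ?G"
    proof
      show "?K \<subseteq> carrier ?G" using q1 by (auto simp: carr)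
      show "\<one>\<^bsub>?G\<^esub> \<in> ?K" using n by (simp add: one)
      fix k assume k: "k \<in> ?K"
      then obtain a where a: "k = (a, 0)" "0 \<le> a" "a < int n" by auto
      have "((- a) mod int n, 0) \<otimes>\<^bsub>?G\<^esub> k = \<one>\<^bsub>?G\<^esub>" by (simp add: a mult one mod_simps)
      then have "inv\<^bsub>?G\<^esub> k = ((- a) mod int n, 0)" by (rule inv_equality) (use a n q1 in \<open>auto simp: carr\<close>)
      then show "inv\<^bsub>?G\<^esub> k \<in> ?K" using n by simp
      fix l assume "l \<in> ?K"
      then show "k \<otimes>\<^bsub>?G\<^esub> l \<in> ?K" using n k by (auto simp: mult)
    qed
    fix k assume k: "k \<in> ?K"
    then obtain a where a: "k = (a, 0)" "0 \<le> a" "a < int n" by auto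
    have kc: "k \<in> carrier ?G" using a q1 by (simp add: carr)
    show "k \<otimes>\<^bsub>?G\<^esub> l = l \<otimes>\<^bsub>?G\<^esub> k" if "l \<in> ?K" for l using that a by (auto simp: mult add.commute)
    have "(0, 1) \<otimes>\<^bsub>?G\<^esub> k = ((r * a) mod int n, 0) \<otimes>\<^bsub>?G\<^esub> (0, 1)" using q1 by (simp add: a mult)
    moreover have "((r * a) mod int n, 0) \<in> ?K" using n by simp
    moreover have "((r * a) mod int n, 0) \<in> carrier ?G" using n q1 by (simp add: carr)
    ultimately have "(0, 1) \<otimes>\<^bsub>?G\<^esub> k \<otimes>\<^bsub>?G\<^esub> inv\<^bsub>?G\<^esub> (0, 1) = ((r * a) mod int n, 0)" using x by (simp add: m_assoc)
    then show "(0, 1) \<otimes>\<^bsub>?G\<^esub> k \<otimes>\<^bsub>?G\<^esub> inv\<^bsub>?G\<^esub> (0, 1) \<in> ?K" using n by simp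
    show "k = \<one>\<^bsub>?G\<^esub>" if "k \<otimes>\<^bsub>?G\<^esub> (0, 1) = (0, 1) \<otimes>\<^bsub>?G\<^esub> k"
    proof -
      have "(r * a) mod int n = a" using that a q1 by (simp add: mult)
      with a(2,3) have "a = 0" by (rule fpf)
      then show ?thesis by (simp add: one a(1))
    qed
  next
    have "(0, 1) [^]\<^bsub>?G\<^esub> i = (0, int i mod int q)" for i :: nat
      by (induction i) (auto simp: one mult mod_simps add.commute)
    then show "(0, 1) [^]\<^bsub>?G\<^esub> q = \<one>\<^bsub>?G\<^esub>" by (simp add: one)
    show "card (carrier ?G) = q * card ?K" by (simp add: carr mult.commute)
    show "(0, 1) \<in> carrier ?G" by (rule x)
  qed auto
qed

lemma split_dihedral_5: "fin_group (dihedral_group 5)"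
  "fin_group.split_by (dihedral_group 5) 2 ({0..<int 5} \<times> {0}) (0, 1)"
proof -
  have "a = 0" if "0 \<le> a" "a < int 5" "(- 1 * a) mod int 5 = a" for a
  proof -
    have "5 dvd 2 * a" using that(3) by presburger
    then show ?thesis using that(1,2) by presburger
  qed
  note S = split_cyclic_semidirect[of 2 5 "- 1", OF _ _ _ this]
  show "fin_group (dihedral_group 5)" "fin_group.split_by (dihedral_group 5) 2 ({0..<int 5} \<times> {0}) (0, 1)"
    unfolding dihedral_group_def by (rule S; simp)+
qed

lemma split_F73: "fin_group F73" "fin_group.split_by F73 3 ({0..<int 7} \<times> {0}) (0, 1)"
proof -
  have "a = 0" if "0 \<le> a" "a < int 7" "(2 * a) mod int 7 = a" for a
    using that by presburger
  note S = split_cyclic_semidirect[of 3 7 2, OF _ _ _ this]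
  show "fin_group F73" "fin_group.split_by F73 3 ({0..<int 7} \<times> {0}) (0, 1)"
    unfolding F73_def by (rule S; simp add: cong_def)+
qed

lemma split_sym_3:
  "fin_group (sym_group 3)"
  "fin_group.split_by (sym_group 3) 2 (carrier (alt_group 3)) (transpose 1 2)" "card (carrier (alt_group 3)) = 3"
proof -
  let ?x = "transpose 1 2 :: nat \<Rightarrow> nat" and ?K = "carrier (alt_group 3)"
  have c6: "card (carrier (sym_group 3)) = 6" by (simp add: sym_group_card_carrier fact_numeral)
  show c3: "card ?K = 3" using alt_group_card_carrier[of 3] by (simp add: fact_numeral)
  show F: "fin_group (sym_group 3)"
    using c6 by (intro fin_groupI sym_group_is_group) (auto intro: card_ge_0_finite)
  interpret fin_group "sym_group 3" by fact
  have x: "?x \<in> carrier (sym_group 3)" by (simp add: sym_group_carrier permutes_swap_id)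
  have K: "subgroup ?K (sym_group 3)" by (rule alt_group_is_subgroup)
  have perm: "permutation p" if "p \<in> carrier (sym_group 3)" for p by (rule sym_group_carrier'[OF that])
  show "split_by 2 ?K ?x"
  proof (rule split_byI)
    show "?x [^]\<^bsub>sym_group 3\<^esub> (2::nat) = \<one>\<^bsub>sym_group 3\<^esub>"
      by (simp add: numeral_2_eq_2 sym_group_mult sym_group_one)
    show "?x \<notin> ?K" by (simp add: alt_group_carrier evenperm_swap)
    fix k assume k: "k \<in> ?K"
    have kc: "k \<in> carrier (sym_group 3)" "evenperm k" using k by (auto simp: alt_group_carrier sym_group_carrier)
    have "?x \<otimes>\<^bsub>sym_group 3\<^esub> ?x = \<one>\<^bsub>sym_group 3\<^esub>" by (simp add: sym_group_mult sym_group_one)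
    then have ix: "inv\<^bsub>sym_group 3\<^esub> ?x = ?x" using x by (simp add: inv_equality)
    have "evenperm (?x \<circ> k \<circ> ?x)"
      using kc perm[OF x] perm[OF kc(1)] by (simp add: evenperm_comp permutation_compose evenperm_swap)
    moreover have "?x \<otimes>\<^bsub>sym_group 3\<^esub> k \<otimes>\<^bsub>sym_group 3\<^esub> ?x \<in> carrier (sym_group 3)" using x kc by simp
    ultimately show "?x \<otimes>\<^bsub>sym_group 3\<^esub> k \<otimes>\<^bsub>sym_group 3\<^esub> inv\<^bsub>sym_group 3\<^esub> ?x \<in> ?K"
      unfolding ix by (simp add: alt_group_carrier sym_group_carrier sym_group_mult)
    show "k = \<one>\<^bsub>sym_group 3\<^esub>" if c: "k \<otimes>\<^bsub>sym_group 3\<^esub> ?x = ?x \<otimes>\<^bsub>sym_group 3\<^esub> k"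
    proof -
      have kp: "k permutes {1..3}" using k by (simp add: alt_group_carrier)
      have kx: "k (?x i) = ?x (k i)" for i using c by (auto simp: sym_group_mult fun_eq_iff)
      have inj: "inj k" using kp by (rule permutes_inj)
      have r: "k i \<in> {1, 2, 3}" if "i \<in> {1, 2, 3}" for i
      proof -
        have "i \<in> {1..3}" using that by auto
        then have "k i \<in> {1..3}" using kp by (simp only: permutes_in_image)
        then show ?thesis by auto
      qed
      have "?x (k 3) = k 3" using kx[of 3] by (simp add: transpose_def)
      then have k3: "k 3 = 3" using r[of 3] by (auto simp: transpose_def split: if_splits)
      have k1: "k 1 = 1 \<or> k 1 = 2" using r[of 1] injD[OF inj, of 1 3] k3 by auto
      have k2: "k 2 = ?x (k 1)" using kx[of 1] by (simp add: transpose_def)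
      have ko: "k i = i" if "i \<notin> {1, 2, 3}" for i
      proof -
        have "i \<notin> {1..3}" using that by auto
        then show ?thesis using kp by (simp add: permutes_not_in)
      qed
      have "k 1 \<noteq> 2"
      proof
        assume 12: "k 1 = 2"
        have "k = ?x"
        proof
          fix i show "k i = ?x i"
            using 12 k2 k3 ko[of i] by (cases "i \<in> {1, 2, 3}") (auto simp: transpose_def)
        qed
        then show False using kc(2) by (simp add: evenperm_swap)
      qed
      then have 1: "k 1 = 1" using k1 by blast
      have "k = id"
      proof
        fix i show "k i = id i"
          using 1 k2 k3 ko[of i] by (cases "i \<in> {1, 2, 3}") (auto simp: transpose_def)
      qed
      then show ?thesis by (simp add: sym_group_one)
    qed
  next
    fix a b assume "a \<in> ?K" "b \<in> ?K"
    then show "a \<otimes>\<^bsub>sym_group 3\<^esub> b = b \<otimes>\<^bsub>sym_group 3\<^esub> a" using prime_subgroup_commute[OF K] c3 by simp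
  qed (use K x c6 c3 in auto)
qed

lemma split_alt_4:
  "\<exists>K x. fin_group.split_by (alt_group 4) 3 K x \<and> card K = 4" "fin_group (alt_group 4)"
proof -
  let ?G = "alt_group 4"
  \<comment> \<open>The Klein four-group and the 3-cycle \<open>x\<close>, which fixes 4 and permutes \<open>a\<close>, \<open>b\<close>, \<open>c\<close> cyclically.\<close>
  define a :: "nat \<Rightarrow> nat" where "a = transpose 1 2 \<circ> transpose 3 4"
  define b :: "nat \<Rightarrow> nat" where "b = transpose 1 4 \<circ> transpose 2 3"
  define c :: "nat \<Rightarrow> nat" where "c = transpose 1 3 \<circ> transpose 2 4"
  define x :: "nat \<Rightarrow> nat" where "x = transpose 1 2 \<circ> transpose 2 3"
  have ev: "transpose i j \<circ> transpose k l \<in> carrier ?G"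
    if "i \<in> {1..4}" "j \<in> {1..4}" "k \<in> {1..4}" "l \<in> {1..4}" "i \<noteq> j" "k \<noteq> l" for i j k l
    using that by (simp add: alt_group_carrier permutes_compose permutes_swap_id evenperm_comp evenperm_swap permutation_swap_id)
  have mem: "a \<in> carrier ?G" "b \<in> carrier ?G" "c \<in> carrier ?G" "x \<in> carrier ?G"
    unfolding a_def b_def c_def x_def by (rule ev; simp)+
  have c12: "card (carrier ?G) = 12" using alt_group_card_carrier[of 4] by (simp add: fact_numeral)
  show F: "fin_group ?G"
    using c12 by (intro fin_groupI alt_group_is_group) (auto intro: card_ge_0_finite)
  interpret fin_group ?G by fact
  note d = a_def b_def c_def x_def transpose_def fun_eq_iff
  have ab: "a \<circ> b = c" "b \<circ> c = a" "c \<circ> a = b" "b \<circ> a = c" "c \<circ> b = a" "a \<circ> c = b" by (auto simp: d)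
  have sq: "a \<circ> a = id" "b \<circ> b = id" "c \<circ> c = id" by (auto simp: d)
  have x3: "x \<circ> x \<circ> x = id" by (auto simp: d)
  have "x \<circ> a = b \<circ> x" "x \<circ> b = c \<circ> x" "x \<circ> c = a \<circ> x" by (auto simp: d)
  then have conj: "x \<circ> a \<circ> (x \<circ> x) = b" "x \<circ> b \<circ> (x \<circ> x) = c" "x \<circ> c \<circ> (x \<circ> x) = a"
    using x3 by (metis comp_assoc comp_id)+
  have at4: "a 4 = 3" "b 4 = 1" "c 4 = 2" "x 4 = 4" "x 1 = 2" "x 2 = 3" "x 3 = 1" by (auto simp: d)
  have m: "p \<otimes>\<^bsub>?G\<^esub> q = p \<circ> q" and o: "\<one>\<^bsub>?G\<^esub> = id" for p q by (simp_all add: alt_group_mult alt_group_one)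
  let ?K = "{id, a, b, c}"
  have ne: "a \<noteq> id" "b \<noteq> id" "c \<noteq> id" "a \<noteq> b" "a \<noteq> c" "b \<noteq> c" using at4 by (auto dest: fun_cong[of _ _ 4])
  have cK: "card ?K = 4" using ne by auto
  have inv: "inv\<^bsub>?G\<^esub> a = a" "inv\<^bsub>?G\<^esub> b = b" "inv\<^bsub>?G\<^esub> c = c"
    using sq by (auto intro!: inv_equality[OF _ mem(1) mem(1)] inv_equality[OF _ mem(2) mem(2)] inv_equality[OF _ mem(3) mem(3)] simp only: m o)
  have io: "inv\<^bsub>?G\<^esub> id = id" using inv_one by (simp add: o)
  have ix: "inv\<^bsub>?G\<^esub> x = x \<circ> x"
  proof (rule inv_equality)
    show "(x \<circ> x) \<otimes>\<^bsub>?G\<^esub> x = \<one>\<^bsub>?G\<^esub>" using x3 by (simp add: m o)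
    show "x \<circ> x \<in> carrier ?G" using m_closed[OF mem(4) mem(4)] by (simp add: m)
  qed (rule mem)
  have idc: "id \<in> carrier ?G" using one_closed by (simp add: o)
  have xK: "x \<notin> ?K"
  proof
    assume "x \<in> ?K"
    then have "x = id" using at4 by (auto dest: fun_cong[of _ _ 4])
    then show False using at4(5) by simp
  qed
  have "split_by 3 ?K x"
  proof (rule split_byI)
    show "subgroup ?K ?G"
    proof
      fix k l assume "k \<in> ?K" "l \<in> ?K"
      then show "k \<otimes>\<^bsub>?G\<^esub> l \<in> ?K" by (auto simp: m ab sq)
    qed (use mem idc inv io in \<open>auto simp: o\<close>)
    show "x [^]\<^bsub>?G\<^esub> (3::nat) = \<one>\<^bsub>?G\<^esub>" using x3 by (simp add: numeral_3_eq_3 m o)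
    fix k assume k: "k \<in> ?K"
    show "k \<otimes>\<^bsub>?G\<^esub> l = l \<otimes>\<^bsub>?G\<^esub> k" if "l \<in> ?K" for l using k that by (auto simp: m ab sq)
    have "x \<circ> id \<circ> (x \<circ> x) = id" using x3 by (simp add: comp_assoc)
    then show "x \<otimes>\<^bsub>?G\<^esub> k \<otimes>\<^bsub>?G\<^esub> inv\<^bsub>?G\<^esub> x \<in> ?K" using k conj unfolding ix m by auto
    show "k = \<one>\<^bsub>?G\<^esub>" if "k \<otimes>\<^bsub>?G\<^esub> x = x \<otimes>\<^bsub>?G\<^esub> k"
    proof -
      have "k (x 4) = x (k 4)" using fun_cong[OF that, of 4] by (simp add: m)
      then have "k 4 = x (k 4)" by (simp add: at4)
      then have "k \<noteq> a" "k \<noteq> b" "k \<noteq> c" using at4 by auto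
      then show ?thesis using k by (auto simp: o)
    qed
  qed (use mem xK c12 cK in auto)
  then show "\<exists>K x. split_by 3 K x \<and> card K = 4" using cK by blast
qed

section \<open>The classification\<close>

lemma triangle_free_if_iso_split:
  assumes G: "fin_group G" and H: "fin_group H" and iso: "G \<cong> H"
    and s: "fin_group.split_by H q K x" and qk: "(q, card K) \<in> {(2, 1), (2, 3), (2, 5), (3, 1), (3, 4), (3, 7)}"
  shows "triangle_free (codegree_graph G)"
proof -
  interpret G: fin_group G by fact
  interpret H: fin_group H by fact
  have "H \<cong> G" using G.iso_sym[OF iso] .
  then obtain \<phi> where "\<phi> \<in> iso H G" by (auto simp: is_iso_def)
  then have "\<phi> \<in> hom H G" "\<phi> ` carrier H = carrier G" by (auto simp: iso_def bij_betw_def)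
  then show ?thesis by (rule triangle_free_image[OF H G _ _ H.split_triangle_free[OF s qk]])
qed

theorem theorem1p4:
  fixes G :: "('a, 'b) monoid_scheme"
  assumes "group G" and "finite (carrier G)" and "carrier G \<noteq> {\<one>\<^bsub>G\<^esub>}"
  shows "triangle_free (codegree_graph G) \<longleftrightarrow>
    G \<cong> integer_mod_group 2 \<or> G \<cong> integer_mod_group 3 \<or>
    G \<cong> alt_group 4 \<or> G \<cong> sym_group 3 \<or> G \<cong> dihedral_group 5 \<or> G \<cong> F73"
proof -
  interpret fin_group G using assms by (intro fin_groupI)
  note F = fin_group_axioms
  obtain KA xA where A: "fin_group.split_by (alt_group 4) 3 KA xA" "card KA = 4" using split_alt_4(1) by blast
  note Z2 = split_integer_mod_group[of 2, simplified] and Z3 = split_integer_mod_group[of 3, simplified]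
  show ?thesis
  proof
    assume "triangle_free (codegree_graph G)"
    then obtain K x where "(split_by 2 K x \<and> card K \<in> {1, 3, 5}) \<or> (split_by 3 K x \<and> card K \<in> {1, 4, 7})"
      using triangle_free_structure assms(3) by blast
    then consider "split_by 2 K x" "card K = 1" | "split_by 2 K x" "card K = 3" | "split_by 2 K x" "card K = 5"
      | "split_by 3 K x" "card K = 1" | "split_by 3 K x" "card K = 4" | "split_by 3 K x" "card K = 7" by auto
    then show "G \<cong> integer_mod_group 2 \<or> G \<cong> integer_mod_group 3 \<or>
      G \<cong> alt_group 4 \<or> G \<cong> sym_group 3 \<or> G \<cong> dihedral_group 5 \<or> G \<cong> F73"
    proof cases
      case 1
      have "G \<cong> integer_mod_group 2" by (rule split_unique[OF F Z2(1) _ 1(1) Z2(2)]) (use 1 in auto)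
      then show ?thesis by blast
    next
      case 2
      have "G \<cong> sym_group 3" by (rule split_unique[OF F split_sym_3(1) _ 2(1) split_sym_3(2)]) (use 2 split_sym_3(3) in auto)
      then show ?thesis by blast
    next
      case 3
      have "G \<cong> dihedral_group 5" by (rule split_unique[OF F split_dihedral_5(1) _ 3(1) split_dihedral_5(2)]) (use 3 in auto)
      then show ?thesis by blast
    next
      case 4
      have "G \<cong> integer_mod_group 3" by (rule split_unique[OF F Z3(1) _ 4(1) Z3(2)]) (use 4 in auto)
      then show ?thesis by blast
    next
      case 5
      have "G \<cong> alt_group 4" by (rule split_unique[OF F split_alt_4(2) _ 5(1) A(1)]) (use 5 A(2) in auto)
      then show ?thesis by blast
    next
      case 6
      have "G \<cong> F73" by (rule split_unique[OF F split_F73(1) _ 6(1) split_F73(2)]) (use 6 in auto)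
      then show ?thesis by blast
    qed
  next
    note t = triangle_free_if_iso_split[OF F]
    assume "G \<cong> integer_mod_group 2 \<or> G \<cong> integer_mod_group 3 \<or>
      G \<cong> alt_group 4 \<or> G \<cong> sym_group 3 \<or> G \<cong> dihedral_group 5 \<or> G \<cong> F73"
    then show "triangle_free (codegree_graph G)"
    proof (elim disjE)
      assume "G \<cong> integer_mod_group 2"
      then show ?thesis by (rule t[OF Z2(1) _ Z2(2)]) simp
    next
      assume "G \<cong> integer_mod_group 3"
      then show ?thesis by (rule t[OF Z3(1) _ Z3(2)]) simp
    next
      assume "G \<cong> alt_group 4"
      then show ?thesis by (rule t[OF split_alt_4(2) _ A(1)]) (simp add: A(2))
    next
      assume "G \<cong> sym_group 3"
      then show ?thesis by (rule t[OF split_sym_3(1) _ split_sym_3(2)]) (simp add: split_sym_3(3))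
    next
      assume "G \<cong> dihedral_group 5"
      then show ?thesis by (rule t[OF split_dihedral_5(1) _ split_dihedral_5(2)]) simp
    next
      assume "G \<cong> F73"
      then show ?thesis by (rule t[OF split_F73(1) _ split_F73(2)]) simp
    qed
  qed
qed

end
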